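(* Let $d\ge 2$ and let $\omega\in KT_d$. Let $\mathcal R$ be the renormalisation operator associated with $\omega$ (defined in the context), an analytic map from an open neighbourhood of $\omega$ in $\mathcal A'_d(\rho)$ to $\mathcal A'_d(\rho)$. Then the constant vector field $\omega$ is a hyperbolic fixed point of $\mathcal R$, with a local stable manifold $\mathcal W^s(\omega)$ of codimension $d-1$ and a local unstable manifold $\mathcal W^u(\omega)$ of dimension $d-1$.
   Context: Norms and spaces. $\|z\|=\sum_{i=1}^d|z_i|$ on $\mathbb C^d$ and $z\cdot z'=\sum_{i=1}^d z_iz_i'$. For $r>0$, $\mathcal D(r)=\{\theta\in\mathbb C^d:\|\mathrm{Im}\,\theta\|<r/(2\pi)\}$. $\mathcal A_d(r)$ (resp. $\mathcal A'_d(r)$) is the complex Banach space of analytic $\mathbb Z^d$-periodic functions $f:\mathcal D(r)\to\mathbb C^d$, $f(\theta)=\sum_{k\in\mathbb Z^d}f_ke^{2\pi i k\cdot\theta}$, with finite norm $\|f\|_r=\sum_k\|f_k\|e^{r\|k\|}$ (resp. $\|f\|'_r=\sum_k(1+2\pi\|k\|)\|f_k\|e^{r\|k\|}$). Vectors of $\mathbb C^d$ are identified with constant vector fields. Koch type vectors. $KT_d$ is the set of vectors $c\,(1,\omega_2,\dots,\omega_d)\in\mathbb R^d$, $c\in\mathbb R\setminus\{0\}$, where $1,\omega_2,\dots,\omega_d$ are rationally independent real algebraic numbers and the field $\mathbb Q(\omega_2,\dots,\omega_d)$ has degree $d$ over $\mathbb Q$. For $\omega\in KT_d$ one fixes a matrix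 $T\in GL(d,\mathbb Z)$ with simple eigenvalues $\lambda_1,\dots,\lambda_d$ such that $0<|\lambda_d|\le\dots\le|\lambda_2|<1<|\lambda_1|$ and $T\omega=\lambda_1\omega$ (such $T$ exists by a known lemma of Koch). $T^*$ is the transpose of $T$, and $\bar\omega\in\mathbb R^d$ is the $\lambda_1$-eigenvector of $T^*$ with $\bar\omega\cdot\omega=1$. Resonant projections. For $\sigma>0$, $I^-_\sigma=\{k\in\mathbb Z^d:|\omega\cdot k|>\sigma\|k\|\}$, $I^+_\sigma=\mathbb Z^d\setminus I^-_\sigma$, and $\mathbb I^\pm_\sigma$ is the projection $\mathbb I^\pm_\sigma X(\theta)=\sum_{k\in I^\pm_\sigma}X_ke^{2\pi ik\cdot\theta}$. Parameters. Fix $0<\kappa<1$ and $0<\rho'<\rho$ with $\kappa\rho<\rho'$. Put $I^\kappa=\{x\in\mathbb R^d:\|T^*x\|\le\kappa\|x\|\}$; it is assumed that the hyperplane $\{x\in\mathbb R^d:\omega\cdot x=0\}$ is contained in $I^\kappa$ (this holds after replacing $T$ by a sufficiently large power). Fix $0<\sigma<\frac12\|\bar\omega\|^{-1}$ such that $I^+_\sigma\subset I^\kappa$. The map $\mathcal U$. Let $\hat\delta=\min\{\frac{\rho-\rho'}{4\pi},\frac{3-\sqrt6}{6}\frac{\sigma}{\|\omega\|}\}$, $\hat\varepsilon=\frac{\sqrt6-2}{12}\sigma\hat\delta$, and $\hat B=\{X\in\mathcal A'_d(\rho):\|X-\omega\|'_\rho<\hat\varepsilon\}$. For $X=\omega+f\in\hat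 B$ and $u\in\mathbb I^-_\sigma\mathcal A'_d(\rho')$ with $\|u\|'_{\rho'}<\hat\delta$ let $F(u)=\mathbb I^-_\sigma\big[(I+Du)^{-1}(\omega+f\circ(\mathrm{Id}+u))\big]\in\mathbb I_\sigma^-\mathcal A_d(\rho')$. Let $u_\lambda$, $\lambda\in[0,1]$, be the solution of $DF(u_\lambda)\frac{du_\lambda}{d\lambda}=-F(0)$, $u_0=0$, with $\|u_\lambda\|'_{\rho'}<\hat\delta$; then $F(u_1)=0$. Set $U_X=\mathrm{Id}+u_1$ and $\mathcal U(X)=(DU_X)^{-1}\,X\circ U_X\in\mathbb I^+_\sigma\mathcal A_d(\rho')$. The map $\mathcal T$. $\mathcal T(X)=T^{-1}\,X\circ T$, a linear map from $\mathbb I^+_\sigma\mathcal A_d(\rho')$ to $\mathcal A'_d(\rho)$. The renormalisation operator. With $\mathbb E(X)=\int_{\mathbb T^d}X(\theta)\,d\theta$ the average, $\mathcal R(X)=\dfrac{1}{\bar\omega\cdot\mathbb E(\tilde X)}\tilde X$, where $\tilde X=\mathcal T\circ\mathcal U(X)$, defined on a sufficiently small open ball $B\subset\hat B$ centred at $\omega$. Hyperbolic means that the spectrum of $D\mathcal R(\omega)$ on $\mathcal A'_d(\rho)$ does not meet the unit circle. $\mathcal W^s(\omega)$ is the set of $X$ in some (sufficiently small) neighbourhood $B$ of $\omega$ with $\mathcal R^n(X)\in B$ for all $n\ge0$; $\mathcal W^u(\omega)$ is defined likewise using inverse iterates of $\mathcal R$ (points of $B$ having a backward $\mathcal R$-orbit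 contained in $B$). Dimension and codimension are over $\mathbb C$. *)

theory Defs
  imports
    "HOL-Analysis.Analysis"
    "HOL-Computational_Algebra.Polynomial"
    "HOL-Library.Function_Algebras"
begin

section \<open>Vectors, matrices and Koch type vectors\<close>

text \<open>
  The coordinates \<open>1, \<dots>, d\<close> are the elements of a finite type \<open>'d\<close>, so \<open>d = CARD('d)\<close>. Where
  their order matters, \<open>'d\<close> is linearly ordered and the coordinate called \<open>1\<close> is its least element.
\<close>

definition first_ix :: "'d::{finite,linorder}" where
  "first_ix = Min UNIV"

definition l1norm :: "'a::real_normed_vector ^ 'd \<Rightarrow> real" where
  "l1norm z = (\<Sum>i\<in>UNIV. norm (z $ i))"

text \<open>On \<open>complex ^ 'd\<close> this is bilinear; it is not the Hermitian inner product.\<close>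

definition dotp :: "'a::comm_semiring_1 ^ 'd \<Rightarrow> 'a ^ 'd \<Rightarrow> 'a" where
  "dotp z w = (\<Sum>i\<in>UNIV. z $ i * w $ i)"

definition vec_of_int :: "int ^ 'd \<Rightarrow> 'a::ring_1 ^ 'd" where
  "vec_of_int k = (\<chi> i. of_int (k $ i))"

definition vec_of_real :: "real ^ 'd \<Rightarrow> complex ^ 'd" where
  "vec_of_real x = (\<chi> i. of_real (x $ i))"

definition mat_of_int :: "int ^ 'd ^ 'd \<Rightarrow> 'a::ring_1 ^ 'd ^ 'd" where
  "mat_of_int T = (\<chi> i j. of_int (T $ i $ j))"

definition is_real_subfield :: "real set \<Rightarrow> bool" where
  "is_real_subfield K \<longleftrightarrow>
     1 \<in> K \<and> (\<forall>x\<in>K. \<forall>y\<in>K. x - y \<in> K \<and> x * y \<in> K) \<and> (\<forall>x\<in>K. inverse x \<in> K)"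

definition rat_scale :: "rat \<Rightarrow> real \<Rightarrow> real" where
  "rat_scale q x = of_rat q * x"

lemma vector_space_rat_scale: "vector_space rat_scale"
  by unfold_locales (simp_all add: rat_scale_def of_rat_add of_rat_mult algebra_simps)

text \<open>\<^term>\<open>vector_space.dim\<close> is \<open>0\<close> on infinite-dimensional spaces, so the equation with
  \<open>CARD('d) > 0\<close> does assert finiteness of the degree.\<close>

definition koch_type :: "(real ^ 'd::{finite,linorder}) set" where
  "koch_type = {c *\<^sub>R v | c v. c \<noteq> 0 \<and> v $ first_ix = 1 \<and>
     (\<forall>i. algebraic (v $ i)) \<and>
     (\<forall>q :: 'd \<Rightarrow> rat. (\<Sum>i\<in>UNIV. of_rat (q i) * v $ i) = 0 \<longrightarrow> (\<forall>i. q i = 0)) \<and>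
     vector_space.dim rat_scale (is_real_subfield hull {v $ i | i. i \<noteq> first_ix}) = CARD('d)}"

text \<open>\<open>T \<in> GL(d, \<int>)\<close> is invertibility of \<open>T\<close> as a matrix over the ring \<^typ>\<open>int\<close>. The characteristic
  polynomial splits as \<open>\<Prod>\<^sub>j (z - \<lambda>\<^sub>j)\<close> with \<open>\<lambda>\<close> injective, which says that \<open>\<lambda>\<^sub>1, \<dots>, \<lambda>\<^sub>d\<close> are
  the eigenvalues and that they are simple.\<close>

definition koch_matrix ::
  "real ^ ('d::{finite,linorder}) \<Rightarrow> int ^ ('d::{finite,linorder}) ^ ('d::{finite,linorder}) \<Rightarrow>
   ('d::{finite,linorder} \<Rightarrow> complex) \<Rightarrow> bool" where
  "koch_matrix \<omega> T lam \<longleftrightarrow>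
     invertible T \<and>
     (\<forall>z. det (mat z - mat_of_int T) = (\<Prod>j\<in>UNIV. z - lam j)) \<and> inj lam \<and>
     (\<forall>i. 0 < cmod (lam i)) \<and>
     (\<forall>i j. i \<le> j \<longrightarrow> cmod (lam j) \<le> cmod (lam i)) \<and>
     (\<forall>i. i \<noteq> first_ix \<longrightarrow> cmod (lam i) < 1) \<and> 1 < cmod (lam first_ix) \<and>
     mat_of_int T *v vec_of_real \<omega> = lam first_ix *s vec_of_real \<omega>"

definition dual_eigenvector ::
  "real ^ ('d::{finite,linorder}) \<Rightarrow> int ^ ('d::{finite,linorder}) ^ ('d::{finite,linorder}) \<Rightarrow>
   ('d::{finite,linorder} \<Rightarrow> complex) \<Rightarrow> real ^ ('d::{finite,linorder}) \<Rightarrow> bool" where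
  "dual_eigenvector \<omega> T lam \<omega>' \<longleftrightarrow>
     transpose (mat_of_int T) *v vec_of_real \<omega>' = lam first_ix *s vec_of_real \<omega>' \<and>
     dotp \<omega>' \<omega> = 1"


section \<open>Spaces of analytic vector fields\<close>

text \<open>
  A function on \<open>\<D>(r)\<close> is represented by its extension by \<open>0\<close> to all of \<open>\<complex>\<^sup>d\<close>, so that equality of
  functions on \<open>\<D>(r)\<close> is equality in HOL. Sums and differences are pointwise.
\<close>

type_synonym 'd vfield = "complex ^ 'd \<Rightarrow> complex ^ 'd"

definition strip :: "real \<Rightarrow> (complex ^ 'd) set" where
  "strip r = {\<theta>. (\<Sum>i\<in>UNIV. \<bar>Im (\<theta> $ i)\<bar>) < r / (2 * pi)}"

definition restr :: "real \<Rightarrow> 'd vfield \<Rightarrow> 'd::finite vfield" where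
  "restr r f = (\<lambda>\<theta>. if \<theta> \<in> strip r then f \<theta> else 0)"

definition const_field :: "real \<Rightarrow> complex ^ 'd \<Rightarrow> 'd::finite vfield" where
  "const_field r v = restr r (\<lambda>_. v)"

definition fscale :: "complex \<Rightarrow> 'd::finite vfield \<Rightarrow> 'd vfield" where
  "fscale c f = (\<lambda>\<theta>. c *s f \<theta>)"

lemma vector_space_fscale: "vector_space fscale"
  by unfold_locales (simp_all add: fscale_def fun_eq_iff vec_eq_iff algebra_simps)

definition fmode :: "int ^ 'd \<Rightarrow> complex ^ 'd \<Rightarrow> complex" where
  "fmode k \<theta> = exp (2 * of_real pi * \<i> * dotp (vec_of_int k) \<theta>)"

definition fcoeff :: "'d::finite vfield \<Rightarrow> int ^ 'd \<Rightarrow> complex ^ 'd" where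
  "fcoeff f k = integral (cbox 0 1) (\<lambda>x :: real ^ 'd. fmode (- k) (vec_of_real x) *s f (vec_of_real x))"

definition fseries :: "(int ^ 'd \<Rightarrow> complex ^ 'd) \<Rightarrow> 'd::finite vfield" where
  "fseries c \<theta> = (\<Sum>\<^sub>\<infinity>k\<in>UNIV. fmode k \<theta> *s c k)"

definition zlen :: "int ^ 'd \<Rightarrow> real" where
  "zlen k = l1norm (vec_of_int k :: real ^ 'd)"

definition complex_differentiable_at :: "'d::finite vfield \<Rightarrow> complex ^ 'd \<Rightarrow> bool" where
  "complex_differentiable_at f \<theta> \<longleftrightarrow>
     (\<exists>L. (f has_derivative L) (at \<theta>) \<and> (\<forall>c v. L (c *s v) = c *s L v))"

text \<open>Analytic \<open>\<int>\<^sup>d\<close>-periodic functions on \<open>\<D>(r)\<close> that are the sum of their Fourier series.\<close>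

definition periodic_analytic :: "real \<Rightarrow> 'd::finite vfield set" where
  "periodic_analytic r = {f.
     (\<forall>\<theta>. \<theta> \<notin> strip r \<longrightarrow> f \<theta> = 0) \<and>
     (\<forall>\<theta>\<in>strip r. complex_differentiable_at f \<theta>) \<and>
     (\<forall>\<theta>\<in>strip r. \<forall>k. f (\<theta> + vec_of_int k) = f \<theta>) \<and>
     (\<forall>\<theta>\<in>strip r. ((\<lambda>k. fmode k \<theta> *s fcoeff f k) has_sum f \<theta>) UNIV)}"

definition normA :: "real \<Rightarrow> 'd::finite vfield \<Rightarrow> real" where
  "normA r f = (\<Sum>\<^sub>\<infinity>k\<in>UNIV. l1norm (fcoeff f k) * exp (r * zlen k))"

definition spaceA :: "real \<Rightarrow> 'd::finite vfield set" where
  "spaceA r = {f \<in> periodic_analytic r.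
     (\<lambda>k. l1norm (fcoeff f k) * exp (r * zlen k)) summable_on UNIV}"

definition normA' :: "real \<Rightarrow> 'd::finite vfield \<Rightarrow> real" where
  "normA' r f = (\<Sum>\<^sub>\<infinity>k\<in>UNIV. (1 + 2 * pi * zlen k) * l1norm (fcoeff f k) * exp (r * zlen k))"

definition spaceA' :: "real \<Rightarrow> 'd::finite vfield set" where
  "spaceA' r = {f \<in> periodic_analytic r.
     (\<lambda>k. (1 + 2 * pi * zlen k) * l1norm (fcoeff f k) * exp (r * zlen k)) summable_on UNIV}"


section \<open>Analysis on normed spaces given by a carrier and a norm\<close>

text \<open>
  \<open>V\<close>, \<open>W\<close> are complex linear subspaces of \<^typ>\<open>'d vfield\<close> with norms \<open>N\<close>, \<open>M\<close>. The values of
  \<open>N\<close> and \<open>M\<close> outside the carriers are meaningless, hence the explicit membership conditions.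
\<close>

definition nball :: "'d::finite vfield set \<Rightarrow> ('d vfield \<Rightarrow> real) \<Rightarrow> 'd vfield \<Rightarrow> real \<Rightarrow> 'd vfield set" where
  "nball V N x r = {y \<in> V. N (y - x) < r}"

definition nopen :: "'d::finite vfield set \<Rightarrow> ('d vfield \<Rightarrow> real) \<Rightarrow> 'd vfield set \<Rightarrow> bool" where
  "nopen V N S \<longleftrightarrow> S \<subseteq> V \<and> (\<forall>x\<in>S. \<exists>r>0. nball V N x r \<subseteq> S)"

definition nclosed :: "'d::finite vfield set \<Rightarrow> ('d vfield \<Rightarrow> real) \<Rightarrow> 'd vfield set \<Rightarrow> bool" where
  "nclosed V N S \<longleftrightarrow> S \<subseteq> V \<and> nopen V N (V - S)"

definition bounded_clinear_on ::
  "'d::finite vfield set \<Rightarrow> ('d vfield \<Rightarrow> real) \<Rightarrow> 'd vfield set \<Rightarrow> ('d vfield \<Rightarrow> real) \<Rightarrow>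
   ('d vfield \<Rightarrow> 'd vfield) \<Rightarrow> bool" where
  "bounded_clinear_on V N W M L \<longleftrightarrow>
     (\<forall>f\<in>V. L f \<in> W) \<and>
     (\<forall>f\<in>V. \<forall>g\<in>V. L (f + g) = L f + L g) \<and>
     (\<forall>f\<in>V. \<forall>c. L (fscale c f) = fscale c (L f)) \<and>
     (\<exists>C. \<forall>f\<in>V. M (L f) \<le> C * N f)"

text \<open>\<open>L\<close> is the (complex) Frechet derivative at \<open>x\<close> of \<open>G\<close>, a map from a neighbourhood of \<open>x\<close> in
  \<open>V\<close> to \<open>W\<close>.\<close>

definition has_cderivative ::
  "'d::finite vfield set \<Rightarrow> ('d vfield \<Rightarrow> real) \<Rightarrow> 'd vfield set \<Rightarrow> ('d vfield \<Rightarrow> real) \<Rightarrow>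
   ('d vfield \<Rightarrow> 'd vfield) \<Rightarrow> ('d vfield \<Rightarrow> 'd vfield) \<Rightarrow> 'd vfield \<Rightarrow> bool" where
  "has_cderivative V N W M G L x \<longleftrightarrow>
     bounded_clinear_on V N W M L \<and>
     (\<forall>e>0. \<exists>\<delta>>0. \<forall>h\<in>V. N h < \<delta> \<longrightarrow>
        G (x + h) \<in> W \<and> M (G (x + h) - G x - L h) \<le> e * N h)"

text \<open>Between complex Banach spaces, a map is analytic on an open set iff it is complex Frechet
  differentiable at every point of it.\<close>

definition analytic_map_on ::
  "'d::finite vfield set \<Rightarrow> ('d vfield \<Rightarrow> real) \<Rightarrow> 'd vfield set \<Rightarrow> ('d vfield \<Rightarrow> real) \<Rightarrow>
   'd vfield set \<Rightarrow> ('d vfield \<Rightarrow> 'd vfield) \<Rightarrow> bool" where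
  "analytic_map_on V N W M S G \<longleftrightarrow>
     nopen V N S \<and> (\<forall>x\<in>S. G x \<in> W \<and> (\<exists>L. has_cderivative V N W M G L x))"

definition op_spectrum ::
  "'d::finite vfield set \<Rightarrow> ('d vfield \<Rightarrow> real) \<Rightarrow> ('d vfield \<Rightarrow> 'd vfield) \<Rightarrow> complex set" where
  "op_spectrum V N L = {z. \<not> (\<exists>S. bounded_clinear_on V N V N S \<and>
     (\<forall>f\<in>V. S (L f - fscale z f) = f \<and> L (S f) - fscale z (S f) = f))}"

definition hyperbolic_fixed_point ::
  "'d::finite vfield set \<Rightarrow> ('d vfield \<Rightarrow> real) \<Rightarrow> ('d vfield \<Rightarrow> 'd vfield) \<Rightarrow> 'd vfield \<Rightarrow> bool" where
  "hyperbolic_fixed_point V N G x \<longleftrightarrow>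
     x \<in> V \<and> G x = x \<and>
     (\<exists>L. has_cderivative V N V N G L x \<and> op_spectrum V N L \<inter> sphere 0 1 = {})"

definition csubspace_of :: "'d::finite vfield set \<Rightarrow> 'd vfield set \<Rightarrow> bool" where
  "csubspace_of V E \<longleftrightarrow> E \<subseteq> V \<and> 0 \<in> E \<and> (\<forall>f\<in>E. \<forall>g\<in>E. f + g \<in> E) \<and> (\<forall>f\<in>E. \<forall>c. fscale c f \<in> E)"

definition has_cdim :: "'d::finite vfield set \<Rightarrow> nat \<Rightarrow> 'd vfield set \<Rightarrow> bool" where
  "has_cdim V n E \<longleftrightarrow> csubspace_of V E \<and>
     (\<exists>b. finite b \<and> card b = n \<and> \<not> module.dependent fscale b \<and> module.span fscale b = E)"

definition has_ccodim :: "'d::finite vfield set \<Rightarrow> nat \<Rightarrow> 'd vfield set \<Rightarrow> bool" where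
  "has_ccodim V n E \<longleftrightarrow> csubspace_of V E \<and>
     (\<exists>F. has_cdim V n F \<and> E \<inter> F = {0} \<and> (\<forall>f\<in>V. \<exists>g\<in>E. \<exists>h\<in>F. f = g + h))"

text \<open>\<open>S\<close> is an analytic submanifold of the Banach space \<open>(V, N)\<close>, modelled on closed subspaces
  with property \<open>P\<close>: near each of its points some biholomorphic map \<open>\<phi>\<close> between open subsets of
  \<open>V\<close> straightens \<open>S\<close> to such a subspace. Closed subspaces of finite dimension or codimension are
  complemented, so for these \<open>P\<close> no splitting condition is needed.\<close>

definition analytic_submanifold ::
  "'d::finite vfield set \<Rightarrow> ('d vfield \<Rightarrow> real) \<Rightarrow> ('d vfield set \<Rightarrow> bool) \<Rightarrow> 'd vfield set \<Rightarrow> bool" where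
  "analytic_submanifold V N P S \<longleftrightarrow> S \<subseteq> V \<and>
     (\<forall>p\<in>S. \<exists>A A' \<phi> \<psi> E.
        p \<in> A \<and> csubspace_of V E \<and> nclosed V N E \<and> P E \<and>
        analytic_map_on V N V N A \<phi> \<and> analytic_map_on V N V N A' \<psi> \<and>
        \<phi> ` A = A' \<and> (\<forall>x\<in>A. \<psi> (\<phi> x) = x) \<and>
        \<phi> ` (A \<inter> S) = A' \<inter> E)"

definition submanifold_of_dim ::
  "'d::finite vfield set \<Rightarrow> ('d vfield \<Rightarrow> real) \<Rightarrow> nat \<Rightarrow> 'd vfield set \<Rightarrow> bool" where
  "submanifold_of_dim V N n = analytic_submanifold V N (has_cdim V n)"

definition submanifold_of_codim ::
  "'d::finite vfield set \<Rightarrow> ('d vfield \<Rightarrow> real) \<Rightarrow> nat \<Rightarrow> 'd vfield set \<Rightarrow> bool" where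
  "submanifold_of_codim V N n = analytic_submanifold V N (has_ccodim V n)"

definition stable_set :: "('d::finite vfield \<Rightarrow> 'd vfield) \<Rightarrow> 'd vfield set \<Rightarrow> 'd vfield set" where
  "stable_set G B = {X \<in> B. \<forall>n. (G ^^ n) X \<in> B}"

definition unstable_set :: "('d::finite vfield \<Rightarrow> 'd vfield) \<Rightarrow> 'd vfield set \<Rightarrow> 'd vfield set" where
  "unstable_set G B =
     {X \<in> B. \<exists>Y :: nat \<Rightarrow> _. Y 0 = X \<and> (\<forall>n. Y n \<in> B \<and> G (Y (Suc n)) = Y n)}"


section \<open>The renormalisation operator\<close>

definition far_modes :: "real ^ 'd \<Rightarrow> real \<Rightarrow> (int ^ 'd) set" where
  "far_modes \<omega> \<sigma> = {k. \<bar>dotp \<omega> (vec_of_int k)\<bar> > \<sigma> * zlen k}"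

definition resonant_modes :: "real ^ 'd \<Rightarrow> real \<Rightarrow> (int ^ 'd) set" where
  "resonant_modes \<omega> \<sigma> = - far_modes \<omega> \<sigma>"

definition contracted_cone :: "int ^ 'd ^ 'd \<Rightarrow> real \<Rightarrow> (real ^ 'd) set" where
  "contracted_cone T \<kappa> = {x. l1norm (transpose (mat_of_int T) *v x) \<le> \<kappa> * l1norm x}"

definition mode_proj :: "real \<Rightarrow> (int ^ 'd) set \<Rightarrow> 'd::finite vfield \<Rightarrow> 'd vfield" where
  "mode_proj r S X = restr r (fseries (\<lambda>k. if k \<in> S then fcoeff X k else 0))"

definition delta_hat :: "real ^ 'd \<Rightarrow> real \<Rightarrow> real \<Rightarrow> real \<Rightarrow> real" where
  "delta_hat \<omega> \<sigma> \<rho> \<rho>' = min ((\<rho> - \<rho>') / (4 * pi)) ((3 - sqrt 6) / 6 * (\<sigma> / l1norm \<omega>))"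

definition eps_hat :: "real ^ 'd \<Rightarrow> real \<Rightarrow> real \<Rightarrow> real \<Rightarrow> real" where
  "eps_hat \<omega> \<sigma> \<rho> \<rho>' = (sqrt 6 - 2) / 12 * \<sigma> * delta_hat \<omega> \<sigma> \<rho> \<rho>'"

text \<open>\<open>(D(Id + u))\<^sup>-\<^sup>1 X \<circ> (Id + u)\<close> on \<open>\<D>(r)\<close>. For a complex differentiable \<open>u\<close>, \<^const>\<open>jacobian\<close> is
  the matrix of complex partial derivatives.\<close>

definition pullback :: "real \<Rightarrow> 'd::finite vfield \<Rightarrow> 'd vfield \<Rightarrow> 'd vfield" where
  "pullback r X u = restr r (\<lambda>\<theta>. matrix_inv (mat 1 + jacobian u (at \<theta>)) *v X (\<theta> + u \<theta>))"

text \<open>Since \<open>X = \<omega> + f\<close>, the bracket \<open>(I + Du)\<^sup>-\<^sup>1 (\<omega> + f \<circ> (Id + u))\<close> in the definition of \<open>F\<close> is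
  the pullback of \<open>X\<close>.\<close>

definition F_map :: "real ^ 'd \<Rightarrow> real \<Rightarrow> real \<Rightarrow> 'd::finite vfield \<Rightarrow> 'd vfield \<Rightarrow> 'd vfield" where
  "F_map \<omega> \<sigma> \<rho>' X u = mode_proj \<rho>' (far_modes \<omega> \<sigma>) (pullback \<rho>' X u)"

definition far_spaceA :: "real ^ 'd \<Rightarrow> real \<Rightarrow> real \<Rightarrow> 'd::finite vfield set" where
  "far_spaceA \<omega> \<sigma> \<rho>' = mode_proj \<rho>' (far_modes \<omega> \<sigma>) ` spaceA \<rho>'"

definition far_spaceA' :: "real ^ 'd \<Rightarrow> real \<Rightarrow> real \<Rightarrow> 'd::finite vfield set" where
  "far_spaceA' \<omega> \<sigma> \<rho>' = mode_proj \<rho>' (far_modes \<omega> \<sigma>) ` spaceA' \<rho>'"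

text \<open>\<open>DF(u\<^sub>t) (du\<^sub>t/dt) = - F(0)\<close> for \<open>t \<in> [0,1]\<close>, \<open>u\<^sub>0 = 0\<close>, with \<open>DF\<close> the Frechet derivative and
  \<open>v = du\<^sub>t/dt\<close> the (at the end points one-sided) derivative in the norm of \<open>\<A>'(\<rho>')\<close>.\<close>

definition homotopy_solution ::
  "real ^ 'd \<Rightarrow> real \<Rightarrow> real \<Rightarrow> real \<Rightarrow> 'd::finite vfield \<Rightarrow> (real \<Rightarrow> 'd vfield) \<Rightarrow> bool" where
  "homotopy_solution \<omega> \<sigma> \<rho> \<rho>' X u \<longleftrightarrow>
     u 0 = 0 \<and>
     (\<forall>t\<in>{0..1}.
        u t \<in> far_spaceA' \<omega> \<sigma> \<rho>' \<and> normA' \<rho>' (u t) < delta_hat \<omega> \<sigma> \<rho> \<rho>' \<and>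
        (\<exists>L v.
           has_cderivative (far_spaceA' \<omega> \<sigma> \<rho>') (normA' \<rho>') (far_spaceA \<omega> \<sigma> \<rho>') (normA \<rho>')
             (F_map \<omega> \<sigma> \<rho>' X) L (u t) \<and>
           v \<in> far_spaceA' \<omega> \<sigma> \<rho>' \<and>
           (\<forall>e>0. \<exists>\<delta>>0. \<forall>s\<in>{0..1}. \<bar>s - t\<bar> < \<delta> \<longrightarrow>
              normA' \<rho>' (u s - u t - fscale (of_real (s - t)) v) \<le> e * \<bar>s - t\<bar>) \<and>
           L v = - F_map \<omega> \<sigma> \<rho>' X 0))"

definition homotopy_end ::
  "real ^ 'd \<Rightarrow> real \<Rightarrow> real \<Rightarrow> real \<Rightarrow> 'd::finite vfield \<Rightarrow> 'd vfield" where
  "homotopy_end \<omega> \<sigma> \<rho> \<rho>' X = (THE w. \<exists>u. homotopy_solution \<omega> \<sigma> \<rho> \<rho>' X u \<and> w = u 1)"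

definition U_op :: "real ^ 'd \<Rightarrow> real \<Rightarrow> real \<Rightarrow> real \<Rightarrow> 'd::finite vfield \<Rightarrow> 'd vfield" where
  "U_op \<omega> \<sigma> \<rho> \<rho>' X = pullback \<rho>' X (homotopy_end \<omega> \<sigma> \<rho> \<rho>' X)"

text \<open>\<open>T\<close> does not map \<open>\<D>(\<rho>)\<close> into \<open>\<D>(\<rho>')\<close>, so \<open>X \<circ> T\<close> on \<open>\<D>(\<rho>)\<close> refers to the analytic
  continuation of \<open>X\<close>, i.e. to the value of its Fourier series, which converges absolutely at
  \<open>T \<theta>\<close> if only modes in \<open>I\<^sup>+\<close> occur.\<close>

definition T_op :: "int ^ 'd ^ 'd \<Rightarrow> real \<Rightarrow> 'd::finite vfield \<Rightarrow> 'd vfield" where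
  "T_op T \<rho> X = restr \<rho> (\<lambda>\<theta>. matrix_inv (mat_of_int T) *v fseries (fcoeff X) (mat_of_int T *v \<theta>))"

definition average :: "'d::finite vfield \<Rightarrow> complex ^ 'd" where
  "average X = integral (cbox 0 1) (\<lambda>x :: real ^ 'd. X (vec_of_real x))"

definition renorm ::
  "real ^ 'd \<Rightarrow> int ^ 'd ^ 'd \<Rightarrow> real ^ 'd \<Rightarrow> real \<Rightarrow> real \<Rightarrow> real \<Rightarrow>
   'd::finite vfield \<Rightarrow> 'd vfield" where
  "renorm \<omega> T \<omega>' \<sigma> \<rho> \<rho>' X =
     (let Y = T_op T \<rho> (U_op \<omega> \<sigma> \<rho> \<rho>' X)
      in fscale (1 / dotp (vec_of_real \<omega>') (average Y)) Y)"

end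

theory Submission
  imports Defs "HOL-Complex_Analysis.Complex_Analysis"
begin

text \<open>
  In weighted Fourier coefficients \<open>\<A>\<close> and \<open>\<A>'\<close> become the plain complex \<open>\<ell>\<^sup>1\<close>, where \<open>\<R>\<close> is bounded near
  \<open>\<omega>\<close> and maps holomorphic curves to holomorphic curves; Cauchy estimates along complex lines then give
  Frechet derivatives, quadratic remainders and Lipschitz constants. Dividing by \<open>2 \<pi> i \<omega> \<cdot> k\<close> on the far
  modes turns the homotopy equation into a fixed point problem for a contraction.

  The derivative of \<open>\<R>\<close> at \<open>\<omega>\<close> is \<open>f \<mapsto> \<lambda>\<^sub>1 \<T> \<I>\<^sup>+ f - (\<omega>' \<cdot> \<E> f) \<omega>\<close>. It kills \<open>\<omega>\<close>, contracts the
  nonconstant modes in a suitably weighted norm because \<open>T\<^sup>*\<close> shortens the resonant modes, and expands the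
  constant fields in \<open>\<omega>'\<^sup>\<bottom>\<close>, on which its inverse is \<open>\<lambda>\<^sub>1\<^sup>-\<^sup>1 T\<close>. This gives the spectral gap, and the
  Lyapunov--Perron method yields the stable manifold as the graph of an analytic map. The unstable manifold is
  affine, as \<open>\<R>\<close> is affine on constant fields \<open>v\<close> with \<open>\<omega>' \<cdot> v = 1\<close>.
\<close>

section \<open>The complex Banach space \<open>\<ell>\<^sup>1\<close> and holomorphic curves in it\<close>

text \<open>Three difficulties shape the proof. First, \<open>U_op\<close> is a definite description
  over solutions of a differential equation in a Banach space, so all solutions must be shown to end
  at the same point: along any of them the far part of the pullback equals \<open>1 - t\<close>
  times its initial value, and this stationary equation has only one small solution. Second, the
  pullback differentiates the unknown. The weight 1 + 2 \<pi> |k| of the primed space pays for that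
  derivative, and since |\<omega> \<cdot> k| > \<sigma> |k| on far modes, dividing by \<omega>
  \<cdot> k gives it back: no small divisors occur. Third, the given norm need not show
  hyperbolicity. The matrix in \<T> can outweigh the gain on short modes, and the contraction
  hypothesis on \<open>T\<close> lives on the hyperplane orthogonal to \<omega>, which is dual to
  the unstable directions; hence a separate seminorm for each part. Moreover the manifolds are
  asserted for every small ball, so the set of orbits confined to such a ball is compared with the
  graph only locally, near each of its points.\<close>

typedef 'j ell1 = "{c :: 'j \<Rightarrow> complex. (\<lambda>j. norm (c j)) summable_on UNIV}"
  morphisms ap Abs_ell1
  by (rule exI[of _ "\<lambda>_. 0"]) simp

setup_lifting type_definition_ell1

lemma ap_summable: "(\<lambda>j. norm (ap x j)) summable_on UNIV"
  using ap[of x] by simp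

lemma ell1_eqI: "(\<And>j. ap x j = ap y j) \<Longrightarrow> x = y"
  by (metis ap_inject ext)

lemma ap_Abs:
  assumes "(\<lambda>j. norm (c j)) summable_on UNIV"
  shows "ap (Abs_ell1 c) = c"
  using assms by (simp add: Abs_ell1_inverse)

lemma summable_norm_bound:
  fixes f :: "'j \<Rightarrow> 'a::real_normed_vector" and g :: "'j \<Rightarrow> real"
  assumes "g summable_on UNIV" "\<And>j. norm (f j) \<le> g j"
  shows "(\<lambda>j. norm (f j)) summable_on UNIV"
  by (rule summable_on_comparison_test[OF assms(1)]) (use assms(2) in auto)

instantiation ell1 :: (type) real_vector
begin

lift_definition zero_ell1 :: "'a ell1" is "\<lambda>_. 0" by simp

lift_definition plus_ell1 :: "'a ell1 \<Rightarrow> 'a ell1 \<Rightarrow> 'a ell1" is "\<lambda>x y j. x j + y j"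
proof -
  fix x y :: "'a \<Rightarrow> complex"
  assume "(\<lambda>j. norm (x j)) summable_on UNIV" "(\<lambda>j. norm (y j)) summable_on UNIV"
  then have "(\<lambda>j. norm (x j) + norm (y j)) summable_on UNIV" by (rule summable_on_add)
  then show "(\<lambda>j. norm (x j + y j)) summable_on UNIV"
    by (rule summable_norm_bound) (rule norm_triangle_ineq)
qed

lift_definition minus_ell1 :: "'a ell1 \<Rightarrow> 'a ell1 \<Rightarrow> 'a ell1" is "\<lambda>x y j. x j - y j"
proof -
  fix x y :: "'a \<Rightarrow> complex"
  assume "(\<lambda>j. norm (x j)) summable_on UNIV" "(\<lambda>j. norm (y j)) summable_on UNIV"
  then have "(\<lambda>j. norm (x j) + norm (y j)) summable_on UNIV" by (rule summable_on_add)
  then show "(\<lambda>j. norm (x j - y j)) summable_on UNIV"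
    by (rule summable_norm_bound) (rule norm_triangle_ineq4)
qed

lift_definition uminus_ell1 :: "'a ell1 \<Rightarrow> 'a ell1" is "\<lambda>x j. - x j" by simp

lift_definition scaleR_ell1 :: "real \<Rightarrow> 'a ell1 \<Rightarrow> 'a ell1" is "\<lambda>r x j. r *\<^sub>R x j"
  by (simp add: summable_on_cmult_right)

instance by standard (transfer; simp add: fun_eq_iff algebra_simps)+

end

instantiation ell1 :: (type) real_normed_vector
begin

lift_definition norm_ell1 :: "'a ell1 \<Rightarrow> real" is "\<lambda>x. \<Sum>\<^sub>\<infinity>j. norm (x j)" .

definition dist_ell1 :: "'a ell1 \<Rightarrow> 'a ell1 \<Rightarrow> real" where "dist_ell1 x y = norm (x - y)"
definition sgn_ell1 :: "'a ell1 \<Rightarrow> 'a ell1" where "sgn_ell1 x = x /\<^sub>R norm x"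
definition uniformity_ell1 :: "('a ell1 \<times> 'a ell1) filter"
  where "uniformity_ell1 = (INF e\<in>{0 <..}. principal {(x, y). dist x y < e})"
definition open_ell1 :: "'a ell1 set \<Rightarrow> bool"
  where "open_ell1 U \<longleftrightarrow> (\<forall>x\<in>U. \<forall>\<^sub>F (x', y) in uniformity. x' = x \<longrightarrow> y \<in> U)"

instance
proof
  fix x y :: "'a ell1" and r :: real
  show "norm (x + y) \<le> norm x + norm y"
  proof transfer
    fix x y :: "'a \<Rightarrow> complex"
    assume s: "(\<lambda>j. norm (x j)) summable_on UNIV" "(\<lambda>j. norm (y j)) summable_on UNIV"
    have s2: "(\<lambda>j. norm (x j) + norm (y j)) summable_on UNIV" using s by (rule summable_on_add)
    have "(\<Sum>\<^sub>\<infinity>j. norm (x j + y j)) \<le> (\<Sum>\<^sub>\<infinity>j. norm (x j) + norm (y j))"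
      by (rule infsum_mono[OF summable_norm_bound[OF s2] s2]) (auto intro: norm_triangle_ineq)
    then show "(\<Sum>\<^sub>\<infinity>j. norm (x j + y j)) \<le> (\<Sum>\<^sub>\<infinity>j. norm (x j)) + (\<Sum>\<^sub>\<infinity>j. norm (y j))"
      using infsum_add[OF s] by simp
  qed
  show "norm (r *\<^sub>R x) = \<bar>r\<bar> * norm x"
    by transfer (simp add: infsum_cmult_right')
  show "(norm x = 0) = (x = 0)"
  proof transfer
    fix x :: "'a \<Rightarrow> complex"
    assume s: "(\<lambda>j. norm (x j)) summable_on UNIV"
    show "((\<Sum>\<^sub>\<infinity>j. norm (x j)) = 0) = (x = (\<lambda>_. 0))"
    proof
      assume "(\<Sum>\<^sub>\<infinity>j. norm (x j)) = 0"
      then have "norm (x j) = 0" for j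
        using nonneg_infsum_le_0D[of "\<lambda>j. norm (x j)" UNIV j] s by simp
      then show "x = (\<lambda>_. 0)" by auto
    qed simp
  qed
qed (simp_all add: dist_ell1_def sgn_ell1_def uniformity_ell1_def open_ell1_def)

end

lemma ap_simps [simp]:
  "ap 0 j = 0" "ap (x + y) j = ap x j + ap y j" "ap (x - y) j = ap x j - ap y j"
  "ap (- x) j = - ap x j" "ap (r *\<^sub>R x) j = r *\<^sub>R ap x j"
  by (transfer, simp)+

lemma norm_ell1_eq: "norm x = (\<Sum>\<^sub>\<infinity>j. norm (ap x j))"
  by transfer simp

lemma ap_sum: "ap (sum f A) j = (\<Sum>i\<in>A. ap (f i) j)"
  by (induction A rule: infinite_finite_induct) auto

lemma sum_ap_le_norm: "finite F \<Longrightarrow> (\<Sum>j\<in>F. norm (ap x j)) \<le> norm x"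
  unfolding norm_ell1_eq by (rule finite_sum_le_infsum[OF ap_summable]) auto

lemma ap_le_norm: "norm (ap x j) \<le> norm x"
  using sum_ap_le_norm[of "{j}" x] by simp

lemma norm_ell1_leI:
  assumes "\<And>F. finite F \<Longrightarrow> (\<Sum>j\<in>F. norm (ap x j)) \<le> M"
  shows "norm x \<le> M"
  unfolding norm_ell1_eq by (rule infsum_le_finite_sums[OF ap_summable]) (use assms in auto)

text \<open>A uniform bound on finite partial sums yields summability and the norm bound at once, so
  elements built coordinatewise need no separate convergence argument.\<close>

lemma ell1_ofI:
  assumes "\<And>F. finite F \<Longrightarrow> (\<Sum>j\<in>F. norm (c j)) \<le> M"
  shows "ap (Abs_ell1 c) = c" "norm (Abs_ell1 c) \<le> M"
proof -
  have "(\<lambda>j. norm (c j)) summable_on UNIV"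
    by (rule nonneg_bdd_above_summable_on) (use assms in \<open>auto intro!: bdd_aboveI\<close>)
  then show 1: "ap (Abs_ell1 c) = c" by (rule ap_Abs)
  show "norm (Abs_ell1 c) \<le> M" by (rule norm_ell1_leI) (simp add: 1 assms)
qed

instance ell1 :: (type) banach
proof
  fix X :: "nat \<Rightarrow> 'a ell1"
  assume C: "Cauchy X"
  have "Cauchy (\<lambda>n. ap (X n) j)" for j
  proof (rule CauchyI)
    fix e :: real assume "0 < e"
    then obtain N where "\<forall>m\<ge>N. \<forall>n\<ge>N. norm (X m - X n) < e" using CauchyD[OF C] by blast
    then have "\<forall>m\<ge>N. \<forall>n\<ge>N. norm (ap (X m) j - ap (X n) j) < e"
      by (metis ap_simps(3) ap_le_norm order_le_less_trans)
    then show "\<exists>M. \<forall>m\<ge>M. \<forall>n\<ge>M. norm (ap (X m) j - ap (X n) j) < e" by blast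
  qed
  then have "\<forall>j. \<exists>l. (\<lambda>n. ap (X n) j) \<longlonglongrightarrow> l"
    by (simp add: Cauchy_convergent_iff convergent_def)
  then obtain c where c: "\<And>j. (\<lambda>n. ap (X n) j) \<longlonglongrightarrow> c j" by metis
  have fin: "(\<Sum>j\<in>F. norm (ap (X m) j - c j)) \<le> e"
    if "finite F" "\<forall>n\<ge>N. norm (X m - X n) < e" for F e m N
  proof (rule tendsto_upperbound)
    show "(\<lambda>n. \<Sum>j\<in>F. norm (ap (X m) j - ap (X n) j)) \<longlonglongrightarrow> (\<Sum>j\<in>F. norm (ap (X m) j - c j))"
      by (intro tendsto_intros c)
    show "\<forall>\<^sub>F n in sequentially. (\<Sum>j\<in>F. norm (ap (X m) j - ap (X n) j)) \<le> e"
      unfolding eventually_sequentially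
    proof (intro exI allI impI)
      fix n assume "N \<le> n"
      have "(\<Sum>j\<in>F. norm (ap (X m - X n) j)) \<le> norm (X m - X n)" by (rule sum_ap_le_norm[OF that(1)])
      also have "\<dots> \<le> e" using that(2) \<open>N \<le> n\<close> by (simp add: less_imp_le)
      finally show "(\<Sum>j\<in>F. norm (ap (X m) j - ap (X n) j)) \<le> e" by simp
    qed
  qed simp
  \<comment> \<open>The limit is written as \<open>X m\<close> minus an element that
    \<open>fin\<close> shows to be summable. Its coordinates are \<open>c\<close> whatever
    \<open>m\<close> is, so one limit serves all indices.\<close>
  have lim: "norm (X m - (X m - Abs_ell1 (\<lambda>j. ap (X m) j - c j))) \<le> e"
      "ap (X m - Abs_ell1 (\<lambda>j. ap (X m) j - c j)) = c"
    if "\<forall>n\<ge>N. norm (X m - X n) < e" for e m N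
  proof -
    note a = ell1_ofI[of "\<lambda>j. ap (X m) j - c j" e, OF fin[OF _ that]]
    show "norm (X m - (X m - Abs_ell1 (\<lambda>j. ap (X m) j - c j))) \<le> e" using a(2) by simp
    show "ap (X m - Abs_ell1 (\<lambda>j. ap (X m) j - c j)) = c" using a(1) by auto
  qed
  obtain N1 where "\<forall>m\<ge>N1. \<forall>n\<ge>N1. norm (X m - X n) < 1" using CauchyD[OF C, of 1] by auto
  then have N1: "\<forall>n\<ge>N1. norm (X N1 - X n) < 1" by blast
  define L where "L = X N1 - Abs_ell1 (\<lambda>j. ap (X N1) j - c j)"
  have L: "ap L = c" unfolding L_def by (rule lim(2)[OF N1])
  have "X \<longlonglongrightarrow> L"
  proof (rule LIMSEQ_I)
    fix e :: real assume "0 < e"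
    then obtain N where N: "\<forall>m\<ge>N. \<forall>n\<ge>N. norm (X m - X n) < e / 2"
      using CauchyD[OF C, of "e / 2"] by auto
    have "norm (X m - L) < e" if "m \<ge> N" for m
    proof -
      have *: "\<forall>n\<ge>N. norm (X m - X n) < e / 2" using N that by blast
      have "X m - Abs_ell1 (\<lambda>j. ap (X m) j - c j) = L"
        by (rule ell1_eqI) (simp only: lim(2)[OF *] L)
      then show ?thesis using lim(1)[OF *] \<open>0 < e\<close> by simp
    qed
    then show "\<exists>no. \<forall>n\<ge>no. norm (X n - L) < e" by blast
  qed
  then show "convergent X" by (auto simp: convergent_def)
qed

lift_definition cs :: "complex \<Rightarrow> 'j ell1 \<Rightarrow> 'j ell1" is "\<lambda>c x j. c * x j"
  by (simp add: norm_mult summable_on_cmult_right)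

lemma ap_cs [simp]: "ap (cs c x) j = c * ap x j"
  by transfer simp

lemma norm_cs [simp]: "norm (cs c x) = norm c * norm x"
  by transfer (simp add: norm_mult infsum_cmult_right')

lemma cs_simps [simp]: "cs 1 x = x" "cs 0 x = 0" "cs c 0 = 0" "cs (-1) x = - x"
  by (auto intro: ell1_eqI)

lemma cs_algebra: "cs c (x + y) = cs c x + cs c y" "cs c (x - y) = cs c x - cs c y"
  "cs (a + b) x = cs a x + cs b x" "cs (a - b) x = cs a x - cs b x" "cs a (cs b x) = cs (a * b) x"
  "cs c (- x) = - cs c x"
  by (auto intro!: ell1_eqI simp: algebra_simps)

lemma scaleR_cs: "r *\<^sub>R x = cs (of_real r) x"
  by (rule ell1_eqI) (simp add: scaleR_conv_of_real)

section \<open>Bounded complex linear maps and unit vectors\<close>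

definition clin :: "('i ell1 \<Rightarrow> 'j ell1) \<Rightarrow> bool" where
  "clin L \<longleftrightarrow> (\<forall>x y. L (x + y) = L x + L y) \<and> (\<forall>c x. L (cs c x) = cs c (L x)) \<and>
    (\<exists>C. \<forall>x. norm (L x) \<le> C * norm x)"

lemma clin_blin:
  assumes "clin L"
  shows "bounded_linear L"
proof -
  obtain C where "\<And>x. norm (L x) \<le> C * norm x" using assms by (auto simp: clin_def)
  then show ?thesis
    using assms by (intro bounded_linear_intro[of L C]) (simp_all add: clin_def scaleR_cs mult.commute)
qed

lemma clin_add: "clin L \<Longrightarrow> L (x + y) = L x + L y"
  and clin_cs: "clin L \<Longrightarrow> L (cs c x) = cs c (L x)"
  by (auto simp: clin_def)

lemma clin_diff: "clin L \<Longrightarrow> L (x - y) = L x - L y"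
  and clin_0: "clin L \<Longrightarrow> L 0 = 0"
  and clin_minus: "clin L \<Longrightarrow> L (- x) = - L x"
  using clin_blin[of L] linear_diff[of L] linear_0[of L] linear_neg[of L] by (auto simp: bounded_linear.linear)

lemma clin_bound:
  assumes "clin L"
  obtains C where "C > 0" "\<And>x. norm (L x) \<le> C * norm x"
  using bounded_linear.pos_bounded[OF clin_blin[OF assms]] by (metis mult.commute)

lemma clinI:
  assumes "\<And>x y. L (x + y) = L x + L y" "\<And>c x. L (cs c x) = cs c (L x)" "\<And>x. norm (L x) \<le> C * norm x"
  shows "clin L"
  using assms unfolding clin_def by blast

lemma clin_id: "clin (\<lambda>x. x)"
  by (rule clinI[of _ 1]) auto

lemma clin_comp: "clin L \<Longrightarrow> clin M \<Longrightarrow> clin (\<lambda>x. L (M x))"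
proof -
  assume L: "clin L" and M: "clin M"
  obtain C D where C: "C > 0" "\<And>x. norm (L x) \<le> C * norm x" and D: "\<And>x. norm (M x) \<le> D * norm x"
    using clin_bound[OF L] clin_bound[OF M] by metis
  have "norm (L (M x)) \<le> (C * D) * norm x" for x
    using order_trans[OF C(2)[of "M x"] mult_left_mono[OF D[of x], of C]] C(1) by (simp add: mult.assoc)
  then show ?thesis using L M by (intro clinI[of _ "C * D"]) (auto simp: clin_add clin_cs)
qed

lemma clin_sum2: "clin L \<Longrightarrow> clin M \<Longrightarrow> clin (\<lambda>x. L x + M x)"
proof -
  assume L: "clin L" and M: "clin M"
  obtain C D where C: "\<And>x. norm (L x) \<le> C * norm x" and D: "\<And>x. norm (M x) \<le> D * norm x"
    using clin_bound[OF L] clin_bound[OF M] by metis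
  have "norm (L x + M x) \<le> (C + D) * norm x" for x
    using norm_triangle_mono[OF C D, of x x] by (simp add: algebra_simps)
  then show ?thesis using L M by (intro clinI[of _ "C + D"]) (auto simp: clin_add clin_cs cs_algebra)
qed

lemma clin_cs': "clin (cs c)"
  by (rule clinI[of _ "norm c"]) (auto simp: cs_algebra mult.commute)

lemma clin_minus2: "clin L \<Longrightarrow> clin M \<Longrightarrow> clin (\<lambda>x. L x - M x)"
  using clin_sum2[OF _ clin_comp[OF clin_cs'[of "-1"]], of L M] by simp

lift_definition sngl :: "'j \<Rightarrow> 'j ell1" is "\<lambda>i j. if j = i then 1 else 0"
proof -
  fix i :: 'j
  have "(\<lambda>j. norm (if j = i then 1 else 0 :: complex)) = (\<lambda>j. if j = i then 1 else 0)" by auto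
  then show "(\<lambda>j. norm (if j = i then 1 else 0 :: complex)) summable_on UNIV"
    using finite_nonzero_values_imp_summable_on[of UNIV "\<lambda>j. if j = i then 1 else 0::real"] by simp
qed

lemma ap_sngl: "ap (sngl i) j = (if j = i then 1 else 0)"
  by transfer simp

lemma norm_sngl [simp]: "norm (sngl i) = 1"
proof (rule antisym)
  show "norm (sngl i) \<le> 1"
  proof (rule norm_ell1_leI)
    fix F :: "'a set" assume "finite F"
    have "(\<Sum>j\<in>F. norm (ap (sngl i) j)) = (\<Sum>j\<in>F. if j = i then 1 else 0)"
      by (intro sum.cong) (auto simp: ap_sngl)
    then show "(\<Sum>j\<in>F. norm (ap (sngl i) j)) \<le> 1" using \<open>finite F\<close> by (simp add: sum.delta)
  qed
  show "1 \<le> norm (sngl i)" using ap_le_norm[of "sngl i" i] by (simp add: ap_sngl)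
qed

text \<open>Outside a finite set \<open>F\<close> the remainder has norm at most
  \<open>norm x\<close> minus the part of the norm carried by \<open>F\<close>. Hence a bounded
  linear map is determined by its values on unit vectors, which is how identities between operators
  on coefficients are verified below.\<close>

lemma has_sum_sngl: "((\<lambda>j. cs (ap x j) (sngl j)) has_sum x) UNIV"
  unfolding has_sum_def tendsto_iff
proof (intro allI impI)
  fix e :: real assume "e > 0"
  have "((\<lambda>j. norm (ap x j)) has_sum norm x) UNIV"
    unfolding norm_ell1_eq by (rule has_sum_infsum[OF ap_summable])
  then have "\<forall>\<^sub>F F in finite_subsets_at_top UNIV. dist (\<Sum>j\<in>F. norm (ap x j)) (norm x) < e"
    using \<open>e > 0\<close> unfolding has_sum_def tendsto_iff by blast
  then obtain X where X: "finite X"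
      and *: "\<forall>Y. finite Y \<and> X \<subseteq> Y \<and> Y \<subseteq> UNIV \<longrightarrow> dist (\<Sum>j\<in>Y. norm (ap x j)) (norm x) < e"
    unfolding eventually_finite_subsets_at_top by blast
  show "\<forall>\<^sub>F F in finite_subsets_at_top UNIV. dist (\<Sum>j\<in>F. cs (ap x j) (sngl j)) x < e"
    unfolding eventually_finite_subsets_at_top
  proof (intro exI[of _ X] conjI allI impI)
    show "finite X" by fact
    show "X \<subseteq> UNIV" by simp
    fix F assume XF: "finite F \<and> X \<subseteq> F \<and> F \<subseteq> UNIV"
    have F: "ap (\<Sum>j\<in>F. cs (ap x j) (sngl j)) i = (if i \<in> F then ap x i else 0)" for i
      using XF by (auto simp: ap_sum ap_sngl if_distrib cong: if_cong)
    have "norm (x - (\<Sum>j\<in>F. cs (ap x j) (sngl j))) \<le> norm x - (\<Sum>j\<in>F. norm (ap x j))"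
    proof (rule norm_ell1_leI)
      fix G :: "'a set" assume "finite G"
      have "(\<Sum>j\<in>G. norm (ap (x - (\<Sum>j\<in>F. cs (ap x j) (sngl j))) j)) = (\<Sum>j\<in>G. if j \<in> F then 0 else norm (ap x j))"
        by (intro sum.cong) (auto simp: F)
      also have "\<dots> = (\<Sum>j\<in>G - F. norm (ap x j))"
        using \<open>finite G\<close> by (simp add: sum.If_cases Diff_eq)
      finally show "(\<Sum>j\<in>G. norm (ap (x - (\<Sum>j\<in>F. cs (ap x j) (sngl j))) j)) \<le> norm x - (\<Sum>j\<in>F. norm (ap x j))"
        using sum_ap_le_norm[of "F \<union> (G - F)" x] sum.union_disjoint[of F "G - F" "\<lambda>j. norm (ap x j)"] XF \<open>finite G\<close>
        by simp
    qed
    moreover have "norm x - (\<Sum>j\<in>F. norm (ap x j)) < e" using * XF by (auto simp: dist_real_def)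
    ultimately show "dist (\<Sum>j\<in>F. cs (ap x j) (sngl j)) x < e" by (simp add: dist_norm norm_minus_commute)
  qed
qed

section \<open>Summable families and holomorphic curves\<close>

lemma bounded_linear_ap: "bounded_linear (\<lambda>x. ap x j)"
  by (rule bounded_linear_intro[of _ 1]) (auto simp: ap_le_norm)

lemma abs_summable_ell1:
  fixes f :: "'i \<Rightarrow> 'j ell1"
  assumes "\<And>F. finite F \<Longrightarrow> (\<Sum>i\<in>F. norm (f i)) \<le> M"
  shows "f summable_on UNIV" "norm (infsum f UNIV) \<le> M" "(\<lambda>i. norm (f i)) summable_on UNIV"
    "ap (infsum f UNIV) j = (\<Sum>\<^sub>\<infinity>i. ap (f i) j)"
proof -
  show s: "(\<lambda>i. norm (f i)) summable_on UNIV"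
    by (rule nonneg_bdd_above_summable_on) (use assms in \<open>auto intro!: bdd_aboveI\<close>)
  then show s': "f summable_on UNIV" using abs_summable_summable by blast
  have "norm (infsum f UNIV) \<le> (\<Sum>\<^sub>\<infinity>i. norm (f i))" using s by (rule norm_infsum_bound)
  also have "\<dots> \<le> M" by (rule infsum_le_finite_sums[OF s]) (use assms in auto)
  finally show "norm (infsum f UNIV) \<le> M" .
  show "ap (infsum f UNIV) j = (\<Sum>\<^sub>\<infinity>i. ap (f i) j)"
    using infsumI[OF has_sum_bounded_linear[OF bounded_linear_ap[of j] has_sum_infsum[OF s']]] by simp
qed

text \<open>Montel's theorem provides a subsequence with a holomorphic limit, and pointwise
  convergence of the whole sequence identifies that limit with \<open>g\<close>.\<close>

lemma holomorphic_pointwise_limit: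
  fixes f :: "nat \<Rightarrow> complex \<Rightarrow> complex"
  assumes U: "open U" and hol: "\<And>n. f n holomorphic_on U" and bd: "\<And>n z. z \<in> U \<Longrightarrow> norm (f n z) \<le> M"
    and lim: "\<And>z. z \<in> U \<Longrightarrow> (\<lambda>n. f n z) \<longlonglongrightarrow> g z"
  shows "g holomorphic_on U"
proof -
  obtain h r where h: "h holomorphic_on U" "strict_mono (r :: nat \<Rightarrow> nat)"
      "\<And>x. x \<in> U \<Longrightarrow> ((\<lambda>n. f (r n) x) \<longlongrightarrow> h x) sequentially"
    by (rule Montel[of U "range f" f]) (use U hol bd in blast)+
  have "g z = h z" if "z \<in> U" for z
    using LIMSEQ_unique[OF LIMSEQ_subseq_LIMSEQ[OF lim[OF that] h(2)]] h(3)[OF that] by (simp add: o_def)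
  then show ?thesis using h(1) holomorphic_cong by metis
qed

text \<open>The initial segments under \<open>to_nat\<close> are cofinal among finite sets, so the
  unordered sum becomes the limit of a sequence. The bound on absolute finite sums bounds all
  partial sums uniformly, as Montel's theorem requires.\<close>

lemma holomorphic_infsum:
  fixes f :: "'i::countable \<Rightarrow> complex \<Rightarrow> complex"
  assumes U: "open U" and hol: "\<And>i. f i holomorphic_on U"
    and bd: "\<And>F z. finite F \<Longrightarrow> z \<in> U \<Longrightarrow> (\<Sum>i\<in>F. norm (f i z)) \<le> M"
  shows "(\<lambda>z. \<Sum>\<^sub>\<infinity>i. f i z) holomorphic_on U"
proof (rule holomorphic_pointwise_limit[OF U, where f = "\<lambda>n z. \<Sum>i | to_nat i < n. f i z"])
  have fin: "finite {i :: 'i. to_nat i < n}" for n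
    using finite_vimageI[OF finite_lessThan inj_to_nat, of n] by (simp add: vimage_def)
  show "(\<lambda>z. \<Sum>i | to_nat i < n. f i z) holomorphic_on U" for n
    by (intro holomorphic_on_sum hol)
  show "norm (\<Sum>i | to_nat i < n. f i z) \<le> M" if "z \<in> U" for n z
    using order_trans[OF norm_sum bd[OF fin that]] .
  show "(\<lambda>n. \<Sum>i | to_nat i < n. f i z) \<longlonglongrightarrow> (\<Sum>\<^sub>\<infinity>i. f i z)" if z: "z \<in> U" for z
  proof -
    have "(\<lambda>i. norm (f i z)) summable_on UNIV"
      by (rule nonneg_bdd_above_summable_on) (use bd[OF _ z] in \<open>auto intro!: bdd_aboveI\<close>)
    then have "(\<lambda>i. f i z) summable_on UNIV" by (rule abs_summable_summable)
    then have *: "(sum (\<lambda>i. f i z) \<longlongrightarrow> (\<Sum>\<^sub>\<infinity>i. f i z)) (finite_subsets_at_top UNIV)"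
      using has_sum_infsum unfolding has_sum_def by blast
    have "filterlim (\<lambda>n. {i :: 'i. to_nat i < n}) (finite_subsets_at_top UNIV) sequentially"
      unfolding filterlim_finite_subsets_at_top
    proof (intro allI impI)
      fix X :: "'i set" assume X: "finite X \<and> X \<subseteq> UNIV"
      have "X \<subseteq> {i. to_nat i < n}" if "n > Max (insert 0 (to_nat ` X))" for n
        using X that by auto
      then show "\<forall>\<^sub>F n in sequentially. finite {i::'i. to_nat i < n} \<and> X \<subseteq> {i. to_nat i < n} \<and> {i::'i. to_nat i < n} \<subseteq> UNIV"
        using fin unfolding eventually_sequentially by (meson Suc_le_eq subset_UNIV)
    qed
    from filterlim_compose[OF * this] show ?thesis .
  qed
qed

text \<open>Holomorphic curves are required to be bounded, so that by Montel's theorem they are closed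
  under coordinatewise limits. A map between such spaces is used as an analytic map if it is
  bounded and takes holomorphic curves to holomorphic curves.\<close>

definition hcurve :: "complex set \<Rightarrow> (complex \<Rightarrow> 'j ell1) \<Rightarrow> bool" where
  "hcurve U \<gamma> \<longleftrightarrow> open U \<and> (\<forall>j. (\<lambda>z. ap (\<gamma> z) j) holomorphic_on U) \<and> (\<exists>M. \<forall>z\<in>U. norm (\<gamma> z) \<le> M)"

lemma hcurve_open: "hcurve U \<gamma> \<Longrightarrow> open U"
  by (simp add: hcurve_def)

lemma hcurve_bound:
  assumes "hcurve U \<gamma>"
  obtains M where "\<And>z. z \<in> U \<Longrightarrow> norm (\<gamma> z) \<le> M"
  using assms by (auto simp: hcurve_def)

lemma hcurveI:
  assumes "open U" "\<And>j. (\<lambda>z. ap (\<gamma> z) j) holomorphic_on U" "\<And>z. z \<in> U \<Longrightarrow> norm (\<gamma> z) \<le> M"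
  shows "hcurve U \<gamma>"
  using assms by (auto simp: hcurve_def)

lemma hcurve_const: "open U \<Longrightarrow> hcurve U (\<lambda>_. x)"
  by (rule hcurveI[of _ _ "norm x"]) auto

lemma hcurve_limit:
  assumes "open U" "\<And>n. hcurve U (\<gamma> n)" "\<And>n z. z \<in> U \<Longrightarrow> norm (\<gamma> n z) \<le> M"
    and lim: "\<And>z. z \<in> U \<Longrightarrow> (\<lambda>n. \<gamma> n z) \<longlonglongrightarrow> g z"
  shows "hcurve U g"
proof (rule hcurveI)
  show "open U" by fact
  fix j
  show "(\<lambda>z. ap (g z) j) holomorphic_on U"
  proof (rule holomorphic_pointwise_limit[OF \<open>open U\<close>, where f = "\<lambda>n z. ap (\<gamma> n z) j" and M = M])
    show "(\<lambda>z. ap (\<gamma> n z) j) holomorphic_on U" for n using assms(2) by (simp add: hcurve_def)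
    show "norm (ap (\<gamma> n z) j) \<le> M" if "z \<in> U" for n z
      using order_trans[OF ap_le_norm assms(3)[OF that]] .
    show "(\<lambda>n. ap (\<gamma> n z) j) \<longlonglongrightarrow> ap (g z) j" if "z \<in> U" for z
      using bounded_linear.tendsto[OF bounded_linear_ap lim[OF that]] .
  qed
next
  fix z assume "z \<in> U"
  show "norm (g z) \<le> M"
    by (rule tendsto_upperbound[OF tendsto_norm[OF lim[OF \<open>z \<in> U\<close>]]]) (use assms(3)[OF \<open>z \<in> U\<close>] in auto)
qed

lemma hcurve_infsum:
  fixes \<gamma> :: "'i::countable \<Rightarrow> complex \<Rightarrow> 'j ell1"
  assumes U: "open U" and h: "\<And>i. hcurve U (\<gamma> i)"
    and bd: "\<And>F z. finite F \<Longrightarrow> z \<in> U \<Longrightarrow> (\<Sum>i\<in>F. norm (\<gamma> i z)) \<le> M"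
  shows "hcurve U (\<lambda>z. \<Sum>\<^sub>\<infinity>i. \<gamma> i z)"
proof (rule hcurveI[OF U])
  show "norm (\<Sum>\<^sub>\<infinity>i. \<gamma> i z) \<le> M" if "z \<in> U" for z
    by (rule abs_summable_ell1(2)) (use bd that in auto)
  fix j
  have "(\<lambda>z. \<Sum>\<^sub>\<infinity>i. ap (\<gamma> i z) j) holomorphic_on U"
  proof (rule holomorphic_infsum[OF U])
    show "(\<lambda>z. ap (\<gamma> i z) j) holomorphic_on U" for i using h by (simp add: hcurve_def)
    show "(\<Sum>i\<in>F. norm (ap (\<gamma> i z) j)) \<le> M" if "finite F" "z \<in> U" for F z
      using order_trans[OF sum_mono[OF ap_le_norm] bd[OF that]] .
  qed
  then show "(\<lambda>z. ap (\<Sum>\<^sub>\<infinity>i. \<gamma> i z) j) holomorphic_on U"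
    by (rule holomorphic_transform) (use abs_summable_ell1(4)[OF bd] in auto)
qed

lemma hcurve_add: "hcurve U \<gamma> \<Longrightarrow> hcurve U \<gamma>' \<Longrightarrow> hcurve U (\<lambda>z. \<gamma> z + \<gamma>' z)"
proof -
  assume h: "hcurve U \<gamma>" "hcurve U \<gamma>'"
  obtain M where M: "\<And>z. z \<in> U \<Longrightarrow> norm (\<gamma> z) \<le> M" using hcurve_bound[OF h(1)] by blast
  obtain M' where M': "\<And>z. z \<in> U \<Longrightarrow> norm (\<gamma>' z) \<le> M'" using hcurve_bound[OF h(2)] by blast
  show ?thesis
  proof (rule hcurveI[OF hcurve_open[OF h(1)]])
    show "(\<lambda>z. ap (\<gamma> z + \<gamma>' z) j) holomorphic_on U" for j
      unfolding ap_simps by (rule holomorphic_on_add) (use h in \<open>simp_all add: hcurve_def\<close>)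
    show "norm (\<gamma> z + \<gamma>' z) \<le> M + M'" if "z \<in> U" for z
      by (rule norm_triangle_mono[OF M[OF that] M'[OF that]])
  qed
qed

lemma hcurve_cs:
  assumes "hcurve U \<gamma>" "f holomorphic_on U" "\<And>z. z \<in> U \<Longrightarrow> norm (f z) \<le> M"
  shows "hcurve U (\<lambda>z. cs (f z) (\<gamma> z))"
proof -
  obtain M' where M': "\<And>z. z \<in> U \<Longrightarrow> norm (\<gamma> z) \<le> M'" using hcurve_bound[OF assms(1)] by blast
  have "norm (f z) * norm (\<gamma> z) \<le> M * M'" if "z \<in> U" for z
    by (rule mult_mono[OF assms(3)[OF that] M'[OF that] order_trans[OF norm_ge_zero assms(3)[OF that]]]) simp
  then have bd: "norm (cs (f z) (\<gamma> z)) \<le> M * M'" if "z \<in> U" for z using that by simp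
  have hol: "(\<lambda>z. ap (cs (f z) (\<gamma> z)) j) holomorphic_on U" for j
    unfolding ap_cs by (rule holomorphic_on_mult[OF assms(2)]) (use assms(1) in \<open>simp add: hcurve_def\<close>)
  show ?thesis by (rule hcurveI[OF hcurve_open[OF assms(1)] hol bd])
qed

text \<open>A coordinate of \<open>L (\<gamma> z)\<close> involves all coordinates of
  \<open>\<gamma> z\<close>, while holomorphy is known only coordinatewise. Expanding along unit
  vectors turns the image into a bounded series of scalar holomorphic functions times fixed
  vectors.\<close>

lemma hcurve_clin:
  fixes L :: "'i::countable ell1 \<Rightarrow> 'j ell1"
  assumes h: "hcurve U \<gamma>" and L: "clin L"
  shows "hcurve U (\<lambda>z. L (\<gamma> z))"
proof -
  obtain M where M: "\<And>z. z \<in> U \<Longrightarrow> norm (\<gamma> z) \<le> M" using hcurve_bound[OF h] by blast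
  obtain C where C: "C > 0" "\<And>x. norm (L x) \<le> C * norm x" using clin_bound[OF L] by blast
  have eq: "L x = (\<Sum>\<^sub>\<infinity>j. cs (ap x j) (L (sngl j)))" for x
    using infsumI[OF has_sum_bounded_linear[OF clin_blin[OF L] has_sum_sngl[of x]]] by (simp add: clin_cs[OF L])
  have "hcurve U (\<lambda>z. \<Sum>\<^sub>\<infinity>j. cs (ap (\<gamma> z) j) (L (sngl j)))"
  proof (rule hcurve_infsum[where M = "C * M"])
    show U: "open U" using h by (rule hcurve_open)
    show "hcurve U (\<lambda>z. cs (ap (\<gamma> z) j) (L (sngl j)))" for j
      by (rule hcurve_cs[OF hcurve_const[OF U]], use h in \<open>simp add: hcurve_def\<close>)
         (use order_trans[OF ap_le_norm M] in blast)
    fix F :: "'i set" and z assume F: "finite F" "z \<in> U"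
    have "(\<Sum>j\<in>F. norm (cs (ap (\<gamma> z) j) (L (sngl j)))) \<le> (\<Sum>j\<in>F. norm (ap (\<gamma> z) j) * C)"
      using C(2)[of "sngl _"] by (intro sum_mono) (simp add: mult_left_mono)
    also have "\<dots> \<le> M * C"
      using order_trans[OF sum_ap_le_norm[OF F(1)] M[OF F(2)]] C(1)
      by (simp add: sum_distrib_right[symmetric])
    finally show "(\<Sum>j\<in>F. norm (cs (ap (\<gamma> z) j) (L (sngl j)))) \<le> C * M" by (simp add: mult.commute)
  qed
  then show ?thesis by (simp add: eq[symmetric])
qed

lemma hcurve_diff:
  assumes "hcurve U \<gamma>" "hcurve U \<gamma>'" shows "hcurve U (\<lambda>z. \<gamma> z - \<gamma>' z)"
proof -
  have "hcurve U (\<lambda>z. cs (-1) (\<gamma>' z))"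
    by (rule hcurve_cs[OF assms(2), of _ 1]) auto
  from hcurve_add[OF assms(1) this] show ?thesis by simp
qed

lemma hcurve_line: "open U \<Longrightarrow> bounded U \<Longrightarrow> hcurve U (\<lambda>z. x + cs z h)"
proof -
  assume U: "open U" "bounded U"
  then obtain M where M: "\<And>z. z \<in> U \<Longrightarrow> norm z \<le> M" by (auto simp: bounded_iff)
  show ?thesis by (intro hcurve_add hcurve_const hcurve_cs[of _ _ "\<lambda>z. z" M] U M holomorphic_on_ident)
qed

section \<open>Cauchy estimates along complex lines\<close>

lemma cnj_sgn_mult: "cnj (sgn z) * z = of_real (norm z)"
proof (cases "z = 0")
  case False
  have "cnj (sgn z) * z = (z * cnj z) / of_real (norm z)" by (simp add: sgn_div_norm scaleR_conv_of_real divide_simps)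
  also have "\<dots> = of_real (norm z)" using False by (simp add: complex_norm_square[symmetric] power2_eq_square)
  finally show ?thesis .
qed simp

text \<open>Duality with bounded sequences, in finite form: choosing \<open>s\<close> as the
  conjugate signs recovers the partial sums of the norm. Estimates for curves thereby reduce to
  estimates for scalar holomorphic functions.\<close>

lemma norm_ell1_dual:
  assumes "\<And>F s. finite F \<Longrightarrow> (\<And>j. norm (s j) \<le> 1) \<Longrightarrow> norm (\<Sum>j\<in>F. s j * ap x j) \<le> M"
  shows "norm x \<le> M"
proof (rule norm_ell1_leI)
  fix F :: "'a set" assume F: "finite F"
  define s where "s j = cnj (sgn (ap x j))" for j
  have "s j * ap x j = of_real (norm (ap x j))" for j
    unfolding s_def by (rule cnj_sgn_mult)
  then have "(\<Sum>j\<in>F. s j * ap x j) = of_real (\<Sum>j\<in>F. norm (ap x j))" by simp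
  moreover have "norm (\<Sum>j\<in>F. s j * ap x j) \<le> M"
    by (rule assms[OF F]) (auto simp: s_def norm_sgn)
  ultimately have "\<bar>\<Sum>j\<in>F. norm (ap x j)\<bar> \<le> M" by (simp only: norm_of_real)
  then show "(\<Sum>j\<in>F. norm (ap x j)) \<le> M" by simp
qed

lemma norm_functional_le:
  assumes "finite F" "\<And>j. norm (s j) \<le> 1"
  shows "norm (\<Sum>j\<in>F. s j * ap x j) \<le> norm x"
proof -
  have "norm (\<Sum>j\<in>F. s j * ap x j) \<le> (\<Sum>j\<in>F. norm (ap x j))"
    using assms(2) by (intro sum_norm_le) (simp add: norm_mult mult_left_le_one_le)
  then show ?thesis using sum_ap_le_norm[OF assms(1), of x] by simp
qed

text \<open>The bound \<open>M\<close> is available only on the open ball, so Cauchy's inequality is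
  applied on smaller circles and their radius then tends to \<open>R\<close>.\<close>

lemma deriv_bound_ball:
  assumes f: "f holomorphic_on ball z R" "\<And>w. w \<in> ball z R \<Longrightarrow> norm (f w) \<le> M" and R: "R > 0"
  shows "norm ((deriv ^^ n) f z) \<le> fact n * M / R ^ n"
proof -
  have *: "norm ((deriv ^^ n) f z) \<le> fact n * M / r ^ n" if r: "0 < r" "r < R" for r
  proof (rule Cauchy_inequality)
    show "f holomorphic_on ball z r" using f(1) r by (auto elim: holomorphic_on_subset)
    show "continuous_on (cball z r) f"
      using f(1) r by (intro holomorphic_on_imp_continuous_on) (auto elim!: holomorphic_on_subset)
    show "norm (f x) \<le> M" if "norm (z - x) = r" for x
      using f(2)[of x] that r by (simp add: dist_norm)
  qed fact
  show ?thesis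
  proof (rule tendsto_lowerbound[where F = "at_left R" and f = "\<lambda>r. fact n * M / r ^ n"])
    show "((\<lambda>r. fact n * M / r ^ n) \<longlongrightarrow> fact n * M / R ^ n) (at_left R)"
      using R by (intro tendsto_intros) auto
    show "\<forall>\<^sub>F r in at_left R. norm ((deriv ^^ n) f z) \<le> fact n * M / r ^ n"
      using eventually_at_left_field[of _ R] * R by (auto simp: eventually_at_left_field intro!: exI[of _ 0])
  qed auto
qed

lemma scalar_quadratic_remainder:
  assumes f: "f holomorphic_on ball 0 R" "\<And>w. w \<in> ball 0 R \<Longrightarrow> norm (f w) \<le> M" and R: "R > 0"
    and h: "norm h < R / 2"
  shows "norm (f h - f 0 - h * deriv f 0) \<le> 8 * M / R\<^sup>2 * (norm h)\<^sup>2"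
proof -
  let ?f = "\<lambda>n. (deriv ^^ n) f"
  \<comment> \<open>Balls of radius \<open>R/2\<close> about points of \<open>ball 0 (R/2)\<close>
    stay in \<open>ball 0 R\<close>, so the second derivative is at most
    \<open>2 * M / (R/2)^2\<close> there; this is the source of the 8.\<close>
  have "norm (?f 0 h - (\<Sum>i\<le>1. ?f i 0 * (h - 0) ^ i / fact i)) \<le> (2 * M / (R/2)^2) * norm (h - 0) ^ Suc 1 / fact 1"
  proof (rule complex_Taylor[where S = "ball 0 (R/2)" and f = ?f])
    show "convex (ball 0 (R / 2) :: complex set)" by simp
    show "(?f i has_field_derivative ?f (Suc i) x) (at x within ball 0 (R/2))" if "x \<in> ball 0 (R/2)" for x i
    proof -
      have "?f i holomorphic_on ball 0 R" by (rule holomorphic_higher_deriv[OF f(1)]) simp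
      moreover have "x \<in> ball 0 R" using that R by auto
      ultimately show ?thesis
        using holomorphic_derivI[of "?f i" "ball 0 R" x] by (auto intro: has_field_derivative_at_within)
    qed
    show "norm (?f (Suc 1) x) \<le> 2 * M / (R/2)^2" if "x \<in> ball 0 (R/2)" for x
    proof -
      have "ball x (R/2) \<subseteq> ball 0 R"
      proof
        fix y assume "y \<in> ball x (R/2)"
        then show "y \<in> ball 0 R" using that dist_triangle[of 0 y x] by simp
      qed
      then have "f holomorphic_on ball x (R/2)" "\<And>w. w \<in> ball x (R/2) \<Longrightarrow> norm (f w) \<le> M"
        using f by (auto intro: holomorphic_on_subset)
      from deriv_bound_ball[OF this, of 2] R show ?thesis by (simp add: numeral_2_eq_2)
    qed
  qed (use R h in auto)
  moreover have "(\<Sum>i\<le>1. ?f i 0 * (h - 0) ^ i / fact i) = f 0 + h * deriv f 0"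
    by simp
  ultimately show ?thesis
    by (simp add: algebra_simps power2_eq_square diff_diff_eq)
qed

lemma curve_functional_holomorphic:
  assumes "hcurve U \<gamma>"
  shows "(\<lambda>z. \<Sum>j\<in>F. s j * ap (\<gamma> z) j) holomorphic_on U"
  using assms by (auto simp: hcurve_def intro!: holomorphic_on_sum holomorphic_on_mult)

text \<open>The coordinatewise derivatives form a summable family because the Cauchy bound holds for
  every finite functional with coefficients in the unit disc, in particular for the one that turns
  their sum into a sum of absolute values.\<close>

lemma curve_derivative:
  fixes \<gamma> :: "complex \<Rightarrow> 'j ell1"
  assumes h: "hcurve (ball 0 R) \<gamma>" and M: "\<And>z. z \<in> ball 0 R \<Longrightarrow> norm (\<gamma> z) \<le> M" and R: "R > 0"
  obtains v where "\<And>j. ap v j = deriv (\<lambda>z. ap (\<gamma> z) j) 0" "norm v \<le> M / R"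
    "\<And>z. norm z < R / 2 \<Longrightarrow> norm (\<gamma> z - \<gamma> 0 - cs z v) \<le> 8 * M / R\<^sup>2 * (norm z)\<^sup>2"
proof -
  let ?d = "\<lambda>j. deriv (\<lambda>z. ap (\<gamma> z) j) 0"
  have field: "(\<lambda>z. ap (\<gamma> z) j) field_differentiable at 0" for j
    using h R by (auto simp: hcurve_def intro: holomorphic_on_imp_differentiable_at)
  have dsum: "deriv (\<lambda>z. \<Sum>j\<in>F. s j * ap (\<gamma> z) j) 0 = (\<Sum>j\<in>F. s j * ?d j)" for F s
    using field by (simp add: deriv_sum field_differentiable_mult)
  have bd: "norm (\<Sum>j\<in>F. s j * ?d j) \<le> M / R" if "finite F" "\<And>j. norm (s j) \<le> 1" for F s
  proof -
    have "norm ((deriv ^^ 1) (\<lambda>z. \<Sum>j\<in>F. s j * ap (\<gamma> z) j) 0) \<le> fact 1 * M / R ^ 1"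
      by (rule deriv_bound_ball[OF curve_functional_holomorphic[OF h] _ R])
         (rule order_trans[OF norm_functional_le[OF that] M])
    then show ?thesis by (simp add: dsum)
  qed
  have fin: "(\<Sum>j\<in>F. norm (?d j)) \<le> M / R" if "finite F" for F
  proof -
    define s where "s j = cnj (sgn (?d j))" for j
    have "s j * ?d j = of_real (norm (?d j))" for j
      unfolding s_def by (rule cnj_sgn_mult)
    then have "(\<Sum>j\<in>F. s j * ?d j) = of_real (\<Sum>j\<in>F. norm (?d j))" by simp
    moreover have "norm (\<Sum>j\<in>F. s j * ?d j) \<le> M / R"
      by (rule bd[OF that]) (auto simp: s_def norm_sgn)
    ultimately have "\<bar>\<Sum>j\<in>F. norm (?d j)\<bar> \<le> M / R" by (simp only: norm_of_real)
    then show ?thesis by simp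
  qed
  note v = ell1_ofI[of ?d "M / R", OF fin]
  show ?thesis
  proof (rule that[of "Abs_ell1 ?d"])
    show "ap (Abs_ell1 ?d) j = ?d j" for j using v(1) by simp
    show "norm (Abs_ell1 ?d) \<le> M / R" by (rule v(2))
    fix z :: complex assume z: "norm z < R / 2"
    show "norm (\<gamma> z - \<gamma> 0 - cs z (Abs_ell1 ?d)) \<le> 8 * M / R\<^sup>2 * (norm z)\<^sup>2"
    proof (rule norm_ell1_dual)
      fix F :: "'j set" and s :: "'j \<Rightarrow> complex" assume F: "finite F" "\<And>j. norm (s j) \<le> 1"
      let ?f = "\<lambda>z. \<Sum>j\<in>F. s j * ap (\<gamma> z) j"
      have "norm (?f z - ?f 0 - z * deriv ?f 0) \<le> 8 * M / R\<^sup>2 * (norm z)\<^sup>2"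
        by (rule scalar_quadratic_remainder[OF curve_functional_holomorphic[OF h] _ R z])
           (rule order_trans[OF norm_functional_le[OF F] M])
      moreover have "(\<Sum>j\<in>F. s j * ap (\<gamma> z - \<gamma> 0 - cs z (Abs_ell1 ?d)) j) = ?f z - ?f 0 - z * deriv ?f 0"
        by (simp add: dsum v(1) right_diff_distrib sum_subtractf sum_distrib_left mult.left_commute)
      ultimately show "norm (\<Sum>j\<in>F. s j * ap (\<gamma> z - \<gamma> 0 - cs z (Abs_ell1 ?d)) j) \<le> 8 * M / R\<^sup>2 * (norm z)\<^sup>2"
        by metis
    qed
  qed
qed

lemma hmap_line_differentiable:
  fixes G :: "'i ell1 \<Rightarrow> 'j ell1"
  assumes G: "\<And>U \<gamma>. hcurve U \<gamma> \<Longrightarrow> \<gamma> ` U \<subseteq> S \<Longrightarrow> hcurve U (\<lambda>z. G (\<gamma> z))"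
    and s: "s > 0" "ball y s \<subseteq> S"
  shows "(\<lambda>z. ap (G (y + cs z h)) j) field_differentiable at 0"
proof -
  \<comment> \<open>The added 1 covers \<open>h = 0\<close> without a case distinction.\<close>
  define e where "e = s / (norm h + 1)"
  have e: "e > 0" using s(1) by (simp add: e_def add_nonneg_pos)
  have "(\<lambda>z. y + cs z h) ` ball 0 e \<subseteq> S"
  proof (rule image_subsetI, rule subsetD[OF s(2)])
    fix z :: complex assume "z \<in> ball 0 e"
    then have "norm z * (norm h + 1) < s" by (simp add: e_def pos_less_divide_eq add_nonneg_pos)
    moreover have "norm z * norm h \<le> norm z * (norm h + 1)" by (rule mult_left_mono) auto
    ultimately show "y + cs z h \<in> ball y s" by (simp add: dist_norm)
  qed
  from G[OF hcurve_line this] have "(\<lambda>z. ap (G (y + cs z h)) j) holomorphic_on ball 0 e" by (simp add: hcurve_def)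
  then show ?thesis using e by (auto intro: holomorphic_on_imp_differentiable_at)
qed

text \<open>Directional derivatives exist by \<open>curve_derivative\<close> and are homogeneous by
  the chain rule; additivity is the point at issue. It comes from a midpoint argument: expand
  \<open>G\<close> at \<open>x\<close>, and also at \<open>m = x + t (h1 + h2)\<close> in the
  directions \<open>k\<close> and \<open>- k\<close> with \<open>k = t (h1 - h2)\<close>. The points
  \<open>m + k\<close> and \<open>m - k\<close> are \<open>x + 2 t h1\<close> and
  \<open>x + 2 t h2\<close>, so values of \<open>G\<close> can be eliminated, leaving a defect of
  order \<open>t^2\<close> against a linear term of order \<open>t\<close>.\<close>

lemma hmap_frechet:
  fixes G :: "'i::countable ell1 \<Rightarrow> 'j ell1"
  assumes G: "\<And>U \<gamma>. hcurve U \<gamma> \<Longrightarrow> \<gamma> ` U \<subseteq> ball x r \<Longrightarrow> hcurve U (\<lambda>z. G (\<gamma> z))"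
    and M: "\<And>y. y \<in> ball x r \<Longrightarrow> norm (G y) \<le> M" and r: "r > 0"
  obtains L where "clin L" "\<And>h. norm (L h) \<le> M / r * norm h"
    "\<And>h. norm h < r / 2 \<Longrightarrow> norm (G (x + h) - G x - L h) \<le> 8 * M / r\<^sup>2 * (norm h)\<^sup>2"
proof -
  have M0: "M \<ge> 0" using M[of x] r norm_ge_zero[of "G x"] by (simp del: norm_ge_zero)
  have ex: "\<exists>L. \<forall>h. norm (L h) \<le> M / s * norm h \<and>
     (norm h < s / 2 \<longrightarrow> norm (G (y + h) - G y - L h) \<le> 8 * M / s\<^sup>2 * (norm h)\<^sup>2) \<and>
     (\<forall>j. ap (L h) j = deriv (\<lambda>z. ap (G (y + cs z h)) j) 0)"
    if s: "s > 0" "ball y s \<subseteq> ball x r" for y s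
  proof (rule choice, rule allI)
    fix h :: "'i ell1"
    show "\<exists>v. norm v \<le> M / s * norm h \<and>
     (norm h < s / 2 \<longrightarrow> norm (G (y + h) - G y - v) \<le> 8 * M / s\<^sup>2 * (norm h)\<^sup>2) \<and>
     (\<forall>j. ap v j = deriv (\<lambda>z. ap (G (y + cs z h)) j) 0)"
    proof (cases "h = 0")
      case True
      then show ?thesis by (intro exI[of _ 0]) auto
    next
      case False
      then have R: "s / norm h > 0" using s by simp
      have sub: "y + cs z h \<in> ball x r" if "z \<in> ball 0 (s / norm h)" for z
      proof (rule subsetD[OF s(2)])
        show "y + cs z h \<in> ball y s" using that False by (simp add: dist_norm pos_less_divide_eq)
      qed
      obtain v where v: "\<And>j. ap v j = deriv (\<lambda>z. ap (G (y + cs z h)) j) 0" "norm v \<le> M / (s / norm h)"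
          "\<And>z. norm z < (s / norm h) / 2 \<Longrightarrow>
            norm (G (y + cs z h) - G (y + cs 0 h) - cs z v) \<le> 8 * M / (s / norm h)\<^sup>2 * (norm z)\<^sup>2"
        by (rule curve_derivative[of "s / norm h" "\<lambda>z. G (y + cs z h)" M, OF _ _ R])
           (rule G[OF hcurve_line], use sub M in auto)
      show ?thesis
      proof (intro exI conjI impI allI)
        show "norm v \<le> M / s * norm h" using v(2) s(1) False by simp
        show "ap v j = deriv (\<lambda>z. ap (G (y + cs z h)) j) 0" for j by (rule v(1))
        assume "norm h < s / 2"
        then have "norm (1::complex) < (s / norm h) / 2" using False by (simp add: field_simps)
        from v(3)[OF this] show "norm (G (y + h) - G y - v) \<le> 8 * M / s\<^sup>2 * (norm h)\<^sup>2"
          by (simp add: power_divide)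
      qed
    qed
  qed
  obtain L where L: "\<And>h. norm (L h) \<le> M / r * norm h"
     "\<And>h. norm h < r / 2 \<Longrightarrow> norm (G (x + h) - G x - L h) \<le> 8 * M / r\<^sup>2 * (norm h)\<^sup>2"
     "\<And>h j. ap (L h) j = deriv (\<lambda>z. ap (G (x + cs z h)) j) 0"
    using ex[of r x] r by auto
  have hom: "L (cs c h) = cs c (L h)" for c h
  proof (rule ell1_eqI)
    fix j
    let ?g = "\<lambda>z. ap (G (x + cs z h)) j"
    have "?g field_differentiable at 0" by (rule hmap_line_differentiable[OF G r]) auto
    then have "(?g has_field_derivative deriv ?g 0) (at (0 * c))" by (simp add: DERIV_deriv_iff_field_differentiable)
    then have "((\<lambda>z. ?g (z * c)) has_field_derivative (deriv ?g 0 * c)) (at 0)"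
      by (rule DERIV_chain2) (auto intro!: derivative_eq_intros)
    then have "deriv (\<lambda>z. ?g (z * c)) 0 = deriv ?g 0 * c" by (rule DERIV_imp_deriv)
    then show "ap (L (cs c h)) j = ap (cs c (L h)) j"
      by (simp add: L(3) cs_algebra mult.commute)
  qed
  have add: "L (h1 + h2) = L h1 + L h2" for h1 h2
  proof -
    define B where "B = 2 * (norm h1 + norm h2) + 1"
    have B: "B > 0" by (simp add: B_def add_nonneg_pos)
    define C where "C = 8 * M / r\<^sup>2 * B\<^sup>2"
    define D where "D = 8 * M / (r/2)\<^sup>2 * B\<^sup>2"
    have "norm (L (h1 + h2) - (L h1 + L h2)) \<le> t * (2 * C + D)" if t: "0 < t" "t < r / (8 * B)" for t :: real
    proof -
      let ?c = "cs (of_real t)"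
      have tB: "t * B < r / 8" using t B by (simp add: field_simps)
      have nt: "norm (?c h) \<le> t * B" if "norm h \<le> B" for h :: "'i ell1"
        using t that by (simp add: mult_left_mono)
      have n12: "norm h1 \<le> B / 2" "norm h2 \<le> B / 2" by (auto simp: B_def)
      have norms: "norm (h1 + h2) \<le> B" "norm (cs 2 h1) \<le> B" "norm (cs 2 h2) \<le> B" "norm (h1 - h2) \<le> B" "norm (h2 - h1) \<le> B"
        using norm_triangle_ineq[of h1 h2] norm_triangle_ineq4[of h1 h2] norm_triangle_ineq4[of h2 h1] n12 by auto
      have qx: "norm (G (x + ?c h) - G x - ?c (L h)) \<le> t\<^sup>2 * C" if "norm h \<le> B" for h
      proof -
        have "norm (G (x + ?c h) - G x - L (?c h)) \<le> 8 * M / r\<^sup>2 * (norm (?c h))\<^sup>2"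
          by (rule L(2)) (use nt[OF that] tB r in auto)
        also have "\<dots> \<le> 8 * M / r\<^sup>2 * (t * B)\<^sup>2"
          by (intro mult_left_mono power_mono nt that) (use M0 in auto)
        finally show ?thesis by (simp add: hom C_def power_mult_distrib mult_ac)
      qed
      \<comment> \<open>The midpoint moves with \<open>t\<close>, but stays so close to
        \<open>x\<close> that the half radius \<open>r/2\<close> is available at \<open>m\<close>.
        The constant \<open>D\<close> of the expansion there does not depend on
        \<open>t\<close>.\<close>
      define m where "m = x + ?c (h1 + h2)"
      have m: "ball m (r/2) \<subseteq> ball x r"
      proof
        fix y assume "y \<in> ball m (r/2)"
        moreover have "dist x m \<le> r / 8" using nt[OF norms(1)] tB by (simp add: m_def dist_norm)
        ultimately show "y \<in> ball x r" using dist_triangle[of x y m] r by simp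
      qed
      obtain L' where L': "\<And>h. norm h < r / 4 \<Longrightarrow> norm (G (m + h) - G m - L' h) \<le> 8 * M / (r/2)\<^sup>2 * (norm h)\<^sup>2"
         "\<And>h j. ap (L' h) j = deriv (\<lambda>z. ap (G (m + cs z h)) j) 0"
        using ex[of "r/2" m] r m by auto
      define k where "k = ?c (h1 - h2)"
      have nk: "norm k \<le> t * B" unfolding k_def by (rule nt[OF norms(4)])
      have "((\<lambda>z. ap (G (m + cs z k)) j) field_differentiable at 0)" for j
        by (rule hmap_line_differentiable[OF G _ m]) (use r in auto)
      then have fd: "((\<lambda>z. ap (G (m + cs z k)) j) has_field_derivative ap (L' k) j) (at 0)" for j
        by (simp add: L'(2) DERIV_deriv_iff_field_differentiable)
      \<comment> \<open>At \<open>m\<close> only directional derivatives are at hand, and oddness is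
        the one property needed: the first-order terms in the directions \<open>k\<close> and
        \<open>- k\<close> then cancel.\<close>
      have Lm: "L' (- k) = - L' k"
      proof (rule ell1_eqI)
        fix j
        let ?g = "\<lambda>z. ap (G (m + cs z k)) j"
        have "((\<lambda>z. ?g (z * (-1))) has_field_derivative (ap (L' k) j * (-1))) (at 0)"
          by (rule DERIV_chain2[of ?g]) (use fd in \<open>auto intro!: derivative_eq_intros\<close>)
        then have "deriv (\<lambda>z. ?g (z * (-1))) 0 = ap (L' k) j * (-1)" by (rule DERIV_imp_deriv)
        moreover have "cs z (- k) = cs (z * (-1)) k" for z by (rule ell1_eqI) simp
        ultimately show "ap (L' (- k)) j = ap (- L' k) j"
          by (subst L'(2)) simp
      qed
      have qm: "norm (G (m + h) - G m - L' h) \<le> t\<^sup>2 * D" if "norm h \<le> t * B" for h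
      proof -
        have "norm (G (m + h) - G m - L' h) \<le> 8 * M / (r/2)\<^sup>2 * (norm h)\<^sup>2"
          by (rule L'(1)) (use that tB r in auto)
        also have "\<dots> \<le> 8 * M / (r/2)\<^sup>2 * (t * B)\<^sup>2"
          by (intro mult_left_mono power_mono that) (use M0 in auto)
        finally show ?thesis by (simp add: D_def power_mult_distrib mult_ac)
      qed
      have mk: "m + k = x + ?c (cs 2 h1)" "m + - k = x + ?c (cs 2 h2)"
        by (rule ell1_eqI; simp add: m_def k_def algebra_simps)+
      define E1 where "E1 = G (x + ?c (h1 + h2)) - G x - ?c (L (h1 + h2))"
      define E2 where "E2 = G (x + ?c (cs 2 h1)) - G x - ?c (L (cs 2 h1))"
      define E3 where "E3 = G (x + ?c (cs 2 h2)) - G x - ?c (L (cs 2 h2))"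
      define E4 where "E4 = G (m + k) - G m - L' k"
      define E5 where "E5 = G (m + - k) - G m - L' (- k)"
      have Es: "norm E1 \<le> t\<^sup>2 * C" "norm E2 \<le> t\<^sup>2 * C" "norm E3 \<le> t\<^sup>2 * C" "norm E4 \<le> t\<^sup>2 * D" "norm E5 \<le> t\<^sup>2 * D"
        unfolding E1_def E2_def E3_def E4_def E5_def by (intro qx qm norms; use nk in simp)+
      \<comment> \<open>In this combination of the five remainders all values of \<open>G\<close>
        and both terms with \<open>L'\<close> cancel.\<close>
      have "cs (of_real (2 * t)) (L (h1 + h2) - (L h1 + L h2)) = E2 + E3 - E4 - E5 - E1 - E1"
        by (rule ell1_eqI) (simp add: E1_def E2_def E3_def E4_def E5_def Lm mk[symmetric] hom m_def[symmetric] algebra_simps)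
      moreover have "norm (cs (of_real (2 * t)) w) = 2 * t * norm w" for w :: "'j ell1"
        unfolding norm_cs norm_of_real using t by simp
      ultimately have "2 * t * norm (L (h1 + h2) - (L h1 + L h2)) = norm (E2 + E3 - E4 - E5 - E1 - E1)"
        by metis
      also have "\<dots> \<le> norm E2 + norm E3 + norm E4 + norm E5 + norm E1 + norm E1"
        by ((rule order_trans[OF norm_triangle_ineq4], rule add_right_mono)+, rule norm_triangle_ineq)
      also have "\<dots> \<le> (2 * t) * (t * (2 * C + D))"
        using Es by (simp add: algebra_simps power2_eq_square)
      finally show ?thesis using t by (simp add: mult_le_cancel_left)
    qed
    then have "\<forall>\<^sub>F t in at_right 0. norm (L (h1 + h2) - (L h1 + L h2)) \<le> t * (2 * C + D)"
      using r B by (auto simp: eventually_at_right_field intro!: exI[of _ "r / (8 * B)"])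
    moreover have "((\<lambda>t. t * (2 * C + D)) \<longlongrightarrow> 0 * (2 * C + D)) (at_right 0)"
      by (intro tendsto_intros)
    ultimately have "norm (L (h1 + h2) - (L h1 + L h2)) \<le> 0 * (2 * C + D)"
      by (intro tendsto_lowerbound[where F = "at_right (0::real)"]) auto
    then show ?thesis by simp
  qed
  show ?thesis
    by (rule that[of L, OF clinI[of L "M / r", OF add hom L(1)] L(1) L(2)])
qed

text \<open>A margin \<open>d\<close> around the segment bounds the derivative of every finite
  functional of \<open>G\<close> along it by \<open>M / d\<close> times the direction, and the mean
  value inequality is applied to these scalar functions. Only a sup bound for \<open>G\<close> is
  required.\<close>

lemma hmap_lipschitz:
  fixes G :: "'i::countable ell1 \<Rightarrow> 'j ell1"
  assumes G: "\<And>U \<gamma>. hcurve U \<gamma> \<Longrightarrow> \<gamma> ` U \<subseteq> S \<Longrightarrow> hcurve U (\<lambda>z. G (\<gamma> z))"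
    and M: "\<And>y. y \<in> S \<Longrightarrow> norm (G y) \<le> M" and d: "d > 0"
    and sub: "\<And>p. p \<in> closed_segment x y \<Longrightarrow> ball p d \<subseteq> S"
  shows "norm (G y - G x) \<le> M / d * norm (y - x)"
proof (cases "x = y")
  case False
  define h where "h = y - x"
  have h: "norm h > 0" using False by (simp add: h_def)
  have seg: "x + cs z h \<in> closed_segment x y" if z: "z \<in> closed_segment 0 1" for z :: complex
  proof -
    obtain u where u: "0 \<le> u" "u \<le> 1" "z = of_real u"
      using z by (auto simp: closed_segment_def scaleR_conv_of_real)
    then have "x + cs z h = (1 - u) *\<^sub>R x + u *\<^sub>R y"
      by (intro ell1_eqI) (simp add: h_def scaleR_conv_of_real algebra_simps)
    then show ?thesis using u by (auto simp: closed_segment_def)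
  qed
  show ?thesis
  proof (rule norm_ell1_dual)
    fix F :: "'j set" and s :: "'j \<Rightarrow> complex" assume F: "finite F" "\<And>j. norm (s j) \<le> 1"
    let ?f = "\<lambda>z. \<Sum>j\<in>F. s j * ap (G (x + cs z h)) j"
    have hol: "?f holomorphic_on ball w (d / norm h)"
      and bd: "v \<in> ball w (d / norm h) \<Longrightarrow> norm (?f v) \<le> M" if w: "w \<in> closed_segment 0 1" for w v
    proof -
      have inS: "x + cs z h \<in> S" if "z \<in> ball w (d / norm h)" for z
      proof (rule subsetD[OF sub[OF seg[OF w]]])
        have "(x + cs w h) - (x + cs z h) = cs (w - z) h" by (rule ell1_eqI) (simp add: algebra_simps)
        then show "x + cs z h \<in> ball (x + cs w h) d"
          using that h by (simp add: dist_norm pos_less_divide_eq)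
      qed
      have "hcurve (ball w (d / norm h)) (\<lambda>z. G (x + cs z h))"
        by (rule G[OF hcurve_line]) (use inS in auto)
      then show "?f holomorphic_on ball w (d / norm h)" by (rule curve_functional_holomorphic)
      show "norm (?f v) \<le> M" if "v \<in> ball w (d / norm h)"
        by (rule order_trans[OF norm_functional_le[OF F] M]) (rule inS[OF that])
    qed
    have "norm (?f 1 - ?f 0) \<le> (M / d * norm h) * norm (1 - 0 :: complex)"
    proof (rule field_differentiable_bound[where S = "closed_segment 0 1" and f' = "deriv ?f"])
      fix w :: complex assume w: "w \<in> closed_segment 0 1"
      have R: "d / norm h > 0" using d h by simp
      have "?f field_differentiable at w"
        using hol[OF w] R by (auto intro: holomorphic_on_imp_differentiable_at)
      then show "(?f has_field_derivative deriv ?f w) (at w within closed_segment 0 1)"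
        by (simp add: DERIV_deriv_iff_field_differentiable has_field_derivative_at_within)
      have "norm ((deriv ^^ 1) ?f w) \<le> fact 1 * M / (d / norm h) ^ 1"
        by (rule deriv_bound_ball[OF hol[OF w] bd[OF w] R])
      then show "norm (deriv ?f w) \<le> M / d * norm h" by simp
    qed auto
    moreover have "x + cs 1 h = y" "x + cs 0 h = x" by (auto simp: h_def)
    ultimately show "norm (\<Sum>j\<in>F. s j * ap (G y - G x) j) \<le> M / d * norm (y - x)"
      by (simp add: right_diff_distrib sum_subtractf h_def)
  qed
qed simp

text \<open>Convergence of the iterates is included because holomorphic dependence of the fixed
  point on parameters is obtained by passing to the limit along them.\<close>

lemma contraction_fixpoint:
  fixes f :: "'j ell1 \<Rightarrow> 'j ell1"
  assumes S: "closed S" "x0 \<in> S" and f: "\<And>x. x \<in> S \<Longrightarrow> f x \<in> S"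
    and q: "q < 1" "\<And>x y. x \<in> S \<Longrightarrow> y \<in> S \<Longrightarrow> norm (f x - f y) \<le> q * norm (x - y)"
  obtains x where "x \<in> S" "f x = x" "(\<lambda>n. (f ^^ n) x0) \<longlonglongrightarrow> x" "\<And>n. (f ^^ n) x0 \<in> S"
proof -
  define p where "p = max q 0"
  have p: "0 \<le> p" "p < 1" "\<And>x y. x \<in> S \<Longrightarrow> y \<in> S \<Longrightarrow> norm (f x - f y) \<le> p * norm (x - y)"
    using q order_trans[OF q(2) mult_right_mono[OF _ norm_ge_zero, of q p]] by (auto simp: p_def)
  have "\<exists>!x. x \<in> S \<and> f x = x"
    by (rule Banach_fix[of S p]) (use S f p in \<open>auto simp: dist_norm complete_eq_closed\<close>)
  then obtain x where x: "x \<in> S" "f x = x" by blast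
  have it: "(f ^^ n) x0 \<in> S" for n by (induction n) (use S f in auto)
  have "norm ((f ^^ n) x0 - x) \<le> p ^ n * norm (x0 - x)" for n
  proof (induction n)
    case (Suc n)
    have "norm ((f ^^ Suc n) x0 - x) = norm (f ((f ^^ n) x0) - f x)" by (simp add: x)
    also have "\<dots> \<le> p * norm ((f ^^ n) x0 - x)" by (rule p(3)[OF it x(1)])
    also have "\<dots> \<le> p * (p ^ n * norm (x0 - x))" by (rule mult_left_mono[OF Suc p(1)])
    finally show ?case by (simp add: mult_ac)
  qed simp
  then have "\<forall>\<^sub>F n in sequentially. norm ((f ^^ n) x0 - x) \<le> p ^ n * norm (x0 - x)" by simp
  moreover have "(\<lambda>n. p ^ n * norm (x0 - x)) \<longlonglongrightarrow> 0"
    by (intro tendsto_mult_left_zero LIMSEQ_realpow_zero p)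
  ultimately have "(\<lambda>n. (f ^^ n) x0 - x) \<longlonglongrightarrow> 0"
    by (rule Lim_null_comparison)
  then have "(\<lambda>n. (f ^^ n) x0) \<longlonglongrightarrow> x" by (rule LIM_zero_cancel)
  then show ?thesis by (intro that[OF x] it)
qed

text \<open>The iterates start from a constant, are holomorphic in the parameter and share the bound
  \<open>s\<close>; their pointwise limit is therefore a holomorphic curve, with no implicit
  function theorem involved.\<close>

lemma hcurve_fixpoint:
  fixes f :: "complex \<Rightarrow> 'j ell1 \<Rightarrow> 'j ell1"
  assumes U: "open U" and x0: "norm (x0 :: 'j ell1) \<le> s"
    and f: "\<And>z x. z \<in> U \<Longrightarrow> norm x \<le> s \<Longrightarrow> norm (f z x) \<le> s"
    and q: "q < 1" "\<And>z x y. z \<in> U \<Longrightarrow> norm x \<le> s \<Longrightarrow> norm y \<le> s \<Longrightarrow> norm (f z x - f z y) \<le> q * norm (x - y)"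
    and hol: "\<And>\<gamma>. hcurve U \<gamma> \<Longrightarrow> (\<And>z. z \<in> U \<Longrightarrow> norm (\<gamma> z) \<le> s) \<Longrightarrow> hcurve U (\<lambda>z. f z (\<gamma> z))"
    and g: "\<And>z. z \<in> U \<Longrightarrow> norm (g z) \<le> s \<and> f z (g z) = g z"
  shows "hcurve U g"
proof (rule hcurve_limit[OF U, where \<gamma> = "\<lambda>n z. (f z ^^ n) x0" and M = s])
  have lim: "(\<lambda>n. (f z ^^ n) x0) \<longlonglongrightarrow> g z" "\<And>n. norm ((f z ^^ n) x0) \<le> s" if z: "z \<in> U" for z
  proof -
    obtain x where x: "norm x \<le> s" "f z x = x" "(\<lambda>n. (f z ^^ n) x0) \<longlonglongrightarrow> x" "\<And>n. norm ((f z ^^ n) x0) \<le> s"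
      by (rule contraction_fixpoint[of "cball 0 s" x0 "f z" q]) (use x0 f[OF z] q(1) q(2)[OF z] in auto)
    have "norm (x - g z) \<le> q * norm (x - g z)" using q(2)[OF z x(1), of "g z"] g[OF z] x(2) by simp
    then have "norm (x - g z) * (1 - q) \<le> 0" by (simp add: algebra_simps)
    then have "x = g z" using q(1) by (simp add: mult_le_0_iff)
    then show "(\<lambda>n. (f z ^^ n) x0) \<longlonglongrightarrow> g z" "\<And>n. norm ((f z ^^ n) x0) \<le> s" using x by auto
  qed
  show "(\<lambda>n. (f z ^^ n) x0) \<longlonglongrightarrow> g z" "\<And>n. norm ((f z ^^ n) x0) \<le> s" if "z \<in> U" for z
    using lim[OF that] by auto
  show "hcurve U (\<lambda>z. (f z ^^ n) x0)" for n
  proof (induction n)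
    case 0 then show ?case by (simp add: hcurve_const U)
  next
    case (Suc n)
    have "hcurve U (\<lambda>z. f z ((f z ^^ n) x0))" by (rule hol[OF Suc]) (use lim in auto)
    then show ?case by simp
  qed
qed

section \<open>Fourier series in weighted coefficients\<close>

text \<open>A reindexing with multipliers. Diagonal operators, extraction of components,
  multiplication by a mode, partial derivatives and composition with \<open>T\<close> are all of
  this kind.\<close>

definition reop :: "('j \<Rightarrow> 'i) \<Rightarrow> ('j \<Rightarrow> complex) \<Rightarrow> 'i ell1 \<Rightarrow> 'j ell1" where
  "reop \<phi> m x = Abs_ell1 (\<lambda>j. m j * ap x (\<phi> j))"

text \<open>Injectivity on the support of the multiplier ensures that each coordinate of
  \<open>x\<close> is counted at most once in a finite sum, which gives the norm bound
  \<open>C\<close>.\<close>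

lemma reop:
  assumes m: "\<And>j. norm (m j) \<le> C" and inj: "inj_on \<phi> {j. m j \<noteq> 0}"
  shows ap_reop: "ap (reop \<phi> m x) j = m j * ap x (\<phi> j)"
    and norm_reop: "norm (reop \<phi> m x) \<le> C * norm x"
    and clin_reop: "clin (reop \<phi> m)"
proof -
  have C: "C \<ge> 0" using order_trans[OF norm_ge_zero m] .
  have fin: "(\<Sum>j\<in>F. norm (m j * ap x (\<phi> j))) \<le> C * norm x" if F: "finite F" for F x
  proof -
    let ?G = "F \<inter> {j. m j \<noteq> 0}"
    have "(\<Sum>j\<in>F. norm (m j * ap x (\<phi> j))) = (\<Sum>j\<in>?G. norm (m j * ap x (\<phi> j)))"
      by (rule sum.mono_neutral_right) (use F in auto)
    also have "\<dots> \<le> (\<Sum>j\<in>?G. C * norm (ap x (\<phi> j)))"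
      by (rule sum_mono) (simp add: norm_mult m mult_right_mono)
    also have "\<dots> = C * (\<Sum>i\<in>\<phi> ` ?G. norm (ap x i))"
      using inj by (subst sum.reindex) (auto simp: sum_distrib_left inj_on_def)
    also have "\<dots> \<le> C * norm x"
      by (intro mult_left_mono sum_ap_le_norm C) (use F in auto)
    finally show ?thesis .
  qed
  note e = ell1_ofI[of "\<lambda>j. m j * ap x (\<phi> j)" "C * norm x" for x, OF fin]
  show ap: "ap (reop \<phi> m x) j = m j * ap x (\<phi> j)" for x j by (simp add: reop_def e(1))
  show n: "norm (reop \<phi> m x) \<le> C * norm x" for x by (simp add: reop_def e(2))
  show "clin (reop \<phi> m)"
    by (rule clinI[of _ C, OF _ _ n]) (auto intro!: ell1_eqI simp: ap algebra_simps)
qed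

definition diagop :: "('j \<Rightarrow> complex) \<Rightarrow> 'j ell1 \<Rightarrow> 'j ell1" where
  "diagop = reop (\<lambda>j. j)"

lemma diagop:
  assumes m: "\<And>j. norm (m j) \<le> C"
  shows ap_diagop: "ap (diagop m x) j = m j * ap x j"
    and norm_diagop: "norm (diagop m x) \<le> C * norm x"
    and clin_diagop: "clin (diagop m)"
proof -
  have "inj_on (\<lambda>j. j) {j. m j \<noteq> 0}" by simp
  note r = reop[OF m this]
  show "ap (diagop m x) j = m j * ap x j" "norm (diagop m x) \<le> C * norm x" "clin (diagop m)"
    unfolding diagop_def by (rule r)+
qed

definition cmpt :: "'d \<Rightarrow> ('k \<times> 'd) ell1 \<Rightarrow> 'k ell1" where
  "cmpt i = reop (\<lambda>k. (k, i)) (\<lambda>_. 1)"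

lemma cmpt: shows ap_cmpt [simp]: "ap (cmpt i x) k = ap x (k, i)"
    and norm_cmpt: "norm (cmpt i x) \<le> norm x" and clin_cmpt: "clin (cmpt i)"
proof -
  have "norm (1::complex) \<le> 1" "inj_on (\<lambda>k. (k, i)) {j. (1::complex) \<noteq> 0}" by (auto simp: inj_on_def)
  note r = reop[OF this]
  show "ap (cmpt i x) k = ap x (k, i)" "norm (cmpt i x) \<le> norm x" "clin (cmpt i)"
    using r(1) r(2)[of x] r(3) by (simp_all add: cmpt_def)
qed

definition mkvec :: "('d \<Rightarrow> 'k ell1) \<Rightarrow> ('k \<times> 'd) ell1" where
  "mkvec f = Abs_ell1 (\<lambda>(k, i). ap (f i) k)"

lemma sum_prod_le:
  fixes f :: "'d::finite \<Rightarrow> 'k ell1"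
  assumes F: "finite F"
  shows "(\<Sum>p\<in>F. norm (case p of (k, i) \<Rightarrow> ap (f i) k)) \<le> (\<Sum>i\<in>UNIV. norm (f i))"
proof -
  have "(\<Sum>p\<in>F. norm (case p of (k, i) \<Rightarrow> ap (f i) k)) \<le> (\<Sum>p\<in>fst ` F \<times> UNIV. norm (case p of (k, i) \<Rightarrow> ap (f i) k))"
    by (rule sum_mono2) (use F in force)+
  also have "\<dots> = (\<Sum>k\<in>fst ` F. \<Sum>i\<in>UNIV. norm (ap (f i) k))"
    by (simp add: sum.cartesian_product case_prod_unfold)
  also have "\<dots> = (\<Sum>i\<in>UNIV. \<Sum>k\<in>fst ` F. norm (ap (f i) k))" by (rule sum.swap)
  also have "\<dots> \<le> (\<Sum>i\<in>UNIV. norm (f i))"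
    by (intro sum_mono sum_ap_le_norm) (use F in auto)
  finally show ?thesis .
qed

lemma mkvec:
  fixes f :: "'d::finite \<Rightarrow> 'k ell1"
  shows ap_mkvec [simp]: "ap (mkvec f) (k, i) = ap (f i) k"
    and norm_mkvec_le: "norm (mkvec f) \<le> (\<Sum>i\<in>UNIV. norm (f i))"
proof -
  note e = ell1_ofI[OF sum_prod_le[of _ f]]
  show "ap (mkvec f) (k, i) = ap (f i) k" by (simp add: mkvec_def e(1))
  show "norm (mkvec f) \<le> (\<Sum>i\<in>UNIV. norm (f i))" unfolding mkvec_def by (rule e(2))
qed

lemma norm_vec_ell1:
  fixes x :: "('k \<times> 'd::finite) ell1"
  shows "norm x = (\<Sum>i\<in>UNIV. norm (cmpt i x))"
proof (rule antisym)
  have x: "x = mkvec (\<lambda>i. cmpt i x)" by (rule ell1_eqI) (auto simp: split_paired_all)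
  show "norm x \<le> (\<Sum>i\<in>UNIV. norm (cmpt i x))" by (subst x) (rule norm_mkvec_le)
  have *: "((\<lambda>k. norm (ap x (k, i))) has_sum norm (cmpt i x)) UNIV" for i
    using has_sum_infsum[OF ap_summable[of "cmpt i x"]] by (simp add: norm_ell1_eq)
  have **: "((\<lambda>k. \<Sum>i\<in>I. norm (ap x (k, i))) has_sum (\<Sum>i\<in>I. norm (cmpt i x))) UNIV" if "finite I" for I
    using that by (induction I) (simp_all add: has_sum_add *)
  have s: "(\<Sum>i\<in>UNIV. norm (cmpt i x)) = (\<Sum>\<^sub>\<infinity>k. \<Sum>i\<in>UNIV. norm (ap x (k, i)))"
      "(\<lambda>k. \<Sum>i\<in>UNIV. norm (ap x (k, i))) summable_on UNIV"
    using infsumI[OF **[OF finite]] has_sum_imp_summable[OF **[OF finite]] by simp_all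
  have "(\<Sum>\<^sub>\<infinity>k. \<Sum>i\<in>UNIV. norm (ap x (k, i))) \<le> norm x"
  proof (rule infsum_le_finite_sums[OF s(2)])
    fix F :: "'k set" assume F: "finite F" "F \<subseteq> UNIV"
    have "(\<Sum>k\<in>F. \<Sum>i\<in>UNIV. norm (ap x (k, i))) = (\<Sum>p\<in>F \<times> UNIV. norm (ap x p))"
      by (simp add: sum.cartesian_product case_prod_unfold)
    also have "\<dots> \<le> norm x" by (rule sum_ap_le_norm) (use F in auto)
    finally show "(\<Sum>k\<in>F. \<Sum>i\<in>UNIV. norm (ap x (k, i))) \<le> norm x" .
  qed
  with s show "(\<Sum>i\<in>UNIV. norm (cmpt i x)) \<le> norm x" by simp
qed

lemma cmpt_mkvec [simp]: "cmpt i (mkvec f) = f i"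
  for f :: "'d::finite \<Rightarrow> 'k ell1"
  by (rule ell1_eqI) simp

lemma norm_mkvec: "norm (mkvec f) = (\<Sum>i\<in>UNIV. norm (f i))"
  for f :: "'d::finite \<Rightarrow> 'k ell1"
  by (simp add: norm_vec_ell1)

lemma hcurve_mkvec:
  fixes \<gamma> :: "'d::finite \<Rightarrow> complex \<Rightarrow> 'k ell1"
  assumes "\<And>i. hcurve U (\<gamma> i)"
  shows "hcurve U (\<lambda>z. mkvec (\<lambda>i. \<gamma> i z))"
proof -
  obtain M where M: "\<And>i z. z \<in> U \<Longrightarrow> norm (\<gamma> i z) \<le> M i"
  proof -
    have "\<forall>i. \<exists>M. \<forall>z\<in>U. norm (\<gamma> i z) \<le> M" using assms by (simp add: hcurve_def)
    from choice[OF this] show thesis using that by blast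
  qed
  show ?thesis
  proof (rule hcurveI[OF hcurve_open[OF assms]])
    show "(\<lambda>z. ap (mkvec (\<lambda>i. \<gamma> i z)) j) holomorphic_on U" for j
      by (cases j) (use assms in \<open>simp add: hcurve_def\<close>)
    show "norm (mkvec (\<lambda>i. \<gamma> i z)) \<le> (\<Sum>i\<in>UNIV. M i)" if "z \<in> U" for z
      unfolding norm_mkvec by (rule sum_mono) (rule M[OF that])
  qed
qed

section \<open>Fourier modes and their orthogonality\<close>

lemma zlen_eq: "zlen k = (\<Sum>i\<in>UNIV. \<bar>real_of_int (k $ i)\<bar>)"
  by (simp add: zlen_def l1norm_def vec_of_int_def)

lemma zlen_nonneg [simp]: "0 \<le> zlen k"
  by (simp add: zlen_eq sum_nonneg)

lemma zlen_0 [simp]: "zlen 0 = 0"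
  by (simp add: zlen_eq)

lemma zlen_triangle: "zlen (j + k) \<le> zlen j + zlen k"
  unfolding zlen_eq sum.distrib[symmetric] by (intro sum_mono) simp

lemma zlen_component: "\<bar>real_of_int (k $ i)\<bar> \<le> zlen k"
  unfolding zlen_eq by (rule member_le_sum) auto

lemma zlen_ge_1: "k \<noteq> 0 \<Longrightarrow> 1 \<le> zlen k"
proof -
  assume "k \<noteq> 0"
  then obtain i where "k $ i \<noteq> 0" by (auto simp: vec_eq_iff)
  then have "1 \<le> \<bar>k $ i\<bar>" by simp
  then have "1 \<le> \<bar>real_of_int (k $ i)\<bar>" by linarith
  then show ?thesis using zlen_component[of k i] by simp
qed

lemma dotp_add_left: "dotp (a + b) c = dotp a c + dotp b c"
  and dotp_add_right: "dotp c (a + b) = dotp c a + dotp c b"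
  by (simp_all add: dotp_def algebra_simps sum.distrib)

lemma dotp_diff_right: "dotp c (a - b) = dotp c a - dotp c b" for a :: "'a::comm_ring_1 ^ 'd"
  by (simp add: dotp_def algebra_simps sum_subtractf)

lemma dotp_smult_right: "dotp c (t *s a) = t * dotp c a"
  by (simp add: dotp_def sum_distrib_left mult_ac)

lemma vec_of_int_add: "vec_of_int (j + k) = vec_of_int j + vec_of_int k"
  by (simp add: vec_of_int_def vec_eq_iff)

lemma vec_of_int_0 [simp]: "vec_of_int 0 = 0"
  by (simp add: vec_of_int_def vec_eq_iff)

lemma dotp_bound:
  fixes \<theta> :: "complex ^ 'd::finite"
  shows "norm (dotp (vec_of_int k) \<theta>) \<le> zlen k * (\<Sum>i\<in>UNIV. norm (\<theta> $ i))"
proof -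
  have "norm (dotp (vec_of_int k) \<theta>) \<le> (\<Sum>i\<in>UNIV. zlen k * norm (\<theta> $ i))"
    unfolding dotp_def using zlen_component[of k]
    by (intro sum_norm_le) (simp add: norm_mult vec_of_int_def mult_right_mono)
  then show ?thesis by (simp add: sum_distrib_left)
qed

lemma fmode_add: "fmode (j + k) \<theta> = fmode j \<theta> * fmode k \<theta>"
  by (simp add: fmode_def vec_of_int_add dotp_add_left distrib_left exp_add)

lemma fmode_0 [simp]: "fmode 0 \<theta> = 1"
  by (simp add: fmode_def dotp_def)

lemma fmode_shift: "fmode k (\<theta> + h) = fmode k \<theta> * exp (2 * of_real pi * \<i> * dotp (vec_of_int k) h)"
  by (simp add: fmode_def dotp_add_right distrib_left exp_add)

lemma fmode_periodic: "fmode k (\<theta> + vec_of_int m) = fmode k \<theta>"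
proof -
  have "dotp (vec_of_int k) (vec_of_int m) = (of_int (\<Sum>i\<in>UNIV. k $ i * m $ i) :: complex)"
    by (simp add: dotp_def vec_of_int_def)
  then have "2 * of_real pi * \<i> * dotp (vec_of_int k) (vec_of_int m) = of_real (2 * of_int (\<Sum>i\<in>UNIV. k $ i * m $ i) * pi) * \<i>"
    by simp
  then show ?thesis unfolding fmode_shift by (simp only: exp_integer_2pi[OF Ints_of_int] mult_1_right)
qed

lemma norm_fmode: "norm (fmode k \<theta>) = exp (- 2 * pi * Im (dotp (vec_of_int k) \<theta>))"
  by (simp add: fmode_def)

lemma norm_fmode_le:
  assumes "\<theta> \<in> strip r"
  shows "norm (fmode k \<theta>) \<le> exp (r * zlen k)"
proof -
  have "- Im (dotp (vec_of_int k) \<theta>) \<le> (\<Sum>i\<in>UNIV. zlen k * \<bar>Im (\<theta> $ i)\<bar>)"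
    unfolding dotp_def Im_sum sum_negf[symmetric]
  proof (rule sum_mono)
    fix i
    have "- Im (vec_of_int k $ i * \<theta> $ i) \<le> \<bar>real_of_int (k $ i)\<bar> * \<bar>Im (\<theta> $ i)\<bar>"
      by (simp add: vec_of_int_def flip: abs_mult)
    also have "\<dots> \<le> zlen k * \<bar>Im (\<theta> $ i)\<bar>" by (intro mult_right_mono zlen_component) auto
    finally show "- Im (vec_of_int k $ i * \<theta> $ i) \<le> zlen k * \<bar>Im (\<theta> $ i)\<bar>" .
  qed
  also have "\<dots> = zlen k * (\<Sum>i\<in>UNIV. \<bar>Im (\<theta> $ i)\<bar>)" by (simp add: sum_distrib_left)
  also have "\<dots> \<le> zlen k * (r / (2 * pi))"
    using assms by (intro mult_left_mono) (auto simp: strip_def)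
  finally have "2 * pi * (- Im (dotp (vec_of_int k) \<theta>)) \<le> 2 * pi * (zlen k * (r / (2 * pi)))"
    by (rule mult_left_mono) simp
  then show ?thesis by (simp add: norm_fmode mult_ac)
qed

lemma vec_of_real_in_strip: "r > 0 \<Longrightarrow> vec_of_real x \<in> strip r"
  by (simp add: strip_def vec_of_real_def)

lemma strip_periodic: "\<theta> + vec_of_int k \<in> strip r \<longleftrightarrow> \<theta> \<in> strip r"
  by (simp add: strip_def vec_of_int_def)

lemma open_strip: "open (strip r)"
  unfolding strip_def by (intro open_Collect_less continuous_intros)

lemma norm_fmode_real: "norm (fmode k (vec_of_real x)) = 1"
proof -
  have "Im (dotp (vec_of_int k) (vec_of_real x)) = 0"
    by (simp add: dotp_def vec_of_int_def vec_of_real_def)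
  then show ?thesis by (simp add: norm_fmode)
qed

lemma continuous_fmode: "continuous_on S (fmode k)"
  unfolding fmode_def dotp_def by (intro continuous_intros)

lemma continuous_vec_of_real: "continuous_on S (vec_of_real :: real ^ 'd::finite \<Rightarrow> _)"
  unfolding vec_of_real_def by (intro continuous_on_vec_lambda continuous_intros)

lemma integral_exp_unit: 
  assumes "m \<noteq> 0"
  shows "(LINT t:{0..1}|lborel. exp (2 * of_real pi * \<i> * of_int m * of_real t)) = 0"
proof -
  let ?c = "2 * of_real pi * \<i> * of_int m :: complex"
  have c: "?c \<noteq> 0" using assms by simp
  have "((\<lambda>t. exp (?c * of_real t)) has_integral (exp (?c * of_real 1) / ?c - exp (?c * of_real 0) / ?c)) {0..1}"
  proof (rule fundamental_theorem_of_calculus)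
    fix t :: real assume "t \<in> {0..1}"
    have "((\<lambda>z. exp (?c * z) / ?c) has_field_derivative exp (?c * of_real t)) (at (of_real t))"
      using c by (auto intro!: derivative_eq_intros)
    then show "((\<lambda>t. exp (?c * of_real t) / ?c) has_vector_derivative exp (?c * of_real t)) (at t within {0..1})"
      by (rule has_vector_derivative_real_field)
  qed simp
  moreover have "exp (?c * of_real 1) = 1"
    using exp_integer_2pi[OF Ints_of_int[of m]] by (simp add: mult_ac)
  ultimately have "integral {0..1} (\<lambda>t. exp (?c * of_real t)) = 0" by (simp add: integral_unique)
  moreover have "set_integrable lborel {0..1} (\<lambda>t. exp (?c * of_real t))"
    by (intro borel_integrable_atLeastAtMost' continuous_intros)
  ultimately show ?thesis by (simp add: set_borel_integral_eq_integral(2))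
qed

text \<open>On the unit cube the mode factorises over the coordinates, so by Fubini the integral is
  a product, and the factor of a coordinate with \<open>k $ i \<noteq> 0\<close> vanishes.\<close>

lemma integral_fmode:
  fixes k :: "int ^ 'd::finite"
  assumes "k \<noteq> 0"
  shows "integral (cbox 0 1) (\<lambda>x :: real ^ 'd. fmode k (vec_of_real x)) = 0"
proof -
  interpret P: product_sigma_finite "\<lambda>_ :: real ^ 'd. lborel :: real measure" by standard
  let ?K = "vec_of_int k :: real ^ 'd"
  let ?e = "\<lambda>b t. indicator {0..1} t *\<^sub>R exp (2 * of_real pi * \<i> * of_real (?K \<bullet> b) * of_real t) :: complex"
  obtain i where i: "k $ i \<noteq> 0" using assms by (auto simp: vec_eq_iff)
  have fm: "fmode k (vec_of_real x) = exp (2 * of_real pi * \<i> * of_real (?K \<bullet> x))" for x :: "real ^ 'd"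
    by (simp add: fmode_def dotp_def vec_of_int_def vec_of_real_def inner_vec_def)
  \<comment> \<open>The indicator of the cube is distributed over the factors, so that the integral
    becomes one over the whole space, where the product formula for \<open>lborel\<close>
    applies.\<close>
  have ind: "indicator (cbox 0 1) x *\<^sub>R fmode k (vec_of_real x) = (\<Prod>b\<in>Basis. ?e b (x \<bullet> b))" for x :: "real ^ 'd"
  proof (cases "x \<in> cbox 0 1")
    case True
    then have b: "x \<bullet> b \<in> {0..1}" if "b \<in> Basis" for b
      using that by (auto simp: mem_box Basis_vec_def inner_axis)
    have "fmode k (vec_of_real x) = (\<Prod>b\<in>Basis. exp (2 * of_real pi * \<i> * of_real (?K \<bullet> b) * of_real (x \<bullet> b)))"
      unfolding fm euclidean_inner[of ?K x] by (simp add: exp_sum[symmetric] sum_distrib_left mult.assoc)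
    then show ?thesis using True b by (auto intro!: prod.cong)
  next
    case False
    then obtain i where "x $ i \<notin> {0..1}" by (auto simp: mem_box_cart)
    then have b: "axis i 1 \<in> (Basis :: (real ^ 'd) set)" "x \<bullet> axis i 1 \<notin> {0..1}"
      by (auto simp: inner_axis Basis_vec_def)
    then have "\<exists>b\<in>Basis. ?e b (x \<bullet> b) = 0" by (intro bexI[of _ "axis i 1"]) auto
    then show ?thesis using False by (simp add: prod_zero)
  qed
  have cont: "continuous_on S (\<lambda>x :: real ^ 'd. fmode k (vec_of_real x))" for S
    unfolding fm by (intro continuous_intros)
  have int: "set_integrable lborel (cbox 0 1) (\<lambda>x :: real ^ 'd. fmode k (vec_of_real x))"
    unfolding set_integrable_def by (rule borel_integrable_compact) (simp_all add: cont)
  have inte: "integrable lborel (?e b)" for b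
    by (rule borel_integrable_atLeastAtMost'[unfolded set_integrable_def]) (intro continuous_intros)
  have "integral (cbox 0 1) (\<lambda>x :: real ^ 'd. fmode k (vec_of_real x)) =
      (LINT x:cbox 0 1|lborel. fmode k (vec_of_real (x :: real ^ 'd)))"
    using set_borel_integral_eq_integral(2)[OF int] by simp
  also have "\<dots> = integral\<^sup>L lborel (\<lambda>x :: real ^ 'd. \<Prod>b\<in>Basis. ?e b (x \<bullet> b))"
    unfolding set_lebesgue_integral_def by (simp add: ind)
  also have "\<dots> = (\<integral>f. (\<Prod>b\<in>Basis. ?e b ((\<Sum>c\<in>Basis. f c *\<^sub>R c) \<bullet> b)) \<partial>(\<Pi>\<^sub>M b\<in>(Basis :: (real ^ 'd) set). lborel))"
    by (subst lborel_eq, rule integral_distr) measurable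
  also have "\<dots> = (\<integral>f. (\<Prod>b\<in>Basis. ?e b (f b)) \<partial>(\<Pi>\<^sub>M b\<in>(Basis :: (real ^ 'd) set). lborel))"
    by (intro Bochner_Integration.integral_cong prod.cong) (simp_all add: inner_sum_left inner_Basis if_distrib cong: if_cong)
  also have "\<dots> = (\<Prod>b\<in>(Basis :: (real ^ 'd) set). integral\<^sup>L lborel (?e b))"
    by (rule P.product_integral_prod) (auto intro: inte)
  also have "\<dots> = 0"
  proof (rule prod_zero)
    show "\<exists>b\<in>(Basis :: (real ^ 'd) set). integral\<^sup>L lborel (?e b) = 0"
    proof (rule bexI[of _ "axis i 1"])
      have "?K \<bullet> axis i 1 = of_int (k $ i)" by (simp add: inner_axis vec_of_int_def)
      then show "integral\<^sup>L lborel (?e (axis i 1)) = 0"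
        using integral_exp_unit[OF i] by (simp add: set_lebesgue_integral_def)
    qed (auto simp: Basis_vec_def)
  qed simp
  finally show ?thesis .
qed

section \<open>Scalar Fourier series in weighted coefficients\<close>

no_notation fps_nth (infixl \<open>$\<close> 75)

definition wt :: "real \<Rightarrow> int ^ 'd \<Rightarrow> real" where
  "wt r k = exp (r * zlen k)"

lemma wt_pos [simp]: "wt r k > 0" "wt r k \<noteq> 0" "0 \<le> wt r k"
  by (simp_all add: wt_def)

text \<open>Dividing by the weight makes the norm of \<open>a\<close> equal to the weighted norm of
  the Fourier coefficients, and it dominates the function on the strip of width
  \<open>r\<close>.\<close>

definition fs :: "real \<Rightarrow> (int ^ 'd) ell1 \<Rightarrow> complex ^ 'd \<Rightarrow> complex" where
  "fs r a \<theta> = (\<Sum>\<^sub>\<infinity>k. ap a k / of_real (wt r k) * fmode k \<theta>)"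

definition emode :: "real \<Rightarrow> complex ^ 'd \<Rightarrow> int ^ 'd \<Rightarrow> complex" where
  "emode r \<theta> k = fmode k \<theta> / of_real (wt r k)"

lemma norm_emode: "\<theta> \<in> strip r \<Longrightarrow> norm (emode r \<theta> k) \<le> 1"
  using norm_fmode_le[of \<theta> r k] by (simp add: emode_def norm_divide wt_def)

lemma fs_terms: "ap a k / of_real (wt r k) * fmode k \<theta> = emode r \<theta> k * ap a k"
  by (simp add: emode_def)

lemma fs_summable:
  assumes "\<theta> \<in> strip r"
  shows "(\<lambda>k. norm (ap a k / of_real (wt r k) * fmode k \<theta>)) summable_on UNIV"
    "(\<lambda>k. ap a k / of_real (wt r k) * fmode k \<theta>) summable_on UNIV"
    "((\<lambda>k. ap a k / of_real (wt r k) * fmode k \<theta>) has_sum fs r a \<theta>) UNIV"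
    "norm (fs r a \<theta>) \<le> norm a"
proof -
  have le: "norm (ap a k / of_real (wt r k) * fmode k \<theta>) \<le> norm (ap a k)" for k
    unfolding fs_terms norm_mult using norm_emode[OF assms] by (simp add: mult_left_le_one_le)
  show s: "(\<lambda>k. norm (ap a k / of_real (wt r k) * fmode k \<theta>)) summable_on UNIV"
    by (rule summable_norm_bound[OF ap_summable le])
  then show s': "(\<lambda>k. ap a k / of_real (wt r k) * fmode k \<theta>) summable_on UNIV"
    by (rule abs_summable_summable)
  then show "((\<lambda>k. ap a k / of_real (wt r k) * fmode k \<theta>) has_sum fs r a \<theta>) UNIV"
    unfolding fs_def by (rule has_sum_infsum)
  have "norm (fs r a \<theta>) \<le> (\<Sum>\<^sub>\<infinity>k. norm (ap a k / of_real (wt r k) * fmode k \<theta>))"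
    unfolding fs_def by (rule norm_infsum_bound[OF s])
  also have "\<dots> \<le> norm a"
    unfolding norm_ell1_eq by (rule infsum_mono[OF s ap_summable le])
  finally show "norm (fs r a \<theta>) \<le> norm a" .
qed

lemma fs_add: "\<theta> \<in> strip r \<Longrightarrow> fs r (a + b) \<theta> = fs r a \<theta> + fs r b \<theta>"
  using infsumI[OF has_sum_add[OF fs_summable(3)[of \<theta> r a] fs_summable(3)[of \<theta> r b]]]
  by (simp add: fs_def[of r "a + b"] add_divide_distrib distrib_right)

lemma fs_cs: "fs r (cs c a) \<theta> = c * fs r a \<theta>"
  unfolding fs_def infsum_cmult_right'[symmetric] by (simp add: mult.assoc)

lemma bounded_linear_fs: "\<theta> \<in> strip r \<Longrightarrow> bounded_linear (\<lambda>a. fs r a \<theta>)"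
  by (rule bounded_linear_intro[of _ 1])
     (simp_all add: fs_add scaleR_cs fs_cs fs_summable(4) scaleR_conv_of_real)

lemma fs_diff: "\<theta> \<in> strip r \<Longrightarrow> fs r (a - b) \<theta> = fs r a \<theta> - fs r b \<theta>"
  using linear_diff[OF bounded_linear.linear[OF bounded_linear_fs]] .

lemma fs_0 [simp]: "fs r 0 \<theta> = 0"
  by (simp add: fs_def)

lemma fs_infsum:
  assumes "\<theta> \<in> strip r" "\<And>F. finite F \<Longrightarrow> (\<Sum>i\<in>F. norm (f i)) \<le> M"
  shows "((\<lambda>i. fs r (f i) \<theta>) has_sum fs r (infsum f UNIV) \<theta>) UNIV"
  by (rule has_sum_bounded_linear[OF bounded_linear_fs[OF assms(1)] has_sum_infsum[OF abs_summable_ell1(1)[OF assms(2)]]])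

lemma fs_sngl: "fs r (sngl k) \<theta> = fmode k \<theta> / of_real (wt r k)"
proof -
  have "((\<lambda>j. ap (sngl k) j / of_real (wt r j) * fmode j \<theta>) has_sum (fmode k \<theta> / of_real (wt r k))) UNIV"
    by (rule has_sum_finite_neutralI[of "{k}"]) (auto simp: ap_sngl)
  then show ?thesis unfolding fs_def by (rule infsumI)
qed

text \<open>The termwise partial derivative in direction \<open>j\<close>; at an interior point of
  the strip the exponential decay of the normalised modes absorbs the factor
  \<open>k $ j\<close>.\<close>

definition dfs :: "real \<Rightarrow> 'd \<Rightarrow> (int ^ 'd) ell1 \<Rightarrow> complex ^ 'd \<Rightarrow> complex" where
  "dfs r j a \<theta> = (\<Sum>\<^sub>\<infinity>k. ap a k / of_real (wt r k) * (2 * of_real pi * \<i> * of_int (k $ j)) * fmode k \<theta>)"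

lemma exp_remainder: "norm (exp w - 1 - w) \<le> (norm w)\<^sup>2 * exp (norm w)" for w :: complex
proof -
  have "norm (exp w - (\<Sum>i\<le>1. w ^ i / fact i)) \<le> exp (norm w) * norm w ^ Suc 1 / fact 1"
    by (rule Taylor_exp_field)
  then show ?thesis by (simp add: power2_eq_square mult_ac diff_diff_eq)
qed

text \<open>An exponential gain absorbs quadratic growth. This is needed for termwise
  differentiation inside the strip and for the multiplier of composition with
  \<open>T\<close>.\<close>

lemma exp_poly_bound:
  fixes a :: real
  assumes "a > 0"
  obtains C :: real where "C > 0" "\<And>x. x \<ge> 0 \<Longrightarrow> (1 + x)\<^sup>2 * exp (- a * x) \<le> C"
proof (rule that[of "2 + 4 / a\<^sup>2"])
  show "2 + 4 / a\<^sup>2 > 0" by (simp add: add_pos_nonneg)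
  fix x :: real assume x: "x \<ge> 0"
  have "(1 + x)\<^sup>2 \<le> 2 * 1 + 2 * x\<^sup>2" using zero_le_power2[of "1 - x"] by (simp add: power2_eq_square algebra_simps)
  also have "x\<^sup>2 \<le> (2 / a\<^sup>2) * exp (a * x)"
  proof -
    have "(a * x)\<^sup>2 / 2 \<le> exp (a * x)"
      using exp_lower_Taylor_quadratic[of "a * x"] assms x mult_nonneg_nonneg[of a x] by linarith
    then show ?thesis using assms by (simp add: field_simps)
  qed
  finally have "(1 + x)\<^sup>2 * exp (- a * x) \<le> (2 * 1 + 2 * ((2 / a\<^sup>2) * exp (a * x))) * exp (- a * x)"
    by (intro mult_right_mono) auto
  also have "\<dots> = 2 * exp (- a * x) + 4 / a\<^sup>2"
    by (simp add: algebra_simps flip: exp_add)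
  also have "\<dots> \<le> 2 + 4 / a\<^sup>2" using assms x by simp
  finally show "(1 + x)\<^sup>2 * exp (- a * x) \<le> 2 + 4 / a\<^sup>2" .
qed

lemma strip_shrink:
  assumes "\<theta> \<in> strip r"
  obtains r' where "r' < r" "\<theta> \<in> strip r'"
proof -
  obtain t where t: "(\<Sum>i\<in>UNIV. \<bar>Im (\<theta> $ i)\<bar>) < t" "t < r / (2 * pi)"
    using assms dense unfolding strip_def by blast
  show ?thesis
    by (rule that[of "2 * pi * t"]) (use t in \<open>simp_all add: strip_def pos_less_divide_eq mult_ac\<close>)
qed

lemma norm_vec_sum_le: "(\<Sum>i\<in>UNIV. norm (h $ i)) \<le> CARD('d) * norm h" for h :: "complex ^ 'd::finite"
proof -
  have "(\<Sum>i\<in>UNIV. norm (h $ i)) \<le> (\<Sum>i\<in>(UNIV::'d set). norm h)" by (intro sum_mono Finite_Cartesian_Product.norm_nth_le)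
  then show ?thesis by simp
qed

lemma has_sum_minus:
  fixes f g :: "'i \<Rightarrow> complex"
  assumes "(f has_sum a) A" "(g has_sum b) A"
  shows "((\<lambda>x. f x - g x) has_sum (a - b)) A"
  using has_sum_add[OF assms(1) has_sum_uminusI[OF assms(2)]] by simp

text \<open>A point of the open strip lies in a strictly smaller one, which leaves a factor
  \<open>exp (- 2 * b * zlen k)\<close>. One half of the exponent pays for the growth of the
  exponential remainder under a shift by \<open>h\<close>, the other half for the factor quadratic
  in \<open>k\<close>.\<close>

lemma fs_has_derivative:
  fixes a :: "(int ^ 'd::finite) ell1"
  assumes th: "\<theta> \<in> strip r"
  shows "(fs r a has_derivative (\<lambda>h. \<Sum>j\<in>UNIV. dfs r j a \<theta> * h $ j)) (at \<theta>)"
proof -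
  obtain r' where r': "r' < r" "\<theta> \<in> strip r'" using strip_shrink[OF th] .
  define b where "b = (r - r') / 2"
  have b: "b > 0" using r' by (simp add: b_def)
  obtain C where C: "C > 0" "\<And>x. x \<ge> 0 \<Longrightarrow> (1 + x)\<^sup>2 * exp (- b * x) \<le> C" using exp_poly_bound[OF b] by blast
  have em: "norm (fmode k \<theta>) / wt r k \<le> exp (- (2 * b) * zlen k)" for k
    using norm_fmode_le[OF r'(2), of k]
    by (simp add: wt_def b_def pos_divide_le_eq field_simps flip: exp_add)
  have lin: "(1 + zlen k) * exp (- (2 * b) * zlen k) \<le> C" for k :: "int ^ 'd"
  proof -
    have "(1 + zlen k) * exp (- (2 * b) * zlen k) \<le> (1 + zlen k)\<^sup>2 * exp (- b * zlen k)"
      using b self_le_power[of "1 + zlen k" 2] by (intro mult_mono) (auto intro!: mult_right_mono)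
    then show ?thesis using C(2)[of "zlen k"] by simp
  qed
  have sd: "(\<lambda>k. norm (ap a k / of_real (wt r k) * (2 * of_real pi * \<i> * of_int (k $ j)) * fmode k \<theta>)) summable_on UNIV" for j
  proof (rule summable_norm_bound[of "\<lambda>k. norm (ap a k) * (2 * pi * C)"])
    show "(\<lambda>k. norm (ap a k) * (2 * pi * C)) summable_on UNIV" by (intro summable_on_cmult_left ap_summable)
    fix k
    have "norm (ap a k / of_real (wt r k) * (2 * of_real pi * \<i> * of_int (k $ j)) * fmode k \<theta>) =
       norm (ap a k) * (2 * pi * (\<bar>of_int (k $ j)\<bar> * (norm (fmode k \<theta>) / wt r k)))"
      by (simp add: norm_mult norm_divide mult_ac)
    also have "\<bar>of_int (k $ j)\<bar> * (norm (fmode k \<theta>) / wt r k) \<le> (1 + zlen k) * exp (- (2 * b) * zlen k)"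
      using zlen_component[of k j] by (intro mult_mono em) (auto simp: order_trans)
    also have "\<dots> \<le> C" by (rule lin)
    finally show "norm (ap a k / of_real (wt r k) * (2 * of_real pi * \<i> * of_int (k $ j)) * fmode k \<theta>) \<le> norm (ap a k) * (2 * pi * C)"
      by (simp add: mult_left_mono)
  qed
  have hsd: "((\<lambda>k. ap a k / of_real (wt r k) * (2 * of_real pi * \<i> * of_int (k $ j)) * fmode k \<theta>) has_sum dfs r j a \<theta>) UNIV" for j
    unfolding dfs_def by (rule has_sum_infsum[OF abs_summable_summable[OF sd]])
  have hsum: "((\<lambda>k. ap a k / of_real (wt r k) * fmode k \<theta> * (2 * of_real pi * \<i> * dotp (vec_of_int k) h))
      has_sum (\<Sum>j\<in>UNIV. dfs r j a \<theta> * h $ j)) UNIV" for h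
  proof -
    have *: "((\<lambda>k. \<Sum>j\<in>J. ap a k / of_real (wt r k) * (2 * of_real pi * \<i> * of_int (k $ j)) * fmode k \<theta> * h $ j)
      has_sum (\<Sum>j\<in>J. dfs r j a \<theta> * h $ j)) UNIV" if "finite J" for J
      using that
    proof (induction J)
      case (insert x J)
      show ?case unfolding sum.insert[OF insert.hyps] by (rule has_sum_add[OF has_sum_cmult_left[OF hsd] insert.IH])
    qed simp
    show ?thesis
      using *[of UNIV] by (simp add: dotp_def vec_of_int_def sum_distrib_left mult_ac)
  qed
  \<comment> \<open>For shifts of this size 2 \<pi> times the sum of the |h_i| is at most
    \<open>b\<close>, so \<open>\<theta> + h\<close> stays in the strip and the exponent in the
    remainder is at most \<open>b * zlen k\<close>.\<close>
  define \<eta> where "\<eta> = min (b / (2 * pi * CARD('d))) ((r - r') / (4 * pi * CARD('d)))"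
  define K where "K = norm a * (C * (2 * pi * CARD('d))\<^sup>2)"
  have card: "real CARD('d) > 0" by simp
  have eta: "\<eta> > 0" using b r' card by (simp add: \<eta>_def)
  have quad: "norm (fs r a (\<theta> + h) - fs r a \<theta> - (\<Sum>j\<in>UNIV. dfs r j a \<theta> * h $ j)) \<le> K * (norm h)\<^sup>2"
    if h: "norm h \<le> \<eta>" for h
  proof -
    let ?s = "\<Sum>i\<in>UNIV. norm (h $ i)"
    have s: "?s \<le> CARD('d) * norm h" by (rule norm_vec_sum_le)
    have s2: "2 * pi * ?s \<le> b"
    proof -
      have "CARD('d) * norm h \<le> CARD('d) * (b / (2 * pi * CARD('d)))"
        using h by (intro mult_left_mono) (auto simp: \<eta>_def)
      then have "?s \<le> b / (2 * pi)" using s by simp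
      then show ?thesis by (simp add: pos_le_divide_eq mult_ac)
    qed
    have inst: "\<theta> + h \<in> strip r"
    proof -
      have "(\<Sum>i\<in>UNIV. \<bar>Im ((\<theta> + h) $ i)\<bar>) \<le> (\<Sum>i\<in>UNIV. \<bar>Im (\<theta> $ i)\<bar>) + ?s"
        unfolding sum.distrib[symmetric]
      proof (rule sum_mono)
        fix i show "\<bar>Im ((\<theta> + h) $ i)\<bar> \<le> \<bar>Im (\<theta> $ i)\<bar> + norm (h $ i)"
          using abs_Im_le_cmod[of "h $ i"] by simp
      qed
      also have "\<dots> < r' / (2 * pi) + b / (2 * pi)"
        using r'(2) s2 by (intro add_less_le_mono) (auto simp: strip_def pos_le_divide_eq mult_ac)
      also have "\<dots> \<le> r / (2 * pi)"
        using r'(1) by (simp add: b_def field_simps)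
      finally show ?thesis by (simp add: strip_def)
    qed
    define t where "t k = ap a k / of_real (wt r k) * fmode k \<theta> *
       (exp (2 * of_real pi * \<i> * dotp (vec_of_int k) h) - 1 - 2 * of_real pi * \<i> * dotp (vec_of_int k) h)" for k
    have ht: "(t has_sum (fs r a (\<theta> + h) - fs r a \<theta> - (\<Sum>j\<in>UNIV. dfs r j a \<theta> * h $ j))) UNIV"
      using has_sum_minus[OF has_sum_minus[OF fs_summable(3)[OF inst, of a] fs_summable(3)[OF th, of a]] hsum[of h]]
      by (simp add: t_def[abs_def] fmode_shift algebra_simps)
    have tk: "norm (t k) \<le> norm (ap a k) * (C * (2 * pi * CARD('d))\<^sup>2 * (norm h)\<^sup>2)" for k
    proof -
      let ?w = "2 * of_real pi * \<i> * dotp (vec_of_int k) h"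
      have w: "norm ?w \<le> zlen k * (2 * pi * ?s)"
        using mult_left_mono[OF dotp_bound[of k h], of "2 * pi"] by (simp add: norm_mult mult_ac)
      have w1: "norm ?w \<le> zlen k * b"
        by (rule order_trans[OF w mult_left_mono[OF s2]]) simp
      have w2: "norm ?w \<le> zlen k * (2 * pi * CARD('d) * norm h)"
        using order_trans[OF w mult_left_mono[OF mult_left_mono[OF s, of "2 * pi"]]] by (simp add: mult_ac)
      have "norm (exp ?w - 1 - ?w) \<le> (norm ?w)\<^sup>2 * exp (norm ?w)" by (rule exp_remainder)
      also have "\<dots> \<le> (zlen k * (2 * pi * CARD('d) * norm h))\<^sup>2 * exp (zlen k * b)"
        by (intro mult_mono power_mono w2) (use w1 in auto)
      finally have e: "norm (exp ?w - 1 - ?w) \<le> (zlen k * (2 * pi * CARD('d) * norm h))\<^sup>2 * exp (zlen k * b)" .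
      have "norm (t k) = norm (ap a k) * ((norm (fmode k \<theta>) / wt r k) * norm (exp ?w - 1 - ?w))"
        by (simp add: t_def norm_mult norm_divide)
      also have "(norm (fmode k \<theta>) / wt r k) * norm (exp ?w - 1 - ?w) \<le>
          exp (- (2 * b) * zlen k) * ((zlen k * (2 * pi * CARD('d) * norm h))\<^sup>2 * exp (zlen k * b))"
        by (intro mult_mono em e) auto
      also have "\<dots> = ((zlen k)\<^sup>2 * exp (- b * zlen k)) * ((2 * pi * CARD('d))\<^sup>2 * (norm h)\<^sup>2)"
        by (simp add: power_mult_distrib mult_ac flip: exp_add)
      also have "\<dots> \<le> C * ((2 * pi * CARD('d))\<^sup>2 * (norm h)\<^sup>2)"
      proof (rule mult_right_mono)
        have "(zlen k)\<^sup>2 * exp (- b * zlen k) \<le> (1 + zlen k)\<^sup>2 * exp (- b * zlen k)"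
          by (intro mult_right_mono power_mono) auto
        then show "(zlen k)\<^sup>2 * exp (- b * zlen k) \<le> C" by (rule order_trans) (rule C(2), simp)
      qed simp
      finally show ?thesis by (simp add: mult_left_mono mult.assoc)
    qed
    have sm: "(\<lambda>k. norm (ap a k) * (C * (2 * pi * CARD('d))\<^sup>2 * (norm h)\<^sup>2)) summable_on UNIV"
      by (intro summable_on_cmult_left ap_summable)
    have st: "(\<lambda>k. norm (t k)) summable_on UNIV" by (rule summable_norm_bound[OF sm tk])
    have "norm (fs r a (\<theta> + h) - fs r a \<theta> - (\<Sum>j\<in>UNIV. dfs r j a \<theta> * h $ j)) \<le> (\<Sum>\<^sub>\<infinity>k. norm (t k))"
      using norm_infsum_bound[OF st] infsumI[OF ht] by simp
    also have "\<dots> \<le> (\<Sum>\<^sub>\<infinity>k. norm (ap a k) * (C * (2 * pi * CARD('d))\<^sup>2 * (norm h)\<^sup>2))"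
      by (rule infsum_mono[OF st sm tk])
    also have "\<dots> = K * (norm h)\<^sup>2"
      unfolding K_def norm_ell1_eq[of a] infsum_cmult_left' by (simp add: mult_ac)
    finally show ?thesis .
  qed
  have K: "K \<ge> 0" using C by (simp add: K_def)
  show ?thesis
    unfolding has_derivative_at2
  proof (intro conjI)
    show "bounded_linear (\<lambda>h. \<Sum>j\<in>UNIV. dfs r j a \<theta> * h $ j)"
      by (intro bounded_linear_sum bounded_linear_const_mult bounded_linear_vec_nth)
    show "((\<lambda>y. (1 / norm (y - \<theta>)) *\<^sub>R (fs r a y - (fs r a \<theta> + (\<Sum>j\<in>UNIV. dfs r j a \<theta> * (y - \<theta>) $ j)))) \<longlongrightarrow> 0) (at \<theta>)"
    proof (rule Lim_null_comparison)
      show "\<forall>\<^sub>F y in at \<theta>. norm ((1 / norm (y - \<theta>)) *\<^sub>R (fs r a y - (fs r a \<theta> + (\<Sum>j\<in>UNIV. dfs r j a \<theta> * (y - \<theta>) $ j)))) \<le> K * norm (y - \<theta>)"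
        unfolding eventually_at
      proof (intro exI[of _ \<eta>] conjI ballI impI)
        fix y assume y: "y \<noteq> \<theta> \<and> dist y \<theta> < \<eta>"
        then have "norm (fs r a y - (fs r a \<theta> + (\<Sum>j\<in>UNIV. dfs r j a \<theta> * (y - \<theta>) $ j))) \<le> K * (norm (y - \<theta>))\<^sup>2"
          using quad[of "y - \<theta>"] by (simp add: dist_norm diff_diff_eq)
        then have "norm (fs r a y - (fs r a \<theta> + (\<Sum>j\<in>UNIV. dfs r j a \<theta> * (y - \<theta>) $ j))) / norm (y - \<theta>) \<le> K * (norm (y - \<theta>))\<^sup>2 / norm (y - \<theta>)"
          by (intro divide_right_mono) auto
        then show "norm ((1 / norm (y - \<theta>)) *\<^sub>R (fs r a y - (fs r a \<theta> + (\<Sum>j\<in>UNIV. dfs r j a \<theta> * (y - \<theta>) $ j)))) \<le> K * norm (y - \<theta>)"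
          using y by (simp add: power2_eq_square)
      qed (rule eta)
      have "((\<lambda>y. K * norm (y - \<theta>)) \<longlongrightarrow> K * norm (\<theta> - \<theta>)) (at \<theta>)" by (intro tendsto_intros)
      then show "((\<lambda>y. K * norm (y - \<theta>)) \<longlongrightarrow> 0) (at \<theta>)" by simp
    qed
  qed
qed

text \<open>The component \<open>i\<close> of the \<open>k\<close>-th Fourier coefficient of \<open>fldA r x\<close> is \<open>ap x (k, i) / wt r k\<close>, so that
  \<open>fldA r\<close> is an isometry onto \<open>\<A>(r)\<close>. Similarly, \<open>fldA r \<circ> em\<close> is an isometry onto \<open>\<A>'(r)\<close>.\<close>

type_synonym 'd cf = "((int ^ 'd) \<times> 'd) ell1"

definition fldA :: "real \<Rightarrow> 'd cf \<Rightarrow> 'd::finite vfield" where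
  "fldA r x = restr r (\<lambda>\<theta>. \<chi> i. fs r (cmpt i x) \<theta>)"

lemma fldA_nth: "\<theta> \<in> strip r \<Longrightarrow> fldA r x \<theta> $ i = fs r (cmpt i x) \<theta>"
  by (simp add: fldA_def restr_def)

lemma fldA_outside: "\<theta> \<notin> strip r \<Longrightarrow> fldA r x \<theta> = 0"
  by (simp add: fldA_def restr_def)

lemma restr_eqI: "(\<And>\<theta>. \<theta> \<in> strip r \<Longrightarrow> f \<theta> = g \<theta>) \<Longrightarrow> restr r f = restr r g"
  by (auto simp: restr_def fun_eq_iff)

lemma fldA_eqI:
  assumes "\<And>\<theta> i. \<theta> \<in> strip r \<Longrightarrow> fs r (cmpt i x) \<theta> = f \<theta> $ i"
  shows "fldA r x = restr r f"
  unfolding fldA_def by (rule restr_eqI) (simp add: vec_eq_iff assms)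

lemma cmpt_simps [simp]: "cmpt i (x + y) = cmpt i x + cmpt i y" "cmpt i (x - y) = cmpt i x - cmpt i y"
  "cmpt i (cs c x) = cs c (cmpt i x)" "cmpt i 0 = 0" "cmpt i (- x) = - cmpt i x"
  by (rule ell1_eqI; simp)+

lemma fldA_add: "fldA r (x + y) = fldA r x + fldA r y"
  by (auto simp: fldA_def restr_def fun_eq_iff vec_eq_iff fs_add)

lemma fldA_cs: "fldA r (cs c x) = fscale c (fldA r x)"
  by (auto simp: fldA_def restr_def fun_eq_iff vec_eq_iff fs_cs fscale_def)

lemma fldA_0: "fldA r 0 = 0"
  by (auto simp: fldA_def restr_def fun_eq_iff vec_eq_iff)

lemma bounded_linear_axis: "bounded_linear (axis i :: complex \<Rightarrow> complex ^ 'd::finite)"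
proof (rule bounded_linear_intro[of _ 1])
  show "norm (axis i c :: complex ^ 'd) \<le> norm c * 1" for c
    by (simp add: norm_vec_def L2_set_def axis_def if_distrib[of norm] if_distrib[of "\<lambda>x. x\<^sup>2"] cong: if_cong)
qed (auto simp: axis_def vec_eq_iff)

lemma vec_axis_sum: "(\<chi> i. f i) = (\<Sum>i\<in>UNIV. axis i (f i))" for f :: "'d::finite \<Rightarrow> complex"
  by (simp add: vec_eq_iff axis_def)

lemma fldA_has_derivative:
  assumes th: "\<theta> \<in> strip r"
  shows "(fldA r x has_derivative (\<lambda>h. \<chi> i. \<Sum>j\<in>UNIV. dfs r j (cmpt i x) \<theta> * h $ j)) (at \<theta>)"
proof (rule has_derivative_transform_within_open[OF _ open_strip th])
  show "((\<lambda>\<theta>. \<chi> i. fs r (cmpt i x) \<theta>) has_derivative (\<lambda>h. \<chi> i. \<Sum>j\<in>UNIV. dfs r j (cmpt i x) \<theta> * h $ j)) (at \<theta>)"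
    unfolding vec_axis_sum
    by (intro has_derivative_sum bounded_linear.has_derivative[OF bounded_linear_axis] fs_has_derivative th)
  show "(\<chi> i. fs r (cmpt i x) \<theta>) = fldA r x \<theta>" if "\<theta> \<in> strip r" for \<theta>
    using that by (simp add: fldA_def restr_def)
qed

lemma sum_axis: "(\<Sum>l\<in>UNIV. f l * axis j 1 $ l) = f j" for f :: "'d::finite \<Rightarrow> complex"
proof -
  have "(\<Sum>l\<in>UNIV. f l * axis j 1 $ l) = (\<Sum>l\<in>UNIV. if l = j then f l else 0)"
    by (rule sum.cong) (auto simp: axis_def)
  then show ?thesis by (simp add: sum.delta)
qed

lemma fldA_jacobian:
  assumes "\<theta> \<in> strip r"
  shows "jacobian (fldA r x) (at \<theta>) = (\<chi> i j. dfs r j (cmpt i x) \<theta>)"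
  unfolding jacobian_def frechet_derivative_at[OF fldA_has_derivative[OF assms], symmetric] matrix_def
  by (simp only: vec_lambda_beta sum_axis)

lemma complex_differentiable_fldA:
  assumes "\<theta> \<in> strip r"
  shows "complex_differentiable_at (fldA r x) \<theta>"
  unfolding complex_differentiable_at_def
proof (rule exI, rule conjI[OF fldA_has_derivative[OF assms]], intro allI)
  fix c :: complex and v :: "complex ^ 'a"
  show "(\<chi> i. \<Sum>j\<in>UNIV. dfs r j (cmpt i x) \<theta> * (c *s v) $ j) = c *s (\<chi> i. \<Sum>j\<in>UNIV. dfs r j (cmpt i x) \<theta> * v $ j)"
    unfolding vec_eq_iff vector_smult_component vec_lambda_beta sum_distrib_left by (simp only: mult.left_commute simp_thms)
qed

lemma continuous_fs_real:
  assumes "r > 0"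
  shows "continuous_on S (\<lambda>x. fs r a (vec_of_real x))"
proof (rule continuous_on_compose2[OF _ continuous_vec_of_real])
  show "continuous_on (strip r) (fs r a)"
    by (intro continuous_at_imp_continuous_on ballI) (rule has_derivative_continuous[OF fs_has_derivative])
qed (use assms in \<open>auto simp: vec_of_real_in_strip\<close>)

text \<open>Both sides are bounded linear in \<open>a\<close>, so it suffices to take unit vectors,
  for which the claim is orthogonality of the modes.\<close>

lemma fs_fourier:
  fixes a :: "(int ^ 'd::finite) ell1"
  assumes r: "r > 0"
  shows "integral (cbox 0 1) (\<lambda>x. fmode (- k) (vec_of_real x) * fs r a (vec_of_real x)) = ap a k / of_real (wt r k)"
proof -
  let ?f = "\<lambda>a x. fmode (- k) (vec_of_real x) * fs r a (vec_of_real x)"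
  let ?L = "\<lambda>a. integral (cbox 0 1) (?f a)"
  have cf: "continuous_on S (\<lambda>x. fmode j (vec_of_real x))" for j :: "int ^ 'd" and S
    by (rule continuous_on_compose2[OF continuous_fmode continuous_vec_of_real]) auto
  have int: "?f a integrable_on cbox 0 1" for a
    by (intro integrable_continuous continuous_on_mult cf continuous_fs_real r)
  have L: "bounded_linear ?L"
  proof (rule bounded_linear_intro)
    fix a b :: "(int ^ 'd) ell1" and c :: real
    have "?f (a + b) = (\<lambda>x. ?f a x + ?f b x)"
      by (simp add: fun_eq_iff fs_add vec_of_real_in_strip r distrib_left)
    then show "?L (a + b) = ?L a + ?L b" by (simp add: Henstock_Kurzweil_Integration.integral_add[OF int int])
    have "?f (c *\<^sub>R a) = (\<lambda>x. c *\<^sub>R ?f a x)"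
      by (simp add: fun_eq_iff scaleR_cs fs_cs scaleR_conv_of_real)
    then show "?L (c *\<^sub>R a) = c *\<^sub>R ?L a" by (simp only: Henstock_Kurzweil_Integration.integral_cmul)
    show "norm (?L a) \<le> norm a * measure lborel (cbox 0 1 :: (real ^ 'd) set)"
    proof (rule has_integral_bound[OF _ integrable_integral[OF int]])
      fix x :: "real ^ 'd"
      show "norm (?f a x) \<le> norm a"
        using fs_summable(4)[OF vec_of_real_in_strip[OF r], of a x] by (simp add: norm_mult norm_fmode_real)
    qed simp
  qed
  have one: "?L (sngl j) = (if j = k then 1 / of_real (wt r k) else 0)" for j
  proof -
    have "?f (sngl j) = (\<lambda>x. (1 / of_real (wt r j)) * fmode (j - k) (vec_of_real x))"
      using fmode_add[of "- k" j] by (simp add: fun_eq_iff fs_sngl)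
    then have "?L (sngl j) = (1 / of_real (wt r j)) * integral (cbox 0 1) (\<lambda>x :: real ^ 'd. fmode (j - k) (vec_of_real x))"
      by (simp only: Henstock_Kurzweil_Integration.integral_mult_right)
    moreover have "integral (cbox 0 1) (\<lambda>x :: real ^ 'd. fmode (j - k) (vec_of_real x)) = (if j = k then 1 else 0)"
    proof (cases "j = k")
      case True
      have "measure lborel (cbox 0 1 :: (real ^ 'd) set) = 1"
        by (subst content_cbox_cart) (auto simp: cbox_interval interval_ne_empty_cart less_eq_vec_def)
      then show ?thesis using True by simp
    next
      case False
      then show ?thesis using integral_fmode[of "j - k"] by simp
    qed
    ultimately show ?thesis by simp
  qed
  have "((\<lambda>j. ?L (cs (ap a j) (sngl j))) has_sum ?L a) UNIV"
    by (rule has_sum_bounded_linear[OF L has_sum_sngl])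
  moreover have "?L (cs c b) = c * ?L b" for c b
    by (simp add: fs_cs mult.left_commute[of _ c])
  ultimately have "((\<lambda>j. ap a j * (if j = k then 1 / of_real (wt r k) else 0)) has_sum ?L a) UNIV"
    by (simp add: one)
  moreover have "((\<lambda>j. ap a j * (if j = k then 1 / of_real (wt r k) else 0)) has_sum (ap a k / of_real (wt r k))) UNIV"
    by (rule has_sum_finite_neutralI[of "{k}"]) auto
  ultimately show ?thesis by (rule has_sum_unique)
qed

lemma fcoeff_fldA:
  assumes r: "r > 0"
  shows "fcoeff (fldA r x) k $ i = ap x (k, i) / of_real (wt r k)"
proof -
  let ?f = "\<lambda>y. fmode (- k) (vec_of_real y) *s fldA r x (vec_of_real y)"
  have nth: "?f y $ i = fmode (- k) (vec_of_real y) * fs r (cmpt i x) (vec_of_real y)" for y i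
    by (simp add: fldA_nth vec_of_real_in_strip r)
  have "continuous_on (cbox 0 1) (\<lambda>y. \<chi> i. ?f y $ i)"
    unfolding nth
    by (intro continuous_on_vec_lambda continuous_on_mult continuous_fs_real r
        continuous_on_compose2[OF continuous_fmode continuous_vec_of_real]) auto
  then have "continuous_on (cbox 0 1) ?f" by (simp only: vec_lambda_eta)
  then have "?f integrable_on cbox 0 1" by (rule integrable_continuous)
  from integral_linear[OF this bounded_linear_vec_nth[of i]]
  have "fcoeff (fldA r x) k $ i = integral (cbox 0 1) (\<lambda>y. ?f y $ i)"
    by (simp add: fcoeff_def o_def)
  then show ?thesis unfolding nth by (simp add: fs_fourier[OF r])
qed

lemma average_eq_fcoeff: "average X = fcoeff X 0"
  by (simp add: average_def fcoeff_def)

lemma has_sum_vec_iff: "(f has_sum s) A \<longleftrightarrow> (\<forall>i. ((\<lambda>k. f k $ i) has_sum s $ i) A)"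
  for f :: "'k \<Rightarrow> complex ^ 'd::finite"
proof
  assume "(f has_sum s) A"
  then show "\<forall>i. ((\<lambda>k. f k $ i) has_sum s $ i) A"
    using has_sum_bounded_linear[OF bounded_linear_vec_nth] by blast
next
  assume *: "\<forall>i. ((\<lambda>k. f k $ i) has_sum s $ i) A"
  show "(f has_sum s) A"
    unfolding has_sum_def by (rule vec_tendstoI) (use * in \<open>simp add: has_sum_def\<close>)
qed

lemma fldA_has_sum:
  assumes r: "r > 0" and "\<theta> \<in> strip r"
  shows "((\<lambda>k. fmode k \<theta> *s fcoeff (fldA r x) k) has_sum fldA r x \<theta>) UNIV"
  unfolding has_sum_vec_iff
proof
  fix i
  show "((\<lambda>k. (fmode k \<theta> *s fcoeff (fldA r x) k) $ i) has_sum fldA r x \<theta> $ i) UNIV"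
    using fs_summable(3)[OF assms(2), of "cmpt i x"]
    by (simp add: fcoeff_fldA[OF r] fldA_nth[OF assms(2)] mult.commute)
qed

lemma l1norm_nonneg [simp]: "0 \<le> l1norm v"
  by (simp add: l1norm_def sum_nonneg)

lemma l1norm_fcoeff_fldA:
  assumes r: "r > 0"
  shows "l1norm (fcoeff (fldA r x) k) * exp (r * zlen k) = (\<Sum>i\<in>UNIV. norm (ap x (k, i)))"
  by (simp add: l1norm_def fcoeff_fldA[OF r] norm_divide sum_distrib_right wt_def)

lemma has_sum_norm_vec:
  "((\<lambda>k. \<Sum>i\<in>UNIV. norm (ap x (k, i))) has_sum norm x) UNIV" for x :: "('k \<times> 'd::finite) ell1"
proof -
  have *: "((\<lambda>k. norm (ap x (k, i))) has_sum norm (cmpt i x)) UNIV" for i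
    using has_sum_infsum[OF ap_summable[of "cmpt i x"]] by (simp add: norm_ell1_eq)
  have "((\<lambda>k. \<Sum>i\<in>I. norm (ap x (k, i))) has_sum (\<Sum>i\<in>I. norm (cmpt i x))) UNIV" if "finite I" for I
    using that by (induction I) (simp_all add: has_sum_add *)
  from this[OF finite] show ?thesis unfolding norm_vec_ell1 .
qed

lemma fldA_periodic_analytic:
  fixes x :: "'d::finite cf"
  assumes r: "r > 0"
  shows "fldA r x \<in> periodic_analytic r"
  unfolding periodic_analytic_def
proof (intro CollectI conjI allI ballI impI)
  fix \<theta> :: "complex ^ 'd"
  show "fldA r x \<theta> = 0" if "\<theta> \<notin> strip r" using that by (rule fldA_outside)
  show "complex_differentiable_at (fldA r x) \<theta>" if "\<theta> \<in> strip r" using that by (rule complex_differentiable_fldA)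
  show "fldA r x (\<theta> + vec_of_int k) = fldA r x \<theta>" if "\<theta> \<in> strip r" for k
    using that by (simp add: fldA_def restr_def strip_periodic fs_def fmode_periodic)
  show "((\<lambda>k. fmode k \<theta> *s fcoeff (fldA r x) k) has_sum fldA r x \<theta>) UNIV" if "\<theta> \<in> strip r"
    using fldA_has_sum[OF r that] .
qed

lemma fldA_spaceA:
  assumes r: "r > 0"
  shows "fldA r x \<in> spaceA r" and normA_fldA: "normA r (fldA r x) = norm x"
proof -
  note s = has_sum_norm_vec[of x]
  show "fldA r x \<in> spaceA r"
    using fldA_periodic_analytic[OF r] has_sum_imp_summable[OF s] by (simp add: spaceA_def l1norm_fcoeff_fldA[OF r])
  show "normA r (fldA r x) = norm x"
    unfolding normA_def l1norm_fcoeff_fldA[OF r] by (rule infsumI[OF s])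
qed

section \<open>The weight for one derivative and the two spaces as \<ell>1\<close>

definition wd :: "int ^ 'd \<Rightarrow> real" where
  "wd k = 1 + 2 * pi * zlen k"

lemma wd_ge_1: "1 \<le> wd k"
  by (simp add: wd_def)

lemma wd_0 [simp]: "wd 0 = 1"
  by (simp add: wd_def)

lemma wd_pos [simp]: "0 < wd k" "wd k \<noteq> 0" "0 \<le> wd k"
  using wd_ge_1[of k] by linarith+

text \<open>The inclusion of the primed space in the unprimed one, when each is identified with
  \<ell>1 through its own weights.\<close>

definition em :: "'d::finite cf \<Rightarrow> 'd cf" where
  "em = diagop (\<lambda>(k, i). 1 / of_real (wd k))"

lemma ap_em: "ap (em x) (k, i) = ap x (k, i) / of_real (wd k)"
  and norm_em: "norm (em x) \<le> norm x" and clin_em: "clin em"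
proof -
  have *: "norm ((\<lambda>(k, i). 1 / complex_of_real (wd k)) p) \<le> 1" for p
    by (cases p) (simp add: norm_divide wd_ge_1)
  note d = diagop[of "\<lambda>(k, i). 1 / complex_of_real (wd k)", OF *]
  show "ap (em x) (k, i) = ap x (k, i) / of_real (wd k)" "norm (em x) \<le> norm x" "clin em"
    unfolding em_def using d(1)[of x "(k, i)"] d(2)[of x] d(3) by simp_all
qed

lemma fldA_em_normA':
  assumes r: "r > 0"
  shows "(1 + 2 * pi * zlen k) * l1norm (fcoeff (fldA r (em x)) k) * exp (r * zlen k) = (\<Sum>i\<in>UNIV. norm (ap x (k, i)))"
proof -
  have "norm (ap (em x) (k, i)) = norm (ap x (k, i)) / wd k" for i
    by (simp add: ap_em norm_divide)
  then have "wd k * (l1norm (fcoeff (fldA r (em x)) k) * exp (r * zlen k)) = (\<Sum>i\<in>UNIV. norm (ap x (k, i)))"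
    unfolding l1norm_fcoeff_fldA[OF r] by (simp add: sum_distrib_left)
  then show ?thesis by (simp only: wd_def mult.assoc)
qed

lemma fldA_spaceA':
  assumes r: "r > 0"
  shows "fldA r (em x) \<in> spaceA' r" and normA'_fldA: "normA' r (fldA r (em x)) = norm x"
proof -
  note s = has_sum_norm_vec[of x]
  show "fldA r (em x) \<in> spaceA' r"
    using fldA_periodic_analytic[OF r] has_sum_imp_summable[OF s] by (simp add: spaceA'_def fldA_em_normA'[OF r])
  show "normA' r (fldA r (em x)) = norm x"
    unfolding normA'_def fldA_em_normA'[OF r] by (rule infsumI[OF s])
qed

lemma periodic_analyticD:
  assumes "f \<in> periodic_analytic r"
  shows "\<theta> \<notin> strip r \<Longrightarrow> f \<theta> = 0"
    and "\<theta> \<in> strip r \<Longrightarrow> ((\<lambda>k. fmode k \<theta> *s fcoeff f k) has_sum f \<theta>) UNIV"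
proof -
  note f = assms[unfolded periodic_analytic_def mem_Collect_eq]
  show "\<theta> \<notin> strip r \<Longrightarrow> f \<theta> = 0" by (rule f[THEN conjunct1, rule_format])
  show "\<theta> \<in> strip r \<Longrightarrow> ((\<lambda>k. fmode k \<theta> *s fcoeff f k) has_sum f \<theta>) UNIV"
    by (rule f[THEN conjunct2, THEN conjunct2, THEN conjunct2, rule_format])
qed

text \<open>Membership in \<open>periodic_analytic\<close> includes convergence of the Fourier
  series to the function, so equal coefficients force equal functions.\<close>

lemma periodic_analytic_eq_fldA:
  assumes r: "r > 0" and f: "f \<in> periodic_analytic r"
    and x: "\<And>k i. ap x (k, i) = fcoeff f k $ i * of_real (wt r k)"
  shows "f = fldA r x"
proof
  fix \<theta>
  show "f \<theta> = fldA r x \<theta>"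
  proof (cases "\<theta> \<in> strip r")
    case True
    then have "((\<lambda>k. fmode k \<theta> *s fcoeff f k) has_sum f \<theta>) UNIV"
      by (rule periodic_analyticD(2)[OF f])
    moreover have "fcoeff (fldA r x) k = fcoeff f k" for k
      by (simp add: vec_eq_iff fcoeff_fldA[OF r] x)
    then have "((\<lambda>k. fmode k \<theta> *s fcoeff f k) has_sum fldA r x \<theta>) UNIV" using fldA_has_sum[OF r True, of x] by simp
    ultimately show ?thesis by (rule has_sum_unique)
  next
    case False
    then have "f \<theta> = 0" by (rule periodic_analyticD(1)[OF f])
    then show ?thesis using False by (simp add: fldA_outside)
  qed
qed

lemma sum_vec_coeffs_le:
  fixes c :: "int ^ 'd::finite \<Rightarrow> complex ^ 'd"
  assumes s: "(\<lambda>k. w k * l1norm (c k)) summable_on UNIV" and w: "\<And>k. w k \<ge> 0" and F: "finite F"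
  shows "(\<Sum>p\<in>F. norm (case p of (k, i) \<Rightarrow> c k $ i * of_real (w k))) \<le> (\<Sum>\<^sub>\<infinity>k. w k * l1norm (c k))"
proof -
  have "(\<Sum>p\<in>F. norm (case p of (k, i) \<Rightarrow> c k $ i * of_real (w k))) \<le>
      (\<Sum>p\<in>fst ` F \<times> UNIV. norm (case p of (k, i) \<Rightarrow> c k $ i * of_real (w k)))"
    by (rule sum_mono2) (use F in force)+
  also have "\<dots> = (\<Sum>k\<in>fst ` F. \<Sum>i\<in>UNIV. norm (c k $ i * of_real (w k)))"
    by (simp add: sum.cartesian_product case_prod_unfold)
  also have "\<dots> = (\<Sum>k\<in>fst ` F. w k * l1norm (c k))"
    by (simp add: l1norm_def sum_distrib_left norm_mult w mult.commute)
  also have "\<dots> \<le> (\<Sum>\<^sub>\<infinity>k. w k * l1norm (c k))"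
    by (rule finite_sum_le_infsum[OF s]) (use F w in auto)
  finally show ?thesis .
qed

lemma weighted_coeffs:
  fixes c :: "int ^ 'd::finite \<Rightarrow> complex ^ 'd"
  assumes s: "(\<lambda>k. w k * l1norm (c k)) summable_on UNIV" and w: "\<And>k. w k \<ge> 0"
  shows "\<exists>x. \<forall>k i. ap x (k, i) = c k $ i * of_real (w k)"
proof -
  define g where "g = (\<lambda>(k, i). c k $ i * of_real (w k))"
  have fin: "(\<Sum>p\<in>F. norm (g p)) \<le> (\<Sum>\<^sub>\<infinity>k. w k * l1norm (c k))" if "finite F" for F
    unfolding g_def by (rule sum_vec_coeffs_le[OF s w that])
  have "ap (Abs_ell1 g) = g" by (rule ell1_ofI(1)[OF fin])
  then show ?thesis by (intro exI[of _ "Abs_ell1 g"]) (simp add: g_def)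
qed

lemma spaceA_fldA:
  fixes f :: "'d::finite vfield"
  assumes r: "r > 0" and f: "f \<in> spaceA r"
  obtains x where "f = fldA r x"
proof -
  have s: "(\<lambda>k. wt r k * l1norm (fcoeff f k)) summable_on UNIV"
    using f by (simp add: spaceA_def wt_def mult.commute)
  obtain x where x: "\<forall>k i. ap x (k, i) = fcoeff f k $ i * of_real (wt r k)"
    using weighted_coeffs[of "wt r" "fcoeff f", OF s wt_pos(3)] ..
  have "f \<in> periodic_analytic r" using f by (simp add: spaceA_def)
  from periodic_analytic_eq_fldA[OF r this x[rule_format]] show ?thesis by (rule that)
qed

lemma spaceA'_fldA:
  fixes f :: "'d::finite vfield"
  assumes r: "r > 0" and f: "f \<in> spaceA' r"
  obtains x where "f = fldA r (em x)"
proof -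
  define w where "w k = wd k * wt r k" for k :: "int ^ 'd"
  have w: "w k \<ge> 0" for k by (simp add: w_def)
  have s: "(\<lambda>k. w k * l1norm (fcoeff f k)) summable_on UNIV"
    using f by (simp add: spaceA'_def w_def wt_def wd_def mult_ac)
  obtain x where x: "\<forall>k i. ap x (k, i) = fcoeff f k $ i * of_real (w k)"
    using weighted_coeffs[of w "fcoeff f", OF s w] ..
  have x': "ap (em x) (k, i) = fcoeff f k $ i * of_real (wt r k)" for k i
    by (simp add: ap_em x w_def)
  have "f \<in> periodic_analytic r" using f by (simp add: spaceA'_def)
  from periodic_analytic_eq_fldA[OF r this x'] show ?thesis by (rule that)
qed

lemma fldA_inj: 
  assumes "r > 0" shows "fldA r x = fldA r y \<longleftrightarrow> x = y"
proof
  assume *: "fldA r x = fldA r y"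
  show "x = y"
  proof (rule ell1_eqI)
    fix j show "ap x j = ap y j"
      using fcoeff_fldA[OF assms, of x "fst j" "snd j"] fcoeff_fldA[OF assms, of y "fst j" "snd j"] * by simp
  qed
qed simp

lemma em_inj: "em x = em y \<longleftrightarrow> x = y"
proof
  assume *: "em x = em y"
  show "x = y"
  proof (rule ell1_eqI)
    fix j show "ap x j = ap y j"
      using ap_em[of x "fst j" "snd j"] ap_em[of y "fst j" "snd j"] * by simp
  qed
qed simp

definition prj :: "(int ^ 'd::finite) set \<Rightarrow> 'd cf \<Rightarrow> 'd cf" where
  "prj S = diagop (\<lambda>(k, i). if k \<in> S then 1 else 0)"

lemma ap_prj: "ap (prj S x) (k, i) = (if k \<in> S then ap x (k, i) else 0)"
  and norm_prj: "norm (prj S x) \<le> norm x" and clin_prj: "clin (prj S)"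
proof -
  have *: "norm ((\<lambda>(k, i). if k \<in> S then (1::complex) else 0) j) \<le> 1" for j
    by (cases j) auto
  note d = diagop[of "\<lambda>(k, i). if k \<in> S then (1::complex) else 0", OF *]
  show "ap (prj S x) (k, i) = (if k \<in> S then ap x (k, i) else 0)" "norm (prj S x) \<le> norm x" "clin (prj S)"
    unfolding prj_def using d(1)[of x "(k, i)"] d(2)[of x] d(3) by simp_all
qed

lemma fseries_fldA:
  assumes r: "r > 0" and th: "\<theta> \<in> strip r"
  shows "fseries (fcoeff (fldA r x)) \<theta> = fldA r x \<theta>"
  unfolding fseries_def by (rule infsumI[OF fldA_has_sum[OF assms]])

lemma mode_proj_fldA:
  assumes r: "r > 0"
  shows "mode_proj r S (fldA r x) = fldA r (prj S x)"
proof -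
  have c: "(\<lambda>k. if k \<in> S then fcoeff (fldA r x) k else 0) = fcoeff (fldA r (prj S x))"
    by (auto simp: fun_eq_iff vec_eq_iff fcoeff_fldA[OF r] ap_prj)
  show ?thesis
    unfolding mode_proj_def c
    by (auto simp: fun_eq_iff restr_def fseries_fldA[OF r] fldA_outside)
qed

definition cst :: "complex ^ 'd::finite \<Rightarrow> 'd cf" where
  "cst v = mkvec (\<lambda>i. cs (v $ i) (sngl 0))"

lemma ap_cst: "ap (cst v) (k, i) = (if k = 0 then v $ i else 0)"
  by (simp add: cst_def ap_sngl)

lemma norm_cst: "norm (cst v) = l1norm v"
  by (simp add: cst_def norm_mkvec l1norm_def)

lemma em_cst: "em (cst v) = cst v"
  by (rule ell1_eqI) (auto simp: split_paired_all ap_em ap_cst)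

lemma fldA_cst: "fldA r (cst v) = const_field r v"
  unfolding const_field_def
  by (rule fldA_eqI) (simp add: cst_def fs_cs fs_sngl wt_def)

section \<open>The Banach algebra of weighted Fourier coefficients\<close>

context
  fixes r :: real
  assumes r: "r > 0"
begin

lemma fs_inj:
  fixes a b :: "(int ^ 'd::finite) ell1"
  assumes "\<And>\<theta>. \<theta> \<in> strip r \<Longrightarrow> fs r a \<theta> = fs r b \<theta>"
  shows "a = b"
proof (rule ell1_eqI)
  fix k
  have "(\<lambda>x. fmode (- k) (vec_of_real x) * fs r a (vec_of_real x)) = (\<lambda>x. fmode (- k) (vec_of_real x) * fs r b (vec_of_real x))"
    by (simp add: assms vec_of_real_in_strip r)
  then show "ap a k = ap b k" using fs_fourier[OF r, of k a] fs_fourier[OF r, of k b] by simp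
qed

lemma wt_mult_le: "wt r (j + k) \<le> wt r j * wt r k"
proof -
  have "r * zlen (j + k) \<le> r * (zlen j + zlen k)" by (rule mult_left_mono[OF zlen_triangle]) (use r in simp)
  then show ?thesis by (simp add: wt_def distrib_left flip: exp_add)
qed

text \<open>Multiplication of the function by \<open>fmode m\<close>. Products and compositions are
  series of such shifts.\<close>

definition shift :: "int ^ 'd::finite \<Rightarrow> (int ^ 'd) ell1 \<Rightarrow> (int ^ 'd) ell1" where
  "shift m = reop (\<lambda>k. k - m) (\<lambda>k. of_real (wt r k / wt r (k - m)))"

lemma shift:
  shows ap_shift: "ap (shift m b) k = of_real (wt r k / wt r (k - m)) * ap b (k - m)"
    and norm_shift: "norm (shift m b) \<le> wt r m * norm b" and clin_shift: "clin (shift m)"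
proof -
  have *: "norm (complex_of_real (wt r k / wt r (k - m))) \<le> wt r m" for k
    using wt_mult_le[of "k - m" m] by (simp add: norm_divide pos_divide_le_eq mult.commute)
  have "inj_on (\<lambda>k. k - m) {k. complex_of_real (wt r k / wt r (k - m)) \<noteq> 0}" by (simp add: inj_on_def)
  note d = reop[of "\<lambda>k. complex_of_real (wt r k / wt r (k - m))", OF * this]
  show "ap (shift m b) k = of_real (wt r k / wt r (k - m)) * ap b (k - m)"
    "norm (shift m b) \<le> wt r m * norm b" "clin (shift m)"
    unfolding shift_def by (rule d)+
qed

lemma shift_sngl: "shift m (sngl j) = cs (of_real (wt r (j + m) / wt r j)) (sngl (j + m))"
  by (rule ell1_eqI) (auto simp: ap_shift ap_sngl algebra_simps)

lemma fs_shift: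
  assumes th: "\<theta> \<in> strip r"
  shows "fs r (shift m b) \<theta> = fmode m \<theta> * fs r b \<theta>"
proof -
  have L: "bounded_linear (\<lambda>b. fs r (shift m b) \<theta>)"
    using bounded_linear_compose[OF bounded_linear_fs[OF th] clin_blin[OF clin_shift]] .
  have "((\<lambda>j. fs r (shift m (cs (ap b j) (sngl j))) \<theta>) has_sum fs r (shift m b) \<theta>) UNIV"
    by (rule has_sum_bounded_linear[OF L has_sum_sngl])
  moreover have "fs r (shift m (cs (ap b j) (sngl j))) \<theta> = fmode m \<theta> * (ap b j / of_real (wt r j) * fmode j \<theta>)" for j
    by (simp add: clin_cs[OF clin_shift] shift_sngl fs_cs fs_sngl fmode_add)
  ultimately have "((\<lambda>j. fmode m \<theta> * (ap b j / of_real (wt r j) * fmode j \<theta>)) has_sum fs r (shift m b) \<theta>) UNIV"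
    by simp
  moreover have "((\<lambda>j. fmode m \<theta> * (ap b j / of_real (wt r j) * fmode j \<theta>)) has_sum fmode m \<theta> * fs r b \<theta>) UNIV"
    by (rule has_sum_cmult_right[OF fs_summable(3)[OF th]])
  ultimately show ?thesis by (rule has_sum_unique)
qed

text \<open>The weight \<open>s\<close> is kept apart from \<open>r\<close> because one estimate
  serves two series: \<open>s = r\<close> for products, and the larger \<open>s = \<rho>\<close> for
  compositions.\<close>

lemma series_bound:
  fixes g :: "int ^ 'd::finite \<Rightarrow> (int ^ 'd) ell1"
  assumes g: "\<And>m. norm (shift m (g m)) \<le> wt s m * B" and B: "B \<ge> 0" and F: "finite F"
  shows "(\<Sum>m\<in>F. norm (cs (ap a m / of_real (wt s m)) (shift m (g m)))) \<le> norm a * B"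
proof -
  have "(\<Sum>m\<in>F. norm (cs (ap a m / of_real (wt s m)) (shift m (g m)))) \<le> (\<Sum>m\<in>F. norm (ap a m) * B)"
  proof (rule sum_mono)
    fix m
    have "norm (cs (ap a m / of_real (wt s m)) (shift m (g m))) = norm (ap a m) * (norm (shift m (g m)) / wt s m)"
      by (simp add: norm_divide)
    also have "\<dots> \<le> norm (ap a m) * B"
      using g[of m] by (intro mult_left_mono) (simp_all add: pos_divide_le_eq mult.commute)
    finally show "norm (cs (ap a m / of_real (wt s m)) (shift m (g m))) \<le> norm (ap a m) * B" .
  qed
  also have "\<dots> \<le> norm a * B"
    unfolding sum_distrib_right[symmetric] by (rule mult_right_mono[OF sum_ap_le_norm[OF F] B])
  finally show ?thesis .
qed

lemma hcurve_series:
  fixes g :: "complex \<Rightarrow> int ^ 'd::finite \<Rightarrow> (int ^ 'd) ell1"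
  assumes h: "hcurve U \<gamma>" and hg: "\<And>m. hcurve U (\<lambda>z. g z m)"
    and g: "\<And>z m. z \<in> U \<Longrightarrow> norm (shift m (g z m)) \<le> wt s m * B" and B: "B \<ge> 0"
  shows "hcurve U (\<lambda>z. \<Sum>\<^sub>\<infinity>m. cs (ap (\<gamma> z) m / of_real (wt s m)) (shift m (g z m)))"
proof -
  obtain M where M: "\<And>z. z \<in> U \<Longrightarrow> norm (\<gamma> z) \<le> M" using hcurve_bound[OF h] by blast
  note U = hcurve_open[OF h]
  show ?thesis
  proof (rule hcurve_infsum[OF U, where M = "M * B"])
    fix m
    have "(\<lambda>z. ap (\<gamma> z) m / of_real (wt s m)) holomorphic_on U"
      using h by (intro holomorphic_on_divide holomorphic_on_const) (simp_all add: hcurve_def)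
    moreover have "norm (ap (\<gamma> z) m / of_real (wt s m)) \<le> M / wt s m" if "z \<in> U" for z
      using order_trans[OF ap_le_norm M[OF that], of m] by (simp add: norm_divide divide_right_mono)
    ultimately show "hcurve U (\<lambda>z. cs (ap (\<gamma> z) m / of_real (wt s m)) (shift m (g z m)))"
      by (intro hcurve_cs hcurve_clin[OF hg clin_shift])
  next
    fix F :: "(int ^ 'd) set" and z assume "finite F" "z \<in> U"
    from series_bound[OF g[OF this(2)] B this(1), of "\<gamma> z"]
    show "(\<Sum>m\<in>F. norm (cs (ap (\<gamma> z) m / of_real (wt s m)) (shift m (g z m)))) \<le> M * B"
      using mult_right_mono[OF M[OF \<open>z \<in> U\<close>] B] by linarith
  qed
qed

definition cmul :: "(int ^ 'd::finite) ell1 \<Rightarrow> (int ^ 'd) ell1 \<Rightarrow> (int ^ 'd) ell1" where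
  "cmul a b = (\<Sum>\<^sub>\<infinity>m. cs (ap a m / of_real (wt r m)) (shift m b))"

lemma norm_cmul: "norm (cmul a b) \<le> norm a * norm b"
  unfolding cmul_def by (rule abs_summable_ell1(2)) (rule series_bound[OF norm_shift norm_ge_zero])

lemma fs_cmul:
  assumes th: "\<theta> \<in> strip r"
  shows "fs r (cmul a b) \<theta> = fs r a \<theta> * fs r b \<theta>"
proof -
  have "((\<lambda>m. fs r (cs (ap a m / of_real (wt r m)) (shift m b)) \<theta>) has_sum fs r (cmul a b) \<theta>) UNIV"
    unfolding cmul_def by (rule fs_infsum[OF th]) (rule series_bound[OF norm_shift norm_ge_zero])
  then have "((\<lambda>m. ap a m / of_real (wt r m) * fmode m \<theta> * fs r b \<theta>) has_sum fs r (cmul a b) \<theta>) UNIV"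
    by (simp add: fs_cs fs_shift[OF th] mult.assoc)
  moreover have "((\<lambda>m. ap a m / of_real (wt r m) * fmode m \<theta> * fs r b \<theta>) has_sum fs r a \<theta> * fs r b \<theta>) UNIV"
    by (rule has_sum_cmult_left[OF fs_summable(3)[OF th]])
  ultimately show ?thesis by (rule has_sum_unique)
qed

lemma hcurve_cmul:
  assumes "hcurve U \<alpha>" "hcurve U \<beta>"
  shows "hcurve U (\<lambda>z. cmul (\<alpha> z) (\<beta> z))"
proof -
  obtain M where M: "\<And>z. z \<in> U \<Longrightarrow> norm (\<beta> z) \<le> M" using hcurve_bound[OF assms(2)] by blast
  show ?thesis
    unfolding cmul_def
  proof (rule hcurve_series[OF assms(1), where B = "max M 0"])
    show "hcurve U \<beta>" by fact
    show "norm (shift m (\<beta> z)) \<le> wt r m * max M 0" if "z \<in> U" for z m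
      using M[OF that] by (intro order_trans[OF norm_shift] mult_left_mono) auto
  qed simp
qed

primrec cpow :: "(int ^ 'd::finite) ell1 \<Rightarrow> nat \<Rightarrow> (int ^ 'd) ell1" where
  "cpow a 0 = sngl 0"
| "cpow a (Suc n) = cmul a (cpow a n)"

lemma norm_cpow: "norm (cpow a n) \<le> norm a ^ n"
proof (induction n)
  case (Suc n)
  show ?case using order_trans[OF norm_cmul mult_left_mono[OF Suc norm_ge_zero]] by simp
qed simp

lemma fs_cpow: "\<theta> \<in> strip r \<Longrightarrow> fs r (cpow a n) \<theta> = fs r a \<theta> ^ n"
  by (induction n) (simp_all add: fs_cmul fs_sngl wt_def)

lemma hcurve_cpow: "hcurve U \<alpha> \<Longrightarrow> hcurve U (\<lambda>z. cpow (\<alpha> z) n)"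
  by (induction n) (simp_all add: hcurve_const hcurve_open hcurve_cmul)

definition cexp :: "(int ^ 'd::finite) ell1 \<Rightarrow> (int ^ 'd) ell1" where
  "cexp a = (\<Sum>\<^sub>\<infinity>n. cs (1 / fact n) (cpow a n))"

lemma cexp_terms_le:
  assumes "norm a \<le> B" "finite F"
  shows "(\<Sum>n\<in>F. norm (cs (1 / fact n) (cpow a n))) \<le> exp B"
proof -
  have B: "B \<ge> 0" using order_trans[OF norm_ge_zero assms(1)] .
  have "(\<Sum>n\<in>F. norm (cs (1 / fact n) (cpow a n))) \<le> (\<Sum>n\<in>F. B ^ n /\<^sub>R fact n)"
  proof (rule sum_mono)
    fix n
    have "norm (cpow a n) \<le> B ^ n" using order_trans[OF norm_cpow power_mono[OF assms(1) norm_ge_zero]] .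
    then show "norm (cs (1 / fact n) (cpow a n)) \<le> B ^ n /\<^sub>R fact n"
      by (simp add: norm_divide divide_right_mono field_simps)
  qed
  also have "\<dots> \<le> (\<Sum>n. B ^ n /\<^sub>R fact n)"
    by (rule sum_le_suminf[OF summable_exp_generic assms(2)]) (use B in simp)
  finally show ?thesis by (simp add: exp_def)
qed

lemma norm_cexp: "norm (cexp a) \<le> exp (norm a)"
  unfolding cexp_def by (rule abs_summable_ell1(2)) (rule cexp_terms_le[OF order_refl])

lemma fs_cexp:
  assumes th: "\<theta> \<in> strip r"
  shows "fs r (cexp a) \<theta> = exp (fs r a \<theta>)"
proof -
  have "((\<lambda>n. fs r (cs (1 / fact n) (cpow a n)) \<theta>) has_sum fs r (cexp a) \<theta>) UNIV"
    unfolding cexp_def by (rule fs_infsum[OF th]) (rule cexp_terms_le[OF order_refl])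
  from has_sum_imp_sums[OF this] have "(\<lambda>n. fs r a \<theta> ^ n /\<^sub>R fact n) sums fs r (cexp a) \<theta>"
    by (simp add: fs_cs fs_cpow[OF th] scaleR_conv_of_real divide_inverse mult.commute)
  then show ?thesis using exp_converges sums_unique2 by blast
qed

lemma hcurve_cexp:
  assumes "hcurve U \<alpha>"
  shows "hcurve U (\<lambda>z. cexp (\<alpha> z))"
proof -
  obtain M where M: "\<And>z. z \<in> U \<Longrightarrow> norm (\<alpha> z) \<le> M" using hcurve_bound[OF assms] by blast
  show ?thesis
    unfolding cexp_def
  proof (rule hcurve_infsum[OF hcurve_open[OF assms], where M = "exp M"])
    show "hcurve U (\<lambda>z. cs (1 / fact n) (cpow (\<alpha> z) n))" for n
      by (rule hcurve_clin[OF hcurve_cpow[OF assms] clin_cs'])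
  qed (rule cexp_terms_le[OF M])
qed

text \<open>Composition with \<open>Id + u\<close> multiplies the mode \<open>k\<close> by \<open>exp (2 \<pi> i k \<cdot> u)\<close>.\<close>

definition klin :: "int ^ 'd::finite \<Rightarrow> 'd cf \<Rightarrow> (int ^ 'd) ell1" where
  "klin k u = (\<Sum>i\<in>UNIV. cs (2 * of_real pi * \<i> * of_int (k $ i)) (cmpt i u))"

lemma clin_sum: "finite I \<Longrightarrow> (\<And>i. i \<in> I \<Longrightarrow> clin (L i)) \<Longrightarrow> clin (\<lambda>x. \<Sum>i\<in>I. L i x)"
proof (induction I rule: finite_induct)
  case empty
  show ?case by (rule clinI[of _ 0]) auto
qed (simp add: clin_sum2)

lemma clin_klin: "clin (klin k)"
  unfolding klin_def by (rule clin_sum) (auto intro: clin_comp[OF clin_cs' clin_cmpt])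

lemma norm_klin: "norm (klin k u) \<le> 2 * pi * zlen k * norm u"
proof -
  have "norm (klin k u) \<le> (\<Sum>i\<in>UNIV. 2 * pi * zlen k * norm (cmpt i u))"
    unfolding klin_def
    by (intro sum_norm_le) (simp add: norm_mult zlen_component mult_right_mono)
  then show ?thesis by (simp add: norm_vec_ell1 sum_distrib_left)
qed

lemma fs_sum: "\<theta> \<in> strip r \<Longrightarrow> fs r (\<Sum>i\<in>I. f i) \<theta> = (\<Sum>i\<in>I. fs r (f i) \<theta>)"
  using linear_sum[OF bounded_linear.linear[OF bounded_linear_fs]] .

lemma fs_klin:
  "\<theta> \<in> strip r \<Longrightarrow> fs r (klin k u) \<theta> = 2 * of_real pi * \<i> * dotp (vec_of_int k) (fldA r u \<theta>)"
  by (simp add: klin_def fs_sum fs_cs dotp_def fldA_nth vec_of_int_def sum_distrib_left mult.assoc)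

definition comp1 :: "real \<Rightarrow> (int ^ 'd::finite) ell1 \<Rightarrow> 'd cf \<Rightarrow> (int ^ 'd) ell1" where
  "comp1 \<rho> a u = (\<Sum>\<^sub>\<infinity>m. cs (ap a m / of_real (wt \<rho> m)) (shift m (cexp (klin m u))))"

text \<open>Here the loss of domain is paid: the factor
  \<open>exp (2 * pi * zlen m * norm u)\<close> caused by the displacement is absorbed by the
  difference between the widths \<open>\<rho>\<close> and \<open>r\<close>.\<close>

lemma comp1_terms:
  assumes "r + 2 * pi * norm u \<le> \<rho>"
  shows "norm (shift m (cexp (klin m u))) \<le> wt \<rho> m * 1"
proof -
  have "norm (shift m (cexp (klin m u))) \<le> wt r m * exp (2 * pi * zlen m * norm u)"
    by (intro order_trans[OF norm_shift] mult_left_mono order_trans[OF norm_cexp]) (simp_all add: norm_klin)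
  also have "\<dots> = exp (zlen m * (r + 2 * pi * norm u))"
    by (simp add: wt_def exp_add[symmetric] algebra_simps)
  also have "\<dots> \<le> exp (zlen m * \<rho>)" using assms by (simp add: mult_left_mono)
  finally show ?thesis by (simp add: wt_def mult.commute)
qed

lemma norm_comp1:
  assumes "r + 2 * pi * norm u \<le> \<rho>"
  shows "norm (comp1 \<rho> a u) \<le> norm a"
proof -
  have "norm (comp1 \<rho> a u) \<le> norm a * 1"
    unfolding comp1_def by (rule abs_summable_ell1(2)) (rule series_bound[OF comp1_terms[OF assms] zero_le_one])
  then show ?thesis by simp
qed

lemma strip_comp:
  assumes th: "\<theta> \<in> strip r" and u: "r + 2 * pi * norm u \<le> \<rho>"
  shows "\<theta> + fldA r u \<theta> \<in> strip \<rho>"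
proof -
  have "(\<Sum>i\<in>UNIV. \<bar>Im ((\<theta> + fldA r u \<theta>) $ i)\<bar>) \<le> (\<Sum>i\<in>UNIV. \<bar>Im (\<theta> $ i)\<bar>) + (\<Sum>i\<in>UNIV. norm (cmpt i u))"
    unfolding sum.distrib[symmetric]
  proof (rule sum_mono)
    fix i
    have "\<bar>Im (fs r (cmpt i u) \<theta>)\<bar> \<le> norm (cmpt i u)"
      using abs_Im_le_cmod order_trans fs_summable(4)[OF th] by blast
    then show "\<bar>Im ((\<theta> + fldA r u \<theta>) $ i)\<bar> \<le> \<bar>Im (\<theta> $ i)\<bar> + norm (cmpt i u)"
      by (simp add: fldA_nth[OF th])
  qed
  also have "\<dots> < r / (2 * pi) + norm u"
    using th by (simp add: strip_def norm_vec_ell1)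
  also have "\<dots> = (r + 2 * pi * norm u) / (2 * pi)" by (simp add: add_divide_distrib)
  also have "\<dots> \<le> \<rho> / (2 * pi)" by (rule divide_right_mono[OF u]) simp
  finally show ?thesis by (simp add: strip_def)
qed

lemma fs_comp1:
  assumes th: "\<theta> \<in> strip r" and u: "r + 2 * pi * norm u \<le> \<rho>"
  shows "fs r (comp1 \<rho> a u) \<theta> = fs \<rho> a (\<theta> + fldA r u \<theta>)"
proof -
  have "((\<lambda>m. fs r (cs (ap a m / of_real (wt \<rho> m)) (shift m (cexp (klin m u)))) \<theta>) has_sum fs r (comp1 \<rho> a u) \<theta>) UNIV"
    unfolding comp1_def by (rule fs_infsum[OF th]) (rule series_bound[OF comp1_terms[OF u] zero_le_one])
  then have "((\<lambda>m. ap a m / of_real (wt \<rho> m) * fmode m (\<theta> + fldA r u \<theta>)) has_sum fs r (comp1 \<rho> a u) \<theta>) UNIV"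
    by (simp add: fs_cs fs_shift[OF th] fs_cexp[OF th] fs_klin[OF th] fmode_shift)
  from has_sum_unique[OF this fs_summable(3)[OF strip_comp[OF th u]]] show ?thesis .
qed

lemma hcurve_comp1:
  assumes h: "hcurve U \<alpha>" "hcurve U \<mu>" and u: "\<And>z. z \<in> U \<Longrightarrow> r + 2 * pi * norm (\<mu> z) \<le> \<rho>"
  shows "hcurve U (\<lambda>z. comp1 \<rho> (\<alpha> z) (\<mu> z))"
  unfolding comp1_def
  by (rule hcurve_series[OF h(1) hcurve_cexp[OF hcurve_clin[OF h(2) clin_klin]] comp1_terms[OF u] zero_le_one])

section \<open>Composition, Jacobian and pullback of vector fields\<close>

definition compos :: "real \<Rightarrow> 'd::finite cf \<Rightarrow> 'd cf \<Rightarrow> 'd cf" where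
  "compos \<rho> X u = mkvec (\<lambda>i. comp1 \<rho> (cmpt i X) u)"

lemma norm_comp: "r + 2 * pi * norm u \<le> \<rho> \<Longrightarrow> norm (compos \<rho> X u) \<le> norm X"
  unfolding compos_def norm_mkvec norm_vec_ell1[of X] by (intro sum_mono norm_comp1)

definition dcf :: "'d::finite \<Rightarrow> 'd \<Rightarrow> 'd cf \<Rightarrow> (int ^ 'd) ell1" where
  "dcf j i = reop (\<lambda>k. (k, i)) (\<lambda>k. of_real (1 / wd k) * (2 * of_real pi * \<i> * of_int (k $ j)))"

text \<open>The weight 1 + 2 \<pi> |k| dominates 2 \<pi> |k_j|, so differentiation from the primed
  to the unprimed space has norm at most one in these coordinates.\<close>

lemma dcf:
  shows ap_dcf: "ap (dcf j i u) k = of_real (1 / wd k) * (2 * of_real pi * \<i> * of_int (k $ j)) * ap u (k, i)"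
    and clin_dcf: "clin (dcf j i)"
    and norm_dcf: "norm (dcf j i u) \<le> norm (cmpt i u)"
proof -
  let ?m = "\<lambda>k. of_real (1 / wd k) * (2 * of_real pi * \<i> * of_int (k $ j)) :: complex"
  have m: "norm (?m k) \<le> 1" for k
  proof -
    have "norm (?m k) = 2 * pi * \<bar>of_int (k $ j)\<bar> / wd k" by (simp add: norm_mult norm_divide)
    moreover have "2 * pi * \<bar>of_int (k $ j)\<bar> \<le> 2 * pi * zlen k" by (rule mult_left_mono[OF zlen_component]) simp
    then have "2 * pi * \<bar>of_int (k $ j)\<bar> \<le> wd k" unfolding wd_def by linarith
    ultimately show ?thesis by (simp only: divide_le_eq_1_pos[OF wd_pos(1)])
  qed
  note d = reop[of ?m, OF m, of "\<lambda>k. (k, i)"]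
  show ap: "ap (dcf j i u) k = ?m k * ap u (k, i)" for k
    unfolding dcf_def by (rule d) (simp add: inj_on_def)
  show "clin (dcf j i)" unfolding dcf_def by (rule d) (simp add: inj_on_def)
  show "norm (dcf j i u) \<le> norm (cmpt i u)"
  proof (rule norm_ell1_leI)
    fix F :: "(int ^ 'a) set" assume F: "finite F"
    have "(\<Sum>k\<in>F. norm (ap (dcf j i u) k)) \<le> (\<Sum>k\<in>F. norm (ap (cmpt i u) k))"
    proof (rule sum_mono)
      fix k
      have "norm (?m k * ap u (k, i)) \<le> 1 * norm (ap u (k, i))"
        unfolding norm_mult[of "?m k"] by (rule mult_right_mono[OF m norm_ge_zero])
      then show "norm (ap (dcf j i u) k) \<le> norm (ap (cmpt i u) k)" by (simp only: ap ap_cmpt mult_1_left)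
    qed
    then show "(\<Sum>k\<in>F. norm (ap (dcf j i u) k)) \<le> norm (cmpt i u)"
      using sum_ap_le_norm[OF F, of "cmpt i u"] by linarith
  qed
qed

lemma fs_dcf: "fs r (dcf j i u) \<theta> = dfs r j (cmpt i (em u)) \<theta>"
proof -
  have "ap (dcf j i u) k / of_real (wt r k) * fmode k \<theta> =
      ap (cmpt i (em u)) k / of_real (wt r k) * (2 * of_real pi * \<i> * of_int (k $ j)) * fmode k \<theta>" for k
    by (simp add: ap_dcf ap_em)
  then show ?thesis by (simp only: fs_def dfs_def)
qed

text \<open>For \<open>u\<close> in \<open>\<A>'\<close>-coordinates and \<open>v\<close> in \<open>\<A>\<close>-coordinates, \<open>Dm u v\<close> represents \<open>Du \<cdot> v\<close>.\<close>

definition Dm :: "'d::finite cf \<Rightarrow> 'd cf \<Rightarrow> 'd cf" where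
  "Dm u v = mkvec (\<lambda>i. \<Sum>j\<in>UNIV. cmul (dcf j i u) (cmpt j v))"

lemma norm_Dm: "norm (Dm u v) \<le> norm u * norm v"
proof -
  have "norm (Dm u v) \<le> (\<Sum>i\<in>UNIV. \<Sum>j\<in>UNIV. norm (cmpt i u) * norm (cmpt j v))"
    unfolding Dm_def norm_mkvec
    by (intro sum_mono sum_norm_le order_trans[OF norm_cmul] mult_right_mono norm_dcf) simp
  also have "\<dots> = norm u * norm v" unfolding norm_vec_ell1 by (rule sum_product[symmetric])
  finally show ?thesis .
qed

lemma fs_Dm: "\<theta> \<in> strip r \<Longrightarrow> fs r (cmpt i (Dm u v)) \<theta> = (\<Sum>j\<in>UNIV. dfs r j (cmpt i (em u)) \<theta> * fs r (cmpt j v) \<theta>)"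
  by (simp add: Dm_def fs_sum fs_cmul fs_dcf)

lemma cf_eqI:
  fixes x y :: "'d::finite cf"
  assumes "\<And>\<theta> i. \<theta> \<in> strip r \<Longrightarrow> fs r (cmpt i x) \<theta> = fs r (cmpt i y) \<theta>"
  shows "x = y"
proof (rule ell1_eqI)
  fix p :: "(int ^ 'd) \<times> 'd"
  have "cmpt (snd p) x = cmpt (snd p) y" by (rule fs_inj) (rule assms)
  from arg_cong[OF this, of "\<lambda>z. ap z (fst p)"] show "ap x p = ap y p" by simp
qed

lemma Dm_diff: "Dm u (v - w) = Dm u v - Dm u w"
  by (rule cf_eqI) (simp add: fs_Dm fs_diff right_diff_distrib sum_subtractf)

lemma hcurve_sum: "open U \<Longrightarrow> (\<And>i. hcurve U (\<gamma> i)) \<Longrightarrow> hcurve U (\<lambda>z. \<Sum>i\<in>I. \<gamma> i z)"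
  by (induction I rule: infinite_finite_induct) (simp_all add: hcurve_const hcurve_add)

lemma hcurve_Dm: "hcurve U \<mu> \<Longrightarrow> hcurve U \<nu> \<Longrightarrow> hcurve U (\<lambda>z. Dm (\<mu> z) (\<nu> z))"
  unfolding Dm_def
  by (intro hcurve_mkvec hcurve_sum hcurve_cmul hcurve_clin[OF _ clin_dcf] hcurve_clin[OF _ clin_cmpt]) (auto simp: hcurve_open)

text \<open>The field (I + Du)^{-1} Y, characterised as a fixed point instead of through pointwise
  inverse matrices; its norm bound and its holomorphic dependence then come from the contraction
  lemmas.\<close>

definition pullv :: "'d::finite cf \<Rightarrow> 'd cf \<Rightarrow> 'd cf" where
  "pullv u Y = (THE v. v = Y - Dm u v)"

lemma pullv:
  assumes u: "norm u < 1"
  shows pullv_eq: "pullv u Y = Y - Dm u (pullv u Y)"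
    and norm_pullv: "norm (pullv u Y) \<le> norm Y / (1 - norm u)"
    and pullv_unique: "v = Y - Dm u v \<Longrightarrow> pullv u Y = v"
proof -
  have contr: "norm ((Y - Dm u v) - (Y - Dm u w)) \<le> norm u * norm (v - w)" for v w
    using norm_Dm[of u "w - v"] by (simp add: Dm_diff norm_minus_commute)
  obtain v where v: "Y - Dm u v = v"
  proof (rule contraction_fixpoint[of UNIV 0 "\<lambda>v. Y - Dm u v" "norm u"])
    fix x assume "Y - Dm u x = x"
    then show thesis by (rule that)
  qed (use u contr in auto)
  have uniq: "w = v" if "w = Y - Dm u w" for w
  proof -
    have "norm (w - v) \<le> norm u * norm (w - v)"
      using contr[of w v] that[symmetric] v by simp
    then have "norm (w - v) * (1 - norm u) \<le> 0" by (simp add: algebra_simps)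
    then show ?thesis using u by (simp add: mult_le_0_iff)
  qed
  have "\<exists>!v. v = Y - Dm u v"
    by (rule ex1I[of _ v], rule v[symmetric], rule uniq)
  from theI'[OF this] show eq: "pullv u Y = Y - Dm u (pullv u Y)" by (simp only: pullv_def)
  show "pullv u Y = w" if "w = Y - Dm u w" for w
    using uniq[OF eq] uniq[OF that] by simp
  have "norm (pullv u Y) \<le> norm Y + norm (Dm u (pullv u Y))"
    by (subst eq) (rule norm_triangle_ineq4)
  also have "\<dots> \<le> norm Y + norm u * norm (pullv u Y)" using norm_Dm by simp
  finally have "norm (pullv u Y) * (1 - norm u) \<le> norm Y" by (simp add: algebra_simps)
  then show "norm (pullv u Y) \<le> norm Y / (1 - norm u)" using u by (simp add: pos_le_divide_eq)
qed

lemma hcurve_pullv: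
  assumes h: "hcurve U \<mu>" "hcurve U \<nu>" and d: "d < 1" "\<And>z. z \<in> U \<Longrightarrow> norm (\<mu> z) \<le> d"
  shows "hcurve U (\<lambda>z. pullv (\<mu> z) (\<nu> z))"
proof -
  obtain M where M: "\<And>z. z \<in> U \<Longrightarrow> norm (\<nu> z) \<le> M" using hcurve_bound[OF h(2)] by blast
  \<comment> \<open>Chosen so that \<open>max M 0 + d * B = B\<close>, which makes the ball of
    radius \<open>B\<close> invariant for all parameters at once.\<close>
  define B where "B = max M 0 / (1 - d)"
  have B: "B \<ge> 0" "(1 - d) * B = max M 0" using d(1) by (simp_all add: B_def)
  show ?thesis
  proof (rule hcurve_fixpoint[of U 0 B "\<lambda>z v. \<nu> z - Dm (\<mu> z) v" d])
    show "open U" by (rule hcurve_open[OF h(1)])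
    show "norm (0 :: 'a cf) \<le> B" using B by simp
    show "norm (\<nu> z - Dm (\<mu> z) v) \<le> B" if z: "z \<in> U" "norm v \<le> B" for z v
    proof -
      have "norm (Dm (\<mu> z) v) \<le> d * B"
        using order_trans[OF norm_Dm mult_mono[OF d(2)[OF z(1)] z(2)]] order_trans[OF norm_ge_zero d(2)[OF z(1)]] by simp
      then have "norm (\<nu> z) + norm (Dm (\<mu> z) v) \<le> max M 0 + d * B" using M[OF z(1)] by linarith
      also have "\<dots> = B" using B(2) by (simp add: algebra_simps)
      finally show ?thesis by (rule order_trans[OF norm_triangle_ineq4])
    qed
    show "norm ((\<nu> z - Dm (\<mu> z) v) - (\<nu> z - Dm (\<mu> z) w)) \<le> d * norm (v - w)" if "z \<in> U" for z v w
      using order_trans[OF norm_Dm mult_right_mono[OF d(2)[OF that]], of "w - v"]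
      by (simp add: Dm_diff norm_minus_commute)
    show "hcurve U (\<lambda>z. \<nu> z - Dm (\<mu> z) (\<gamma> z))" if "hcurve U \<gamma>" for \<gamma>
      by (rule hcurve_diff[OF h(2) hcurve_Dm[OF h(1) that]])
    show "norm (pullv (\<mu> z) (\<nu> z)) \<le> B \<and> \<nu> z - Dm (\<mu> z) (pullv (\<mu> z) (\<nu> z)) = pullv (\<mu> z) (\<nu> z)" if z: "z \<in> U" for z
    proof
      have u: "norm (\<mu> z) < 1" using d(2)[OF z] d(1) by simp
      show "\<nu> z - Dm (\<mu> z) (pullv (\<mu> z) (\<nu> z)) = pullv (\<mu> z) (\<nu> z)" by (rule pullv_eq[OF u, symmetric])
      have "norm (\<nu> z) / (1 - norm (\<mu> z)) \<le> max M 0 / (1 - d)"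
        using M[OF z] d(1) d(2)[OF z] by (intro frac_le) auto
      then show "norm (pullv (\<mu> z) (\<nu> z)) \<le> B" unfolding B_def by (rule order_trans[OF norm_pullv[OF u]])
    qed
  qed (rule d(1))
qed

text \<open>The coordinate form of \<open>pullback\<close>: here \<open>X\<close> is given in
  unprimed coordinates of width \<open>\<rho>\<close>, \<open>u\<close> in primed and the result in
  unprimed coordinates of width \<open>r\<close>.\<close>

definition pull :: "real \<Rightarrow> 'd::finite cf \<Rightarrow> 'd cf \<Rightarrow> 'd cf" where
  "pull \<rho> X u = pullv u (compos \<rho> X (em u))"

lemma em_margin: "r + 2 * pi * norm u \<le> \<rho> \<Longrightarrow> r + 2 * pi * norm (em u) \<le> \<rho>"
proof -
  assume "r + 2 * pi * norm u \<le> \<rho>"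
  moreover have "2 * pi * norm (em u) \<le> 2 * pi * norm u" by (rule mult_left_mono[OF norm_em]) simp
  ultimately show ?thesis by linarith
qed

lemma norm_pull:
  assumes "norm u < 1" "r + 2 * pi * norm u \<le> \<rho>"
  shows "norm (pull \<rho> X u) \<le> norm X / (1 - norm u)"
  unfolding pull_def
  by (rule order_trans[OF norm_pullv[OF assms(1)] divide_right_mono[OF norm_comp[OF em_margin[OF assms(2)]]]])
     (use assms in simp)

lemma hcurve_pull:
  assumes h: "hcurve U \<xi>" "hcurve U \<mu>" and d: "d < 1" "\<And>z. z \<in> U \<Longrightarrow> norm (\<mu> z) \<le> d" "r + 2 * pi * d \<le> \<rho>"
  shows "hcurve U (\<lambda>z. pull \<rho> (\<xi> z) (\<mu> z))"
proof -
  have m: "r + 2 * pi * norm (em (\<mu> z)) \<le> \<rho>" if "z \<in> U" for z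
  proof (rule em_margin)
    have "2 * pi * norm (\<mu> z) \<le> 2 * pi * d" using d(2)[OF that] by simp
    then show "r + 2 * pi * norm (\<mu> z) \<le> \<rho>" using d(3) by linarith
  qed
  show ?thesis
    unfolding pull_def compos_def
    by (rule hcurve_pullv[OF h(2) hcurve_mkvec[OF hcurve_comp1[OF hcurve_clin[OF h(1) clin_cmpt] hcurve_clin[OF h(2) clin_em] m]] d(1,2)])
qed

lemma fldA_pull:
  fixes X u :: "'d::finite cf"
  assumes u: "norm u < 1" "r + 2 * pi * norm u \<le> \<rho>"
  shows "pullback r (fldA \<rho> X) (fldA r (em u)) = fldA r (pull \<rho> X u)"
  unfolding pullback_def
proof (rule fldA_eqI[symmetric])
  fix \<theta> :: "complex ^ 'd" and i
  assume th: "\<theta> \<in> strip r"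
  let ?J = "jacobian (fldA r (em u)) (at \<theta>)"
  let ?A = "mat 1 + ?J"
  let ?p = "fldA r (pull \<rho> X u) \<theta>"
  have J: "?J $ i $ j = dfs r j (cmpt i (em u)) \<theta>" for i j
    by (simp add: fldA_jacobian[OF th])
  have Jle: "norm (?J $ i $ j) \<le> norm (cmpt i u)" for i j
    unfolding J fs_dcf[symmetric] using order_trans[OF fs_summable(4)[OF th] norm_dcf] .
  \<comment> \<open>\<open>matrix_inv\<close> is meaningful only for an invertible matrix. The
    Jacobian has operator norm at most \<open>norm u < 1\<close> for the sum norm, so adding the
    identity leaves a trivial kernel.\<close>
  have "x = 0" if "?A *v x = 0" for x
  proof -
    have x: "x $ i = - (\<Sum>j\<in>UNIV. ?J $ i $ j * x $ j)" for i
    proof -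
      have "(?A *v x) $ i = x $ i + (\<Sum>j\<in>UNIV. ?J $ i $ j * x $ j)"
        unfolding matrix_vector_mult_add_rdistrib matrix_vector_mul_lid by (simp add: matrix_vector_mult_def)
      then show ?thesis using that by (simp add: eq_neg_iff_add_eq_0)
    qed
    let ?n = "\<Sum>i\<in>UNIV. norm (x $ i)"
    have "?n \<le> (\<Sum>i\<in>UNIV. \<Sum>j\<in>UNIV. norm (cmpt i u) * norm (x $ j))"
    proof (rule sum_mono)
      fix i
      have "norm (x $ i) = norm (\<Sum>j\<in>UNIV. ?J $ i $ j * x $ j)" by (subst x) simp
      also have "\<dots> \<le> (\<Sum>j\<in>UNIV. norm (cmpt i u) * norm (x $ j))"
        by (rule sum_norm_le) (simp add: norm_mult Jle mult_right_mono)
      finally show "norm (x $ i) \<le> (\<Sum>j\<in>UNIV. norm (cmpt i u) * norm (x $ j))" .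
    qed
    also have "\<dots> = norm u * ?n" unfolding norm_vec_ell1 by (rule sum_product[symmetric])
    finally have "?n * (1 - norm u) \<le> 0" by (simp add: algebra_simps)
    then have "?n \<le> 0" using u(1) by (simp add: mult_le_0_iff)
    then have "?n = 0" by (simp add: sum_nonneg order_antisym)
    then have "norm (x $ i) = 0" for i by (simp add: sum_nonneg_eq_0_iff)
    then show "x = 0" by (simp add: vec_eq_iff)
  qed
  then obtain B where B: "B ** ?A = mat 1" using matrix_left_invertible_ker by blast
  then have "?A ** B = mat 1" by (simp add: matrix_left_right_inverse)
  with B have "\<exists>A'. ?A ** A' = mat 1 \<and> A' ** ?A = mat 1" by blast
  from someI_ex[OF this] have inv: "matrix_inv ?A ** ?A = mat 1" by (simp add: matrix_inv_def)
  have "(?A *v ?p) $ i = fldA \<rho> X (\<theta> + fldA r (em u) \<theta>) $ i" for i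
  proof -
    have "fs r (cmpt i (pull \<rho> X u)) \<theta> + fs r (cmpt i (Dm u (pull \<rho> X u))) \<theta> = fs r (comp1 \<rho> (cmpt i X) (em u)) \<theta>"
    proof -
      have "fs r (cmpt i (pull \<rho> X u)) \<theta> = fs r (cmpt i (compos \<rho> X (em u))) \<theta> - fs r (cmpt i (Dm u (pull \<rho> X u))) \<theta>"
        unfolding pull_def fs_diff[OF th, symmetric] cmpt_simps(2)[symmetric]
        by (rule arg_cong[OF pullv_eq[OF u(1)]])
      then show ?thesis by (simp add: compos_def)
    qed
    moreover have "(?A *v ?p) $ i = ?p $ i + (\<Sum>j\<in>UNIV. ?J $ i $ j * ?p $ j)"
      unfolding matrix_vector_mult_add_rdistrib matrix_vector_mul_lid by (simp add: matrix_vector_mult_def)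
    ultimately show ?thesis
      by (simp add: J fldA_nth[OF th] fs_Dm[OF th] fs_comp1[OF th em_margin[OF u(2)]] fldA_nth[OF strip_comp[OF th em_margin[OF u(2)]]])
  qed
  then have "?A *v ?p = fldA \<rho> X (\<theta> + fldA r (em u) \<theta>)" by (simp add: vec_eq_iff)
  then have "matrix_inv ?A *v fldA \<rho> X (\<theta> + fldA r (em u) \<theta>) = ?p"
    using inv by (metis matrix_vector_mul_assoc matrix_vector_mul_lid)
  then show "fs r (cmpt i (pull \<rho> X u)) \<theta> = (matrix_inv ?A *v fldA \<rho> X (\<theta> + fldA r (em u) \<theta>)) $ i"
    by (simp add: fldA_nth[OF th])
qed

lemma pull_add:
  assumes u: "norm u < 1" "r + 2 * pi * norm u \<le> \<rho>"
  shows "pull \<rho> (X + Y) u = pull \<rho> X u + pull \<rho> Y u"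
proof -
  have c: "compos \<rho> (X + Y) (em u) = compos \<rho> X (em u) + compos \<rho> Y (em u)"
    by (rule cf_eqI)
       (simp add: compos_def fs_add fs_comp1[OF _ em_margin[OF u(2)]] strip_comp[OF _ em_margin[OF u(2)]])
  have D: "Dm u (v + w) = Dm u v + Dm u w" for v w
    by (rule cf_eqI) (simp add: fs_Dm fs_add distrib_left sum.distrib)
  show ?thesis
    unfolding pull_def
  proof (rule pullv_unique[OF u(1)])
    let ?x = "pullv u (compos \<rho> X (em u))" and ?y = "pullv u (compos \<rho> Y (em u))"
    have "?x + ?y = (compos \<rho> X (em u) - Dm u ?x) + (compos \<rho> Y (em u) - Dm u ?y)"
      using pullv_eq[OF u(1)] by metis
    then show "?x + ?y = compos \<rho> (X + Y) (em u) - Dm u (?x + ?y)"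
      unfolding c D by (simp add: algebra_simps)
  qed
qed

lemma comp_cst:
  assumes "r + 2 * pi * norm u \<le> \<rho>"
  shows "compos \<rho> (cst w) (em u) = cst w"
proof (rule cf_eqI)
  fix \<theta> :: "complex ^ 'a" and i
  assume th: "\<theta> \<in> strip r"
  have "fs s (cmpt i (cst w)) t = w $ i" for s t
    by (simp add: cst_def fs_cs fs_sngl wt_def)
  then show "fs r (cmpt i (compos \<rho> (cst w) (em u))) \<theta> = fs r (cmpt i (cst w)) \<theta>"
    by (simp add: compos_def fs_comp1[OF th em_margin[OF assms]])
qed

text \<open>Composition does not change a constant, so the pullback \<open>p\<close> satisfies p = w
  - Du p. Substituting once gives p - w + Du w = Du (Du p), a term of second order in
  \<open>u\<close>.\<close>

lemma pull_cst_estimate: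
  assumes u: "norm u < 1" "r + 2 * pi * norm u \<le> \<rho>"
  shows "norm (pull \<rho> (cst w) u - cst w + Dm u (cst w)) \<le> (norm u)\<^sup>2 * (l1norm w / (1 - norm u))"
proof -
  let ?p = "pull \<rho> (cst w) u"
  have p: "?p = cst w - Dm u ?p"
    using pullv_eq[OF u(1), of "cst w"] by (simp add: pull_def comp_cst[OF u(2)])
  have 1: "Dm u ?p = cst w - ?p" using p by (metis diff_diff_eq2 add_diff_cancel_left')
  have "?p - cst w + Dm u (cst w) = Dm u (cst w) - Dm u ?p" unfolding 1 by simp
  also have "\<dots> = Dm u (cst w - ?p)" by (simp add: Dm_diff)
  also have "\<dots> = Dm u (Dm u ?p)" by (simp only: 1)
  finally have "norm (?p - cst w + Dm u (cst w)) \<le> norm u * (norm u * norm ?p)"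
    using order_trans[OF norm_Dm mult_left_mono[OF norm_Dm norm_ge_zero], of u u ?p] by simp
  also have "\<dots> \<le> norm u * (norm u * (l1norm w / (1 - norm u)))"
    using norm_pull[OF u, of "cst w"] by (intro mult_left_mono) (simp_all add: norm_cst)
  finally show ?thesis by (simp add: power2_eq_square mult.assoc)
qed

text \<open>Applied to a constant field the Jacobian is diagonal in Fourier space, with symbol 2
  \<pi> i k \<cdot> w. For w = \<omega> these are the divisors of the problem.\<close>

lemma ap_Dm_cst:
  "ap (Dm u (cst w)) (k, i) = ap u (k, i) / of_real (wd k) * (2 * of_real pi * \<i> * dotp (vec_of_int k) w)"
proof -
  have "cmpt i (Dm u (cst w)) = (\<Sum>j\<in>UNIV. cs (w $ j) (dcf j i u))"
    by (rule fs_inj) (simp add: Dm_def fs_sum fs_cmul cst_def fs_cs fs_sngl wt_def mult.commute)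
  then have "ap (cmpt i (Dm u (cst w))) k = (\<Sum>j\<in>UNIV. w $ j * ap (dcf j i u) k)"
    by (simp add: ap_sum)
  then show ?thesis
    by (simp add: ap_dcf dotp_def vec_of_int_def sum_distrib_left sum_divide_distrib mult_ac)
qed

lemma pull_0: "r \<le> \<rho> \<Longrightarrow> pull \<rho> (cst w) 0 = cst w"
proof -
  assume "r \<le> \<rho>"
  moreover have "Dm 0 (cst w) = 0" using norm_Dm[of 0 "cst w"] by simp
  ultimately show ?thesis using pull_cst_estimate[of 0 \<rho> w] by simp
qed

end

lemma dotp_le_l1norm: "\<bar>dotp x y\<bar> \<le> l1norm x * l1norm y" for x y :: "real ^ 'd::finite"
proof -
  have "\<bar>dotp x y\<bar> \<le> (\<Sum>i\<in>UNIV. \<bar>x $ i\<bar> * l1norm y)"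
    unfolding dotp_def
  proof (rule order_trans[OF sum_abs sum_mono])
    fix i
    have "\<bar>y $ i\<bar> \<le> l1norm y" unfolding l1norm_def real_norm_def by (rule member_le_sum) auto
    then show "\<bar>x $ i * y $ i\<bar> \<le> \<bar>x $ i\<bar> * l1norm y" by (simp add: abs_mult mult_left_mono)
  qed
  then show ?thesis by (simp add: l1norm_def sum_distrib_right)
qed

lemma prj_em: "prj S (em x) = em (prj S x)"
  by (rule ell1_eqI) (simp add: split_paired_all ap_prj ap_em)

lemma prj_prj: "prj S (prj S x) = prj S x"
  by (rule ell1_eqI) (simp add: split_paired_all ap_prj)

lemma prj_simps: "prj S (x + y) = prj S x + prj S y" "prj S (x - y) = prj S x - prj S y" "prj S (cs c x) = cs c (prj S x)" "prj S 0 = 0"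
  by (rule clin_add[OF clin_prj] clin_diff[OF clin_prj] clin_cs[OF clin_prj] clin_0[OF clin_prj])+

section \<open>The elimination of far modes\<close>

text \<open>\<open>\<iota>\<close> identifies the subspace \<open>A\<close> of \<open>\<ell>\<^sup>1\<close> isometrically with \<open>(V, N)\<close>.\<close>

definition repr :: "'j ell1 set \<Rightarrow> ('j ell1 \<Rightarrow> 'd::finite vfield) \<Rightarrow> 'd vfield set \<Rightarrow> ('d vfield \<Rightarrow> real) \<Rightarrow> bool" where
  "repr A \<iota> V N \<longleftrightarrow> V = \<iota> ` A \<and> inj \<iota> \<and> (\<forall>x y. \<iota> (x + y) = \<iota> x + \<iota> y) \<and> (\<forall>c x. \<iota> (cs c x) = fscale c (\<iota> x)) \<and>
     (\<forall>x. N (\<iota> x) = norm x) \<and> (\<forall>x\<in>A. \<forall>y\<in>A. x + y \<in> A) \<and> (\<forall>c. \<forall>x\<in>A. cs c x \<in> A)"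

lemma reprD:
  assumes "repr A \<iota> V N"
  shows "V = \<iota> ` A" "\<iota> x = \<iota> y \<longleftrightarrow> x = y" "\<iota> (x + y) = \<iota> x + \<iota> y" "\<iota> (cs c x) = fscale c (\<iota> x)"
    "N (\<iota> x) = norm x" "x \<in> A \<Longrightarrow> y \<in> A \<Longrightarrow> x + y \<in> A" "x \<in> A \<Longrightarrow> cs c x \<in> A"
  using assms by (simp_all add: repr_def inj_eq)

lemma repr_diff:
  assumes "repr A \<iota> V N"
  shows "\<iota> (x - y) = \<iota> x - \<iota> y" "\<iota> 0 = 0" "\<iota> (- x) = - \<iota> x" "x \<in> A \<Longrightarrow> y \<in> A \<Longrightarrow> x - y \<in> A"
    "\<iota> x \<in> V \<longleftrightarrow> x \<in> A"
proof -
  note d = reprD[OF assms]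
  show d1: "\<iota> (x - y) = \<iota> x - \<iota> y" for x y using d(3)[of "x - y" y] by simp
  show d2: "\<iota> 0 = 0" using d1[of 0 0] by simp
  show "\<iota> (- x) = - \<iota> x" using d1[of 0 x] d2 by simp
  show "x - y \<in> A" if "x \<in> A" "y \<in> A" using d(6)[OF that(1) d(7)[OF that(2), of "-1"]] by simp
  show "\<iota> x \<in> V \<longleftrightarrow> x \<in> A" using d(2) by (auto simp: d(1))
qed

text \<open>Transfers derivatives from \<ell>1 to vector fields. A quadratic remainder is assumed
  because that is what \<open>hmap_frechet\<close> yields; the carriers may be proper subspaces so
  that fields without resonant modes are covered.\<close>

lemma repr_cderivative:
  assumes V: "repr A \<iota> V N" and W: "repr B \<kappa> W M"
    and L: "clin L" "\<And>x. x \<in> A \<Longrightarrow> L x \<in> B" and x0: "x0 \<in> A" and s: "s > 0"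
    and G: "\<And>h. h \<in> A \<Longrightarrow> norm h < s \<Longrightarrow> G (\<iota> (x0 + h)) = \<kappa> (H (x0 + h)) \<and> H (x0 + h) \<in> B"
    and q: "\<And>h. h \<in> A \<Longrightarrow> norm h < s \<Longrightarrow> norm (H (x0 + h) - H x0 - L h) \<le> C * (norm h)\<^sup>2"
  shows "has_cderivative V N W M G (\<lambda>f. \<kappa> (L (inv \<iota> f))) (\<iota> x0)"
proof -
  note v = reprD[OF V] repr_diff[OF V] and w = reprD[OF W] repr_diff[OF W]
  have inv: "inv \<iota> (\<iota> x) = x" for x using V by (simp add: repr_def)
  have A0: "0 \<in> A" using v(7)[OF x0, of 0] by simp
  obtain K where K: "K > 0" "\<And>x. norm (L x) \<le> K * norm x"
    using clin_bound[OF L(1)] by blast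
  show ?thesis
    unfolding has_cderivative_def bounded_clinear_on_def
  proof (intro conjI ballI allI impI)
    show "\<kappa> (L (inv \<iota> f)) \<in> W" if "f \<in> V" for f using that L(2) by (auto simp: v(1) w(1) inv)
    show "\<kappa> (L (inv \<iota> (f + g))) = \<kappa> (L (inv \<iota> f)) + \<kappa> (L (inv \<iota> g))" if fg: "f \<in> V" "g \<in> V" for f g
    proof -
      obtain x y where "f = \<iota> x" "g = \<iota> y" using fg by (auto simp: v(1))
      then show ?thesis by (simp add: v(3)[symmetric] inv clin_add[OF L(1)] w(3))
    qed
    show "\<kappa> (L (inv \<iota> (fscale c f))) = fscale c (\<kappa> (L (inv \<iota> f)))" if f: "f \<in> V" for f c
    proof -
      obtain x where "f = \<iota> x" using f by (auto simp: v(1))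
      then show ?thesis by (simp add: v(4)[symmetric] inv clin_cs[OF L(1)] w(4))
    qed
    show "\<exists>C. \<forall>f\<in>V. M (\<kappa> (L (inv \<iota> f))) \<le> C * N f"
      by (rule exI[of _ K]) (auto simp: v(1) v(5) w(5) inv K(2))
    fix e :: real assume e: "e > 0"
    define d where "d = min s (e / (\<bar>C\<bar> + 1))"
    show "\<exists>\<delta>>0. \<forall>h\<in>V. N h < \<delta> \<longrightarrow> G (\<iota> x0 + h) \<in> W \<and> M (G (\<iota> x0 + h) - G (\<iota> x0) - \<kappa> (L (inv \<iota> h))) \<le> e * N h"
    proof (intro exI[of _ d] conjI ballI impI)
      show "d > 0" using s e by (simp add: d_def)
      fix f assume f: "f \<in> V" "N f < d"
      then obtain h where h: "h \<in> A" "f = \<iota> h" by (auto simp: v(1))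
      have nh: "norm h < s" "norm h < e / (\<bar>C\<bar> + 1)" using f(2) by (simp_all add: h v(5) d_def)
      have g: "G (\<iota> x0 + f) = \<kappa> (H (x0 + h))" "H (x0 + h) \<in> B"
        using G[OF h(1) nh(1)] by (simp_all only: h(2) v(3) simp_thms)
      have g0: "G (\<iota> x0) = \<kappa> (H x0)" using G[OF A0] s by simp
      show "G (\<iota> x0 + f) \<in> W" using g by (simp add: w(1))
      have "G (\<iota> x0 + f) - G (\<iota> x0) - \<kappa> (L (inv \<iota> f)) = \<kappa> (H (x0 + h) - H x0 - L h)"
        unfolding g0 h(2) inv w(8) g(1)[unfolded h(2)] ..
      then have "M (G (\<iota> x0 + f) - G (\<iota> x0) - \<kappa> (L (inv \<iota> f))) \<le> C * (norm h)\<^sup>2"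
        using q[OF h(1) nh(1)] by (simp add: w(5))
      also have "\<dots> \<le> \<bar>C\<bar> * (norm h)\<^sup>2" by (rule mult_right_mono) auto
      also have "\<dots> \<le> (\<bar>C\<bar> * norm h) * norm h" by (simp add: power2_eq_square mult.assoc)
      also have "\<dots> \<le> e * norm h"
      proof (rule mult_right_mono)
        have "norm h * (\<bar>C\<bar> + 1) < e" using nh(2) by (simp add: pos_less_divide_eq add_nonneg_pos)
        then show "\<bar>C\<bar> * norm h \<le> e" using norm_ge_zero[of h] by (simp add: algebra_simps del: norm_ge_zero)
      qed simp
      finally show "M (G (\<iota> x0 + f) - G (\<iota> x0) - \<kappa> (L (inv \<iota> f))) \<le> e * N f" by (simp add: h v(5))
    qed
  qed
qed

lemma repr_spaceA: "s > 0 \<Longrightarrow> repr UNIV (fldA s) (spaceA s) (normA s)"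
  unfolding repr_def
  using spaceA_fldA fldA_spaceA by (auto simp: fldA_add fldA_cs normA_fldA inj_def fldA_inj) blast

lemma repr_spaceA': "s > 0 \<Longrightarrow> repr UNIV (\<lambda>x. fldA s (em x)) (spaceA' s) (normA' s)"
  unfolding repr_def
  using spaceA'_fldA fldA_spaceA'
  by (auto simp: fldA_add fldA_cs clin_add[OF clin_em] clin_cs[OF clin_em] normA'_fldA inj_def fldA_inj em_inj) blast

text \<open>The bound \<open>sw\<close> will follow from \<omega>' \<cdot> \<omega> = 1 and the
  bound on \<sigma>. It converts smallness relative to \<sigma> into smallness of
  \<open>\<delta>\<close> itself.\<close>

locale resonance =
  fixes \<omega> :: "real ^ 'd::finite" and \<sigma> \<rho> \<rho>' :: real
  assumes rho': "0 < \<rho>'" and rho: "\<rho>' < \<rho>" and sig: "0 < \<sigma>" and sw: "\<sigma> < l1norm \<omega> / 2"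
begin

abbreviation "\<delta> \<equiv> delta_hat \<omega> \<sigma> \<rho> \<rho>'"
abbreviation "FM \<equiv> far_modes \<omega> \<sigma>"
abbreviation "w \<equiv> cst (vec_of_real \<omega>)"
text \<open>A radius on which the contraction estimates close. The constant 50 makes the shift at
  \<open>u = 0\<close> at most \<open>\<delta> / 10\<close> and keeps the Lipschitz constant of
  \<open>H\<close> below \<open>3 / 7 * \<sigma>\<close>; it stays below \<open>eps_hat\<close>
  because (sqrt 6 - 2) / 12 > 1 / 50.\<close>

definition "e0 = \<sigma> * \<delta> / 50"

lemma norm_w: "norm w = l1norm \<omega>"
  by (simp add: norm_cst l1norm_def vec_of_real_def)

lemma wpos: "l1norm \<omega> > 0"
  using sig sw by simp

lemma sqrt6: "2.449 < sqrt 6" "sqrt 6 < 2.45"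
proof -
  show "2.449 < sqrt 6" by (rule real_less_rsqrt) (simp add: power2_eq_square)
  show "sqrt 6 < 2.45" by (rule real_less_lsqrt) (simp_all add: power2_eq_square)
qed

text \<open>The number 0.092 bounds (3 - sqrt 6) / 6 from above, and 0.046 is half of it because
  \<sigma> < |\<omega>| / 2. The last claim allows displacements up to \<open>2 * \<delta>\<close>,
  so that Cauchy estimates on the ball of radius \<open>\<delta>\<close> have a margin
  \<open>\<delta>\<close>.\<close>

lemma delta: "\<delta> > 0" "\<delta> \<le> 0.046" "\<delta> * l1norm \<omega> \<le> 0.092 * \<sigma>" "\<rho>' + 2 * pi * (2 * \<delta>) \<le> \<rho>"
proof -
  show "\<delta> > 0" using rho sig wpos sqrt6 by (simp add: delta_hat_def)
  have "\<delta> * l1norm \<omega> \<le> ((3 - sqrt 6) / 6 * (\<sigma> / l1norm \<omega>)) * l1norm \<omega>"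
    using wpos by (intro mult_right_mono) (simp_all add: delta_hat_def)
  also have "\<dots> = (3 - sqrt 6) / 6 * \<sigma>" using wpos by simp
  also have "\<dots> \<le> 0.092 * \<sigma>" using sqrt6 sig by (intro mult_right_mono) simp_all
  finally show 1: "\<delta> * l1norm \<omega> \<le> 0.092 * \<sigma>" .
  then have "\<delta> * l1norm \<omega> \<le> 0.046 * l1norm \<omega>" using sw by simp
  then show "\<delta> \<le> 0.046" using wpos by simp
  have "\<delta> \<le> (\<rho> - \<rho>') / (4 * pi)" by (simp add: delta_hat_def)
  then have "\<delta> * (4 * pi) \<le> \<rho> - \<rho>'" by (simp add: pos_le_divide_eq)
  then show "\<rho>' + 2 * pi * (2 * \<delta>) \<le> \<rho>" by (simp add: algebra_simps)
qed

lemma e0: "e0 > 0" "e0 \<le> eps_hat \<omega> \<sigma> \<rho> \<rho>'"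
proof -
  show "e0 > 0" using sig delta(1) by (simp add: e0_def)
  have "(1 / 50) * (\<sigma> * \<delta>) \<le> (sqrt 6 - 2) / 12 * (\<sigma> * \<delta>)"
    using sqrt6 sig delta(1) by (intro mult_right_mono) simp_all
  then show "e0 \<le> eps_hat \<omega> \<sigma> \<rho> \<rho>'" by (simp add: e0_def eps_hat_def mult.assoc)
qed

lemma far_dotp: "dotp (vec_of_int k) (vec_of_real \<omega>) = complex_of_real (dotp \<omega> (vec_of_int k))"
  by (simp add: dotp_def vec_of_int_def vec_of_real_def mult.commute)

text \<open>\<open>K\<close> inverts \<open>u \<mapsto> Du \<cdot> \<omega>\<close> on the far modes.\<close>

definition km :: "(int ^ 'd) \<times> 'd \<Rightarrow> complex" where
  "km p = (if fst p \<in> FM then of_real (wd (fst p)) / (2 * of_real pi * \<i> * dotp (vec_of_int (fst p)) (vec_of_real \<omega>)) else 0)"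

lemma far_nz: "k \<in> FM \<Longrightarrow> dotp \<omega> (vec_of_int k) \<noteq> 0" "k \<in> FM \<Longrightarrow> k \<noteq> 0"
proof -
  have *: "0 \<le> \<sigma> * zlen k" using sig by simp
  show "k \<in> FM \<Longrightarrow> dotp \<omega> (vec_of_int k) \<noteq> 0" using * by (auto simp: far_modes_def)
  show "k \<in> FM \<Longrightarrow> k \<noteq> 0" by (auto simp: far_modes_def dotp_def vec_of_int_def)
qed

text \<open>On far modes the divisor is at least \<sigma> |k|, so with x = 2 \<pi> |k| \<ge> 6 the
  multiplier is at most (1 + x) / (x \<sigma>), and (1 + x) / x \<le> 7 / 6.\<close>

lemma norm_km: "norm (km p) \<le> 7 / (6 * \<sigma>)"
proof (cases "fst p \<in> FM")
  case True
  let ?z = "zlen (fst p)"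
  have z: "1 \<le> ?z" using zlen_ge_1[OF far_nz(2)[OF True]] .
  have f: "\<sigma> * ?z \<le> \<bar>dotp \<omega> (vec_of_int (fst p))\<bar>" using True by (simp add: far_modes_def)
  have "norm (km p) = wd (fst p) / (2 * pi * \<bar>dotp \<omega> (vec_of_int (fst p))\<bar>)"
    using True by (simp add: km_def far_dotp norm_divide norm_mult)
  also have "\<dots> \<le> wd (fst p) / (2 * pi * (\<sigma> * ?z))"
    using sig z f far_nz(1)[OF True] by (intro divide_left_mono mult_left_mono mult_pos_pos) (auto simp: mult_le_0_iff)
  also have "\<dots> \<le> 7 / (6 * \<sigma>)"
  proof -
    have "6 \<le> 2 * pi * ?z" using mult_mono[of 6 "2 * pi" 1 ?z] pi_gt3 z by simp
    moreover have "6 * (1 + y) \<le> 7 * y" if "6 \<le> y" for y :: real using that by simp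
    ultimately have "6 * wd (fst p) \<le> 7 * (2 * pi * ?z)" unfolding wd_def by blast
    then have "6 * wd (fst p) * \<sigma> \<le> 7 * (2 * pi * ?z) * \<sigma>" using sig by (intro mult_right_mono) auto
    then show ?thesis using sig z by (simp add: divide_simps mult_ac)
  qed
  finally show ?thesis .
qed (use sig in \<open>simp add: km_def\<close>)

definition "K = diagop km"

lemma K: "ap (K x) p = km p * ap x p" "norm (K x) \<le> 7 / (6 * \<sigma>) * norm x" "clin K"
  unfolding K_def by (rule diagop[OF norm_km])+

lemma K_Dm: "K (Dm \<rho>' u w) = prj FM u"
proof (rule ell1_eqI, simp only: split_paired_all)
  fix k i
  show "ap (K (Dm \<rho>' u w)) (k, i) = ap (prj FM u) (k, i)"
    using far_nz(1)[of k] by (simp add: K(1) km_def ap_Dm_cst[OF rho'] ap_prj far_dotp)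
qed

lemma K_eqD: "K x = K y \<Longrightarrow> prj FM x = prj FM y"
proof (rule ell1_eqI, simp only: split_paired_all)
  fix k i assume "K x = K y"
  from arg_cong[OF this, of "\<lambda>v. ap v (k, i)"] have "km (k, i) * ap x (k, i) = km (k, i) * ap y (k, i)"
    by (simp add: K(1))
  moreover have "km (k, i) \<noteq> 0" if "k \<in> FM" using far_nz(1)[OF that] that by (simp add: km_def far_dotp)
  ultimately show "ap (prj FM x) (k, i) = ap (prj FM y) (k, i)" by (auto simp: ap_prj)
qed

lemma K_prj: "K (prj FM x) = K x" "prj FM (K x) = K x"
  by (rule ell1_eqI, simp add: split_paired_all K(1) ap_prj km_def)+

lemma K_w: "K w = 0"
  by (rule ell1_eqI) (auto simp: split_paired_all K(1) ap_cst km_def dest: far_nz(2))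

definition P :: "'d cf \<Rightarrow> 'd cf \<Rightarrow> 'd cf" where
  "P X u = pull \<rho>' \<rho> (em X) u"

lemma small: "norm u \<le> 2 * \<delta> \<Longrightarrow> norm u < 1" "norm u \<le> 2 * \<delta> \<Longrightarrow> \<rho>' + 2 * pi * norm u \<le> \<rho>"
proof -
  assume u: "norm u \<le> 2 * \<delta>"
  then show "norm u < 1" using delta(2) by simp
  have "2 * pi * norm u \<le> 2 * pi * (2 * \<delta>)" using u by (rule mult_left_mono) simp
  then show "\<rho>' + 2 * pi * norm u \<le> \<rho>" using delta(4) by linarith
qed

lemma P_add: "norm u \<le> 2 * \<delta> \<Longrightarrow> P (X + Y) u = P X u + P Y u"
  unfolding P_def clin_add[OF clin_em] by (rule pull_add[OF rho' small])

lemma norm_P: "norm u \<le> 2 * \<delta> \<Longrightarrow> norm (P X u) \<le> norm X / (1 - norm u)"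
  unfolding P_def
  by (rule order_trans[OF norm_pull[OF rho' small] divide_right_mono[OF norm_em]]) (use small in \<open>auto intro: less_imp_le\<close>)

lemma P_w: "norm u \<le> 2 * \<delta> \<Longrightarrow> norm (P w u - w + Dm \<rho>' u w) \<le> (norm u)\<^sup>2 * (l1norm \<omega> / (1 - norm u))"
proof -
  assume u: "norm u \<le> 2 * \<delta>"
  have "l1norm (vec_of_real \<omega>) = l1norm \<omega>" using norm_w by (simp add: norm_cst)
  then show ?thesis using pull_cst_estimate[OF rho' small[OF u], of "vec_of_real \<omega>"] by (simp add: P_def em_cst)
qed

lemma P_cst_0: "P (cst v) 0 = cst v"
  unfolding P_def em_cst by (rule pull_0[OF rho']) (use rho in simp)

lemma hcurve_P:
  assumes "hcurve U \<xi>" "hcurve U \<mu>" "\<And>z. z \<in> U \<Longrightarrow> norm (\<mu> z) \<le> 2 * \<delta>"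
  shows "hcurve U (\<lambda>z. P (\<xi> z) (\<mu> z))"
  unfolding P_def
  by (rule hcurve_pull[OF rho' hcurve_clin[OF assms(1) clin_em] assms(2), of "2 * \<delta>"]) (use delta assms(3) in auto)

text \<open>The remainder of the pullback after its affine part \<open>w - Dm \<rho>' u w\<close>.
  It is quadratic in \<open>u\<close> when \<open>X = w\<close>, and on far modes the linear term is
  what \<open>K\<close> inverts.\<close>

definition H :: "'d cf \<Rightarrow> 'd cf \<Rightarrow> 'd cf" where
  "H X u = P X u + Dm \<rho>' u w - w"

lemma H_bound:
  assumes u: "norm u \<le> 2 * \<delta>"
  shows "norm (H X u) \<le> ((norm u)\<^sup>2 * l1norm \<omega> + norm (X - w)) / (1 - norm u)"
proof -
  have "H X u = (P w u - w + Dm \<rho>' u w) + P (X - w) u"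
    using P_add[OF u, of w "X - w"] by (simp add: H_def)
  then have "norm (H X u) \<le> norm (P w u - w + Dm \<rho>' u w) + norm (P (X - w) u)"
    by (metis norm_triangle_ineq)
  also have "\<dots> \<le> (norm u)\<^sup>2 * (l1norm \<omega> / (1 - norm u)) + norm (X - w) / (1 - norm u)"
    by (rule add_mono[OF P_w[OF u] norm_P[OF u]])
  finally show ?thesis by (simp add: add_divide_distrib)
qed

lemma Dm_hcurve: "hcurve U \<mu> \<Longrightarrow> hcurve U (\<lambda>z. Dm \<rho>' (\<mu> z) w)"
  by (rule hcurve_Dm[OF rho']) (auto intro: hcurve_const hcurve_open)

lemma hcurve_H:
  assumes "hcurve U \<xi>" "hcurve U \<mu>" "\<And>z. z \<in> U \<Longrightarrow> norm (\<mu> z) \<le> 2 * \<delta>"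
  shows "hcurve U (\<lambda>z. H (\<xi> z) (\<mu> z))"
  unfolding H_def
  by (intro hcurve_diff hcurve_add hcurve_P Dm_hcurve hcurve_const assms) (auto intro: hcurve_open assms)

lemma H_lipschitz:
  assumes X: "norm (X - w) \<le> e0" and u: "norm u < \<delta>" "norm v < \<delta>"
  shows "norm (H X u - H X v) \<le> 3 / 7 * \<sigma> * norm (u - v)"
proof -
  let ?M = "((2 * \<delta>)\<^sup>2 * l1norm \<omega> + e0) / (1 - 2 * \<delta>)"
  have "norm (H X u - H X v) \<le> ?M / \<delta> * norm (u - v)"
  proof (rule hmap_lipschitz[where S = "ball 0 (2 * \<delta>)"])
    show "hcurve U (\<lambda>z. H X (\<gamma> z))" if "hcurve U \<gamma>" "\<gamma> ` U \<subseteq> ball 0 (2 * \<delta>)" for U \<gamma>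
      by (rule hcurve_H[OF hcurve_const[OF hcurve_open[OF that(1)]] that(1)]) (use that(2) in \<open>auto simp: image_subset_iff less_imp_le\<close>)
    show "norm (H X y) \<le> ?M" if "y \<in> ball 0 (2 * \<delta>)" for y
    proof -
      have y: "norm y \<le> 2 * \<delta>" using that by simp
      have "((norm y)\<^sup>2 * l1norm \<omega> + norm (X - w)) / (1 - norm y) \<le> ?M"
        using y X delta(1,2) wpos e0(1)
        by (intro frac_le add_mono mult_right_mono power_mono add_nonneg_nonneg mult_nonneg_nonneg) auto
      with H_bound[OF y] show ?thesis by (rule order_trans)
    qed
    show "\<delta> > 0" by (rule delta)
    show "ball p \<delta> \<subseteq> ball 0 (2 * \<delta>)" if "p \<in> closed_segment v u" for p
    proof -
      have "closed_segment v u \<subseteq> ball 0 \<delta>" by (rule closed_segment_subset) (use u in auto)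
      then have "norm p < \<delta>" using that by auto
      show ?thesis
      proof
        fix x assume "x \<in> ball p \<delta>"
        then show "x \<in> ball 0 (2 * \<delta>)" using \<open>norm p < \<delta>\<close> dist_triangle[of 0 x p] by simp
      qed
    qed
  qed
  also have "\<dots> \<le> 3 / 7 * \<sigma> * norm (u - v)"
  proof (rule mult_right_mono)
    \<comment> \<open>Numerically 4 * 0.092 + 0.02 = 0.388, just below 3 / 7 * 0.908. Together with
      the norm \<open>7 / (6 * \<sigma>)\<close> of \<open>K\<close> the constant
      \<open>3 / 7 * \<sigma>\<close> produces the contraction rate 1 / 2.\<close>
    have "4 * a + s / 50 \<le> 3 / 7 * s * (1 - 2 * 0.046)" if "a \<le> 0.092 * s" "0 < s" for a s :: real
      using that by simp
    from this[OF delta(3) sig]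
    have "(4 * (\<delta> * l1norm \<omega>) + \<sigma> / 50) \<le> 3 / 7 * \<sigma> * (1 - 2 * 0.046)" .
    also have "\<dots> \<le> 3 / 7 * \<sigma> * (1 - 2 * \<delta>)" using delta(2) sig by (intro mult_left_mono) auto
    finally have 1: "(4 * (\<delta> * l1norm \<omega>) + \<sigma> / 50) / (1 - 2 * \<delta>) \<le> 3 / 7 * \<sigma>"
      using delta(2) by (simp add: pos_divide_le_eq)
    have "(2 * \<delta>)\<^sup>2 * l1norm \<omega> + e0 = \<delta> * (4 * (\<delta> * l1norm \<omega>) + \<sigma> / 50)"
      by (simp add: e0_def power2_eq_square algebra_simps)
    then show "?M / \<delta> \<le> 3 / 7 * \<sigma>" using 1 delta(1) by simp
  qed simp
  finally show ?thesis .
qed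

text \<open>Fixed points of \<open>\<Psi> X t\<close> solve \<open>F(u) = (1 - t) F(0)\<close>, which is the integrated homotopy equation.\<close>

definition \<Psi> :: "'d cf \<Rightarrow> complex \<Rightarrow> 'd cf \<Rightarrow> 'd cf" where
  "\<Psi> X t u = K (H X u) - cs (1 - t) (K (P X 0))"

lemma Psi_lipschitz:
  assumes X: "norm (X - w) \<le> e0" and u: "norm u < \<delta>" "norm v < \<delta>"
  shows "norm (\<Psi> X t u - \<Psi> X t v) \<le> 1 / 2 * norm (u - v)"
proof -
  have "norm (\<Psi> X t u - \<Psi> X t v) = norm (K (H X u - H X v))"
    by (simp add: \<Psi>_def clin_diff[OF K(3)])
  also have "\<dots> \<le> 7 / (6 * \<sigma>) * (3 / 7 * \<sigma> * norm (u - v))"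
    using sig by (intro order_trans[OF K(2)] mult_left_mono H_lipschitz assms) auto
  finally show ?thesis using sig by simp
qed

lemma K_P0: "norm (K (P X 0)) \<le> 7 / (6 * \<sigma>) * norm (X - w)"
proof -
  have 0: "norm (0 :: 'd cf) \<le> 2 * \<delta>" using delta(1) by simp
  have "P X 0 = w + P (X - w) 0" using P_add[OF 0, of w "X - w"] by (simp add: P_cst_0)
  then have "K (P X 0) = K (P (X - w) 0)" by (simp add: clin_add[OF K(3)] K_w)
  then show ?thesis
    using order_trans[OF K(2) mult_left_mono[OF norm_P[OF 0], of "7 / (6 * \<sigma>)"]] sig by simp
qed

text \<open>The parameter ranges over a complex disc of radius 2, not just over [0,1], so that the
  solution is holomorphic near every point of the interval. Then |1 - t| \<le> 3, and (1 + 3) * 7 /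
  6 \<le> 5.\<close>

lemma Psi_0:
  assumes t: "norm t \<le> 2"
  shows "norm (\<Psi> X t 0) \<le> 5 / \<sigma> * norm (X - w)"
proof -
  have 0: "norm (0 :: 'd cf) \<le> 2 * \<delta>" using delta(1) by simp
  have "norm (1 - t) \<le> 3" using norm_triangle_ineq4[of 1 t] t by simp
  then have "norm (cs (1 - t) (K (P X 0))) \<le> 3 * (7 / (6 * \<sigma>) * norm (X - w))"
    unfolding norm_cs by (intro mult_mono K_P0) auto
  moreover have "norm (K (H X 0)) \<le> 7 / (6 * \<sigma>) * norm (X - w)"
    using order_trans[OF K(2) mult_left_mono[OF H_bound[OF 0, of X], of "7 / (6 * \<sigma>)"]] sig by simp
  ultimately have "norm (\<Psi> X t 0) \<le> 4 * (7 / (6 * \<sigma>) * norm (X - w))"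
    unfolding \<Psi>_def using norm_triangle_ineq4[of "K (H X 0)" "cs (1 - t) (K (P X 0))"] by linarith
  also have "\<dots> = (14 / 3) * (norm (X - w) / \<sigma>)" by simp
  also have "\<dots> \<le> 5 * (norm (X - w) / \<sigma>)" using sig by (intro mult_right_mono) auto
  finally show ?thesis by simp
qed

lemma Psi_ball:
  assumes X: "norm (X - w) \<le> e0" and t: "norm t \<le> 2" and u: "norm u \<le> \<delta> / 2"
  shows "norm (\<Psi> X t u) \<le> \<delta> / 2"
proof -
  have "norm (\<Psi> X t u) \<le> norm (\<Psi> X t u - \<Psi> X t 0) + norm (\<Psi> X t 0)"
    using norm_triangle_ineq[of "\<Psi> X t u - \<Psi> X t 0" "\<Psi> X t 0"] by simp
  also have "norm (\<Psi> X t u - \<Psi> X t 0) \<le> 1 / 2 * norm (u - 0)"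
    by (rule Psi_lipschitz[OF X]) (use u delta(1) in auto)
  also have "norm (\<Psi> X t 0) \<le> 5 / \<sigma> * e0"
    using sig by (intro order_trans[OF Psi_0[OF t]] mult_left_mono X) auto
  also have "5 / \<sigma> * e0 = \<delta> / 10" using sig by (simp add: e0_def)
  finally show ?thesis using u delta(1) by simp
qed

definition sol :: "'d cf \<Rightarrow> complex \<Rightarrow> 'd cf" where
  "sol X t = (THE u. norm u < \<delta> \<and> \<Psi> X t u = u)"

lemma Psi_unique:
  assumes X: "norm (X - w) \<le> e0" and u: "norm u < \<delta>" "\<Psi> X t u = u" and v: "norm v < \<delta>" "\<Psi> X t v = v"
  shows "u = v"
proof -
  have "norm (u - v) \<le> 1 / 2 * norm (u - v)" using Psi_lipschitz[OF X u(1) v(1), of t] u(2) v(2) by simp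
  then show ?thesis by simp
qed

text \<open>Existence takes place in the ball of radius \<open>\<delta> / 2\<close>, which
  \<open>Psi_ball\<close> shows to be invariant. Uniqueness is stated on the larger ball of radius
  \<open>\<delta>\<close>, because that is the only bound a \<open>homotopy_solution\<close>
  provides.\<close>

lemma sol:
  assumes X: "norm (X - w) \<le> e0" and t: "norm t \<le> 2"
  shows "norm (sol X t) \<le> \<delta> / 2" "\<Psi> X t (sol X t) = sol X t"
    "norm v < \<delta> \<Longrightarrow> \<Psi> X t v = v \<Longrightarrow> v = sol X t"
    "norm (sol X t) \<le> 10 / \<sigma> * norm (X - w)"
proof -
  obtain u where u: "norm u \<le> \<delta> / 2" "\<Psi> X t u = u"
  proof (rule contraction_fixpoint[of "cball 0 (\<delta> / 2)" 0 "\<Psi> X t" "1 / 2"])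
    show "norm (\<Psi> X t x - \<Psi> X t y) \<le> 1 / 2 * norm (x - y)" if "x \<in> cball 0 (\<delta> / 2)" "y \<in> cball 0 (\<delta> / 2)" for x y
      by (rule Psi_lipschitz[OF X]) (use that delta(1) in auto)
    fix x assume "x \<in> cball 0 (\<delta> / 2)" "\<Psi> X t x = x"
    then show thesis by (intro that[of x]) simp_all
  qed (use Psi_ball[OF X t] delta(1) in auto)
  have ud: "norm u < \<delta>" using u(1) delta(1) by simp
  have s: "sol X t = u"
    unfolding sol_def
  proof (rule the_equality)
    show "norm u < \<delta> \<and> \<Psi> X t u = u" using ud u(2) by simp
    show "v = u" if "norm v < \<delta> \<and> \<Psi> X t v = v" for v using Psi_unique[OF X _ _ ud u(2)] that by blast
  qed
  show "norm (sol X t) \<le> \<delta> / 2" "\<Psi> X t (sol X t) = sol X t" using u by (simp_all add: s)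
  show "v = sol X t" if "norm v < \<delta>" "\<Psi> X t v = v" unfolding s by (rule Psi_unique[OF X that ud u(2)])
  have "norm u \<le> norm (\<Psi> X t u - \<Psi> X t 0) + norm (\<Psi> X t 0)"
    using norm_triangle_ineq[of "\<Psi> X t u - \<Psi> X t 0" "\<Psi> X t 0"] u(2) by simp
  also have "norm (\<Psi> X t u - \<Psi> X t 0) \<le> 1 / 2 * norm (u - 0)"
    by (rule Psi_lipschitz[OF X ud]) (use delta(1) in auto)
  finally have "norm u \<le> 2 * norm (\<Psi> X t 0)" by simp
  then show "norm (sol X t) \<le> 10 / \<sigma> * norm (X - w)" using Psi_0[OF t, of X] by (simp add: s)
qed

text \<open>By \<open>K_Dm\<close> and \<open>K_w\<close>, \<open>\<Psi> X t u\<close> is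
  \<open>prj FM u\<close> plus \<open>K\<close> of the difference between the pullback at
  \<open>u\<close> and \<open>1 - t\<close> times the one at 0. The range of \<open>K\<close>
  consists of far modes and \<open>K\<close> is injective on them, so a fixed point is a far field
  with the stated pullback.\<close>

lemma Psi_fixed_iff:
  assumes u: "norm u \<le> 2 * \<delta>"
  shows "\<Psi> X t u = u \<longleftrightarrow> prj FM u = u \<and> prj FM (P X u) = cs (1 - t) (prj FM (P X 0))"
proof -
  have e: "\<Psi> X t u = K (P X u) - cs (1 - t) (K (P X 0)) + prj FM u"
    by (simp add: \<Psi>_def H_def clin_add[OF K(3)] clin_diff[OF K(3)] K_w K_Dm)
  have far: "prj FM (\<Psi> X t u) = \<Psi> X t u" unfolding e by (simp add: prj_simps K_prj prj_prj)
  show ?thesis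
  proof
    assume *: "\<Psi> X t u = u"
    then have pu: "prj FM u = u" using far by simp
    then have "K (P X u) = K (cs (1 - t) (P X 0))" using * e by (simp add: clin_cs[OF K(3)])
    from K_eqD[OF this] pu show "prj FM u = u \<and> prj FM (P X u) = cs (1 - t) (prj FM (P X 0))"
      by (simp add: prj_simps)
  next
    assume *: "prj FM u = u \<and> prj FM (P X u) = cs (1 - t) (prj FM (P X 0))"
    then have "K (P X u) = cs (1 - t) (K (P X 0))"
      by (metis K_prj(1) clin_cs[OF K(3)])
    then show "\<Psi> X t u = u" using * e by simp
  qed
qed

text \<open>Joint holomorphy is used in two ways: in \<open>t\<close> alone to differentiate the
  homotopy, and in \<open>X\<close> at \<open>t = 1\<close> for analyticity of \<U>.\<close>

lemma hcurve_sol: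
  assumes h: "hcurve U \<xi>" and t: "\<tau> holomorphic_on U"
    and X: "\<And>z. z \<in> U \<Longrightarrow> norm (\<xi> z - w) \<le> e0" and t2: "\<And>z. z \<in> U \<Longrightarrow> norm (\<tau> z) \<le> 2"
  shows "hcurve U (\<lambda>z. sol (\<xi> z) (\<tau> z))"
proof (rule hcurve_fixpoint[of U 0 "\<delta> / 2" "\<lambda>z. \<Psi> (\<xi> z) (\<tau> z)" "1 / 2"])
  show U: "open U" by (rule hcurve_open[OF h])
  show "norm (0 :: 'd cf) \<le> \<delta> / 2" using delta(1) by simp
  show "norm (\<Psi> (\<xi> z) (\<tau> z) x) \<le> \<delta> / 2" if "z \<in> U" "norm x \<le> \<delta> / 2" for z x
    by (rule Psi_ball[OF X[OF that(1)] t2[OF that(1)] that(2)])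
  show "norm (\<Psi> (\<xi> z) (\<tau> z) x - \<Psi> (\<xi> z) (\<tau> z) y) \<le> 1 / 2 * norm (x - y)"
    if "z \<in> U" "norm x \<le> \<delta> / 2" "norm y \<le> \<delta> / 2" for z x y
    by (rule Psi_lipschitz[OF X[OF that(1)]]) (use that delta(1) in auto)
  show "norm (sol (\<xi> z) (\<tau> z)) \<le> \<delta> / 2 \<and> \<Psi> (\<xi> z) (\<tau> z) (sol (\<xi> z) (\<tau> z)) = sol (\<xi> z) (\<tau> z)" if "z \<in> U" for z
    using sol(1,2)[OF X[OF that] t2[OF that]] by simp
  show "hcurve U (\<lambda>z. \<Psi> (\<xi> z) (\<tau> z) (\<gamma> z))" if g: "hcurve U \<gamma>" "\<And>z. z \<in> U \<Longrightarrow> norm (\<gamma> z) \<le> \<delta> / 2" for \<gamma>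
  proof -
    have gd: "norm (\<gamma> z) \<le> 2 * \<delta>" if "z \<in> U" for z using g(2)[OF that] delta(1) by simp
    have b: "norm (1 - \<tau> z) \<le> 3" if "z \<in> U" for z using norm_triangle_ineq4[of 1 "\<tau> z"] t2[OF that] by simp
    have "hcurve U (\<lambda>z. P (\<xi> z) 0)" by (rule hcurve_P[OF h hcurve_const[OF U]]) (use delta(1) in simp)
    then show ?thesis
      unfolding \<Psi>_def
      by (intro hcurve_diff hcurve_clin[OF hcurve_H[OF h g(1) gd] K(3)] hcurve_cs[OF hcurve_clin[OF _ K(3)] _ b]
          holomorphic_on_diff holomorphic_on_const t)
  qed
qed simp

end

section \<open>The homotopy equation and its solutions\<close>

lemma has_cderivativeD:
  assumes "has_cderivative V N W M G L x"
  shows "f \<in> V \<Longrightarrow> L f \<in> W" "f \<in> V \<Longrightarrow> g \<in> V \<Longrightarrow> L (f + g) = L f + L g"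
    "f \<in> V \<Longrightarrow> L (fscale c f) = fscale c (L f)" "\<exists>C. \<forall>f\<in>V. M (L f) \<le> C * N f"
    "e > 0 \<Longrightarrow> \<exists>d>0. \<forall>h\<in>V. N h < d \<longrightarrow> G (x + h) \<in> W \<and> M (G (x + h) - G x - L h) \<le> e * N h"
  using assms unfolding has_cderivative_def bounded_clinear_on_def by simp_all

lemma repr_ex:
  assumes "repr A \<iota> V N" "f \<in> V"
  shows "\<exists>x. x \<in> A \<and> f = \<iota> x"
proof -
  have "f \<in> \<iota> ` A" using assms by (simp add: repr_def)
  then show ?thesis by (rule imageE) (intro exI conjI)
qed

context resonance
begin

lemma rho_pos: "\<rho> > 0" using rho rho' by simp

abbreviation "A \<equiv> {x :: 'd cf. prj FM x = x}"

lemma image_prj: "range (\<lambda>x. f (prj S x)) = f ` {x. prj S x = x}"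
proof
  show "range (\<lambda>x. f (prj S x)) \<subseteq> f ` {x. prj S x = x}"
    by (rule image_subsetI, rule imageI) (simp add: prj_prj)
  show "f ` {x. prj S x = x} \<subseteq> range (\<lambda>x. f (prj S x))"
  proof (rule image_subsetI)
    fix x assume "x \<in> {x. prj S x = x}"
    then have "f x = f (prj S x)" by simp
    then show "f x \<in> range (\<lambda>x. f (prj S x))" by (rule range_eqI)
  qed
qed

lemma repr_far': "repr A (\<lambda>x. fldA \<rho>' (em x)) (far_spaceA' \<omega> \<sigma> \<rho>') (normA' \<rho>')"
proof -
  have r: "repr UNIV (\<lambda>x :: 'd cf. fldA \<rho>' (em x)) (spaceA' \<rho>') (normA' \<rho>')" by (rule repr_spaceA'[OF rho'])
  note d = reprD[OF r]
  have "far_spaceA' \<omega> \<sigma> \<rho>' = (\<lambda>x. fldA \<rho>' (em x)) ` A"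
    unfolding far_spaceA'_def d(1) image_image mode_proj_fldA[OF rho'] prj_em
    by (rule image_prj)
  then show ?thesis
    using r unfolding repr_def by (simp add: prj_simps)
qed

lemma repr_far: "repr A (fldA \<rho>') (far_spaceA \<omega> \<sigma> \<rho>') (normA \<rho>')"
proof -
  have r: "repr UNIV (fldA \<rho>' :: 'd cf \<Rightarrow> _) (spaceA \<rho>') (normA \<rho>')" by (rule repr_spaceA[OF rho'])
  note d = reprD[OF r]
  have "far_spaceA \<omega> \<sigma> \<rho>' = fldA \<rho>' ` A"
    unfolding far_spaceA_def d(1) image_image mode_proj_fldA[OF rho']
    by (rule image_prj)
  then show ?thesis
    using r unfolding repr_def by (simp add: prj_simps)
qed

lemma F_map_eq:
  assumes "norm u \<le> 2 * \<delta>"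
  shows "F_map \<omega> \<sigma> \<rho>' (fldA \<rho> (em X)) (fldA \<rho>' (em u)) = fldA \<rho>' (prj FM (P X u))"
  unfolding F_map_def fldA_pull[OF rho' small[OF assms]] mode_proj_fldA[OF rho'] P_def ..

lemma F_frechet:
  assumes u: "norm u < \<delta>"
  obtains L C where "clin L" "\<And>h. L h \<in> A"
    "\<And>h. norm h < \<delta> / 2 \<Longrightarrow> norm (prj FM (P X (u + h)) - prj FM (P X u) - L h) \<le> C * (norm h)\<^sup>2"
proof -
  have sub: "norm y \<le> 2 * \<delta>" if "y \<in> ball u \<delta>" for y
    using dist_triangle[of 0 y u] that u by simp
  obtain L where L: "clin L" "\<And>h. norm (L h) \<le> norm X / (1 - 2 * \<delta>) / \<delta> * norm h"
    "\<And>h. norm h < \<delta> / 2 \<Longrightarrow> norm (P X (u + h) - P X u - L h) \<le> 8 * (norm X / (1 - 2 * \<delta>)) / \<delta>\<^sup>2 * (norm h)\<^sup>2"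
  proof (rule hmap_frechet[of u \<delta> "P X" "norm X / (1 - 2 * \<delta>)"])
    show "hcurve U (\<lambda>z. P X (\<gamma> z))" if "hcurve U \<gamma>" "\<gamma> ` U \<subseteq> ball u \<delta>" for U \<gamma>
      by (rule hcurve_P[OF hcurve_const[OF hcurve_open[OF that(1)]] that(1)]) (use that(2) sub in blast)
    show "norm (P X y) \<le> norm X / (1 - 2 * \<delta>)" if "y \<in> ball u \<delta>" for y
      using sub[OF that] delta(2) by (intro order_trans[OF norm_P[OF sub[OF that]]] frac_le) auto
    show "\<delta> > 0" by (rule delta)
  qed (rule that)
  show ?thesis
  proof (rule that[of "\<lambda>h. prj FM (L h)"])
    show "clin (\<lambda>h. prj FM (L h))" by (rule clin_comp[OF clin_prj L(1)])
    show "prj FM (L h) \<in> A" for h by (simp add: prj_prj)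
    show "norm (prj FM (P X (u + h)) - prj FM (P X u) - prj FM (L h)) \<le> 8 * (norm X / (1 - 2 * \<delta>)) / \<delta>\<^sup>2 * (norm h)\<^sup>2"
      if "norm h < \<delta> / 2" for h
      unfolding prj_simps[symmetric] by (rule order_trans[OF norm_prj L(3)[OF that]])
  qed
qed

lemma F_cderivative:
  assumes u: "norm u < \<delta>" "u \<in> A"
    and L: "clin L" "\<And>h. L h \<in> A"
    "\<And>h. norm h < \<delta> / 2 \<Longrightarrow> norm (prj FM (P X (u + h)) - prj FM (P X u) - L h) \<le> C * (norm h)\<^sup>2"
  shows "has_cderivative (far_spaceA' \<omega> \<sigma> \<rho>') (normA' \<rho>') (far_spaceA \<omega> \<sigma> \<rho>') (normA \<rho>')
    (F_map \<omega> \<sigma> \<rho>' (fldA \<rho> (em X))) (\<lambda>f. fldA \<rho>' (L (inv (\<lambda>x. fldA \<rho>' (em x)) f))) (fldA \<rho>' (em u))"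
proof (rule repr_cderivative[OF repr_far' repr_far L(1) L(2) u(2)])
  show "\<delta> / 2 > 0" using delta(1) by simp
  show "F_map \<omega> \<sigma> \<rho>' (fldA \<rho> (em X)) (fldA \<rho>' (em (u + h))) = fldA \<rho>' (prj FM (P X (u + h))) \<and> prj FM (P X (u + h)) \<in> A"
    if "norm h < \<delta> / 2" for h
  proof -
    have "norm (u + h) \<le> 2 * \<delta>" using norm_triangle_ineq[of u h] that u(1) delta(1) by linarith
    from F_map_eq[OF this] show ?thesis by (simp add: prj_prj)
  qed
qed (rule L(3))

lemma sol_A:
  assumes "norm (X - w) \<le> e0" "norm t \<le> 2"
  shows "sol X t \<in> A" "prj FM (P X (sol X t)) = cs (1 - t) (prj FM (P X 0))" "norm (sol X t) < \<delta>" "norm (sol X t) \<le> 2 * \<delta>"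
proof -
  show 1: "norm (sol X t) < \<delta>" "norm (sol X t) \<le> 2 * \<delta>" using sol(1)[OF assms] delta(1) by auto
  show "sol X t \<in> A" "prj FM (P X (sol X t)) = cs (1 - t) (prj FM (P X 0))"
    using sol(2)[OF assms] Psi_fixed_iff[OF 1(2), of X t] by simp_all
qed

lemma sol_0:
  assumes "norm (X - w) \<le> e0"
  shows "sol X 0 = 0"
proof -
  have "\<Psi> X 0 0 = 0" using Psi_fixed_iff[of 0 X 0] delta(1) by (simp add: prj_simps)
  from sol(3)[OF assms _ _ this] show ?thesis using delta(1) by simp
qed

text \<open>The unit disc about a point of [0,1] lies in the disc of radius 2 where
  \<open>sol\<close> is holomorphic. Since \<open>sol\<close> takes values in far fields, projecting
  the derivative to far modes does not affect the remainder.\<close>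

lemma sol_derivative:
  assumes X: "norm (X - w) \<le> e0" and t: "0 \<le> t" "t \<le> 1"
  obtains v C where "v \<in> A" "C \<ge> 0"
    "\<And>\<tau>. norm \<tau> < 1 / 2 \<Longrightarrow> norm (sol X (of_real t + \<tau>) - sol X (of_real t) - cs \<tau> v) \<le> C * (norm \<tau>)\<^sup>2"
proof -
  have tt: "norm (of_real t + z) \<le> 2" if "z \<in> ball 0 1" for z :: complex
    using norm_triangle_ineq[of "of_real t" z] that t by simp
  have tn: "norm (of_real t + z) \<le> 2" if "norm z < 1 / 2" for z :: complex
    using tt[of z] that by simp
  have h: "hcurve (ball 0 1) (\<lambda>z. sol X (of_real t + z))"
    by (rule hcurve_sol) (use X tt in \<open>auto intro!: hcurve_const holomorphic_intros\<close>)
  obtain v where v: "\<And>z. norm z < 1 / 2 \<Longrightarrow> norm (sol X (of_real t + z) - sol X (of_real t + 0) - cs z v) \<le> 8 * \<delta> / 1\<^sup>2 * (norm z)\<^sup>2"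
  proof (rule curve_derivative[OF h, of \<delta>])
    show "norm (sol X (of_real t + z)) \<le> \<delta>" if "z \<in> ball 0 1" for z
      using sol_A(3)[OF X tt[OF that]] by simp
  qed (use that in auto)
  show ?thesis
  proof (rule that[of "prj FM v" "8 * \<delta>"])
    show "prj FM v \<in> A" by (simp add: prj_prj)
    show "8 * \<delta> \<ge> 0" using delta(1) by simp
    fix \<tau> :: complex assume \<tau>: "norm \<tau> < 1 / 2"
    have "sol X (of_real t + \<tau>) - sol X (of_real t) - cs \<tau> (prj FM v) = prj FM (sol X (of_real t + \<tau>) - sol X (of_real t + 0) - cs \<tau> v)"
      using sol_A(1)[OF X tn[OF \<tau>]] sol_A(1)[OF X tn, of 0] by (simp add: prj_simps)
    then show "norm (sol X (of_real t + \<tau>) - sol X (of_real t) - cs \<tau> (prj FM v)) \<le> 8 * \<delta> * (norm \<tau>)\<^sup>2"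
      using order_trans[OF norm_prj v[OF \<tau>]] by simp
  qed
qed

lemma small_quadratic:
  fixes a C :: real
  assumes "s > 0" "\<And>\<tau>. 0 < \<tau> \<Longrightarrow> \<tau> < s \<Longrightarrow> \<tau> * a \<le> C * \<tau>\<^sup>2"
  shows "a \<le> 0"
proof (rule ccontr)
  assume "\<not> a \<le> 0"
  then have a: "a > 0" by simp
  define \<tau> where "\<tau> = min (s / 2) (a / (2 * (\<bar>C\<bar> + 1)))"
  have t: "0 < \<tau>" "\<tau> < s" "\<tau> \<le> a / (2 * (\<bar>C\<bar> + 1))" using a assms(1) by (auto simp: \<tau>_def)
  have "\<tau> * a \<le> \<tau> * (C * \<tau>)" using assms(2)[OF t(1,2)] by (simp add: power2_eq_square mult_ac)
  then have "a \<le> C * \<tau>" using t(1) by simp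
  also have "\<dots> \<le> (\<bar>C\<bar> + 1) * \<tau>" using t(1) by (intro mult_right_mono) auto
  also have "\<dots> \<le> a / 2" using t(3) by (simp add: field_simps)
  finally show False using a by simp
qed

text \<open>Differentiating \<open>prj FM (P X (sol X t)) = cs (1 - t) (prj FM (P X 0))\<close> in
  \<open>t\<close> gives the homotopy equation. The chain rule is carried out by comparing
  first-order expansions.\<close>

lemma homotopy_exists:
  assumes X: "norm (X - w) \<le> e0"
  shows "homotopy_solution \<omega> \<sigma> \<rho> \<rho>' (fldA \<rho> (em X)) (\<lambda>t. fldA \<rho>' (em (sol X (of_real t))))"
  unfolding homotopy_solution_def
proof (intro conjI ballI)
  show "fldA \<rho>' (em (sol X (of_real 0))) = 0" by (simp add: sol_0[OF X] clin_0[OF clin_em] fldA_0)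
  fix t :: real assume "t \<in> {0..1}"
  then have t: "0 \<le> t" "t \<le> 1" "norm (complex_of_real t) \<le> 2" by auto
  let ?u = "\<lambda>t :: real. fldA \<rho>' (em (sol X (of_real t)))"
  let ?x = "sol X (of_real t)"
  note f = reprD[OF repr_far'] repr_diff[OF repr_far']
  note sA = sol_A[OF X t(3)]
  show "?u t \<in> far_spaceA' \<omega> \<sigma> \<rho>'" unfolding f(12) by (rule sA(1))
  show "normA' \<rho>' (?u t) < \<delta>" unfolding f(5) by (rule sA(3))
  obtain L C where L: "clin L" "\<And>h. L h \<in> A"
    "\<And>h. norm h < \<delta> / 2 \<Longrightarrow> norm (prj FM (P X (?x + h)) - prj FM (P X ?x) - L h) \<le> C * (norm h)\<^sup>2"
    using F_frechet[OF sA(3)] by blast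
  obtain v D where v: "v \<in> A" "D \<ge> 0"
    "\<And>\<tau>. norm \<tau> < 1 / 2 \<Longrightarrow> norm (sol X (of_real t + \<tau>) - ?x - cs \<tau> v) \<le> D * (norm \<tau>)\<^sup>2"
    using sol_derivative[OF X t(1,2)] by blast
  obtain KL where KL: "KL > 0" "\<And>x. norm (L x) \<le> KL * norm x" using clin_bound[OF L(1)] by blast
  \<comment> \<open>For real \<tau> > 0 the quantity \<tau> |L v + F(0)| is bounded by the quadratic
    remainders of the map and of the curve, hence by a multiple of \<tau>^2; so the norm
    vanishes.\<close>
  have Lv: "L v = - prj FM (P X 0)"
  proof -
    define a where "a = norm (L v + prj FM (P X 0))"
    define E where "E = D + norm v"
    have E: "E \<ge> 0" using v(2) by (simp add: E_def)
    \<comment> \<open>This keeps the increment \<open>h\<close> of the curve below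
      \<open>\<delta> / 2\<close>, the range in which the expansion of the map is valid.\<close>
    define s where "s = min (1 / 2) (\<delta> / (2 * (E + 1)))"
    have s: "s > 0" using delta(1) E by (simp add: s_def)
    have "a \<le> 0"
    proof (rule small_quadratic[OF s, of _ "\<bar>C\<bar> * E\<^sup>2 + KL * D"])
      fix \<tau> :: real assume \<tau>: "0 < \<tau>" "\<tau> < s"
      have \<tau>1: "\<tau> < 1 / 2" "\<tau> < \<delta> / (2 * (E + 1))" using \<tau>(2) by (auto simp: s_def)
      define h where "h = sol X (of_real t + of_real \<tau>) - ?x"
      have r1: "norm (h - cs (of_real \<tau>) v) \<le> D * \<tau>\<^sup>2" using v(3)[of "of_real \<tau>"] \<tau>(1) \<tau>1(1) by (simp add: h_def)
      have tau2: "\<tau>\<^sup>2 \<le> \<tau>" using \<tau>(1) \<tau>1(1) by (simp add: power2_eq_square)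
      have "norm h \<le> norm (h - cs (of_real \<tau>) v) + norm (cs (of_real \<tau>) v)"
        using norm_triangle_ineq[of "h - cs (of_real \<tau>) v" "cs (of_real \<tau>) v"] by simp
      also have "\<dots> \<le> D * \<tau> + \<tau> * norm v"
        using r1 mult_left_mono[OF tau2 v(2)] \<tau>(1) by simp
      finally have nh: "norm h \<le> E * \<tau>" by (simp add: E_def algebra_simps)
      have "\<tau> * (2 * (E + 1)) < \<delta>" using \<tau>1(2) E by (simp add: pos_less_divide_eq)
      then have nh2: "norm h < \<delta> / 2" using nh \<tau>(1) E by (simp add: algebra_simps)
      have tn: "norm (complex_of_real t + of_real \<tau>) \<le> 2"
        using norm_triangle_ineq[of "complex_of_real t" "of_real \<tau>"] t(1,2) \<tau>(1) \<tau>1(1) by simp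
      have xh: "?x + h = sol X (of_real t + of_real \<tau>)" by (simp add: h_def)
      have "prj FM (P X (?x + h)) - prj FM (P X ?x) = cs (of_real (- \<tau>)) (prj FM (P X 0))"
        unfolding xh sA(2) sol_A(2)[OF X tn] cs_algebra(4)[symmetric] by simp
      then have q: "norm (cs (of_real (- \<tau>)) (prj FM (P X 0)) - L h) \<le> C * (norm h)\<^sup>2" using L(3)[OF nh2] by simp
      have "cs (of_real \<tau>) (L v + prj FM (P X 0)) = - (cs (of_real (- \<tau>)) (prj FM (P X 0)) - L h) - L (h - cs (of_real \<tau>) v)"
        by (rule ell1_eqI) (simp add: clin_diff[OF L(1)] clin_cs[OF L(1)] algebra_simps)
      then have "norm (cs (of_real \<tau>) (L v + prj FM (P X 0))) \<le>
          norm (cs (of_real (- \<tau>)) (prj FM (P X 0)) - L h) + norm (L (h - cs (of_real \<tau>) v))"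
        using norm_triangle_ineq4[of "- (cs (of_real (- \<tau>)) (prj FM (P X 0)) - L h)" "L (h - cs (of_real \<tau>) v)"]
        by (simp only: norm_minus_cancel)
      also have "\<dots> \<le> C * (norm h)\<^sup>2 + KL * (D * \<tau>\<^sup>2)"
        by (intro add_mono q order_trans[OF KL(2)] mult_left_mono r1) (use KL in simp)
      also have "C * (norm h)\<^sup>2 \<le> \<bar>C\<bar> * (E * \<tau>)\<^sup>2"
        by (intro mult_mono power_mono nh) auto
      finally show "\<tau> * a \<le> (\<bar>C\<bar> * E\<^sup>2 + KL * D) * \<tau>\<^sup>2"
        using \<tau>(1) by (simp add: a_def power_mult_distrib algebra_simps)
    qed
    then show ?thesis by (simp add: a_def eq_neg_iff_add_eq_0)
  qed
  show "\<exists>L v. has_cderivative (far_spaceA' \<omega> \<sigma> \<rho>') (normA' \<rho>') (far_spaceA \<omega> \<sigma> \<rho>') (normA \<rho>')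
             (F_map \<omega> \<sigma> \<rho>' (fldA \<rho> (em X))) L (?u t) \<and>
           v \<in> far_spaceA' \<omega> \<sigma> \<rho>' \<and>
           (\<forall>e>0. \<exists>\<delta>>0. \<forall>s\<in>{0..1}. \<bar>s - t\<bar> < \<delta> \<longrightarrow>
              normA' \<rho>' (?u s - ?u t - fscale (of_real (s - t)) v) \<le> e * \<bar>s - t\<bar>) \<and>
           L v = - F_map \<omega> \<sigma> \<rho>' (fldA \<rho> (em X)) 0"
  proof (rule exI[of _ "\<lambda>f. fldA \<rho>' (L (inv (\<lambda>x. fldA \<rho>' (em x)) f))"], rule exI[of _ "fldA \<rho>' (em v)"], intro conjI)
    show "has_cderivative (far_spaceA' \<omega> \<sigma> \<rho>') (normA' \<rho>') (far_spaceA \<omega> \<sigma> \<rho>') (normA \<rho>')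
      (F_map \<omega> \<sigma> \<rho>' (fldA \<rho> (em X))) (\<lambda>f. fldA \<rho>' (L (inv (\<lambda>x. fldA \<rho>' (em x)) f))) (?u t)"
      by (rule F_cderivative[OF sA(3) sA(1) L])
    show "fldA \<rho>' (em v) \<in> far_spaceA' \<omega> \<sigma> \<rho>'" unfolding f(12) by (rule v(1))
    have inv: "inv (\<lambda>x. fldA \<rho>' (em x)) (fldA \<rho>' (em v)) = v"
      using inv_f_f[of "\<lambda>x. fldA \<rho>' (em x)" v] repr_far' by (simp add: repr_def)
    have F0: "F_map \<omega> \<sigma> \<rho>' (fldA \<rho> (em X)) 0 = fldA \<rho>' (prj FM (P X 0))"
      using F_map_eq[of 0 X] delta(1) by (simp add: clin_0[OF clin_em] fldA_0)
    show "fldA \<rho>' (L (inv (\<lambda>x. fldA \<rho>' (em x)) (fldA \<rho>' (em v)))) = - F_map \<omega> \<sigma> \<rho>' (fldA \<rho> (em X)) 0"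
      unfolding inv Lv F0 by (rule repr_diff(3)[OF repr_far])
    show "\<forall>e>0. \<exists>\<delta>>0. \<forall>s\<in>{0..1}. \<bar>s - t\<bar> < \<delta> \<longrightarrow>
              normA' \<rho>' (?u s - ?u t - fscale (of_real (s - t)) (fldA \<rho>' (em v))) \<le> e * \<bar>s - t\<bar>"
    proof (intro allI impI)
      fix e :: real assume e: "e > 0"
      show "\<exists>\<delta>>0. \<forall>s\<in>{0..1}. \<bar>s - t\<bar> < \<delta> \<longrightarrow>
              normA' \<rho>' (?u s - ?u t - fscale (of_real (s - t)) (fldA \<rho>' (em v))) \<le> e * \<bar>s - t\<bar>"
      proof (intro exI[of _ "min (1 / 2) (e / (D + 1))"] conjI ballI impI)
        show "min (1 / 2) (e / (D + 1)) > 0" using e v(2) by simp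
        fix s :: real assume s: "\<bar>s - t\<bar> < min (1 / 2) (e / (D + 1))"
        have "normA' \<rho>' (?u s - ?u t - fscale (of_real (s - t)) (fldA \<rho>' (em v))) =
            norm (sol X (of_real t + of_real (s - t)) - ?x - cs (of_real (s - t)) v)"
          unfolding f(4)[symmetric] f(8)[symmetric] f(5) by simp
        also have "\<dots> \<le> D * (norm (complex_of_real (s - t)))\<^sup>2" by (rule v(3)) (use s in \<open>simp del: of_real_diff\<close>)
        also have "\<dots> = (D * \<bar>s - t\<bar>) * \<bar>s - t\<bar>" by (simp only: norm_of_real power2_eq_square mult.assoc)
        also have "\<dots> \<le> e * \<bar>s - t\<bar>"
        proof (rule mult_right_mono)
          have "\<bar>s - t\<bar> * (D + 1) < e" using s v(2) by (simp add: pos_less_divide_eq)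
          then show "D * \<bar>s - t\<bar> \<le> e" by (simp add: algebra_simps)
        qed simp
        finally show "normA' \<rho>' (?u s - ?u t - fscale (of_real (s - t)) (fldA \<rho>' (em v))) \<le> e * \<bar>s - t\<bar>" .
      qed
    qed
  qed
qed

lemma repr_norm_add:
  assumes "repr B \<kappa> V M" "f \<in> V" "g \<in> V"
  shows "M (f + g) \<le> M f + M g"
proof -
  note d = reprD[OF assms(1)]
  obtain x y where "f = \<kappa> x" "g = \<kappa> y" using assms(2,3) by (auto simp: d(1))
  then show ?thesis by (simp add: d(3)[symmetric] d(5) norm_triangle_ineq)
qed

text \<open>Needed because \<open>homotopy_end\<close> is a definite description. An arbitrary
  solution is known only through a Frechet derivative and a velocity at each time; they show that
  the far part of the pullback minus \<open>1 - t\<close> times its initial value has zero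
  derivative, hence is zero. At time 1 the solution is then a fixed point of
  \<open>\<Psi> X 1\<close>, which is unique.\<close>

lemma homotopy_unique:
  assumes X: "norm (X - w) \<le> e0" and hs: "homotopy_solution \<omega> \<sigma> \<rho> \<rho>' (fldA \<rho> (em X)) u"
  shows "u 1 = fldA \<rho>' (em (sol X 1))"
proof -
  let ?\<iota> = "\<lambda>x. fldA \<rho>' (em x)" and ?F = "F_map \<omega> \<sigma> \<rho>' (fldA \<rho> (em X))"
  note f = reprD[OF repr_far'] repr_diff[OF repr_far'] and k = reprD[OF repr_far] repr_diff[OF repr_far]
  have "\<exists>y. y \<in> A \<and> u t = ?\<iota> y" if "t \<in> {0..1}" for t
  proof -
    have "u t \<in> far_spaceA' \<omega> \<sigma> \<rho>'" using hs that by (simp add: homotopy_solution_def)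
    then show ?thesis by (rule repr_ex[OF repr_far'])
  qed
  then have "\<forall>t\<in>{0..1}. \<exists>y. y \<in> A \<and> u t = ?\<iota> y" by (intro ballI)
  from bchoice[OF this] obtain x where "\<forall>t\<in>{0..1}. x t \<in> A \<and> u t = ?\<iota> (x t)" ..
  then have x: "x t \<in> A \<and> u t = ?\<iota> (x t)" if "t \<in> {0..1}" for t using that by (rule bspec)
  have nx: "norm (x t) < \<delta>" if "t \<in> {0..1}" for t
  proof -
    have "normA' \<rho>' (u t) < \<delta>" using hs that by (simp add: homotopy_solution_def)
    then show ?thesis using x[OF that] f(5)[of "x t"] by simp
  qed
  have nx2: "norm (x t) \<le> 2 * \<delta>" if "t \<in> {0..1}" for t using nx[OF that] delta(1) by simp
  have Fx: "?F (u t) = fldA \<rho>' (prj FM (P X (x t)))" if "t \<in> {0..1}" for t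
    using F_map_eq[OF nx2[OF that], of X] x[OF that] by simp
  define Q where "Q = prj FM (P X 0)"
  have F0: "?F 0 = fldA \<rho>' Q"
    using F_map_eq[of 0 X] delta(1) by (simp add: clin_0[OF clin_em] fldA_0 Q_def)
  have QA: "prj FM y \<in> A" for y by (simp add: prj_prj)
  \<comment> \<open>The quantity conserved along any solution; it vanishes at time 0.\<close>
  define D where "D t = prj FM (P X (x t)) - cs (of_real (1 - t)) Q" for t :: real
  have deriv: "(D has_vector_derivative 0) (at t within {0..1})" if t: "t \<in> {0..1}" for t
    unfolding has_vector_derivative_def has_derivative_within_alt
  proof (intro conjI allI impI)
    show "bounded_linear (\<lambda>h :: real. h *\<^sub>R (0 :: 'd cf))" by simp
    fix e :: real assume e: "e > 0"
    note hs2 = hs[unfolded homotopy_solution_def, THEN conjunct2, THEN bspec, OF t, THEN conjunct2, THEN conjunct2]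
    from hs2 obtain L where "\<exists>v. has_cderivative (far_spaceA' \<omega> \<sigma> \<rho>') (normA' \<rho>') (far_spaceA \<omega> \<sigma> \<rho>') (normA \<rho>') ?F L (u t) \<and>
        v \<in> far_spaceA' \<omega> \<sigma> \<rho>' \<and>
        (\<forall>e>0. \<exists>d>0. \<forall>s\<in>{0..1}. \<bar>s - t\<bar> < d \<longrightarrow> normA' \<rho>' (u s - u t - fscale (of_real (s - t)) v) \<le> e * \<bar>s - t\<bar>) \<and>
        L v = - ?F 0" ..
    then obtain v0 where q0: "has_cderivative (far_spaceA' \<omega> \<sigma> \<rho>') (normA' \<rho>') (far_spaceA \<omega> \<sigma> \<rho>') (normA \<rho>') ?F L (u t) \<and>
        v0 \<in> far_spaceA' \<omega> \<sigma> \<rho>' \<and>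
        (\<forall>e>0. \<exists>d>0. \<forall>s\<in>{0..1}. \<bar>s - t\<bar> < d \<longrightarrow> normA' \<rho>' (u s - u t - fscale (of_real (s - t)) v0) \<le> e * \<bar>s - t\<bar>) \<and>
        L v0 = - ?F 0" ..
    note L = q0[THEN conjunct1] and v0 = q0[THEN conjunct2, THEN conjunct1]
      and vel = q0[THEN conjunct2, THEN conjunct2, THEN conjunct1] and Lv0 = q0[THEN conjunct2, THEN conjunct2, THEN conjunct2]
    from repr_ex[OF repr_far' v0] obtain v where "v \<in> A \<and> v0 = ?\<iota> v" ..
    note v = conjunct1[OF this] conjunct2[OF this]
    note L' = has_cderivativeD[OF L]
    from L'(4) obtain C where C: "\<forall>g\<in>far_spaceA' \<omega> \<sigma> \<rho>'. normA \<rho>' (L g) \<le> C * normA' \<rho>' g" ..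
    \<comment> \<open>The error is split into two halves: \<open>e1\<close> controls the velocity
      remainder after the bounded operator \<open>L\<close>, and \<open>e2\<close> the remainder of
      the map on increments of size at most \<open>B * \<bar>s - t\<bar>\<close>.\<close>
    define e1 where "e1 = e / (2 * (\<bar>C\<bar> + 1))"
    have e1: "e1 > 0" using e by (simp add: e1_def add_nonneg_pos)
    define B where "B = norm v + e1"
    have B: "B > 0" using e1 by (simp add: B_def add_nonneg_pos)
    define e2 where "e2 = e / (2 * B)"
    have e2: "e2 > 0" using e B by (simp add: e2_def)
    from vel[rule_format, OF e1] obtain d2 where "d2 > 0 \<and> (\<forall>s\<in>{0..1}. \<bar>s - t\<bar> < d2 \<longrightarrow> normA' \<rho>' (u s - u t - fscale (of_real (s - t)) v0) \<le> e1 * \<bar>s - t\<bar>)" ..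
    note d2 = conjunct1[OF this] conjunct2[OF this]
    from L'(5)[OF e2] obtain d1 where "d1 > 0 \<and> (\<forall>h\<in>far_spaceA' \<omega> \<sigma> \<rho>'. normA' \<rho>' h < d1 \<longrightarrow>
        ?F (u t + h) \<in> far_spaceA \<omega> \<sigma> \<rho>' \<and> normA \<rho>' (?F (u t + h) - ?F (u t) - L h) \<le> e2 * normA' \<rho>' h)" ..
    note d1 = conjunct1[OF this] conjunct2[OF this]
    show "\<exists>d>0. \<forall>s\<in>{0..1}. norm (s - t) < d \<longrightarrow> norm (D s - D t - (s - t) *\<^sub>R 0) \<le> e * norm (s - t)"
    proof (intro exI[of _ "min d2 (d1 / B)"] conjI ballI impI)
      show "min d2 (d1 / B) > 0" using d1(1) d2(1) B by simp
      fix s :: real assume s: "s \<in> {0..1}" and "norm (s - t) < min d2 (d1 / B)"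
      then have st: "\<bar>s - t\<bar> < d2" "\<bar>s - t\<bar> * B < d1" using B by (simp_all add: pos_less_divide_eq)
      let ?c = "complex_of_real (s - t)"
      define h where "h = x s - x t"
      define g where "g = h - cs ?c v"
      have hA: "h \<in> A" "g \<in> A" "cs ?c v \<in> A"
        unfolding g_def h_def using x[OF s] x[OF t] v(1) by (simp_all add: prj_simps)
      have ih: "?\<iota> h = u s - u t" using x[OF s] x[OF t] by (simp add: h_def f(8))
      have ng: "norm g \<le> e1 * \<bar>s - t\<bar>"
        using d2(2)[rule_format, OF s st(1)] unfolding v(2) ih[symmetric] f(4)[symmetric] f(8)[symmetric] f(5) g_def .
      have "norm h \<le> norm g + norm (cs ?c v)" using norm_triangle_ineq[of g "cs ?c v"] by (simp add: g_def)
      also have "norm (cs ?c v) = norm v * \<bar>s - t\<bar>" unfolding norm_cs norm_of_real by simp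
      finally have nh: "norm h \<le> B * \<bar>s - t\<bar>" using ng by (simp add: B_def algebra_simps)
      have iV: "?\<iota> h \<in> far_spaceA' \<omega> \<sigma> \<rho>'" "?\<iota> g \<in> far_spaceA' \<omega> \<sigma> \<rho>'" "?\<iota> (cs ?c v) \<in> far_spaceA' \<omega> \<sigma> \<rho>'"
        unfolding f(12) by (rule hA)+
      have "normA' \<rho>' (?\<iota> h) < d1" unfolding f(5) using nh st(2) by (simp add: mult.commute)
      note q0 = d1(2)[rule_format, OF iV(1) this]
      have q: "?F (u t + ?\<iota> h) \<in> far_spaceA \<omega> \<sigma> \<rho>'"
          "normA \<rho>' (?F (u t + ?\<iota> h) - ?F (u t) - L (?\<iota> h)) \<le> e2 * normA' \<rho>' (?\<iota> h)" by (rule conjunct1[OF q0], rule conjunct2[OF q0])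
      have us: "u t + ?\<iota> h = u s" by (simp add: ih)
      have "?\<iota> h = ?\<iota> g + ?\<iota> (cs ?c v)" unfolding f(3)[symmetric] by (simp add: g_def)
      then have "L (?\<iota> h) = L (?\<iota> g) + L (?\<iota> (cs ?c v))" using L'(2)[OF iV(2,3)] by (simp only:)
      also have "L (?\<iota> (cs ?c v)) = fscale ?c (L v0)" using L'(3)[OF v0] unfolding f(4) v(2) .
      also have "\<dots> = - fldA \<rho>' (cs ?c Q)" unfolding Lv0 F0 k(10)[symmetric] k(4)[symmetric] by (simp add: cs_algebra)
      finally have Lh: "L (?\<iota> h) = L (?\<iota> g) - fldA \<rho>' (cs ?c Q)" by (simp only: add_uminus_conv_diff)
      have Dd: "D s - D t = prj FM (P X (x s)) - prj FM (P X (x t)) + cs ?c Q"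
        by (rule ell1_eqI) (simp add: D_def algebra_simps)
      have eq: "fldA \<rho>' (D s - D t) = (?F (u t + ?\<iota> h) - ?F (u t) - L (?\<iota> h)) + L (?\<iota> g)"
        unfolding Dd us Fx[OF s] Fx[OF t] Lh k(3) k(8) by simp
      have m1: "?F (u t + ?\<iota> h) - ?F (u t) - L (?\<iota> h) \<in> far_spaceA \<omega> \<sigma> \<rho>'"
      proof -
        from repr_ex[OF repr_far L'(1)[OF iV(1)]] obtain y where "y \<in> A \<and> L (?\<iota> h) = fldA \<rho>' y" ..
        note y = conjunct1[OF this] conjunct2[OF this]
        show ?thesis unfolding us Fx[OF s] Fx[OF t] y(2) k(8)[symmetric] k(12)
          using y(1) by (simp add: prj_simps prj_prj)
      qed
      have "L (?\<iota> g) \<in> far_spaceA \<omega> \<sigma> \<rho>'" by (rule L'(1)[OF iV(2)])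
      from order_trans[OF repr_norm_add[OF repr_far m1 this] add_mono[OF q(2) bspec[OF C iV(2)]]]
      have "normA \<rho>' (fldA \<rho>' (D s - D t)) \<le> e2 * normA' \<rho>' (?\<iota> h) + C * normA' \<rho>' (?\<iota> g)"
        unfolding eq .
      then have "norm (D s - D t) \<le> e2 * norm h + C * norm g" unfolding f(5) k(5) .
      also have "\<dots> \<le> e2 * (B * \<bar>s - t\<bar>) + (\<bar>C\<bar> + 1) * (e1 * \<bar>s - t\<bar>)"
        using e1 by (intro add_mono mult_mono nh ng) (use e2 in auto)
      also have "\<dots> = e * \<bar>s - t\<bar>" using B by (simp add: e1_def e2_def field_simps add_nonneg_pos)
      finally show "norm (D s - D t - (s - t) *\<^sub>R 0) \<le> e * norm (s - t)" by simp
    qed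
  qed
  obtain c where c: "\<And>t. t \<in> {0..1} \<Longrightarrow> D t = c"
    using has_vector_derivative_zero_constant[OF convex_closed_interval deriv] by blast
  have x0: "x 0 = 0"
  proof -
    have "?\<iota> (x 0) = ?\<iota> 0" using x[of 0] hs by (simp add: homotopy_solution_def f(9))
    then show ?thesis unfolding f(2) .
  qed
  have "D 1 = D 0" using c[of 0] c[of 1] by simp
  also have "D 0 = 0" by (simp add: D_def x0 Q_def)
  finally have "prj FM (P X (x 1)) = 0" by (simp add: D_def)
  then have "\<Psi> X 1 (x 1) = x 1" using Psi_fixed_iff[OF nx2[of 1], of X 1] x[of 1] by simp
  from sol(3)[OF X _ nx[of 1] this] have "x 1 = sol X 1" by simp
  then show ?thesis using x[of 1] by simp
qed

lemma homotopy_end_eq: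
  assumes X: "norm (X - w) \<le> e0"
  shows "homotopy_end \<omega> \<sigma> \<rho> \<rho>' (fldA \<rho> (em X)) = fldA \<rho>' (em (sol X 1))"
  unfolding homotopy_end_def
proof (rule the_equality)
  show "\<exists>u. homotopy_solution \<omega> \<sigma> \<rho> \<rho>' (fldA \<rho> (em X)) u \<and> fldA \<rho>' (em (sol X 1)) = u 1"
    by (intro exI conjI, rule homotopy_exists[OF X]) simp
  show "v = fldA \<rho>' (em (sol X 1))" if "\<exists>u. homotopy_solution \<omega> \<sigma> \<rho> \<rho>' (fldA \<rho> (em X)) u \<and> v = u 1" for v
    using that homotopy_unique[OF X] by blast
qed

text \<open>\<open>\<U>\<close> in coefficients: \<open>X\<close> in \<open>\<A>'(\<rho>)\<close>-, \<open>Wm X\<close> in \<open>\<A>(\<rho>')\<close>-coordinates.\<close>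

definition Wm :: "'d cf \<Rightarrow> 'd cf" where
  "Wm X = P X (sol X 1)"

lemma n1: "norm (1::complex) \<le> 2" by simp

lemma U_op_eq:
  assumes X: "norm (X - w) \<le> e0"
  shows "U_op \<omega> \<sigma> \<rho> \<rho>' (fldA \<rho> (em X)) = fldA \<rho>' (Wm X)"
  unfolding U_op_def homotopy_end_eq[OF X] Wm_def P_def
  by (rule fldA_pull[OF rho' small[OF sol_A(4)[OF X n1]]])

lemma Wm_resonant:
  assumes X: "norm (X - w) \<le> e0"
  shows "prj FM (Wm X) = 0"
  using sol_A(2)[OF X n1] by (simp add: Wm_def)

lemma hcurve_Wm:
  assumes h: "hcurve U \<xi>" and X: "\<And>z. z \<in> U \<Longrightarrow> norm (\<xi> z - w) \<le> e0"
  shows "hcurve U (\<lambda>z. Wm (\<xi> z))"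
  unfolding Wm_def
  by (rule hcurve_P[OF h hcurve_sol[OF h holomorphic_on_const X n1]]) (use sol_A(4)[OF X n1] in auto)

lemma norm_Wm:
  assumes X: "norm (X - w) \<le> e0"
  shows "norm (Wm X) \<le> 2 * norm X"
proof -
  have "norm (sol X 1) < 1 / 2" using sol_A(3)[OF X n1] delta(2) by simp
  then have "norm X / (1 - norm (sol X 1)) \<le> norm X / (1 / 2)" by (intro divide_left_mono) auto
  then show ?thesis unfolding Wm_def using norm_P[OF sol_A(4)[OF X n1], of X] by simp
qed

text \<open>A constant field has no far modes, so the zero displacement already solves the
  elimination problem and uniqueness makes it the solution.\<close>

lemma Wm_cst:
  assumes X: "norm (cst v - w) \<le> e0"
  shows "Wm (cst v) = cst v"
proof -
  have "prj FM (cst v) = 0"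
    by (rule ell1_eqI) (auto simp: split_paired_all ap_prj ap_cst dest: far_nz(2))
  then have "\<Psi> (cst v) 1 0 = 0" using Psi_fixed_iff[of 0 "cst v" 1] delta(1) by (simp add: prj_simps P_cst_0)
  then have "sol (cst v) 1 = 0" using sol(3)[OF X n1 _ \<open>\<Psi> (cst v) 1 0 = 0\<close>] delta(1) by simp
  then show ?thesis by (simp add: Wm_def P_cst_0)
qed

text \<open>The displacement is of first order in \<open>f\<close>, but its first-order effect on
  \<omega> is \<open>Dm \<rho>' ?u w\<close>, which contains only far modes and is lost under the
  projection to resonant ones. What remains is the quadratic error of \<open>P_w\<close> and the
  change of \<open>P f\<close> between 0 and the displacement, a product of two small
  factors.\<close>

lemma Wm_expansion:
  obtains C where "C \<ge> 0" "\<And>f. norm f \<le> e0 \<Longrightarrow> norm (Wm (w + f) - w - prj (- FM) (P f 0)) \<le> C * (norm f)\<^sup>2"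
proof -
  define C where "C = 2 * l1norm \<omega> * (10 / \<sigma>)\<^sup>2 + 2 / \<delta> * (10 / \<sigma>)"
  have C: "C \<ge> 0" using sig wpos delta(1) by (simp add: C_def)
  have "norm (Wm (w + f) - w - prj (- FM) (P f 0)) \<le> C * (norm f)\<^sup>2" if f: "norm f \<le> e0" for f
  proof -
    let ?u = "sol (w + f) 1"
    have X: "norm (w + f - w) \<le> e0" using f by simp
    note u = sol_A[OF X n1] and us = sol(4)[OF X n1, simplified]
    have u12: "norm ?u < 1 / 2" using u(3) delta(2) by simp
    let ?E = "P w ?u - w + Dm \<rho>' ?u w"
    have pr: "prj (- FM) y = y - prj FM y" for y
      by (rule ell1_eqI) (auto simp: split_paired_all ap_prj)
    have Dfar: "prj (- FM) (Dm \<rho>' ?u w) = 0"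
    proof (rule ell1_eqI, simp only: split_paired_all)
      fix k i
      have "k \<notin> FM \<Longrightarrow> ap ?u (k, i) = 0" using arg_cong[of _ _ "\<lambda>v. ap v (k, i)", OF u(1)[simplified]] by (simp add: ap_prj)
      then show "ap (prj (- FM) (Dm \<rho>' ?u w)) (k, i) = ap 0 (k, i)" by (simp add: ap_prj ap_Dm_cst[OF rho'])
    qed
    have Pw: "prj (- FM) w = w"
      by (rule ell1_eqI) (auto simp: split_paired_all ap_prj ap_cst dest: far_nz(2))
    have e: "Wm (w + f) = ?E + w - Dm \<rho>' ?u w + P f ?u"
      unfolding Wm_def P_add[OF u(4)] by simp
    have "Wm (w + f) = prj (- FM) (Wm (w + f))" unfolding pr Wm_resonant[OF X] by simp
    also have "\<dots> = prj (- FM) ?E + w + prj (- FM) (P f ?u)"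
      unfolding e prj_simps Dfar Pw by simp
    finally have "Wm (w + f) - w - prj (- FM) (P f 0) = prj (- FM) ?E + (prj (- FM) (P f ?u) - prj (- FM) (P f 0))"
      by simp
    then have "Wm (w + f) - w - prj (- FM) (P f 0) = prj (- FM) (?E + (P f ?u - P f 0))"
      by (simp only: prj_simps)
    then have "norm (Wm (w + f) - w - prj (- FM) (P f 0)) \<le> norm ?E + norm (P f ?u - P f 0)"
      using order_trans[OF norm_prj norm_triangle_ineq] by metis
    also have "norm ?E \<le> (norm ?u)\<^sup>2 * (l1norm \<omega> / (1 / 2))"
      using u12 wpos by (intro order_trans[OF P_w[OF u(4)]] mult_left_mono divide_left_mono) auto
    also have "norm (P f ?u - P f 0) \<le> 2 * norm f / \<delta> * norm (?u - 0)"
    proof (rule hmap_lipschitz[where S = "ball 0 (2 * \<delta>)"])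
      show "hcurve U (\<lambda>z. P f (\<gamma> z))" if "hcurve U \<gamma>" "\<gamma> ` U \<subseteq> ball 0 (2 * \<delta>)" for U \<gamma>
        by (rule hcurve_P[OF hcurve_const[OF hcurve_open[OF that(1)]] that(1)]) (use that(2) in \<open>auto simp: image_subset_iff less_imp_le\<close>)
      show "norm (P f y) \<le> 2 * norm f" if "y \<in> ball 0 (2 * \<delta>)" for y
      proof -
        have y: "norm y \<le> 2 * \<delta>" using that by simp
        have "norm f / (1 - norm y) \<le> norm f / (1 / 2)" using y delta(2) by (intro divide_left_mono) auto
        then show ?thesis using norm_P[OF y, of f] by simp
      qed
      show "\<delta> > 0" by (rule delta)
      show "ball p \<delta> \<subseteq> ball 0 (2 * \<delta>)" if "p \<in> closed_segment 0 ?u" for p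
      proof -
        have "closed_segment 0 ?u \<subseteq> ball 0 \<delta>" by (rule closed_segment_subset) (use u(3) delta(1) in auto)
        then have "norm p < \<delta>" using that by auto
        show ?thesis
        proof
          fix x assume "x \<in> ball p \<delta>"
          then show "x \<in> ball 0 (2 * \<delta>)" using \<open>norm p < \<delta>\<close> dist_triangle[of 0 x p] by simp
        qed
      qed
    qed
    also have "(norm ?u)\<^sup>2 * (l1norm \<omega> / (1 / 2)) \<le> (10 / \<sigma> * norm f)\<^sup>2 * (2 * l1norm \<omega>)"
      using us wpos by (intro mult_mono power_mono) auto
    also have "2 * norm f / \<delta> * norm (?u - 0) \<le> 2 * norm f / \<delta> * (10 / \<sigma> * norm f)"
      using us delta(1) by (intro mult_left_mono) auto
    finally have "norm (Wm (w + f) - w - prj (- FM) (P f 0)) \<le>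
        (10 / \<sigma> * norm f)\<^sup>2 * (2 * l1norm \<omega>) + 2 * norm f / \<delta> * (10 / \<sigma> * norm f)" by simp
    then show ?thesis by (simp only: C_def power_mult_distrib power2_eq_square) (simp add: algebra_simps)
  qed
  with C show ?thesis by (rule that)
qed

text \<open>Pulling back by the identity only restricts a field from the wide to the narrow strip.
  Fourier coefficients are unchanged, so the factor is the quotient of the weights.\<close>

lemma ap_P_0: "ap (P f 0) (k, i) = of_real (wt \<rho>' k / (wt \<rho> k * wd k)) * ap f (k, i)"
proof -
  define g where "g = P f 0"
  have D0: "Dm \<rho>' 0 v = 0" for v :: "'d cf" using norm_Dm[OF rho', of 0 v] by simp
  have g: "g = compos \<rho>' \<rho> (em f) (em 0)"
    using pullv_eq[OF rho', of 0 "compos \<rho>' \<rho> (em f) (em 0)"] by (simp add: g_def P_def pull_def[OF rho'] D0)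
  have s: "\<rho>' + 2 * pi * norm (em 0 :: 'd cf) \<le> \<rho>" using rho by (simp add: clin_0[OF clin_em])
  have st: "\<theta> \<in> strip \<rho>" if "\<theta> \<in> strip \<rho>'" for \<theta> :: "complex ^ 'd"
    using strip_comp[OF rho' that s] by (simp add: clin_0[OF clin_em] fldA_0)
  have fsg: "fs \<rho>' (cmpt i g) \<theta> = fs \<rho> (cmpt i (em f)) \<theta>" if "\<theta> \<in> strip \<rho>'" for \<theta>
    using fs_comp1[OF rho' that s, of "cmpt i (em f)"] by (simp add: g compos_def[OF rho'] clin_0[OF clin_em] fldA_0)
  have "(\<lambda>x. fmode (- k) (vec_of_real x) * fs \<rho>' (cmpt i g) (vec_of_real x)) =
     (\<lambda>x. fmode (- k) (vec_of_real x) * fs \<rho> (cmpt i (em f)) (vec_of_real x))"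
    by (simp add: fsg vec_of_real_in_strip rho')
  then have "ap g (k, i) / of_real (wt \<rho>' k) = ap (em f) (k, i) / of_real (wt \<rho> k)"
    using fs_fourier[OF rho', of k "cmpt i g"] fs_fourier[OF rho_pos, of k "cmpt i (em f)"] by simp
  then show ?thesis by (simp add: g_def ap_em field_simps)
qed

end

section \<open>The renormalisation operator in coefficients\<close>

lemma mat_of_int_mult: "mat_of_int (A ** B) = mat_of_int A ** mat_of_int B"
  for A B :: "int ^ 'd::finite ^ 'd"
  by (simp add: mat_of_int_def matrix_matrix_mult_def vec_eq_iff)

lemma mat_of_int_1: "mat_of_int (mat 1) = (mat 1 :: 'a::ring_1 ^ 'd::finite ^ 'd)"
  by (simp add: mat_of_int_def mat_def vec_eq_iff)

lemma vec_of_int_mult: "vec_of_int (A *v k) = mat_of_int A *v vec_of_int k"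
  for A :: "int ^ 'd::finite ^ 'd"
  by (simp add: mat_of_int_def vec_of_int_def matrix_vector_mult_def vec_eq_iff)

lemma mat_of_int_transpose: "mat_of_int (transpose A) = transpose (mat_of_int A)"
  by (simp add: mat_of_int_def transpose_def vec_eq_iff)

lemma dotp_transpose: "dotp (transpose A *v x) y = dotp x (A *v y)"
  for A :: "'a::comm_semiring_1 ^ 'd::finite ^ 'd"
proof -
  have "dotp (transpose A *v x) y = (\<Sum>i\<in>UNIV. \<Sum>j\<in>UNIV. A $ j $ i * x $ j * y $ i)"
    by (simp add: dotp_def matrix_vector_mult_def transpose_def sum_distrib_right)
  also have "\<dots> = (\<Sum>j\<in>UNIV. \<Sum>i\<in>UNIV. A $ j $ i * x $ j * y $ i)" by (rule sum.swap)
  also have "\<dots> = dotp x (A *v y)"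
    by (simp add: dotp_def matrix_vector_mult_def sum_distrib_left mult_ac)
  finally show ?thesis .
qed

lemma matrix_inv_eqI:
  fixes A :: "'a::semiring_1 ^ 'd::finite ^ 'd"
  assumes "A ** B = mat 1" "B ** A = mat 1"
  shows "matrix_inv A = B"
proof -
  have "A ** matrix_inv A = mat 1 \<and> matrix_inv A ** A = mat 1"
    unfolding matrix_inv_def by (rule someI[of _ B]) (use assms in simp)
  then have "matrix_inv A = (B ** A) ** matrix_inv A" using assms by simp
  also have "\<dots> = B" unfolding matrix_mul_assoc[symmetric] using \<open>A ** matrix_inv A = mat 1 \<and> _\<close> by simp
  finally show ?thesis .
qed

locale renormalisation = resonance \<omega> \<sigma> \<rho> \<rho>'
  for \<omega> :: "real ^ 'd::finite" and \<sigma> \<rho> \<rho>' :: real +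
  fixes \<omega>' :: "real ^ 'd" and T :: "int ^ 'd ^ 'd" and lam :: complex and \<kappa> :: real
  assumes invT: "invertible T"
    and eig: "mat_of_int T *v vec_of_real \<omega> = lam *s vec_of_real \<omega>"
    and lam1: "1 < cmod lam"
    and dual: "transpose (mat_of_int T) *v vec_of_real \<omega>' = lam *s vec_of_real \<omega>'"
    and pair: "dotp \<omega>' \<omega> = 1"
    and kap: "0 < \<kappa>" "\<kappa> < 1" "\<kappa> * \<rho> < \<rho>'"
    and cone: "vec_of_int ` resonant_modes \<omega> \<sigma> \<subseteq> contracted_cone T \<kappa>"
begin

definition "Ti = matrix_inv T"
abbreviation "Tc \<equiv> mat_of_int T :: complex ^ 'd ^ 'd"
abbreviation "Tic \<equiv> mat_of_int Ti :: complex ^ 'd ^ 'd"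

lemma lam0 [simp]: "lam \<noteq> 0" using lam1 by auto

lemma Ti: "T ** Ti = mat 1" "Ti ** T = mat 1"
proof -
  have "\<exists>A'. T ** A' = mat 1 \<and> A' ** T = mat 1" using invT by (simp add: invertible_def)
  from someI_ex[OF this] show "T ** Ti = mat 1" "Ti ** T = mat 1" by (simp_all add: Ti_def matrix_inv_def)
qed

lemma Tic: "Tc ** Tic = mat 1" "Tic ** Tc = mat 1" "matrix_inv Tc = Tic"
proof -
  show 1: "Tc ** Tic = mat 1" "Tic ** Tc = mat 1"
    unfolding mat_of_int_mult[symmetric] Ti by (rule mat_of_int_1)+
  show "matrix_inv Tc = Tic" by (rule matrix_inv_eqI[OF 1])
qed

definition Tt :: "int ^ 'd \<Rightarrow> int ^ 'd" where "Tt k = transpose T *v k"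
definition Sm :: "int ^ 'd \<Rightarrow> int ^ 'd" where "Sm k = transpose Ti *v k"

lemma Sm_Tt: "Sm (Tt k) = k" "Tt (Sm k) = k" "Sm 0 = 0" "Tt 0 = 0"
  unfolding Sm_def Tt_def
  by (simp_all add: matrix_vector_mul_assoc matrix_transpose_mul[symmetric] Ti transpose_mat del: transpose_matrix_vector)

lemma bij_Sm: "bij Sm"
  by (rule bij_betw_byWitness[where f' = Tt]) (auto simp: Sm_Tt)

lemma Sm_eq_0: "Sm m = 0 \<longleftrightarrow> m = 0"
  by (metis Sm_Tt)

lemma zlen_Tt:
  assumes "k \<notin> FM"
  shows "zlen (Tt k) \<le> \<kappa> * zlen k"
proof -
  have "(vec_of_int k :: real ^ 'd) \<in> contracted_cone T \<kappa>"
    using cone assms by (auto simp: resonant_modes_def)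
  then show ?thesis
    by (simp add: zlen_def contracted_cone_def Tt_def vec_of_int_mult mat_of_int_transpose del: transpose_matrix_vector)
qed

lemma fmode_Tt: "fmode (Tt k) \<theta> = fmode k (Tc *v \<theta>)"
  by (simp add: fmode_def Tt_def vec_of_int_mult mat_of_int_transpose dotp_transpose del: transpose_matrix_vector)

lemma zero_FM: "0 \<notin> FM" using far_nz(2) by blast

text \<open>\<open>X \<circ> T\<close> has at the mode \<open>m = T\<^sup>* k\<close> the coefficient of \<open>X\<close> at \<open>k = Sm m\<close>; the multiplier accounts for
  the change of weights from \<open>\<A>(\<rho>')\<close> to \<open>\<A>'(\<rho>)\<close>. It vanishes on far modes, where it would be unbounded.\<close>

definition tm :: "int ^ 'd \<Rightarrow> complex" where
  "tm m = (if Sm m \<in> FM then 0 else of_real (wd m * wt \<rho> m / wt \<rho>' (Sm m)))"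

text \<open>For resonant k the mode m = \<open>Tt k\<close> satisfies |m| \<le> \<kappa> |k|, so the
  quotient of exponential weights is at most exp (- (\<rho>' - \<kappa> \<rho>) |k|). This decay
  absorbs the polynomial weight; it is here that \<kappa> \<rho> < \<rho>' enters.\<close>

lemma tm_bound: "\<exists>C>0. \<forall>m. norm (tm m) \<le> C"
proof -
  define a where "a = \<rho>' - \<kappa> * \<rho>"
  have a: "a > 0" using kap by (simp add: a_def)
  obtain C where C: "C > 0" "\<And>x. x \<ge> 0 \<Longrightarrow> (1 + x)\<^sup>2 * exp (- a * x) \<le> C" using exp_poly_bound[OF a] by blast
  have "norm (tm m) \<le> 8 * C" for m
  proof (cases "Sm m \<in> FM")
    case False
    let ?k = "Sm m"
    have z: "zlen m \<le> \<kappa> * zlen ?k" using zlen_Tt[OF False] by (simp add: Sm_Tt)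
    have z1: "zlen m \<le> zlen ?k" using z kap mult_left_le_one_le[of "zlen ?k" \<kappa>] by simp
    have "wd m \<le> 8 * (1 + zlen ?k)"
    proof -
      have "2 * pi * zlen m \<le> 8 * zlen ?k" using z1 pi_less_4 by (intro mult_mono) auto
      then show ?thesis by (simp add: wd_def)
    qed
    also have "\<dots> \<le> 8 * (1 + zlen ?k)\<^sup>2" using self_le_power[of "1 + zlen ?k" 2] by simp
    finally have w: "wd m \<le> 8 * (1 + zlen ?k)\<^sup>2" .
    have "wt \<rho> m / wt \<rho>' ?k = exp (\<rho> * zlen m - \<rho>' * zlen ?k)" by (simp add: wt_def exp_diff)
    also have "\<dots> \<le> exp (- a * zlen ?k)"
      using mult_left_mono[OF z, of \<rho>] rho_pos by (simp add: a_def algebra_simps)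
    finally have e: "wt \<rho> m / wt \<rho>' ?k \<le> exp (- a * zlen ?k)" .
    have "norm (tm m) = wd m * (wt \<rho> m / wt \<rho>' ?k)" using False by (simp add: tm_def norm_mult norm_divide)
    also have "\<dots> \<le> (8 * (1 + zlen ?k)\<^sup>2) * exp (- a * zlen ?k)" by (intro mult_mono w e) auto
    also have "\<dots> \<le> 8 * C" using C(2)[of "zlen ?k"] by (simp add: mult.assoc)
    finally show ?thesis .
  qed (use C in \<open>simp add: tm_def\<close>)
  then show ?thesis using C(1) by (intro exI[of _ "8 * C"]) simp
qed

section \<open>Composition with \<open>T\<close> and the normalising functional\<close>

definition zz :: "'d \<Rightarrow> 'd cf \<Rightarrow> (int ^ 'd) ell1" where
  "zz j y = reop Sm tm (cmpt j y)"

lemma zz: "ap (zz j y) m = tm m * ap y (Sm m, j)" "clin (zz j)"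
proof -
  obtain C where "C > 0 \<and> (\<forall>m. norm (tm m) \<le> C)" using tm_bound ..
  then have C: "norm (tm m) \<le> C" for m by simp
  have "inj_on Sm {j. tm j \<noteq> 0}" using bij_Sm by (auto simp: bij_def inj_def inj_on_def)
  note r = reop[OF C this]
  show "ap (zz j y) m = tm m * ap y (Sm m, j)" by (simp add: zz_def r(1))
  show "clin (zz j)" unfolding zz_def by (rule clin_comp[OF r(3) clin_cmpt])
qed

definition Th :: "'d cf \<Rightarrow> 'd cf" where
  "Th y = mkvec (\<lambda>i. \<Sum>j\<in>UNIV. cs (Tic $ i $ j) (zz j y))"

lemma ap_Th: "ap (Th y) (m, i) = tm m * (\<Sum>j\<in>UNIV. Tic $ i $ j * ap y (Sm m, j))"
  by (simp add: Th_def ap_sum zz(1) sum_distrib_left mult_ac)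

lemma clin_mkvec:
  fixes L :: "'e::finite \<Rightarrow> 'k ell1 \<Rightarrow> 'j ell1"
  assumes L: "\<And>i. clin (L i)"
  shows "clin (\<lambda>y. mkvec (\<lambda>i. L i y))"
proof -
  have "\<forall>i. \<exists>C. \<forall>x. norm (L i x) \<le> C * norm x" using L by (simp add: clin_def)
  from choice[OF this] obtain C where C: "\<forall>i. \<forall>x. norm (L i x) \<le> C i * norm x" ..
  show ?thesis
  proof (rule clinI)
    show "norm (mkvec (\<lambda>i. L i y)) \<le> (\<Sum>i\<in>UNIV. C i) * norm y" for y
      unfolding norm_mkvec sum_distrib_right using C by (intro sum_mono) simp
  qed (rule ell1_eqI, simp add: split_paired_all clin_add[OF L] clin_cs[OF L])+
qed

lemma clin_Th: "clin Th"
  unfolding Th_def by (rule clin_mkvec, rule clin_sum[OF rho_pos]) (auto intro!: clin_comp[OF clin_cs'] zz(2))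

text \<open>The point \<open>Tc *v \<theta>\<close> may leave the narrow strip, so values of the
  field are of no help there. Its Fourier series is summed after reindexing by the bijection
  \<open>Sm\<close>; absence of far modes in \<open>y\<close> matches the zeros of
  \<open>tm\<close>, which keep the coefficients bounded.\<close>

lemma T_op_eq:
  assumes y: "prj FM y = 0"
  shows "T_op T \<rho> (fldA \<rho>' y) = fldA \<rho> (em (Th y))"
  unfolding T_op_def Tic(3)
proof (rule fldA_eqI[symmetric])
  fix \<theta> :: "complex ^ 'd" and i
  assume th: "\<theta> \<in> strip \<rho>"
  have y0: "ap y (k, j) = 0" if "k \<in> FM" for k j
    using arg_cong[OF y, of "\<lambda>v. ap v (k, j)"] that by (simp add: ap_prj)
  have w1: "norm (1 / complex_of_real (wd k)) \<le> 1" for k :: "int ^ 'd" by (simp add: norm_divide wd_ge_1)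
  define e where "e = diagop (\<lambda>k :: int ^ 'd. 1 / complex_of_real (wd k))"
  have e: "ap (e a) k = ap a k / of_real (wd k)" for a k
    unfolding e_def using diagop(1)[OF w1] by simp
  define s where "s j = fs \<rho> (e (zz j y)) \<theta>" for j
  define a where "a j k = fmode k (Tc *v \<theta>) * (ap y (k, j) / of_real (wt \<rho>' k))" for j k
  have "ap (e (zz j y)) m / of_real (wt \<rho> m) * fmode m \<theta> = a j (Sm m)" for j m
  proof (cases "Sm m \<in> FM")
    case False
    have "fmode m \<theta> = fmode (Sm m) (Tc *v \<theta>)" using fmode_Tt[of "Sm m" \<theta>] by (simp add: Sm_Tt)
    then show ?thesis using False by (simp add: e zz(1) tm_def a_def)
  qed (simp add: e zz(1) tm_def a_def y0)
  then have "((\<lambda>m. a j (Sm m)) has_sum s j) UNIV" for j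
    using fs_summable(3)[OF th, of "e (zz j y)"] by (simp add: s_def)
  then have aj: "(a j has_sum s j) UNIV" for j
    using has_sum_reindex_bij_betw[OF bij_Sm, of "a j" "s j"] by simp
  have "fseries (fcoeff (fldA \<rho>' y)) (Tc *v \<theta>) = (\<chi> j. s j)"
    unfolding fseries_def
  proof (rule infsumI, unfold has_sum_vec_iff, rule allI)
    fix j
    show "((\<lambda>k. (fmode k (Tc *v \<theta>) *s fcoeff (fldA \<rho>' y) k) $ j) has_sum (\<chi> j. s j) $ j) UNIV"
      using aj[of j] by (simp add: fcoeff_fldA[OF rho'] a_def[abs_def])
  qed
  then have "(Tic *v fseries (fcoeff (fldA \<rho>' y)) (Tc *v \<theta>)) $ i = (\<Sum>j\<in>UNIV. Tic $ i $ j * s j)"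
    by (simp add: matrix_vector_mult_def)
  moreover have "cmpt i (em (Th y)) = (\<Sum>j\<in>UNIV. cs (Tic $ i $ j) (e (zz j y)))"
    by (rule ell1_eqI) (simp add: ap_em ap_sum e Th_def sum_divide_distrib)
  ultimately show "fs \<rho> (cmpt i (em (Th y))) \<theta> = (Tic *v fseries (fcoeff (fldA \<rho>' y)) (Tc *v \<theta>)) $ i"
    by (simp add: fs_sum[OF rho_pos th] fs_cs s_def)
qed

text \<open>The functional f \<mapsto> \<omega>' \<cdot> \<E> f by which \<R> normalises. All
  weights are 1 at the mode 0, so the same formula holds in primed and unprimed coordinates.\<close>

definition \<beta> :: "'d cf \<Rightarrow> complex" where
  "\<beta> z = (\<Sum>i\<in>UNIV. of_real (\<omega>' $ i) * ap z (0, i))"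

lemma beta_lin: "\<beta> (x + y) = \<beta> x + \<beta> y" "\<beta> (x - y) = \<beta> x - \<beta> y" "\<beta> (cs c x) = c * \<beta> x"
  by (simp_all add: \<beta>_def distrib_left right_diff_distrib sum.distrib sum_subtractf sum_distrib_left mult_ac)

lemma beta_bound: "norm (\<beta> z) \<le> l1norm \<omega>' * norm z"
proof -
  have "norm (\<beta> z) \<le> (\<Sum>i\<in>UNIV. \<bar>\<omega>' $ i\<bar> * norm z)"
    unfolding \<beta>_def by (rule sum_norm_le) (simp add: norm_mult ap_le_norm mult_left_mono)
  then show ?thesis by (simp add: l1norm_def sum_distrib_right)
qed

lemma beta_cst: "\<beta> (cst v) = dotp (vec_of_real \<omega>') v"
  by (simp add: \<beta>_def ap_cst dotp_def vec_of_real_def)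

lemma beta_w: "\<beta> w = 1"
proof -
  have "dotp (vec_of_real \<omega>') (vec_of_real \<omega>) = complex_of_real (dotp \<omega>' \<omega>)"
    by (simp add: dotp_def vec_of_real_def)
  then show ?thesis by (simp add: beta_cst pair)
qed

lemma tm_0: "tm 0 = 1"
  by (simp add: tm_def Sm_Tt zero_FM wt_def)

lemma beta_Th: "\<beta> (Th y) = \<beta> y / lam"
proof -
  let ?y = "\<chi> j. ap y (0, j)"
  have "\<beta> (Th y) = dotp (vec_of_real \<omega>') (Tic *v ?y)"
    by (simp add: \<beta>_def ap_Th tm_0 Sm_Tt dotp_def vec_of_real_def matrix_vector_mult_def)
  also have "lam * \<dots> = dotp (transpose Tc *v vec_of_real \<omega>') (Tic *v ?y)"
    unfolding dual by (simp add: dotp_def sum_distrib_left mult.assoc)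
  also have "\<dots> = dotp (vec_of_real \<omega>') ?y"
    unfolding dotp_transpose matrix_vector_mul_assoc Tic by simp
  also have "\<dots> = \<beta> y" by (simp add: \<beta>_def dotp_def vec_of_real_def)
  finally show ?thesis by (simp add: field_simps)
qed

lemma Th_cst: "Th (cst v) = cst (Tic *v v)"
proof (rule ell1_eqI, simp only: split_paired_all)
  fix m i
  show "ap (Th (cst v)) (m, i) = ap (cst (Tic *v v)) (m, i)"
    by (simp add: ap_Th ap_cst Sm_eq_0 tm_0 matrix_vector_mult_def)
qed

lemma cst_smult: "cst (c *s v) = cs c (cst v)"
  by (rule ell1_eqI) (simp add: split_paired_all ap_cst)

lemma Th_w: "Th w = cs (1 / lam) w"
proof -
  have "Tic *v (lam *s vec_of_real \<omega>) = vec_of_real \<omega>"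
    unfolding eig[symmetric] matrix_vector_mul_assoc Tic by simp
  then have "lam *s (Tic *v vec_of_real \<omega>) = vec_of_real \<omega>"
    by (simp only: matrix_vector_mult_scaleR[symmetric] vector_scalar_commute)
  then have "cs lam (cst (Tic *v vec_of_real \<omega>)) = w" by (simp add: cst_smult[symmetric])
  from arg_cong[OF this, of "cs (1 / lam)"] show ?thesis by (simp add: Th_cst cs_algebra)
qed

text \<open>\<open>Rh\<close> is \<open>\<R>\<close> and \<open>Lh\<close> below its derivative at \<open>\<omega>\<close>; the factor \<open>lam\<close> comes from \<open>\<omega>' \<cdot> T\<^sup>-\<^sup>1 v = (\<omega>' \<cdot> v) / \<lambda>\<^sub>1\<close>.\<close>

definition Rh :: "'d cf \<Rightarrow> 'd cf" where
  "Rh X = cs (lam / \<beta> (Wm X)) (Th (Wm X))"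

lemma renorm_eq:
  assumes X: "norm (X - w) \<le> e0"
  shows "renorm \<omega> T \<omega>' \<sigma> \<rho> \<rho>' (fldA \<rho> (em X)) = fldA \<rho> (em (Rh X))"
proof -
  let ?Y = "fldA \<rho> (em (Th (Wm X)))"
  have Y: "T_op T \<rho> (U_op \<omega> \<sigma> \<rho> \<rho>' (fldA \<rho> (em X))) = ?Y"
    unfolding U_op_eq[OF X] by (rule T_op_eq[OF Wm_resonant[OF X]])
  have "dotp (vec_of_real \<omega>') (average ?Y) = \<beta> (Th (Wm X))"
    by (simp add: average_eq_fcoeff dotp_def vec_of_real_def \<beta>_def fcoeff_fldA[OF rho_pos] ap_em wt_def)
  then have "renorm \<omega> T \<omega>' \<sigma> \<rho> \<rho>' (fldA \<rho> (em X)) = fscale (1 / (\<beta> (Wm X) / lam)) ?Y"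
    unfolding renorm_def Y Let_def by (simp add: beta_Th)
  also have "\<dots> = fldA \<rho> (em (Rh X))" by (simp add: Rh_def clin_cs[OF clin_em] fldA_cs)
  finally show ?thesis .
qed

text \<open>The derivative of \<open>Wm\<close> at \<open>w\<close>, by \<open>Wm_expansion\<close>:
  restriction to the narrower strip followed by the projection to resonant modes.\<close>

definition Jf :: "'d cf \<Rightarrow> 'd cf" where
  "Jf f = prj (- FM) (P f 0)"

lemma norm_Jf: "norm (Jf f) \<le> norm f"
proof -
  have "norm (0 :: 'd cf) \<le> 2 * \<delta>" using delta(1) by simp
  from norm_P[OF this, of f] show ?thesis unfolding Jf_def using norm_prj[of "- FM" "P f 0"] by simp
qed

lemma ap_Jf: "ap (Jf f) (k, i) = (if k \<in> FM then 0 else of_real (wt \<rho>' k / (wt \<rho> k * wd k)) * ap f (k, i))"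
  by (simp add: Jf_def ap_prj ap_P_0)

lemma beta_Jf: "\<beta> (Jf f) = \<beta> f"
  by (simp add: \<beta>_def ap_Jf zero_FM wt_def)

lemma clin_Jf: "clin Jf"
  by (rule clinI[of _ 1]) (auto intro!: ell1_eqI simp: split_paired_all ap_Jf algebra_simps add_divide_distrib norm_Jf)

definition Lh :: "'d cf \<Rightarrow> 'd cf" where
  "Lh f = cs lam (Th (Jf f)) - cs (\<beta> f) w"

lemma clin_beta: "clin (\<lambda>f. cs (\<beta> f) x)"
proof (rule clinI)
  show "norm (cs (\<beta> f) x) \<le> (l1norm \<omega>' * norm x) * norm f" for f
    using mult_right_mono[OF beta_bound[of f], of "norm x"] by (simp add: mult_ac)
qed (simp_all add: beta_lin cs_algebra)

lemma clin_Lh: "clin Lh"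
  unfolding Lh_def by (intro clin_minus2 clin_comp[OF clin_cs' clin_comp[OF clin_Th clin_Jf]] clin_beta)

text \<open>The quotient is never expanded: the remainder is multiplied by its denominator
  \<open>\<beta> (Wm (w + f))\<close>, which stays above 1 / 2 in modulus on the chosen
  ball.\<close>

lemma Rh_main:
  obtains e1 C M where "0 < e1" "e1 \<le> e0" "e1 \<le> 1" "0 \<le> C"
    "\<And>f. norm f \<le> e1 \<Longrightarrow> norm (Rh (w + f) - w - Lh f) \<le> C * (norm f)\<^sup>2"
    "\<And>X. norm (X - w) \<le> e1 \<Longrightarrow> \<beta> (Rh X) = 1 \<and> norm (Rh X) \<le> M"
    "\<And>U \<xi>. hcurve U \<xi> \<Longrightarrow> (\<And>z. z \<in> U \<Longrightarrow> norm (\<xi> z - w) \<le> e1) \<Longrightarrow> hcurve U (\<lambda>z. Rh (\<xi> z))"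
proof -
  obtain C where C: "C \<ge> 0" "\<And>f. norm f \<le> e0 \<Longrightarrow> norm (Wm (w + f) - w - Jf f) \<le> C * (norm f)\<^sup>2"
    unfolding Jf_def using Wm_expansion by blast
  obtain D where D: "D > 0" "\<And>x. norm (Th x) \<le> D * norm x" using clin_bound[OF clin_Th] by blast
  define l where "l = l1norm \<omega>'"
  have l: "l \<ge> 0" by (simp add: l_def)
  have bb: "norm (\<beta> z) \<le> l * norm z" for z unfolding l_def by (rule beta_bound)
  \<comment> \<open>The perturbation of the denominator is at most
    \<open>l * (C + 1) * norm f\<close>, so this radius keeps it below 1 / 2. The minimum with 1
    allows squares of norms to be replaced by norms.\<close>
  define e1 where "e1 = min (min e0 1) (1 / (2 * (l * (C + 1) + 1)))"
  have pos: "l * (C + 1) + 1 > 0" using l C(1) by (simp add: add_nonneg_pos)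
  have e1: "0 < e1" "e1 \<le> e0" "e1 \<le> 1" "e1 \<le> 1 / (2 * (l * (C + 1) + 1))"
    using e0 pos by (auto simp: e1_def)
  define E where "E f = Wm (w + f) - w - Jf f" for f
  have nE: "norm (E f) \<le> C * (norm f)\<^sup>2" if "norm f \<le> e1" for f
    unfolding E_def by (rule C(2)) (use that e1 in simp)
  have sq: "(norm f)\<^sup>2 \<le> norm f" if "norm f \<le> e1" for f :: "'d cf"
    using that e1(3) by (simp add: power2_eq_square mult_left_le_one_le)
  have nE1: "norm (E f) \<le> C * norm f" if "norm f \<le> e1" for f
    by (rule order_trans[OF nE[OF that] mult_left_mono[OF sq[OF that] C(1)]])
  have Wm_eq: "Wm (w + f) = w + Jf f + E f" for f by (simp add: E_def)
  have bW: "\<beta> (Wm (w + f)) = 1 + \<beta> f + \<beta> (E f)" for f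
    unfolding Wm_eq by (simp add: beta_lin beta_w beta_Jf)
  have small: "norm (\<beta> f + \<beta> (E f)) \<le> 1 / 2" if f: "norm f \<le> e1" for f
  proof -
    have "norm (\<beta> f + \<beta> (E f)) \<le> l * norm f + l * (C * norm f)"
      by (intro norm_triangle_mono order_trans[OF bb] mult_left_mono nE1 f l order_refl)
    also have "\<dots> = (l * (C + 1)) * norm f" by (simp add: algebra_simps)
    also have "\<dots> \<le> (l * (C + 1) + 1) * e1" using f l C(1) pos by (intro mult_mono) auto
    also have "\<dots> \<le> 1 / 2"
      using mult_left_mono[OF e1(4), of "l * (C + 1) + 1"] pos by (simp add: divide_simps) (simp add: algebra_simps)
    finally show ?thesis .
  qed
  have half: "norm (\<beta> (Wm (w + f))) \<ge> 1 / 2" if f: "norm f \<le> e1" for f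
  proof -
    have "1 / 2 \<le> norm (1 + x)" if "norm x \<le> 1 / 2" for x :: complex
      using norm_triangle_ineq2[of 1 "- x"] that by simp
    from this[OF small[OF f]] show ?thesis unfolding bW by (simp only: add.assoc)
  qed
  have halfX: "norm (\<beta> (Wm X)) \<ge> 1 / 2" if "norm (X - w) \<le> e1" for X
    using half[of "X - w"] that by simp
  obtain KL where KL: "KL > 0" "\<And>x. norm (Lh x) \<le> KL * norm x" using clin_bound[OF clin_Lh] by blast
  define C2 where "C2 = 2 * (cmod lam * (D * C) + l * C * l1norm \<omega> + (l + l * C) * KL)"
  define M where "M = (cmod lam / (1 / 2)) * (D * (2 * (l1norm \<omega> + 1)))"
  show ?thesis
  proof (rule that[of e1 C2 M])
    show "0 < e1" "e1 \<le> e0" "e1 \<le> 1" by fact+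
    show "0 \<le> C2" using D(1) C(1) l wpos KL(1) by (simp add: C2_def)
    show "norm (Rh (w + f) - w - Lh f) \<le> C2 * (norm f)\<^sup>2" if f: "norm f \<le> e1" for f
    proof -
      define b where "b = \<beta> (Wm (w + f))"
      have b: "norm b \<ge> 1 / 2" "b \<noteq> 0" using half[OF f] by (auto simp: b_def)
      define g where "g = cs lam (Th (Jf f))"
      have ThW: "cs lam (Th (Wm (w + f))) = w + g + cs lam (Th (E f))"
        unfolding Wm_eq g_def by (simp add: clin_add[OF clin_Th] Th_w cs_algebra)
      \<comment> \<open>After multiplication by \<open>b\<close> the zeroth and first orders cancel.
        The surviving terms contain the quadratic remainder \<open>E f\<close> or a product of two
        factors of first order.\<close>
      define num where "num = cs lam (Th (E f)) - cs (\<beta> (E f)) w - cs (\<beta> f + \<beta> (E f)) (Lh f)"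
      have "cs b (Rh (w + f) - w - Lh f) = cs lam (Th (Wm (w + f))) - cs b w - cs b (Lh f)"
        using b(2) by (simp add: Rh_def b_def[symmetric] cs_algebra)
      also have "\<dots> = num"
        unfolding ThW num_def unfolding b_def bW Lh_def g_def
        by (rule ell1_eqI) (simp add: algebra_simps)
      finally have eq: "norm b * norm (Rh (w + f) - w - Lh f) = norm num" by (metis norm_cs)
      have "norm num \<le> cmod lam * (D * (C * (norm f)\<^sup>2)) + (l * (C * (norm f)\<^sup>2)) * l1norm \<omega> + (l * norm f + l * (C * norm f)) * (KL * norm f)"
        unfolding num_def
      proof (intro norm_triangle_le_diff add_mono)
        show "norm (cs lam (Th (E f))) \<le> cmod lam * (D * (C * (norm f)\<^sup>2))"
          unfolding norm_cs using D(1) by (intro mult_left_mono order_trans[OF D(2)] nE f) auto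
        show "norm (cs (\<beta> (E f)) w) \<le> (l * (C * (norm f)\<^sup>2)) * l1norm \<omega>"
          unfolding norm_cs norm_w using wpos l by (intro mult_right_mono order_trans[OF bb] mult_left_mono nE f) auto
        show "norm (cs (\<beta> f + \<beta> (E f)) (Lh f)) \<le> (l * norm f + l * (C * norm f)) * (KL * norm f)"
          unfolding norm_cs using l C(1)
          by (intro mult_mono KL norm_triangle_mono order_trans[OF bb] mult_left_mono nE1 f) auto
      qed
      also have "\<dots> = 1 / 2 * (C2 * (norm f)\<^sup>2)"
        by (simp add: C2_def power2_eq_square algebra_simps)
      finally have n: "norm num \<le> 1 / 2 * (C2 * (norm f)\<^sup>2)" .
      have "1 / 2 * norm (Rh (w + f) - w - Lh f) \<le> norm b * norm (Rh (w + f) - w - Lh f)"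
        using b(1) by (rule mult_right_mono) simp
      then show ?thesis using eq n by simp
    qed
    show "\<beta> (Rh X) = 1 \<and> norm (Rh X) \<le> M" if X: "norm (X - w) \<le> e1" for X
    proof
      have nz: "\<beta> (Wm X) \<noteq> 0" using halfX[OF X] by auto
      show "\<beta> (Rh X) = 1" using nz by (simp add: Rh_def beta_lin beta_Th)
      have X0: "norm (X - w) \<le> e0" using X e1 by simp
      have "norm X \<le> l1norm \<omega> + 1" using norm_triangle_ineq2[of X w] X e1(3) by (simp add: norm_w)
      then have "norm (Th (Wm X)) \<le> D * (2 * (l1norm \<omega> + 1))"
        using D norm_Wm[OF X0] by (intro order_trans[OF D(2)] mult_left_mono) auto
      moreover have "norm (lam / \<beta> (Wm X)) \<le> cmod lam / (1 / 2)"
        unfolding norm_divide using halfX[OF X] nz by (intro divide_left_mono) auto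
      ultimately show "norm (Rh X) \<le> M" unfolding Rh_def norm_cs M_def using D(1) by (intro mult_mono) auto
    qed
    show "hcurve U (\<lambda>z. Rh (\<xi> z))" if h: "hcurve U \<xi>" and X: "\<And>z. z \<in> U \<Longrightarrow> norm (\<xi> z - w) \<le> e1" for U \<xi>
    proof -
      have X0: "norm (\<xi> z - w) \<le> e0" if "z \<in> U" for z using X[OF that] e1 by simp
      have hW: "hcurve U (\<lambda>z. Wm (\<xi> z))" by (rule hcurve_Wm[OF h X0])
      have "(\<lambda>z. \<beta> (Wm (\<xi> z))) holomorphic_on U"
        unfolding \<beta>_def using hW by (intro holomorphic_on_sum holomorphic_on_mult holomorphic_on_const) (simp add: hcurve_def)
      moreover have "\<beta> (Wm (\<xi> z)) \<noteq> 0" if "z \<in> U" for z using halfX[OF X[OF that]] by auto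
      ultimately have q: "(\<lambda>z. lam / \<beta> (Wm (\<xi> z))) holomorphic_on U"
        by (intro holomorphic_on_divide holomorphic_on_const)
      show ?thesis
        unfolding Rh_def
      proof (rule hcurve_cs[OF hcurve_clin[OF hW clin_Th] q])
        show "norm (lam / \<beta> (Wm (\<xi> z))) \<le> cmod lam / (1 / 2)" if "z \<in> U" for z
          unfolding norm_divide using halfX[OF X[OF that]] by (intro divide_left_mono) auto
      qed
    qed
  qed
qed

lemma Rh_cst:
  assumes "norm (cst v - w) \<le> e0"
  shows "Rh (cst v) = cs (lam / \<beta> (cst v)) (cst (Tic *v v))"
  unfolding Rh_def Wm_cst[OF assms] Th_cst ..

end

section \<open>Local dynamics at a saddle\<close>

lemma geometric_steps_convergent:
  fixes x :: "nat \<Rightarrow> 'a::banach"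
  assumes "\<And>k. norm (x (Suc k) - x k) \<le> c * m ^ k" "0 \<le> m" "m < 1"
  shows "convergent x"
proof -
  have "summable (\<lambda>k. c * m ^ k)" using assms(2,3) by (intro summable_mult summable_geometric) simp
  then have "summable (\<lambda>k. x (Suc k) - x k)" by (rule summable_comparison_test') (rule assms(1))
  from summable_LIMSEQ[OF this] have "(\<lambda>n. x n - x 0) \<longlonglongrightarrow> (\<Sum>k. x (Suc k) - x k)"
    by (simp add: sum_lessThan_telescope)
  from tendsto_add[OF this tendsto_const[of "x 0"]] have "x \<longlonglongrightarrow> (\<Sum>k. x (Suc k) - x k) + x 0" by simp
  then show ?thesis by (rule convergentI)
qed

text \<open>\<open>Ps\<close> and \<open>Pu\<close> are the spectral projections of \<open>L\<close>, \<open>B\<close> is the inverse of \<open>L\<close> on the unstable subspace, and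
  \<open>a\<close> is an adapted norm. The last assumption makes the local unstable manifold flat.\<close>

locale saddle =
  fixes L B Ps Pu Q :: "'j::countable ell1 \<Rightarrow> 'j ell1" and a :: "'j ell1 \<Rightarrow> real" and q s C1 C2 :: real
  assumes cl: "clin L" "clin B" "clin Ps" "clin Pu"
    and split: "Ps x + Pu x = x"
    and PP: "Ps (Ps x) = Ps x"
    and LP: "Ps (L x) = L (Ps x)" and PB: "Pu (B x) = B x" and BP: "B (Pu x) = B x"
    and LB: "L (B x) = Pu x" and BL: "B (L x) = Pu x"
    and a_add: "a (x + y) \<le> a x + a y" and a_cs: "a (cs c x) = cmod c * a x"
    and norm_a: "norm x \<le> C1 * a x" and a_norm: "a x \<le> C2 * norm x"
    and a_max: "a x = max (a (Ps x)) (a (Pu x))"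
    and C: "0 < C1" "0 < C2" and q: "0 < q" "q < 1" and s: "0 < s"
    and a_L: "a (L (Ps x)) \<le> q * a (Ps x)" and a_B: "a (B x) \<le> q * a (Pu x)"
    and Q0: "Q 0 = 0"
    and Qlip: "a x \<le> s \<Longrightarrow> a y \<le> s \<Longrightarrow> a (Q x - Q y) \<le> (1 - q) / 2 * a (x - y)"
    and Qh: "hcurve U \<xi> \<Longrightarrow> (\<And>z. z \<in> U \<Longrightarrow> a (\<xi> z) \<le> s) \<Longrightarrow> hcurve U (\<lambda>z. Q (\<xi> z))"
    and Qu: "a (Pu x) \<le> s \<Longrightarrow> Q (Pu x) = 0"
begin

text \<open>\<open>eta\<close> is the Lipschitz constant granted to \<open>Q\<close> and
  \<open>mu = q + eta\<close> the rate that survives the perturbation. Being the midpoint of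
  \<open>q\<close> and 1, it leaves room for the cone estimates.\<close>

definition "mu = (1 + q) / 2"
definition "eta = (1 - q) / 2"

lemma mu: "0 < mu" "mu < 1" "0 < eta" "eta < 1" "q + eta = mu" "q < mu" "q * (1 + eta) \<le> mu"
proof -
  show m: "0 < mu" "mu < 1" "0 < eta" "eta < 1" "q + eta = mu" "q < mu" using q by (auto simp: mu_def eta_def field_simps)
  have "q * eta \<le> eta" using q m by (intro mult_left_le_one_le) auto
  then show "q * (1 + eta) \<le> mu" using m(5) by (simp add: algebra_simps)
qed

lemma a_0 [simp]: "a 0 = 0" using a_cs[of 0 0] by simp
lemma a_minus: "a (- x) = a x" using a_cs[of "-1" x] by simp
lemma a_diff: "a (x - y) \<le> a x + a y" using a_add[of x "- y"] by (simp add: a_minus)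
lemma a_nonneg [simp]: "0 \<le> a x"
  using norm_a[of x] norm_ge_zero[of x] C(1) by (metis order_trans zero_le_mult_iff not_less_iff_gr_or_eq not_le)
lemma a_eq_0: "a x \<le> 0 \<Longrightarrow> x = 0"
  using norm_a[of x] C(1) a_nonneg[of x] by simp
lemma a_Ps_le: "a (Ps x) \<le> a x" and a_Pu_le: "a (Pu x) \<le> a x"
  using a_max[of x] by auto

lemma Pu_eq: "Pu x = x - Ps x" using split[of x] by (simp add: algebra_simps)

lemma proj: "Pu (Pu x) = Pu x" "Ps (Pu x) = 0" "Pu (Ps x) = 0" "Ps (B x) = 0" "Pu (L x) = L (Pu x)"
proof -
  note e = Pu_eq
  show 1: "Ps (Pu x) = 0" for x unfolding e by (simp add: clin_diff[OF cl(3)] PP)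
  show "Pu (Pu x) = Pu x" by (subst (1) e) (simp add: 1)
  show "Pu (Ps x) = 0" unfolding e by (simp add: PP)
  show "Ps (B x) = 0" using 1[of "B x"] by (simp add: PB)
  show "Pu (L x) = L (Pu x)" unfolding e by (simp add: LP clin_diff[OF cl(1)])
qed

lemma a_L_le: "a (L (Ps x)) \<le> q * a x" and a_B_le: "a (B x) \<le> q * a x"
  by (rule order_trans[OF a_L] order_trans[OF a_B], rule mult_left_mono[OF a_Ps_le] mult_left_mono[OF a_Pu_le],
      use q in simp)+

lemma a_sum_split: "Ps p = p \<Longrightarrow> a (p + B y) = max (a p) (a (B y))"
proof -
  assume p: "Ps p = p"
  have "Pu p = 0" using proj(3)[of p] by (simp add: p)
  then show ?thesis using a_max[of "p + B y"]
    by (simp add: clin_add[OF cl(3)] clin_add[OF cl(4)] p proj PB)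
qed

text \<open>The dynamics in coordinates centred at the fixed point.\<close>

definition "F x = L x + Q x"

lemma Ps_F_diff: "a x \<le> s \<Longrightarrow> a y \<le> s \<Longrightarrow> a (Ps (F x - F y)) \<le> mu * a (x - y)"
proof -
  assume xy: "a x \<le> s" "a y \<le> s"
  have eq: "F x - F y = L (x - y) + (Q x - Q y)" by (simp add: F_def clin_diff[OF cl(1)])
  have "a (Ps (F x - F y)) \<le> a (L (Ps (x - y))) + a (Ps (Q x - Q y))"
    unfolding eq clin_add[OF cl(3)] LP by (rule a_add)
  also have "\<dots> \<le> q * a (x - y) + eta * a (x - y)"
  proof (rule add_mono)
    show "a (L (Ps (x - y))) \<le> q * a (x - y)"
      by (rule a_L_le)
    show "a (Ps (Q x - Q y)) \<le> eta * a (x - y)"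
      using a_Ps_le[of "Q x - Q y"] Qlip[OF xy] by (simp add: eta_def)
  qed
  also have "\<dots> = mu * a (x - y)" by (simp add: mu(5)[symmetric] algebra_simps)
  finally show ?thesis .
qed

text \<open>Differences of orbits that lie in the unstable cone stay there and grow.\<close>

lemma Pu_F_diff:
  assumes xy: "a x \<le> s" "a y \<le> s" and c: "a (Ps (x - y)) \<le> a (Pu (x - y))"
  shows "a (Pu (x - y)) \<le> mu * a (Pu (F x - F y))"
proof -
  let ?A = "a (Pu (x - y))" and ?A' = "a (Pu (F x - F y))"
  have D: "a (x - y) = ?A" using a_max[of "x - y"] c by simp
  have "Pu (x - y) = B (F x - F y) - B (Q x - Q y)"
    by (simp add: F_def clin_diff[OF cl(2)] clin_add[OF cl(2)] BL clin_diff[OF cl(4)])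
  then have "?A \<le> a (B (F x - F y)) + a (B (Q x - Q y))" by (metis a_diff)
  also have "a (B (Q x - Q y)) \<le> q * (eta * ?A)"
  proof -
    have "a (Pu (Q x - Q y)) \<le> eta * ?A"
      using a_Pu_le[of "Q x - Q y"] Qlip[OF xy] D by (simp add: eta_def)
    then show ?thesis using a_B[of "Q x - Q y"] mult_left_mono[of _ "eta * ?A" q] q by (meson less_imp_le order_trans)
  qed
  also have "a (B (F x - F y)) \<le> q * ?A'" by (rule a_B)
  finally have 1: "(1 - q * eta) * ?A \<le> q * ?A'" by (simp add: algebra_simps)
  have t: "q * eta \<le> eta" using q mu by (intro mult_left_le_one_le) auto
  have "q * eta * mu \<le> eta" by (rule order_trans[OF mult_right_le_one_le t]) (use mu q in auto)
  \<comment> \<open>Since \<open>q * eta * mu \<le> eta\<close>, the right-hand side is at least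
    \<open>mu - eta\<close>, which is \<open>q\<close>.\<close>
  then have "q \<le> (1 - q * eta) * mu" using mu(5) by (simp add: algebra_simps)
  from mult_right_mono[OF this, of ?A'] 1 have "(1 - q * eta) * ?A \<le> (1 - q * eta) * (mu * ?A')"
    by (simp add: mult_ac)
  moreover have "0 < 1 - q * eta" using t mu(4) by linarith
  ultimately show ?thesis by simp
qed

section \<open>Invariant cones and bounded orbits\<close>

definition orbit :: "(nat \<Rightarrow> 'j ell1) \<Rightarrow> bool" where
  "orbit z \<longleftrightarrow> (\<forall>n. a (z n) \<le> s \<and> z (Suc n) = F (z n))"

lemma geometric_zero:
  assumes "\<And>k. x \<le> mu ^ k * c"
  shows "x \<le> 0"
proof -
  have "(\<lambda>k. mu ^ k * c) \<longlonglongrightarrow> 0"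
    by (intro tendsto_mult_left_zero LIMSEQ_realpow_zero) (use mu in auto)
  then show ?thesis by (rule LIMSEQ_le_const) (use assms in auto)
qed

text \<open>Were the difference of two orbits to lie in the unstable cone at one time, it would stay
  there and grow by a factor \<open>1 / mu\<close> at every step, against the bound
  \<open>2 * s\<close>.\<close>

lemma cone_forward:
  assumes z: "orbit z" "orbit z'"
  shows "a (Pu (z n - z' n)) \<le> a (Ps (z n - z' n))"
proof (rule ccontr)
  assume c: "\<not> ?thesis"
  define D where "D k = z (n + k) - z' (n + k)" for k
  have zs: "a (z m) \<le> s" "a (z' m) \<le> s" "z (Suc m) = F (z m)" "z' (Suc m) = F (z' m)" for m
    using z by (auto simp: orbit_def)
  have "a (Ps (D k)) < a (Pu (D k)) \<and> a (Pu (D 0)) \<le> mu ^ k * a (Pu (D k))" for k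
  proof (induction k)
    case 0
    then show ?case using c by (simp add: D_def)
  next
    case (Suc k)
    let ?x = "z (n + k)" and ?y = "z' (n + k)"
    have Dk: "D k = ?x - ?y" and Dk': "D (Suc k) = F ?x - F ?y" by (simp_all add: D_def zs)
    have aD: "a (D k) = a (Pu (D k))" using a_max[of "D k"] Suc by simp
    have u: "a (Pu (D k)) \<le> mu * a (Pu (D (Suc k)))"
      unfolding Dk Dk' by (rule Pu_F_diff[OF zs(1,2)]) (use Suc in \<open>simp add: Dk\<close>)
    have st: "a (Ps (D (Suc k))) \<le> mu * a (Pu (D k))"
      using Ps_F_diff[OF zs(1,2), of "n + k" "n + k"] unfolding Dk' aD[symmetric] by (simp add: Dk)
    have p: "0 < a (Pu (D k))" using Suc a_nonneg[of "Ps (D k)"] by linarith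
    then have p': "0 < a (Pu (D (Suc k)))" using u mu by (metis zero_less_mult_pos less_le_trans)
    have "mu * a (Pu (D k)) < a (Pu (D k))" using p mu by simp
    moreover have "mu * a (Pu (D (Suc k))) < a (Pu (D (Suc k)))" using p' mu by simp
    ultimately have 1: "a (Ps (D (Suc k))) < a (Pu (D (Suc k)))" using st u by linarith
    have "a (Pu (D 0)) \<le> mu ^ k * (mu * a (Pu (D (Suc k))))"
      using Suc mult_left_mono[OF u, of "mu ^ k"] mu by (meson less_imp_le order_trans zero_le_power)
    then show ?case using 1 by (simp add: mult_ac)
  qed note I = this
  have "a (Pu (D 0)) \<le> mu ^ k * (2 * s)" for k
  proof -
    have "a (Pu (D k)) \<le> 2 * s"
      using a_Pu_le[of "D k"] a_diff[of "z (n + k)" "z' (n + k)"] zs(1)[of "n + k"] zs(2)[of "n + k"] by (simp add: D_def)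
    then have "mu ^ k * a (Pu (D k)) \<le> mu ^ k * (2 * s)" using mu by (intro mult_left_mono) auto
    then show ?thesis using I[of k] by linarith
  qed
  from geometric_zero[OF this] I[of 0] a_nonneg[of "Ps (D 0)"] show False by linarith
qed

text \<open>In the stable cone the adapted norm of a difference equals that of its stable component,
  which one step contracts by \<open>mu\<close>.\<close>

lemma orbit_contract:
  assumes z: "orbit z" "orbit z'"
  shows "a (z n - z' n) \<le> mu ^ n * a (Ps (z 0 - z' 0))"
proof -
  have e: "a (z n - z' n) = a (Ps (z n - z' n))" for n
    using a_max[of "z n - z' n"] cone_forward[OF z, of n] by simp
  show ?thesis
  proof (induction n)
    case 0
    then show ?case using e[of 0] by simp
  next
    case (Suc n)
    have "a (z (Suc n) - z' (Suc n)) \<le> mu * a (z n - z' n)"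
      unfolding e[of "Suc n"] using z Ps_F_diff[of "z n" "z' n"] by (simp add: orbit_def)
    also have "\<dots> \<le> mu * (mu ^ n * a (Ps (z 0 - z' 0)))" by (rule mult_left_mono[OF Suc]) (use mu in simp)
    finally show ?case by (simp add: mult_ac)
  qed
qed

text \<open>The given orbit is compared with the explicit backward orbit of \<open>Pu (y 0)\<close>
  under \<open>B\<close>, which lies in the flat unstable subspace. The time-zero difference is
  purely stable; if it were nonzero it would remain in the stable cone and grow at every backward
  step, contradicting boundedness.\<close>

lemma backward_orbit:
  assumes y: "\<And>n. a (y n) \<le> s" "\<And>n. F (y (Suc n)) = y n"
  shows "Pu (y 0) = y 0" "y n = (B ^^ n) (y 0)"
proof -
  have main: "Ps (y 0) = 0" if y: "\<And>n. a (y n) \<le> s" "\<And>n. F (y (Suc n)) = y n" for y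
  proof -
    define v where "v = Pu (y 0)"
    define y' where "y' n = (B ^^ n) v" for n
    have Puy': "Pu (y' n) = y' n" for n by (induction n) (simp_all add: y'_def v_def proj PB)
    have ay': "a (y' n) \<le> s" for n
    proof (induction n)
      case 0
      then show ?case using a_Pu_le[of "y 0"] y(1)[of 0] by (simp add: y'_def v_def)
    next
      case (Suc n)
      have "a (y' (Suc n)) \<le> q * a (y' n)" using a_B[of "y' n"] by (simp add: y'_def Puy'[unfolded y'_def])
      also have "\<dots> \<le> a (y' n)" using q by (intro mult_left_le_one_le) auto
      finally show ?case using Suc by simp
    qed
    have Fy': "F (y' (Suc n)) = y' n" for n
    proof -
      have "Q (y' (Suc n)) = 0" using Qu[of "y' (Suc n)"] Puy'[of "Suc n"] ay'[of "Suc n"] by simp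
      moreover have "L (y' (Suc n)) = y' n" using Puy'[of n] by (simp add: y'_def LB)
      ultimately show ?thesis by (simp add: F_def)
    qed
    define D where "D k = y k - y' k" for k
    have PuD: "Pu (D 0) = 0" by (simp add: D_def y'_def v_def clin_diff[OF cl(4)] proj)
    show "Ps (y 0) = 0"
    proof (rule ccontr)
      assume ne: "Ps (y 0) \<noteq> 0"
      have PsD: "Ps (D 0) = Ps (y 0)" by (simp add: D_def y'_def v_def clin_diff[OF cl(3)] proj)
      then have p0: "0 < a (Ps (D 0))" using ne a_eq_0[of "Ps (D 0)"] by force
      have "a (Pu (D k)) < a (Ps (D k)) \<and> a (Ps (D 0)) \<le> mu ^ k * a (Ps (D k))" for k
      proof (induction k)
        case 0
        then show ?case using p0 by (simp add: PuD)
      next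
        case (Suc k)
        let ?x = "y (Suc k)" and ?y = "y' (Suc k)"
        have Dk: "D k = F ?x - F ?y" and Dk': "D (Suc k) = ?x - ?y" by (simp_all add: D_def y Fy')
        have st: "a (Ps (D k)) \<le> mu * a (D (Suc k))"
          unfolding Dk Dk' by (rule Ps_F_diff[OF y(1) ay'])
        \<comment> \<open>If the earlier difference lay in the unstable cone, one forward step would
          keep its image there, contrary to the induction hypothesis for \<open>D k\<close>.\<close>
        have 1: "a (Pu (D (Suc k))) < a (Ps (D (Suc k)))"
        proof (rule ccontr)
          assume n: "\<not> ?thesis"
          have aD: "a (D (Suc k)) = a (Pu (D (Suc k)))" using a_max[of "D (Suc k)"] n by simp
          have u: "a (Pu (D (Suc k))) \<le> mu * a (Pu (D k))"
            unfolding Dk Dk' by (rule Pu_F_diff[OF y(1) ay']) (use n in \<open>simp add: Dk'\<close>)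
          have "mu * a (Pu (D k)) \<le> a (Pu (D k))" using mu by (intro mult_left_le_one_le) auto
          moreover have "mu * a (Pu (D (Suc k))) \<le> a (Pu (D (Suc k)))" using mu by (intro mult_left_le_one_le) auto
          ultimately show False using st[unfolded aD] u Suc by linarith
        qed
        have aD: "a (D (Suc k)) = a (Ps (D (Suc k)))" using a_max[of "D (Suc k)"] 1 by simp
        have "a (Ps (D 0)) \<le> mu ^ k * (mu * a (Ps (D (Suc k))))"
          using Suc mult_left_mono[OF st, of "mu ^ k"] mu aD by (metis less_imp_le order_trans zero_le_power)
        then show ?case using 1 by (simp add: mult_ac)
      qed note I = this
      have "a (Ps (D 0)) \<le> mu ^ k * (2 * s)" for k
      proof -
        have "a (Ps (D k)) \<le> 2 * s"
          using a_Ps_le[of "D k"] a_diff[of "y k" "y' k"] y(1)[of k] ay'[of k] by (simp add: D_def)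
        then have "mu ^ k * a (Ps (D k)) \<le> mu ^ k * (2 * s)" using mu by (intro mult_left_mono) auto
        then show ?thesis using I[of k] by linarith
      qed
      from geometric_zero[OF this] p0 show False by linarith
    qed
  qed
  have Ps0: "Ps (y n) = 0" for n
    \<comment> \<open>Every tail of a backward orbit is again a backward orbit, so the claim at time
      zero yields it at every time.\<close>
    by (rule main[of "\<lambda>k. y (n + k)", simplified]) (use y(1) y(2)[of "n + _"] in simp_all)
  then have Puy: "Pu (y n) = y n" for n by (simp add: Pu_eq)
  then show "Pu (y 0) = y 0" .
  show "y n = (B ^^ n) (y 0)"
  proof (induction n)
    case (Suc n)
    have "Q (y (Suc n)) = 0" using Qu[of "y (Suc n)"] y(1)[of "Suc n"] Puy[of "Suc n"] by simp
    then have "B (y n) = B (L (y (Suc n)))" using y(2)[of n] by (simp add: F_def)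
    then have "B (y n) = y (Suc n)" by (simp add: BL Puy)
    then show ?case using Suc by simp
  qed simp
qed

lemma unstable_orbit:
  assumes "Pu v = v" "a v \<le> s"
  shows "Pu ((B ^^ n) v) = (B ^^ n) v" "a ((B ^^ n) v) \<le> q ^ n * a v" "F ((B ^^ Suc n) v) = (B ^^ n) v"
proof -
  show P: "Pu ((B ^^ n) v) = (B ^^ n) v" for n by (induction n) (simp_all add: assms PB)
  show aB: "a ((B ^^ n) v) \<le> q ^ n * a v" for n
  proof (induction n)
    case (Suc n)
    have "a ((B ^^ Suc n) v) \<le> q * a ((B ^^ n) v)" using a_B[of "(B ^^ n) v"] by (simp add: P)
    also have "\<dots> \<le> q * (q ^ n * a v)" by (rule mult_left_mono[OF Suc]) (use q in simp)
    finally show ?case by (simp add: mult_ac)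
  qed simp
  have "q ^ Suc n * a v \<le> a v" using q by (intro mult_left_le_one_le power_le_one) auto
  then have "a ((B ^^ Suc n) v) \<le> s" using aB[of "Suc n"] assms(2) by linarith
  then have "Q ((B ^^ Suc n) v) = 0" using Qu[of "(B ^^ Suc n) v"] by (simp only: P)
  moreover have "L ((B ^^ Suc n) v) = (B ^^ n) v" by (simp add: LB P)
  ultimately show "F ((B ^^ Suc n) v) = (B ^^ n) v" by (simp add: F_def)
qed

text \<open>Lyapunov--Perron iteration: the fixed points of this map on bounded sequences are the orbits in
  the \<open>s\<close>-ball whose stable component at time \<open>0\<close> is that of \<open>f\<close>.\<close>

primrec iter :: "'j ell1 \<Rightarrow> nat \<Rightarrow> nat \<Rightarrow> 'j ell1" where
  "iter f 0 = (\<lambda>n. 0)"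
| "iter f (Suc k) = (\<lambda>n. (case n of 0 \<Rightarrow> Ps f | Suc m \<Rightarrow> Ps (F (iter f k m))) + B (iter f k (Suc n) - Q (iter f k n)))"

text \<open>The geometric series with ratio \<open>mu\<close> and first term \<open>s1\<close> has
  sum \<open>s\<close>, so iterations that start at 0 with such steps never leave the
  \<open>s\<close>-ball.\<close>

definition "s1 = s * (1 - mu)"

lemma s1: "0 < s1" "s1 \<le> s" using s mu by (auto simp: s1_def algebra_simps)

text \<open>Both bounds are proved together: the step estimate needs the iterates to lie in the
  \<open>s\<close>-ball, where \<open>Qlip\<close> applies, and the position estimate sums the
  previous steps.\<close>

lemma iter_bounds:
  assumes f: "a (Ps f) \<le> s1"
  shows "a (iter f k n) \<le> s * (1 - mu ^ k) \<and> a (iter f (Suc k) n - iter f k n) \<le> mu ^ k * s1"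
proof (induction k arbitrary: n)
  case 0
  have "a (iter f (Suc 0) n) \<le> s1" for n
    using f s1 by (cases n) (simp_all add: Q0 F_def clin_0[OF cl(1)] clin_0[OF cl(2)] clin_0[OF cl(3)])
  then show ?case by simp
next
  case (Suc k)
  let ?e = "mu ^ k * s1"
  have I: "a (iter f k n) \<le> s * (1 - mu ^ k)" "a (iter f (Suc k) n - iter f k n) \<le> ?e" for n
    using Suc by blast+
  have b1: "a (iter f (Suc k) n) \<le> s * (1 - mu ^ Suc k)" for n
  proof -
    have "a (iter f (Suc k) n) \<le> a (iter f (Suc k) n - iter f k n) + a (iter f k n)"
      using a_add[of "iter f (Suc k) n - iter f k n" "iter f k n"] by simp
    also have "\<dots> \<le> ?e + s * (1 - mu ^ k)" by (intro add_mono I)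
    also have "\<dots> = s * (1 - mu ^ Suc k)" by (simp add: s1_def algebra_simps)
    finally show ?thesis .
  qed
  have le: "s * (1 - mu ^ j) \<le> s" for j using s mu by (intro mult_right_le_one_le) (auto intro: power_le_one)
  have bs: "a (iter f k n) \<le> s" "a (iter f (Suc k) n) \<le> s" for n
    using order_trans[OF I(1) le] order_trans[OF b1 le] .
  define D where "D n = iter f (Suc k) n - iter f k n" for n
  \<comment> \<open>The difference of successive iterates is split into a stable vector and an image
    under \<open>B\<close>. The adapted norm of their sum is the maximum of the two, so no factor 2
    spoils the contraction.\<close>
  define p where "p n = (case n of 0 \<Rightarrow> 0 | Suc m \<Rightarrow> Ps (F (iter f (Suc k) m) - F (iter f k m)))" for n
  have Psp: "Ps (p n) = p n" for n by (cases n) (simp_all add: p_def PP clin_0[OF cl(3)])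
  define y where "y = D (Suc n) - (Q (iter f (Suc k) n) - Q (iter f k n))"
  have eq: "iter f (Suc (Suc k)) n - iter f (Suc k) n = p n + B y"
  proof -
    have 1: "iter f (Suc j) n = (case n of 0 \<Rightarrow> Ps f | Suc m \<Rightarrow> Ps (F (iter f j m))) + B (iter f j (Suc n) - Q (iter f j n))" for j
      by (rule iter.simps(2)[THEN fun_cong])
    have "iter f (Suc (Suc k)) n - iter f (Suc k) n =
        (case n of 0 \<Rightarrow> Ps f | Suc m \<Rightarrow> Ps (F (iter f (Suc k) m))) - (case n of 0 \<Rightarrow> Ps f | Suc m \<Rightarrow> Ps (F (iter f k m)))
        + (B (iter f (Suc k) (Suc n) - Q (iter f (Suc k) n)) - B (iter f k (Suc n) - Q (iter f k n)))"
      unfolding 1[of "Suc k"] 1[of k] by simp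
    also have "\<dots> = p n + B y"
      by (cases n) (simp_all add: p_def y_def D_def clin_diff[OF cl(2)] clin_diff[OF cl(3)] del: iter.simps)
    finally show ?thesis .
  qed
  have e0: "0 \<le> ?e" using mu s1 by simp
  have "a (p n) \<le> mu * ?e"
  proof (cases n)
    case (Suc m)
    have "a (p n) \<le> mu * a (iter f (Suc k) m - iter f k m)"
      unfolding p_def Suc nat.case by (rule Ps_F_diff[OF bs(2,1)])
    also have "\<dots> \<le> mu * ?e" by (intro mult_left_mono I) (use mu in simp)
    finally show ?thesis .
  qed (use e0 mu in \<open>simp add: p_def\<close>)
  moreover have "a (B y) \<le> mu * ?e"
  proof -
    have "a (Q (iter f (Suc k) n) - Q (iter f k n)) \<le> eta * a (iter f (Suc k) n - iter f k n)"
      using Qlip[OF bs(2,1)] by (simp add: eta_def)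
    also have "\<dots> \<le> eta * ?e" by (intro mult_left_mono I) (use mu in simp)
    finally have "a y \<le> ?e + eta * ?e"
      unfolding y_def using a_diff[of "D (Suc n)" "Q (iter f (Suc k) n) - Q (iter f k n)"] I(2)[of "Suc n"]
      unfolding D_def by linarith
    have "a (B y) \<le> q * a y" by (rule a_B_le)
    also have "\<dots> \<le> q * (?e + eta * ?e)" by (intro mult_left_mono) (use \<open>a y \<le> _\<close> q in auto)
    also have "\<dots> = (q * (1 + eta)) * ?e" by (simp add: algebra_simps)
    also have "\<dots> \<le> mu * ?e" by (rule mult_right_mono[OF mu(7) e0])
    finally show ?thesis .
  qed
  ultimately have "a (iter f (Suc (Suc k)) n - iter f (Suc k) n) \<le> mu ^ Suc k * s1"
    unfolding eq a_sum_split[OF Psp] by (simp add: mult.assoc)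
  then show ?case using b1[of n] by blast
qed

lemma iter_le_s: "a (Ps f) \<le> s1 \<Longrightarrow> a (iter f k n) \<le> s"
proof -
  assume f: "a (Ps f) \<le> s1"
  have "s * (1 - mu ^ k) \<le> s" using s mu by (intro mult_right_le_one_le) (auto intro: power_le_one)
  then show ?thesis using iter_bounds[OF f, of k n] by linarith
qed

section \<open>The stable manifold as a graph\<close>

definition "zlim f n = lim (\<lambda>k. iter f k n)"

lemma zlim:
  assumes f: "a (Ps f) \<le> s1"
  shows "(\<lambda>k. iter f k n) \<longlonglongrightarrow> zlim f n"
proof -
  have "norm (iter f (Suc k) n - iter f k n) \<le> (C1 * s1) * mu ^ k" for k
  proof -
    have "norm (iter f (Suc k) n - iter f k n) \<le> C1 * a (iter f (Suc k) n - iter f k n)" by (rule norm_a)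
    also have "\<dots> \<le> C1 * (mu ^ k * s1)"
      using iter_bounds[OF f, of k n] C by (intro mult_left_mono) auto
    finally show ?thesis by (simp add: mult_ac)
  qed
  then have "convergent (\<lambda>k. iter f k n)"
    by (rule geometric_steps_convergent) (use mu in auto)
  then show ?thesis by (simp add: zlim_def convergent_LIMSEQ_iff)
qed

text \<open>Subadditivity and the bound of \<open>a\<close> by the norm replace continuity of the
  adapted norm.\<close>

lemma a_tendsto:
  assumes "x \<longlonglongrightarrow> l" "\<And>k. a (x k) \<le> c"
  shows "a l \<le> c"
proof -
  have "a l \<le> C2 * norm (l - x k) + c" for k
    using a_add[of "l - x k" "x k"] a_norm[of "l - x k"] assms(2)[of k] by simp
  moreover have "(\<lambda>k. C2 * norm (l - x k) + c) \<longlonglongrightarrow> C2 * norm (l - l) + c"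
    by (intro tendsto_intros assms(1))
  ultimately show ?thesis using LIMSEQ_le_const[of "\<lambda>k. C2 * norm (l - x k) + c" "C2 * norm (l - l) + c" "a l"] by auto
qed

lemma Q_tendsto:
  assumes x: "x \<longlonglongrightarrow> l" "\<And>k. a (x k) \<le> s"
  shows "(\<lambda>k. Q (x k)) \<longlonglongrightarrow> Q l"
proof (rule Lim_null[THEN iffD2], rule Lim_null_comparison[OF always_eventually, rule_format])
  have al: "a l \<le> s" by (rule a_tendsto[OF x])
  show "norm (Q (x k) - Q l) \<le> C1 * (eta * (C2 * norm (x k - l)))" for k
  proof -
    have "norm (Q (x k) - Q l) \<le> C1 * a (Q (x k) - Q l)" by (rule norm_a)
    also have "\<dots> \<le> C1 * (eta * a (x k - l))"
      using Qlip[OF x(2) al] C by (intro mult_left_mono) (auto simp: eta_def)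
    also have "\<dots> \<le> C1 * (eta * (C2 * norm (x k - l)))"
      using C mu by (intro mult_left_mono a_norm) auto
    finally show ?thesis .
  qed
  have "(\<lambda>k. C1 * (eta * (C2 * norm (x k - l)))) \<longlonglongrightarrow> C1 * (eta * (C2 * norm (l - l)))"
    by (intro tendsto_intros x)
  then show "(\<lambda>k. C1 * (eta * (C2 * norm (x k - l)))) \<longlonglongrightarrow> 0" by simp
qed

lemma clin_tendsto: "clin T \<Longrightarrow> x \<longlonglongrightarrow> l \<Longrightarrow> (\<lambda>k. T (x k)) \<longlonglongrightarrow> T l"
  by (rule bounded_linear.tendsto[OF clin_blin])

text \<open>The limit solves the Lyapunov-Perron equation. Its stable component is the dynamics from
  the prescribed start; applying \<open>L\<close> to its unstable component and using
  \<open>LB\<close> turns the backward formula into the forward dynamics.\<close>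

lemma zlim_orbit:
  assumes f: "a (Ps f) \<le> s1"
  shows "orbit (zlim f)" "Ps (zlim f 0) = Ps f"
proof -
  note t = zlim[OF f] and tQ = Q_tendsto[OF zlim[OF f] iter_le_s[OF f]]
  have az: "a (zlim f n) \<le> s" for n by (rule a_tendsto[OF t iter_le_s[OF f]])
  have fix0: "zlim f n = (case n of 0 \<Rightarrow> Ps f | Suc m \<Rightarrow> Ps (F (zlim f m))) + B (zlim f (Suc n) - Q (zlim f n))" for n
  proof (rule LIMSEQ_unique)
    show "(\<lambda>k. iter f (Suc k) n) \<longlonglongrightarrow> zlim f n" by (rule LIMSEQ_Suc[OF t])
    have 1: "(\<lambda>k. B (iter f k (Suc n) - Q (iter f k n))) \<longlonglongrightarrow> B (zlim f (Suc n) - Q (zlim f n))"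
      by (intro clin_tendsto[OF cl(2)] tendsto_diff t tQ)
    have 2: "(\<lambda>k. case n of 0 \<Rightarrow> Ps f | Suc m \<Rightarrow> Ps (F (iter f k m))) \<longlonglongrightarrow> (case n of 0 \<Rightarrow> Ps f | Suc m \<Rightarrow> Ps (F (zlim f m)))"
    proof (cases n)
      case (Suc m)
      have "(\<lambda>k. Ps (F (iter f k m))) \<longlonglongrightarrow> Ps (F (zlim f m))"
        unfolding F_def by (intro clin_tendsto[OF cl(3)] tendsto_add clin_tendsto[OF cl(1)] t tQ)
      then show ?thesis by (simp add: Suc)
    qed simp
    show "(\<lambda>k. iter f (Suc k) n) \<longlonglongrightarrow> (case n of 0 \<Rightarrow> Ps f | Suc m \<Rightarrow> Ps (F (zlim f m))) + B (zlim f (Suc n) - Q (zlim f n))"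
      unfolding iter.simps(2) by (rule tendsto_add[OF 2 1])
  qed
  have Psz: "Ps (zlim f n) = (case n of 0 \<Rightarrow> Ps f | Suc m \<Rightarrow> Ps (F (zlim f m)))" for n
    by (subst fix0) (cases n, simp_all add: clin_add[OF cl(3)] PP proj)
  show "Ps (zlim f 0) = Ps f" using Psz[of 0] by simp
  have Puz: "Pu (zlim f n) = B (zlim f (Suc n) - Q (zlim f n))" for n
    by (subst fix0) (cases n, simp_all add: clin_add[OF cl(4)] PB proj)
  have "Pu (zlim f (Suc n)) = Pu (F (zlim f n))" for n
  proof -
    have "L (Pu (zlim f n)) = Pu (zlim f (Suc n)) - Pu (Q (zlim f n))"
      unfolding Puz[of n] LB by (rule clin_diff[OF cl(4)])
    then show ?thesis by (simp add: F_def clin_add[OF cl(4)] proj(5) algebra_simps)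
  qed
  moreover have "Ps (zlim f (Suc n)) = Ps (F (zlim f n))" for n using Psz[of "Suc n"] by simp
  ultimately have "zlim f (Suc n) = F (zlim f n)" for n by (metis split)
  then show "orbit (zlim f)" using az by (simp add: orbit_def)
qed

text \<open>The unstable component of the confined orbit over \<open>Ps f\<close>. It is taken as a
  function on the whole space that depends on \<open>Ps f\<close> only, which makes the
  straightening chart explicitly invertible.\<close>

definition "gr f = Pu (zlim f 0)"

lemma gr_proj: "Ps (gr f) = 0" "Pu (gr f) = gr f"
  by (simp_all add: gr_def proj)

lemma zlim_0: "a (Ps f) \<le> s1 \<Longrightarrow> zlim f 0 = Ps f + gr f"
  using split[of "zlim f 0"] zlim_orbit(2)[of f] by (simp add: gr_def)

lemma iter_Ps:
  assumes "Ps f = Ps f'"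
  shows "iter f k = iter f' k"
  by (induction k) (simp_all add: assms cong: nat.case_cong)

lemma gr_Ps:
  assumes "Ps f = Ps f'"
  shows "gr f = gr f'"
  by (simp only: gr_def zlim_def iter_Ps[OF assms])

text \<open>\<open>orbit_contract\<close> at time 0 bounds the distance of two orbits by that of
  their stable components, so the orbit over a given stable component is unique.\<close>

lemma orbit_gr:
  assumes "orbit z" "a (Ps (z 0)) \<le> s1"
  shows "Pu (z 0) = gr (z 0)"
proof -
  have "a (z 0 - zlim (z 0) 0) \<le> 0"
    using orbit_contract[OF assms(1) zlim_orbit(1)[OF assms(2)], of 0] zlim_orbit(2)[OF assms(2)]
    by (simp add: clin_diff[OF cl(3)])
  then have "z 0 = zlim (z 0) 0" using a_eq_0 by fastforce
  then show ?thesis unfolding gr_def by (rule arg_cong)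
qed

lemma gr_lipschitz:
  assumes "a (Ps f) \<le> s1" "a (Ps f') \<le> s1"
  shows "norm (gr f - gr f') \<le> C1 * C2 * norm (f - f')"
proof -
  have "a (gr f - gr f') \<le> a (zlim f 0 - zlim f' 0)"
    unfolding gr_def clin_diff[OF cl(4), symmetric] by (rule a_Pu_le)
  also have "\<dots> \<le> a (Ps (zlim f 0 - zlim f' 0))"
    using orbit_contract[OF zlim_orbit(1)[OF assms(1)] zlim_orbit(1)[OF assms(2)], of 0] by simp
  also have "Ps (zlim f 0 - zlim f' 0) = Ps (f - f')"
    by (simp add: clin_diff[OF cl(3)] zlim_orbit(2) assms)
  also have "a (Ps (f - f')) \<le> C2 * norm (f - f')" by (rule order_trans[OF a_Ps_le a_norm])
  finally have "C1 * a (gr f - gr f') \<le> C1 * (C2 * norm (f - f'))" by (rule mult_left_mono) (use C in simp)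
  then show ?thesis using norm_a[of "gr f - gr f'"] by (simp add: mult.assoc)
qed

lemma gr_bound: "a (Ps f) \<le> s1 \<Longrightarrow> norm (gr f) \<le> C1 * s"
proof -
  assume f: "a (Ps f) \<le> s1"
  have "a (gr f) \<le> s" using zlim_orbit(1)[OF f] a_Pu_le[of "zlim f 0"] by (auto simp: orbit_def gr_def intro: order_trans)
  then show ?thesis using norm_a[of "gr f"] mult_left_mono[of "a (gr f)" s C1] C by linarith
qed

text \<open>Each Lyapunov-Perron iterate is holomorphic in the parameter, all share one bound, and
  \<open>gr\<close> is the projection of their limit.\<close>

lemma hcurve_gr:
  assumes h: "hcurve U \<xi>" and s1: "\<And>z. z \<in> U \<Longrightarrow> a (Ps (\<xi> z)) \<le> s1"
  shows "hcurve U (\<lambda>z. gr (\<xi> z))"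
proof -
  have it: "hcurve U (\<lambda>z. iter (\<xi> z) k n)" for k n
  proof (induction k arbitrary: n)
    case 0
    then show ?case by (simp add: hcurve_const hcurve_open[OF h])
  next
    case (Suc k)
    have Q: "hcurve U (\<lambda>z. Q (iter (\<xi> z) k n))" for n
      by (rule Qh[OF Suc iter_le_s[OF s1]])
    have 1: "hcurve U (\<lambda>z. B (iter (\<xi> z) k (Suc n) - Q (iter (\<xi> z) k n)))"
      by (rule hcurve_clin[OF hcurve_diff[OF Suc Q] cl(2)])
    have "hcurve U (\<lambda>z. case n of 0 \<Rightarrow> Ps (\<xi> z) | Suc m \<Rightarrow> Ps (F (iter (\<xi> z) k m)))"
    proof (cases n)
      case 0
      then show ?thesis using hcurve_clin[OF h cl(3)] by simp
    next
      case (Suc m)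
      show ?thesis unfolding Suc nat.case F_def
        by (rule hcurve_clin[OF hcurve_add[OF hcurve_clin[OF Suc.IH cl(1)] Q] cl(3)])
    qed
    from hcurve_add[OF this 1] show ?case by simp
  qed
  show ?thesis
    unfolding gr_def
  proof (rule hcurve_clin[OF _ cl(4)], rule hcurve_limit[OF hcurve_open[OF h] it])
    show "(\<lambda>k. iter (\<xi> z) k 0) \<longlonglongrightarrow> zlim (\<xi> z) 0" if "z \<in> U" for z by (rule zlim[OF s1[OF that]])
    show "norm (iter (\<xi> z) k 0) \<le> C1 * s" if "z \<in> U" for z k
      using norm_a[of "iter (\<xi> z) k 0"] mult_left_mono[OF iter_le_s[OF s1[OF that]], of C1 k 0] C by linarith
  qed
qed

text \<open>For |z| = 1 the equation L x - z x = y is rewritten as x = K x + M y, dividing by z on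
  the stable part and applying \<open>B\<close> on the unstable part. Then \<open>K\<close>
  contracts the adapted norm by \<open>q\<close>, and a Neumann series solves the equation.\<close>

lemma resolvent_exists:
  assumes z: "cmod z = 1"
  obtains S where "clin S" "\<And>x. S (L x - cs z x) = x" "\<And>x. L (S x) - cs z (S x) = x"
proof -
  have z0: "z \<noteq> 0" "cmod (inverse z) = 1" "inverse z * z = 1" "z * inverse z = 1"
  proof -
    show "z \<noteq> 0" using z by auto
    then show "inverse z * z = 1" "z * inverse z = 1" by simp_all
  qed (simp add: z norm_inverse)
  define K where "K x = cs (inverse z) (L (Ps x)) + B (cs z x)" for x
  define M where "M y = B y - cs (inverse z) (Ps y)" for y
  have K: "clin K" unfolding K_def
    by (intro clin_sum2 clin_comp[OF clin_cs'] clin_comp[OF cl(1)] cl clin_comp[OF cl(2) clin_cs'])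
  have M: "clin M" unfolding M_def
    by (intro clin_minus2 clin_comp[OF clin_cs' cl(3)] cl)
  have aK: "a (K x) \<le> q * a x" for x
  proof -
    have "Ps (cs (inverse z) (L (Ps x))) = cs (inverse z) (L (Ps x))"
      by (simp add: clin_cs[OF cl(3)] LP PP)
    from a_sum_split[OF this, of "cs z x"] have "a (K x) = max (a (L (Ps x))) (a (B (cs z x)))"
      by (simp add: K_def a_cs z0)
    moreover have "a (L (Ps x)) \<le> q * a x" by (rule a_L_le)
    moreover have "a (B (cs z x)) \<le> q * a x"
      using a_B_le[of "cs z x"] by (simp add: a_cs z)
    ultimately show ?thesis by simp
  qed
  have eqv: "L x - cs z x = y \<longleftrightarrow> x = K x + M y" for x y
  proof
    assume y: "L x - cs z x = y"
    have "B y = Pu x - B (cs z x)" by (simp add: y[symmetric] clin_diff[OF cl(2)] BL)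
    then have 1: "B y + B (cs z x) = Pu x" by simp
    have "cs (inverse z) (Ps y) = cs (inverse z) (L (Ps x)) - Ps x"
      by (simp add: y[symmetric] clin_diff[OF cl(3)] LP clin_cs[OF cl(3)] cs_algebra z0)
    then have 2: "cs (inverse z) (L (Ps x)) - cs (inverse z) (Ps y) = Ps x" by simp
    have "K x + M y = (cs (inverse z) (L (Ps x)) - cs (inverse z) (Ps y)) + (B y + B (cs z x))"
      by (simp add: K_def M_def)
    then show "x = K x + M y" unfolding 1 2 split by (rule sym)
  next
    assume x: "x = K x + M y"
    have 1: "Ps x = cs (inverse z) (L (Ps x)) - cs (inverse z) (Ps y)"
      by (subst x) (simp add: K_def M_def clin_add[OF cl(3)] clin_diff[OF cl(3)] clin_cs[OF cl(3)] LP PP proj)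
    have 2: "Pu x = B (cs z x) + B y"
      by (subst x) (simp add: K_def M_def clin_add[OF cl(4)] clin_diff[OF cl(4)] clin_cs[OF cl(4)] proj PB clin_0[OF cl(1)])
    have "cs z (Ps x) = L (Ps x) - Ps y"
      by (subst 1) (simp add: cs_algebra z0)
    then have s': "L (Ps x) - cs z (Ps x) = Ps y" by simp
    have "L (Pu x) = cs z (Pu x) + Pu y"
      by (subst 2) (simp add: clin_add[OF cl(1)] LB clin_cs[OF cl(4)])
    then have "L (Ps x + Pu x) - cs z (Ps x + Pu x) = Ps y + Pu y"
      unfolding clin_add[OF cl(1)] cs_algebra using s' by (simp add: algebra_simps)
    then show "L x - cs z x = y" by (simp only: split)
  qed
  have uniq: "x = x'" if "x = K x + M y" "x' = K x' + M y" for x x' y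
  proof -
    have "x - x' = K (x - x')" using that by (simp add: clin_diff[OF K]) (metis add_diff_cancel_right)
    then have "a (x - x') \<le> q * a (x - x')" using aK[of "x - x'"] by simp
    then have "(1 - q) * a (x - x') \<le> 0" by (simp add: algebra_simps)
    then have "a (x - x') \<le> 0" using q by (simp add: mult_le_0_iff)
    then show ?thesis using a_eq_0[of "x - x'"] by simp
  qed
  have ex: "\<exists>x. x = K x + M y" for y
  proof -
    \<comment> \<open>The terms of the Neumann series for the inverse of \<open>1 - K\<close>,
      applied to \<open>M y\<close>.\<close>
    define t where "t n = (K ^^ n) (M y)" for n
    have at: "a (t n) \<le> q ^ n * a (M y)" for n
    proof (induction n)
      case (Suc n)
      have "a (t (Suc n)) \<le> q * a (t n)" using aK[of "t n"] by (simp add: t_def)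
      also have "\<dots> \<le> q * (q ^ n * a (M y))" by (rule mult_left_mono[OF Suc]) (use q in simp)
      finally show ?case by (simp add: mult_ac)
    qed (simp add: t_def)
    have nt: "norm (t n) \<le> (C1 * a (M y)) * q ^ n" for n
      using order_trans[OF norm_a mult_left_mono[OF at[of n], of C1]] C by (simp add: mult_ac)
    have "summable (\<lambda>n. (C1 * a (M y)) * q ^ n)" using q by (intro summable_mult summable_geometric) simp
    then have t: "summable t" by (rule summable_comparison_test') (rule nt)
    have t0: "t 0 = M y" by (simp add: t_def)
    have "K (\<Sum>n. t n) = (\<Sum>n. K (t n))" by (rule bounded_linear.suminf[OF clin_blin[OF K] t])
    also have "\<dots> = (\<Sum>n. t (Suc n))" by (simp add: t_def)
    also have "\<dots> = (\<Sum>n. t n) - M y" using suminf_split_head[OF t] t0 by simp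
    finally show ?thesis by (intro exI[of _ "\<Sum>n. t n"]) simp
  qed
  then have "\<forall>y. \<exists>x. x = K x + M y" ..
  from choice[OF this] obtain S where S: "\<forall>y. S y = K (S y) + M y" ..
  \<comment> \<open>A solution is merely chosen for each \<open>y\<close>; uniqueness makes the
    choice linear.\<close>
  have S': "S y = K (S y) + M y" for y using S by simp
  have aS: "(1 - q) * a (S y) \<le> a (M y)" for y
    using S'[of y] a_add[of "K (S y)" "M y"] aK[of "S y"] by (simp add: algebra_simps)
  obtain CM where CM: "CM > 0" "\<And>x. norm (M x) \<le> CM * norm x" using clin_bound[OF M] by blast
  show ?thesis
  proof (rule that[of S])
    show "L (S x) - cs z (S x) = x" for x using S'[of x] by (simp only: eqv)
    show "S (L x - cs z x) = x" for x
      by (rule uniq[OF S']) (simp only: eqv[symmetric])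
    show "clin S"
    proof (rule clinI)
      show "S (x + y) = S x + S y" for x y
      proof (rule uniq[OF S'])
        show "S x + S y = K (S x + S y) + M (x + y)"
          unfolding clin_add[OF K] clin_add[OF M] using S'[of x] S'[of y] by (metis add.assoc add.left_commute)
      qed
      show "S (cs c x) = cs c (S x)" for c x
      proof (rule uniq[OF S'])
        show "cs c (S x) = K (cs c (S x)) + M (cs c x)"
          unfolding clin_cs[OF K] clin_cs[OF M] cs_algebra(1)[symmetric] using S'[of x] by simp
      qed
      show "norm (S y) \<le> (C1 * (C2 * CM / (1 - q))) * norm y" for y
      proof -
        have "(1 - q) * a (S y) \<le> C2 * (CM * norm y)"
          using aS[of y] a_norm[of "M y"] mult_left_mono[OF CM(2)[of y], of C2] C by linarith
        then have "a (S y) \<le> C2 * (CM * norm y) / (1 - q)" using q by (simp add: pos_le_divide_eq mult.commute)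
        then have "C1 * a (S y) \<le> C1 * (C2 * (CM * norm y) / (1 - q))" using C by (intro mult_left_mono) auto
        then show ?thesis using norm_a[of "S y"] by (simp add: mult_ac)
      qed
    qed
  qed
qed

end

section \<open>The spectral splitting of the renormalisation operator\<close>

lemma dotp_commute: "dotp x y = dotp y x"
  by (simp add: dotp_def mult.commute)

lemma dotp_vec_of_real: "dotp (vec_of_real x) (vec_of_real y) = of_real (dotp x y)"
  by (simp add: dotp_def vec_of_real_def)

lemma norm_dotp_le: "cmod (dotp (vec_of_real x) v) \<le> l1norm x * b" if "\<And>i. cmod (v $ i) \<le> b"
  unfolding dotp_def l1norm_def sum_distrib_right
  by (rule sum_norm_le) (use that in \<open>auto simp: norm_mult vec_of_real_def intro!: mult_left_mono\<close>)

definition m0 :: "'d::finite cf \<Rightarrow> complex ^ 'd" where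
  "m0 f = (\<chi> i. ap f (0, i))"

lemma m0_simps: "m0 (f + g) = m0 f + m0 g" "m0 (f - g) = m0 f - m0 g" "m0 (cs c f) = c *s m0 f" "m0 (cst v) = v" "m0 0 = 0"
  by (simp_all add: m0_def vec_eq_iff ap_cst)

lemma prj_0: "prj {0} f = cst (m0 f)"
  by (rule ell1_eqI) (auto simp: split_paired_all ap_prj ap_cst m0_def)

locale hyperbolic_renormalisation = renormalisation \<omega> \<sigma> \<rho> \<rho>' \<omega>' T lam \<kappa>
  for \<omega> :: "real ^ 'd::finite" and \<sigma> \<rho> \<rho>' :: real and \<omega>' T lam \<kappa> +
  assumes hyp: "{x. dotp \<omega> x = 0} \<subseteq> contracted_cone T \<kappa>"
begin

text \<open>Projects onto the constant fields v with \<omega>' \<cdot> v = 0: the average minus its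
  part along \<omega>. The direction \<omega> belongs to the stable part, since the normalisation
  makes \<open>Lh\<close> annihilate it.\<close>

definition Pu :: "'d cf \<Rightarrow> 'd cf" where "Pu f = prj {0} f - cs (\<beta> f) w"
definition Ps :: "'d cf \<Rightarrow> 'd cf" where "Ps f = f - Pu f"
definition Bu :: "'d cf \<Rightarrow> 'd cf" where "Bu f = cs (1 / lam) (cst (Tc *v m0 (Pu f)))"

lemma beta_m0: "\<beta> f = dotp (vec_of_real \<omega>') (m0 f)"
  by (simp add: \<beta>_def dotp_def m0_def vec_of_real_def)

lemma m0_Pu: "m0 (Pu f) = m0 f - \<beta> f *s vec_of_real \<omega>"
  by (simp add: Pu_def prj_0 m0_simps)

lemma Pu_cst_m0: "Pu f = cst (m0 (Pu f))"
proof -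
  have "cs (\<beta> f) w = cst (\<beta> f *s vec_of_real \<omega>)" by (simp add: cst_smult)
  then have "Pu f = cst (m0 f) - cst (\<beta> f *s vec_of_real \<omega>)" by (simp add: Pu_def prj_0)
  moreover have "cst u - cst v = cst (u - v)" for u v :: "complex ^ 'd"
    by (rule ell1_eqI) (simp add: split_paired_all ap_cst)
  ultimately show ?thesis by (simp add: m0_simps)
qed

lemma beta_Pu: "\<beta> (Pu f) = 0"
  by (simp add: Pu_def beta_lin beta_w) (simp add: beta_m0 prj_0 m0_simps)

lemma Pu_cst: "\<beta> (cst v) = 0 \<Longrightarrow> Pu (cst v) = cst v"
  by (simp add: Pu_def prj_0 m0_simps)

lemma Pu_Pu: "Pu (Pu f) = Pu f"
  using Pu_cst[of "m0 (Pu f)"] beta_Pu[of f] by (simp add: Pu_cst_m0[symmetric])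

lemma clin_Pu: "clin Pu" and clin_Ps: "clin Ps"
proof -
  show u: "clin Pu" unfolding Pu_def by (intro clin_minus2 clin_prj clin_beta)
  show "clin Ps" unfolding Ps_def by (intro clin_minus2 clin_id u)
qed

lemma Jf_cst: "Jf (cst v) = cst v"
  by (rule ell1_eqI) (auto simp: split_paired_all ap_Jf ap_cst zero_FM wt_def wd_def)

lemma Lh_cst: "\<beta> (cst v) = 0 \<Longrightarrow> Lh (cst v) = cs lam (cst (Tic *v v))"
  by (simp add: Lh_def Jf_cst Th_cst)

lemma beta_Tic: "\<beta> (cst (Tic *v v)) = \<beta> (cst v) / lam"
  using beta_Th[of "cst v"] by (simp add: Th_cst)

lemma beta_Tc: "\<beta> (cst (Tc *v v)) = lam * \<beta> (cst v)"
  using beta_Tic[of "Tc *v v"] by (simp add: matrix_vector_mul_assoc Tic)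

lemma Lh_w: "Lh w = 0"
  by (simp add: Lh_def Jf_cst Th_w beta_w cs_algebra)

lemma beta_Lh: "\<beta> (Lh f) = 0"
  by (simp add: Lh_def beta_lin beta_w beta_Th beta_Jf)

text \<open>\<open>Sm\<close> fixes 0, so the constant mode of the image depends on the constant
  mode alone.\<close>

lemma m0_Lh: "m0 f = 0 \<Longrightarrow> m0 (Lh f) = 0"
proof -
  assume 0: "m0 f = 0"
  have "ap f (0, i) = 0" for i using arg_cong[OF 0, of "\<lambda>v. v $ i"] by (simp add: m0_def)
  then have "ap (Jf f) (0, i) = 0" for i by (simp add: ap_Jf)
  moreover have "\<beta> f = 0" by (simp add: beta_m0 0 dotp_def)
  ultimately show ?thesis by (simp add: m0_def vec_eq_iff Lh_def ap_Th Sm_Tt)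
qed

lemma decomp: "f = Pu f + cs (\<beta> f) w + (f - prj {0} f)"
  by (simp add: Pu_def)

lemma m0_nonconst: "m0 (f - prj {0} f) = 0"
  by (simp add: prj_0 m0_simps)

lemma Pu_m0: "m0 f = 0 \<Longrightarrow> Pu f = 0"
  using clin_0[OF clin_prj] by (simp add: Pu_def prj_0 beta_m0 dotp_def ell1_eqI[of "cst 0" 0] split_paired_all ap_cst)

lemma Lh_cst_ex: "\<beta> (cst v) = 0 \<Longrightarrow> Pu (Lh (cst v)) = Lh (cst v)"
  by (simp add: Lh_cst cst_smult[symmetric], rule Pu_cst) (simp add: cst_smult beta_lin beta_Tic)

lemma Pu_Lh: "Pu (Lh f) = Lh (Pu f)"
proof -
  let ?n = "f - prj {0} f"
  have "Lh f = Lh (Pu f) + Lh ?n"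
    by (subst decomp[of f]) (simp only: clin_add[OF clin_Lh] clin_cs[OF clin_Lh] Lh_w cs_simps add_0_right)
  moreover have "Pu (Lh ?n) = 0" by (rule Pu_m0[OF m0_Lh[OF m0_nonconst]])
  moreover have "Pu (Lh (Pu f)) = Lh (Pu f)"
    using Lh_cst_ex[of "m0 (Pu f)"] beta_Pu[of f] by (simp add: Pu_cst_m0[symmetric])
  ultimately show ?thesis by (simp add: clin_add[OF clin_Pu])
qed

lemma Bu_cst: "Bu f = cst ((1 / lam) *s (Tc *v m0 (Pu f)))"
  by (simp add: Bu_def cst_smult)

lemma beta_Bu: "\<beta> (Bu f) = 0"
proof -
  have "\<beta> (cst (m0 (Pu f))) = 0" using beta_Pu[of f] by (simp add: Pu_cst_m0[symmetric])
  then show ?thesis by (simp add: Bu_def beta_lin beta_Tc)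
qed

lemma Pu_Bu: "Pu (Bu f) = Bu f"
  unfolding Bu_cst by (rule Pu_cst) (use beta_Bu[of f] in \<open>simp add: Bu_cst\<close>)

lemma Bu_Pu: "Bu (Pu f) = Bu f"
  by (simp add: Bu_def Pu_Pu)

lemma mult_smult: "A *v (c *s v) = c *s (A *v v)" for A :: "complex ^ 'd ^ 'd"
  by (simp add: matrix_vector_mult_def vec_eq_iff sum_distrib_left mult_ac)

lemma Lh_Bu: "Lh (Bu f) = Pu f"
proof -
  have "Lh (Bu f) = cs lam (cst (Tic *v ((1 / lam) *s (Tc *v m0 (Pu f)))))"
    unfolding Bu_cst by (rule Lh_cst) (use beta_Bu[of f] in \<open>simp add: Bu_cst\<close>)
  also have "\<dots> = cst (m0 (Pu f))"
    by (simp add: mult_smult cst_smult cs_algebra matrix_vector_mul_assoc Tic)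
  finally show ?thesis by (simp add: Pu_cst_m0[symmetric])
qed

lemma Bu_Lh: "Bu (Lh f) = Pu f"
proof -
  have "\<beta> (cst (m0 (Pu f))) = 0" using beta_Pu[of f] by (simp add: Pu_cst_m0[symmetric])
  from Lh_cst[OF this] have "Pu (Lh f) = cst (lam *s (Tic *v m0 (Pu f)))"
    by (simp add: Pu_Lh Pu_cst_m0[symmetric] cst_smult)
  then have "Bu (Lh f) = cst (m0 (Pu f))"
    unfolding Bu_def by (simp add: m0_simps mult_smult cst_smult cs_algebra matrix_vector_mul_assoc Tic)
  then show ?thesis by (simp add: Pu_cst_m0[symmetric])
qed

lemma clin_Bu: "clin Bu"
proof -
  have 1: "Bu f = cs (1 / lam) (mkvec (\<lambda>i. \<Sum>j\<in>UNIV. cs (Tc $ i $ j) (cmpt j (Pu f))))" for f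
  proof (rule ell1_eqI, simp only: split_paired_all)
    fix k i
    have "ap (Pu f) (k, j) = (if k = 0 then m0 (Pu f) $ j else 0)" for j
      by (subst Pu_cst_m0) (rule ap_cst)
    then show "ap (Bu f) (k, i) = ap (cs (1 / lam) (mkvec (\<lambda>i. \<Sum>j\<in>UNIV. cs (Tc $ i $ j) (cmpt j (Pu f))))) (k, i)"
      by (simp add: Bu_def ap_cst ap_sum matrix_vector_mult_def)
  qed
  have 2: "clin (\<lambda>f. mkvec (\<lambda>i. \<Sum>j\<in>UNIV. cs (Tc $ i $ j) (cmpt j (Pu f))))"
    by (rule clin_mkvec, rule clin_sum[OF rho_pos]) (auto intro!: clin_comp[OF clin_cs'] clin_comp[OF clin_cmpt] clin_Pu)
  show ?thesis unfolding 1[abs_def] by (rule clin_comp[OF clin_cs' 2])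
qed

text \<open>The unstable directions form the dual of the hyperplane \<open>\<omega>\<^sup>\<bottom>\<close>, on which the transpose of \<open>T\<close>
  contracts the \<open>\<ell>\<^sup>1\<close>-norm; this is the dual norm.\<close>

definition Hyp :: "(real ^ 'd) set" where "Hyp = {x. dotp \<omega> x = 0 \<and> l1norm x \<le> 1}"

definition nu :: "'d cf \<Rightarrow> real" where
  "nu f = (SUP x\<in>Hyp. cmod (dotp (vec_of_real x) (m0 f)))"

lemma Hyp_0: "0 \<in> Hyp"
  by (simp add: Hyp_def dotp_def l1norm_def)

lemma ap_m0: "cmod (m0 f $ i) \<le> norm f"
  by (simp add: m0_def ap_le_norm)

lemma nu_upper: "x \<in> Hyp \<Longrightarrow> cmod (dotp (vec_of_real x) (m0 f)) \<le> nu f"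
  unfolding nu_def
proof (rule cSUP_upper)
  show "bdd_above ((\<lambda>x. cmod (dotp (vec_of_real x) (m0 f))) ` Hyp)"
  proof (rule bdd_aboveI2)
    fix x assume "x \<in> Hyp"
    then have "l1norm x * norm f \<le> 1 * norm f" by (intro mult_right_mono) (auto simp: Hyp_def)
    then show "cmod (dotp (vec_of_real x) (m0 f)) \<le> norm f"
      using norm_dotp_le[of "m0 f" "norm f" x] ap_m0[of f] by simp
  qed
qed

lemma nu_least: "(\<And>x. x \<in> Hyp \<Longrightarrow> cmod (dotp (vec_of_real x) (m0 f)) \<le> c) \<Longrightarrow> nu f \<le> c"
  unfolding nu_def by (rule cSUP_least) (use Hyp_0 in auto)

lemma nu_nonneg: "0 \<le> nu f"
  using nu_upper[OF Hyp_0, of f] norm_ge_zero order_trans by blast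

lemma nu_hyper:
  assumes x: "dotp \<omega> x = 0"
  shows "cmod (dotp (vec_of_real x) (m0 f)) \<le> l1norm x * nu f"
proof (cases "l1norm x = 0")
  case True
  then have "x = 0" by (simp add: l1norm_def sum_nonneg_eq_0_iff vec_eq_iff)
  then show ?thesis by (simp add: dotp_def vec_of_real_def l1norm_def)
next
  case False
  define c where "c = l1norm x"
  have c: "c > 0" using False l1norm_nonneg[of x] by (simp add: c_def del: l1norm_nonneg)
  define y where "y = (\<chi> i. x $ i / c)"
  have "dotp \<omega> y = dotp \<omega> x / c" by (simp add: y_def dotp_def sum_divide_distrib)
  moreover have "l1norm y = l1norm x / c" using c by (simp add: y_def l1norm_def sum_divide_distrib)
  ultimately have "y \<in> Hyp" using x c by (simp add: Hyp_def) (simp add: c_def[symmetric])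
  from nu_upper[OF this, of f]
  have "cmod (dotp (vec_of_real y) (m0 f)) \<le> nu f" .
  moreover have "dotp (vec_of_real y) (m0 f) = dotp (vec_of_real x) (m0 f) / of_real c"
    by (simp add: y_def dotp_def sum_divide_distrib vec_of_real_def)
  ultimately show ?thesis using c by (simp add: norm_divide divide_le_eq c_def[symmetric] mult.commute)
qed

lemma nu_add: "nu (f + g) \<le> nu f + nu g"
proof (rule nu_least)
  fix x assume x: "x \<in> Hyp"
  show "cmod (dotp (vec_of_real x) (m0 (f + g))) \<le> nu f + nu g"
    unfolding m0_simps dotp_add_right by (intro norm_triangle_mono nu_upper x)
qed

lemma nu_cs: "nu (cs c f) = cmod c * nu f"
proof -
  have le: "nu (cs c f) \<le> cmod c * nu f" for c f
    by (rule nu_least) (simp add: m0_simps dotp_smult_right norm_mult mult_left_mono nu_upper)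
  show ?thesis
  proof (cases "c = 0")
    case True
    then show ?thesis using le[of 0 f] nu_nonneg[of "cs c f"] by simp
  next
    case False
    then have "nu f \<le> cmod (inverse c) * nu (cs c f)" using le[of "inverse c" "cs c f"] by (simp add: cs_algebra)
    then have "cmod c * nu f \<le> nu (cs c f)" using False by (simp add: norm_inverse norm_divide field_simps)
    then show ?thesis using le[of c f] by simp
  qed
qed

lemma nu_Pu: "nu (Pu f) = nu f"
  unfolding nu_def
proof (rule SUP_cong[OF refl])
  fix x assume "x \<in> Hyp"
  then have "dotp (vec_of_real x) (vec_of_real \<omega>) = (0 :: complex)"
    by (simp add: dotp_vec_of_real dotp_commute[of x] Hyp_def)
  then show "cmod (dotp (vec_of_real x) (m0 (Pu f))) = cmod (dotp (vec_of_real x) (m0 f))"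
    by (simp add: m0_Pu dotp_diff_right dotp_smult_right)
qed

lemma nu_0: "nu 0 = 0" using nu_cs[of 0 0] by simp

lemma nu_Ps: "nu (Ps f) = 0"
proof -
  have "Pu (Ps f) = 0" by (simp add: Ps_def clin_diff[OF clin_Pu] Pu_Pu)
  then show ?thesis using nu_Pu[of "Ps f"] by (simp add: nu_0)
qed

text \<open>By duality the test vector x is replaced by its image y under the transpose of
  \<open>T\<close>. The eigenvector equation keeps y in the hyperplane orthogonal to \<omega>, the
  cone hypothesis gives |y| \<le> \<kappa>, and division by \<open>lam\<close> only helps.\<close>

lemma nu_Bu: "nu (Bu f) \<le> \<kappa> * nu f"
proof (rule nu_least)
  fix x assume x: "x \<in> Hyp"
  define y where "y = transpose (mat_of_int T) *v x"
  have yc: "vec_of_real y = transpose Tc *v vec_of_real x"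
    by (simp add: y_def vec_of_real_def vec_eq_iff matrix_vector_mult_def transpose_def mat_of_int_def
        del: transpose_matrix_vector)
  have "complex_of_real (dotp \<omega> y) = dotp (vec_of_real y) (vec_of_real \<omega>)"
    by (simp add: dotp_vec_of_real dotp_commute)
  also have "\<dots> = lam * of_real (dotp x \<omega>)"
    unfolding yc dotp_transpose eig by (simp add: dotp_smult_right dotp_vec_of_real)
  finally have y0: "dotp \<omega> y = 0" using x by (simp add: Hyp_def dotp_commute[of x])
  have xc: "x \<in> contracted_cone T \<kappa>" using hyp x by (auto simp: Hyp_def)
  have "l1norm y \<le> \<kappa> * 1"
    using xc x kap mult_left_mono[of "l1norm x" 1 \<kappa>] unfolding contracted_cone_def Hyp_def y_def mem_Collect_eq by linarith
  then have ly: "l1norm y \<le> \<kappa>" by simp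
  have "dotp (vec_of_real x) (m0 (Bu f)) = (1 / lam) * dotp (vec_of_real y) (m0 (Pu f))"
    by (simp add: Bu_cst m0_simps dotp_smult_right yc dotp_transpose del: transpose_matrix_vector)
  then have "cmod (dotp (vec_of_real x) (m0 (Bu f))) = cmod (dotp (vec_of_real y) (m0 (Pu f))) / cmod lam"
    by (simp add: norm_mult norm_divide)
  also have "\<dots> \<le> cmod (dotp (vec_of_real y) (m0 (Pu f)))"
    using lam1 by (simp add: divide_le_eq mult_left_le_one_le mult_le_cancel_left1)
  also have "\<dots> \<le> l1norm y * nu (Pu f)" by (rule nu_hyper[OF y0])
  also have "\<dots> \<le> \<kappa> * nu f" unfolding nu_Pu by (rule mult_right_mono[OF ly nu_nonneg])
  finally show "cmod (dotp (vec_of_real x) (m0 (Bu f))) \<le> \<kappa> * nu f" .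
qed

text \<open>\<open>nu\<close> tests only vectors orthogonal to \<omega>. The vector e_i - \<omega>_i
  \<omega>' is orthogonal to \<omega> because \<omega> \<cdot> \<omega>' = 1, and it reads off the
  i-th component of \<open>Pu f\<close>, on which \<omega>' vanishes.\<close>

lemma norm_Pu_nu: "norm (Pu f) \<le> (\<Sum>i\<in>UNIV. l1norm (axis i 1 - (\<omega> $ i) *s \<omega>')) * nu f"
proof -
  have "cmod (m0 (Pu f) $ i) \<le> l1norm (axis i 1 - (\<omega> $ i) *s \<omega>') * nu f" for i
  proof -
    let ?x = "axis i 1 - (\<omega> $ i) *s \<omega>'"
    have "dotp \<omega> ?x = dotp \<omega> (axis i 1) - \<omega> $ i * dotp \<omega>' \<omega>"
      by (simp add: dotp_diff_right dotp_smult_right dotp_commute[of \<omega> \<omega>'])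
    also have "dotp \<omega> (axis i 1) = \<omega> $ i" by (simp add: dotp_def axis_def if_distrib cong: if_cong)
    finally have x0: "dotp \<omega> ?x = 0" by (simp add: pair)
    have "dotp (vec_of_real ?x) (m0 (Pu f)) = m0 (Pu f) $ i - of_real (\<omega> $ i) * \<beta> (Pu f)"
    proof -
      have "dotp (vec_of_real ?x) (m0 (Pu f)) =
        (\<Sum>j\<in>UNIV. (if j = i then m0 (Pu f) $ j else 0) - of_real (\<omega> $ i) * (of_real (\<omega>' $ j) * m0 (Pu f) $ j))"
        unfolding dotp_def by (rule sum.cong) (auto simp: vec_of_real_def axis_def algebra_simps)
      then show ?thesis by (simp add: sum_subtractf sum_distrib_left beta_m0 dotp_def vec_of_real_def)
    qed
    then have "dotp (vec_of_real ?x) (m0 (Pu f)) = m0 (Pu f) $ i" by (simp add: beta_Pu)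
    then show ?thesis using nu_hyper[OF x0, of "Pu f"] by (simp add: nu_Pu)
  qed
  then have "l1norm (m0 (Pu f)) \<le> (\<Sum>i\<in>UNIV. l1norm (axis i 1 - (\<omega> $ i) *s \<omega>') * nu f)"
    unfolding l1norm_def[of "m0 (Pu f)"] by (rule sum_mono)
  then show ?thesis by (subst Pu_cst_m0) (simp add: norm_cst sum_distrib_right)
qed

text \<open>Bounds the effect of \<open>lam\<close> times the inverse matrix on the components of a
  mode; the weight constructed below has to gain \<open>1 / (2 * C0)\<close> in order to beat
  it.\<close>

definition "C0 = cmod lam * (\<Sum>i\<in>UNIV. \<Sum>j\<in>UNIV. cmod (Tic $ i $ j)) + 1"

lemma C0: "C0 \<ge> 1" by (simp add: C0_def sum_nonneg)

text \<open>The linear part moves a mode \<open>k\<close> to a shorter one, with a factor that is small only for long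
  \<open>k\<close>. A weight growing fast enough up to some length makes the factor uniformly small.\<close>

lemma weight_exists:
  "\<exists>h :: int ^ 'd \<Rightarrow> real. (\<forall>k. k \<noteq> 0 \<longrightarrow> 1 \<le> h k) \<and> (\<exists>M. \<forall>k. \<bar>h k\<bar> \<le> M) \<and> h 0 = 0 \<and>
     (\<forall>m. m \<noteq> 0 \<longrightarrow> Sm m \<notin> FM \<longrightarrow> h m * (wd m * wt \<rho> m) \<le> 1 / (2 * C0) * (h (Sm m) * (wd (Sm m) * wt \<rho> (Sm m))))"
proof -
  define \<epsilon> where "\<epsilon> = 1 / (2 * C0)"
  have ep: "0 < \<epsilon>" "\<epsilon> \<le> 1" using C0 by (auto simp: \<epsilon>_def)
  obtain p where p: "\<kappa> ^ p < \<epsilon>" using real_arch_pow_inv[OF ep(1) kap(2)] by blast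
  define c where "c = \<rho> * (1 - \<kappa>)"
  have c: "c > 0" using rho_pos kap by (simp add: c_def)
  define R where "R = max 1 (- ln \<epsilon> / c)"
  have R: "R \<ge> 1" "exp (- c * R) \<le> \<epsilon>"
  proof -
    have "- ln \<epsilon> \<le> c * R" using c by (simp add: R_def max_def field_simps)
    then have "exp (- c * R) \<le> exp (ln \<epsilon>)" by simp
    then show "exp (- c * R) \<le> \<epsilon>" using ep by simp
  qed (simp add: R_def)
  \<comment> \<open>Up to length \<open>R\<close> the power gains \<kappa>^p < \<epsilon> when a
    mode is shortened by \<kappa>; beyond \<open>R\<close> the exponential weights alone gain
    \<epsilon>. Truncation at \<open>R\<close> keeps \<open>h\<close> bounded, so the new norm
    remains equivalent to the old one.\<close>
  define h where "h k = (if k = 0 then 0 else (min (zlen k) R) ^ p)" for k :: "int ^ 'd"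
  have h1: "1 \<le> h k" if "k \<noteq> 0" for k using that zlen_ge_1[OF that] R(1) by (simp add: h_def one_le_power)
  have hM: "\<bar>h k\<bar> \<le> R ^ p" for k using R(1) by (auto simp: h_def intro!: power_mono)
  have main: "h m * (wd m * wt \<rho> m) \<le> \<epsilon> * (h (Sm m) * (wd (Sm m) * wt \<rho> (Sm m)))" if m: "m \<noteq> 0" "Sm m \<notin> FM" for m
  proof -
    let ?k = "Sm m"
    have k0: "?k \<noteq> 0" using m by (simp add: Sm_eq_0)
    have z: "zlen m \<le> \<kappa> * zlen ?k" using zlen_Tt[OF m(2)] by (simp add: Sm_Tt)
    have z1: "zlen m \<le> zlen ?k" using z kap mult_left_le_one_le[of "zlen ?k" \<kappa>] by simp
    have zm: "0 \<le> zlen m" by simp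
    have wdm: "wd m \<le> wd ?k" using z1 by (simp add: wd_def mult_left_mono)
    have e1: "wt \<rho> m \<le> wt \<rho> ?k" using z1 rho_pos by (simp add: wt_def)
    have "h m * wt \<rho> m \<le> \<epsilon> * (h ?k * wt \<rho> ?k)"
    proof (cases "zlen ?k \<le> R")
      case True
      have "h m \<le> (\<kappa> * zlen ?k) ^ p" using m True z z1 by (auto simp: h_def min_def intro!: power_mono)
      also have "\<dots> = \<kappa> ^ p * h ?k" using k0 True by (simp add: h_def power_mult_distrib)
      also have "\<dots> \<le> \<epsilon> * h ?k" using p h1[OF k0] by (intro mult_right_mono) auto
      finally have "h m * wt \<rho> m \<le> (\<epsilon> * h ?k) * wt \<rho> ?k" using e1 ep h1[OF k0] by (intro mult_mono) auto
      then show ?thesis by (simp add: mult.assoc)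
    next
      case False
      have hh: "h m \<le> h ?k" using m k0 False z1 R(1) by (auto simp: h_def min_def intro!: power_mono)
      have "wt \<rho> m \<le> exp (\<rho> * (\<kappa> * zlen ?k))" using mult_left_mono[OF z, of \<rho>] rho_pos by (simp add: wt_def)
      also have "\<dots> = exp (- c * zlen ?k) * wt \<rho> ?k" by (simp add: wt_def c_def exp_add[symmetric] algebra_simps)
      also have "\<dots> \<le> \<epsilon> * wt \<rho> ?k"
      proof (rule mult_right_mono)
        have "exp (- c * zlen ?k) \<le> exp (- c * R)" using False c by simp
        then show "exp (- c * zlen ?k) \<le> \<epsilon>" using R(2) by linarith
      qed simp
      finally have "h m * wt \<rho> m \<le> h ?k * (\<epsilon> * wt \<rho> ?k)" using hh h1[OF m(1)] h1[OF k0] by (intro mult_mono) auto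
      then show ?thesis by (simp add: mult_ac)
    qed
    then have "(h m * wt \<rho> m) * wd m \<le> (\<epsilon> * (h ?k * wt \<rho> ?k)) * wd ?k"
    proof (rule mult_mono[OF _ wdm])
      show "0 \<le> wd m" using wd_ge_1[of m] by simp
      show "0 \<le> \<epsilon> * (h ?k * wt \<rho> ?k)" using ep h1[OF k0] by (intro mult_nonneg_nonneg) auto
    qed
    then show ?thesis by (simp add: mult_ac)
  qed
  show ?thesis
    by (rule exI[of _ h]) (use h1 hM main in \<open>auto simp: \<epsilon>_def[symmetric], auto simp: h_def\<close>)
qed

section \<open>The weighted seminorm on nonconstant modes and the adapted norm\<close>

definition hw :: "int ^ 'd \<Rightarrow> real" where
  "hw = (SOME h. (\<forall>k. k \<noteq> 0 \<longrightarrow> 1 \<le> h k) \<and> (\<exists>M. \<forall>k. \<bar>h k\<bar> \<le> M) \<and> h 0 = 0 \<and>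
     (\<forall>m. m \<noteq> 0 \<longrightarrow> Sm m \<notin> FM \<longrightarrow> h m * (wd m * wt \<rho> m) \<le> 1 / (2 * C0) * (h (Sm m) * (wd (Sm m) * wt \<rho> (Sm m)))))"

lemma hw: "k \<noteq> 0 \<Longrightarrow> 1 \<le> hw k" "\<exists>M. \<forall>k. \<bar>hw k\<bar> \<le> M" "hw 0 = 0"
  "m \<noteq> 0 \<Longrightarrow> Sm m \<notin> FM \<Longrightarrow> hw m * (wd m * wt \<rho> m) \<le> 1 / (2 * C0) * (hw (Sm m) * (wd (Sm m) * wt \<rho> (Sm m)))"
  using someI_ex[OF weight_exists] unfolding hw_def[symmetric] by blast+

text \<open>The norm of \<open>Dw f\<close> is the weighted norm of the nonconstant part; constants
  disappear because \<open>hw 0 = 0\<close>.\<close>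

definition Dw :: "'d cf \<Rightarrow> 'd cf" where "Dw = diagop (\<lambda>(k, i). of_real (hw k))"

lemma Dw: "ap (Dw f) (k, i) = of_real (hw k) * ap f (k, i)" "clin Dw"
proof -
  obtain M where M: "\<forall>k. \<bar>hw k\<bar> \<le> M" using hw(2) ..
  have *: "norm ((\<lambda>(k, i). complex_of_real (hw k)) j) \<le> M" for j using M by (cases j) simp
  show "ap (Dw f) (k, i) = of_real (hw k) * ap f (k, i)" "clin Dw" 
    using diagop[where m = "\<lambda>(k :: int ^ 'd, i :: 'd). complex_of_real (hw k)" and C = M, OF *] by (simp_all add: Dw_def)
qed

lemma Dw_cst: "Dw (cst v) = 0"
  by (rule ell1_eqI) (auto simp: split_paired_all Dw ap_cst hw(3))

lemma norm_nonconst: "norm (f - prj {0} f) \<le> norm (Dw f)"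
proof -
  define g where "g = (\<lambda>(k :: int ^ 'd, i :: 'd). complex_of_real (if k = 0 then 0 else 1 / hw k))"
  have g: "norm (g j) \<le> 1" for j
    using hw(1)[of "fst j"] by (auto simp: g_def split_beta norm_divide)
  have "f - prj {0} f = diagop g (Dw f)"
  proof (rule ell1_eqI, simp only: split_paired_all)
    fix k i
    show "ap (f - prj {0} f) (k, i) = ap (diagop g (Dw f)) (k, i)"
      using hw(1)[of k] by (auto simp: diagop(1)[where m = g and C = 1, OF g] Dw ap_prj) (auto simp: g_def)
  qed
  then show ?thesis using diagop(2)[where m = g and C = 1 and x = "Dw f", OF g] by simp
qed

text \<open>The rank-one term of \<open>Lh\<close> is constant and invisible here. In the remaining
  term all weights of the two strips combine into one multiplier between the modes
  \<open>Sm m\<close> and \<open>m\<close>, of size at most \<open>1 / (2 * C0)\<close>, and summing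
  over the matrix entries costs less than \<open>C0\<close>.\<close>

lemma norm_Dw_Lh: "norm (Dw (Lh f)) \<le> 1 / 2 * norm (Dw f)"
proof -
  define G where "G m = (if m = 0 \<or> Sm m \<in> FM then 0 else
    complex_of_real ((hw m * (wd m * wt \<rho> m)) / (hw (Sm m) * (wd (Sm m) * wt \<rho> (Sm m)))))" for m
  have G: "norm (G m) \<le> 1 / (2 * C0)" for m
  proof (cases "m = 0 \<or> Sm m \<in> FM")
    case False
    have d: "hw (Sm m) \<ge> 1" "hw m \<ge> 1" using False hw(1)[of "Sm m"] hw(1)[of m] by (auto simp: Sm_eq_0)
    have w1: "wd (Sm m) \<ge> 1" "wd m \<ge> 1" by (rule wd_ge_1)+
    have pos: "0 < hw (Sm m) * (wd (Sm m) * wt \<rho> (Sm m))" using d w1 by (intro mult_pos_pos) auto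
    have "norm (G m) = (hw m * (wd m * wt \<rho> m)) / (hw (Sm m) * (wd (Sm m) * wt \<rho> (Sm m)))"
      using False d w1 by (simp add: G_def norm_divide norm_mult del: of_real_divide of_real_mult)
    also have "\<dots> \<le> 1 / (2 * C0)" using hw(4)[of m] False pos by (simp add: pos_divide_le_eq)
    finally show ?thesis .
  qed (use C0 in \<open>simp add: G_def\<close>)
  have inj: "inj_on Sm {j. G j \<noteq> 0}" using bij_Sm by (auto simp: bij_def inj_def inj_on_def)
  note r = reop[OF G inj]
  have eq: "Dw (Lh f) = mkvec (\<lambda>i. \<Sum>j\<in>UNIV. cs (lam * Tic $ i $ j) (reop Sm G (cmpt j (Dw f))))"
  proof (rule ell1_eqI, simp only: split_paired_all)
    fix m i
    have "of_real (hw m) * tm m * ap (Jf f) (Sm m, j) = G m * ap (Dw f) (Sm m, j)" if m: "m \<noteq> 0" for j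
    proof (cases "Sm m \<in> FM")
      case False
      then have "hw (Sm m) \<noteq> 0" using hw(1)[of "Sm m"] m by (auto simp: Sm_eq_0)
      then show ?thesis using False m wd_ge_1[of "Sm m"]
        by (simp add: tm_def ap_Jf G_def Dw field_simps)
    qed (simp add: tm_def G_def)
    then have *: "of_real (hw m) * (tm m * (x * ap (Jf f) (Sm m, j))) = x * (G m * ap (Dw f) (Sm m, j))" for j and x :: complex
      by (cases "m = 0") (auto simp: hw(3) G_def mult_ac)
    have "ap (Dw (Lh f)) (m, i) = of_real (hw m) * (lam * ap (Th (Jf f)) (m, i))"
      using hw(3) by (cases "m = 0") (simp_all add: Dw Lh_def ap_cst)
    also have "\<dots> = lam * (\<Sum>j\<in>UNIV. of_real (hw m) * (tm m * (Tic $ i $ j * ap (Jf f) (Sm m, j))))"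
      by (simp add: ap_Th sum_distrib_left mult_ac)
    also have "\<dots> = (\<Sum>j\<in>UNIV. lam * Tic $ i $ j * (G m * ap (Dw f) (Sm m, j)))"
      unfolding * by (simp add: sum_distrib_left mult.assoc)
    finally show "ap (Dw (Lh f)) (m, i) = ap (mkvec (\<lambda>i. \<Sum>j\<in>UNIV. cs (lam * Tic $ i $ j) (reop Sm G (cmpt j (Dw f))))) (m, i)"
      by (simp add: ap_sum r(1))
  qed
  have "norm (Dw (Lh f)) \<le> (\<Sum>i\<in>UNIV. \<Sum>j\<in>UNIV. (cmod lam * cmod (Tic $ i $ j)) * (1 / (2 * C0) * norm (Dw f)))"
    unfolding eq norm_mkvec
  proof (intro sum_mono sum_norm_le)
    fix i j
    have "norm (reop Sm G (cmpt j (Dw f))) \<le> 1 / (2 * C0) * norm (cmpt j (Dw f))" by (rule r(2))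
    also have "\<dots> \<le> 1 / (2 * C0) * norm (Dw f)" using C0 by (intro mult_left_mono norm_cmpt) auto
    finally show "norm (cs (lam * Tic $ i $ j) (reop Sm G (cmpt j (Dw f)))) \<le> (cmod lam * cmod (Tic $ i $ j)) * (1 / (2 * C0) * norm (Dw f))"
      unfolding norm_cs norm_mult by (rule mult_left_mono) auto
  qed
  also have "\<dots> = (C0 - 1) * (1 / (2 * C0) * norm (Dw f))"
    by (simp add: C0_def sum_distrib_right sum_distrib_left sum_divide_distrib)
  also have "\<dots> \<le> C0 * (1 / (2 * C0) * norm (Dw f))" using C0 by (intro mult_right_mono) auto
  also have "\<dots> = 1 / 2 * norm (Dw f)" using C0 by simp
  finally show ?thesis .
qed

text \<open>On the stable subspace \<open>nu\<close> vanishes and on the unstable subspace the other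
  two terms do, which produces the maximum norm that the abstract saddle requires. The term with
  \<open>\<beta>\<close> measures the direction \<omega>.\<close>

definition aa :: "'d cf \<Rightarrow> real" where
  "aa f = max (cmod (\<beta> f) + norm (Dw f)) (nu f)"

text \<open>The rate 1 / 2 comes from the nonconstant modes, \<kappa> from the inverse on the
  unstable constants.\<close>

definition "qq = max (1 / 2) \<kappa>"

lemma Dw_Pu: "Dw (Pu f) = 0" by (subst Pu_cst_m0) (rule Dw_cst)

lemma Dw_Ps: "Dw (Ps f) = Dw f" by (simp add: Ps_def clin_diff[OF Dw(2)] Dw_Pu)

lemma aa_Ps: "aa (Ps f) = cmod (\<beta> f) + norm (Dw f)"
proof -
  have "\<beta> (Ps f) = \<beta> f" by (simp add: Ps_def beta_lin beta_Pu)
  moreover have "max x 0 = x" if "0 \<le> x" for x :: real using that by simp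
  ultimately show ?thesis by (simp add: aa_def nu_Ps Dw_Ps)
qed

lemma aa_Pu: "aa (Pu f) = nu f"
  by (simp add: aa_def beta_Pu Dw_Pu nu_Pu nu_nonneg max_def)

lemma aa_equiv: "\<exists>C1>0. \<forall>f. norm f \<le> C1 * aa f" "\<exists>C2>0. \<forall>f. aa f \<le> C2 * norm f"
proof -
  define c where "c = (\<Sum>i\<in>UNIV. l1norm (axis i 1 - (\<omega> $ i) *s \<omega>'))"
  have c0: "c \<ge> 0" by (simp add: c_def sum_nonneg)
  have "norm f \<le> (c + l1norm \<omega> + 1) * aa f" for f
  proof -
    have "norm f = norm (Pu f + cs (\<beta> f) w + (f - prj {0} f))" by (simp only: decomp[symmetric])
    also have "\<dots> \<le> c * nu f + cmod (\<beta> f) * l1norm \<omega> + norm (Dw f)"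
      by (intro norm_triangle_mono norm_nonconst norm_Pu_nu[of f, folded c_def]) (simp add: norm_w)
    also have "\<dots> \<le> c * aa f + aa f * l1norm \<omega> + aa f"
      using c0 by (intro add_mono mult_left_mono mult_right_mono) (auto simp: aa_def le_max_iff_disj)
    finally show ?thesis by (simp add: algebra_simps)
  qed
  moreover have "0 < c + l1norm \<omega> + 1" using c0 wpos by simp
  ultimately show "\<exists>C1>0. \<forall>f. norm f \<le> C1 * aa f" by blast
  obtain M where M: "M > 0" "\<And>f. norm (Dw f) \<le> M * norm f" using clin_bound[OF Dw(2)] by blast
  have "aa f \<le> (l1norm \<omega>' + M + 1) * norm f" for f
  proof -
    have n: "nu f \<le> norm f"
    proof (rule nu_least)
      fix x assume "x \<in> Hyp"
      then have "l1norm x * norm f \<le> 1 * norm f" by (intro mult_right_mono) (auto simp: Hyp_def)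
      then show "cmod (dotp (vec_of_real x) (m0 f)) \<le> norm f"
        using norm_dotp_le[of "m0 f" "norm f" x] ap_m0[of f] by simp
    qed
    have "aa f \<le> cmod (\<beta> f) + norm (Dw f) + nu f" using nu_nonneg[of f] by (simp add: aa_def)
    also have "\<dots> \<le> l1norm \<omega>' * norm f + M * norm f + norm f" by (intro add_mono beta_bound M n)
    finally show ?thesis by (simp add: algebra_simps)
  qed
  moreover have "0 < l1norm \<omega>' + M + 1" using M l1norm_nonneg[of \<omega>'] by linarith
  ultimately show "\<exists>C2>0. \<forall>f. aa f \<le> C2 * norm f" by blast
qed

text \<open>For a constant perturbation v with \<omega>' \<cdot> v = 0 no elimination occurs and the
  normalising denominator is exactly 1, so the nonlinear remainder vanishes identically.\<close>

lemma Rh_unstable: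
  assumes "norm (Pu f) \<le> e0"
  shows "Rh (w + Pu f) = w + Lh (Pu f)"
proof -
  define v where "v = m0 (Pu f)"
  have v: "Pu f = cst v" unfolding v_def by (rule Pu_cst_m0)
  have b: "\<beta> (cst v) = 0" using beta_Pu[of f] by (simp add: v)
  have s: "w + cst v = cst (vec_of_real \<omega> + v)" by (rule ell1_eqI) (simp add: split_paired_all ap_cst)
  have "Rh (w + cst v) = cs (lam / \<beta> (w + cst v)) (Th (w + cst v))"
    unfolding s Th_cst by (rule Rh_cst) (use assms in \<open>simp add: v s[symmetric]\<close>)
  also have "\<dots> = w + Lh (cst v)"
    by (simp add: beta_lin beta_w b clin_add[OF clin_Th] Th_w Lh_cst[OF b] Th_cst[of v] cs_algebra)
  finally show ?thesis by (simp add: v)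
qed

lemma saddle_Rh:
  obtains e1 C M s C1 C2 where "0 < e1" "e1 \<le> e0" "0 \<le> C"
    "\<And>f. norm f \<le> e1 \<Longrightarrow> norm (Rh (w + f) - w - Lh f) \<le> C * (norm f)\<^sup>2"
    "\<And>X. norm (X - w) \<le> e1 \<Longrightarrow> \<beta> (Rh X) = 1 \<and> norm (Rh X) \<le> M"
    "\<And>U \<xi>. hcurve U \<xi> \<Longrightarrow> (\<And>z. z \<in> U \<Longrightarrow> norm (\<xi> z - w) \<le> e1) \<Longrightarrow> hcurve U (\<lambda>z. Rh (\<xi> z))"
    "saddle Lh Bu Ps Pu (\<lambda>h. Rh (w + h) - w - Lh h) aa qq s C1 C2"
proof -
  obtain e1 C M where e1: "0 < e1" "e1 \<le> e0" "e1 \<le> 1" "0 \<le> C"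
    and quad: "\<And>f. norm f \<le> e1 \<Longrightarrow> norm (Rh (w + f) - w - Lh f) \<le> C * (norm f)\<^sup>2"
    and bd: "\<And>X. norm (X - w) \<le> e1 \<Longrightarrow> \<beta> (Rh X) = 1 \<and> norm (Rh X) \<le> M"
    and hc: "\<And>U \<xi>. hcurve U \<xi> \<Longrightarrow> (\<And>z. z \<in> U \<Longrightarrow> norm (\<xi> z - w) \<le> e1) \<Longrightarrow> hcurve U (\<lambda>z. Rh (\<xi> z))"
    by (rule Rh_main) blast
  obtain C1 where "C1 > 0 \<and> (\<forall>f. norm f \<le> C1 * aa f)" using aa_equiv(1) ..
  then have C1: "C1 > 0" "norm f \<le> C1 * aa f" for f by auto
  obtain C2 where "C2 > 0 \<and> (\<forall>f. aa f \<le> C2 * norm f)" using aa_equiv(2) ..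
  then have C2: "C2 > 0" "aa f \<le> C2 * norm f" for f by auto
  define Qf where "Qf h = Rh (w + h) - w - Lh h" for h
  have q: "0 < qq" "qq < 1" "1 / 2 \<le> qq" "\<kappa> \<le> qq" using kap by (auto simp: qq_def)
  \<comment> \<open>The Cauchy estimate for the remainder needs the ball of radius
    \<open>2 * R\<close> inside the \<open>e1\<close>-ball. The second bound makes the resulting
    Lipschitz constant \<open>4 * C * R\<close>, converted to the adapted norm, at most
    \<open>(1 - qq) / 2\<close>.\<close>
  define R where "R = min (e1 / 2) ((1 - qq) / (8 * (C + 1) * C1 * C2))"
  have den: "0 < 8 * (C + 1) * C1 * C2" using e1 C1 C2 by simp
  have R: "0 < R" "2 * R \<le> e1" "R \<le> (1 - qq) / (8 * (C + 1) * C1 * C2)"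
    using e1 q den by (auto simp: R_def)
  have R3: "C2 * (4 * C * R) * C1 \<le> (1 - qq) / 2"
  proof -
    have "R * (8 * (C + 1) * C1 * C2) \<le> 1 - qq" using R(3) den by (simp add: pos_le_divide_eq)
    then have "8 * (C * R * C1 * C2) + 8 * (R * C1 * C2) \<le> 1 - qq" by (simp add: algebra_simps)
    moreover have "0 \<le> R * C1 * C2" using R C1 C2 by simp
    ultimately show ?thesis by (simp add: mult_ac)
  qed
  define s where "s = R / C1"
  have s: "s > 0" using R C1 by (simp add: s_def)
  have as: "norm f \<le> R" if "aa f \<le> s" for f
    using C1(2)[of f] mult_left_mono[OF that, of C1] C1(1) by (simp add: s_def)
  have hQ: "hcurve U (\<lambda>z. Qf (\<xi> z))" if h: "hcurve U \<xi>" and n: "\<And>z. z \<in> U \<Longrightarrow> norm (\<xi> z) \<le> e1" for U \<xi>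
    unfolding Qf_def
    by (intro hcurve_diff hc hcurve_add hcurve_const[OF hcurve_open[OF h]] h hcurve_clin[OF h clin_Lh]) (simp add: n)
  have lipQ: "norm (Qf x - Qf y) \<le> 4 * C * R * norm (x - y)" if xy: "norm x \<le> R" "norm y \<le> R" for x y
  proof -
    have "norm (Qf x - Qf y) \<le> (C * (2 * R)\<^sup>2) / R * norm (x - y)"
    proof (rule hmap_lipschitz[where S = "cball 0 (2 * R)"])
      show "hcurve U (\<lambda>z. Qf (\<gamma> z))" if g: "hcurve U \<gamma>" "\<gamma> ` U \<subseteq> cball 0 (2 * R)" for U \<gamma>
      proof (rule hQ[OF g(1)])
        fix z assume "z \<in> U"
        then have "\<gamma> z \<in> cball 0 (2 * R)" using g(2) by blast
        then show "norm (\<gamma> z) \<le> e1" using R(2) by simp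
      qed
      show "norm (Qf z) \<le> C * (2 * R)\<^sup>2" if "z \<in> cball 0 (2 * R)" for z
      proof -
        have z: "norm z \<le> 2 * R" using that by simp
        have "norm (Qf z) \<le> C * (norm z)\<^sup>2" unfolding Qf_def by (rule quad) (use z R(2) in simp)
        also have "\<dots> \<le> C * (2 * R)\<^sup>2" using z e1(4) by (intro mult_left_mono power_mono) auto
        finally show ?thesis .
      qed
      show "0 < R" by fact
      show "ball p R \<subseteq> cball 0 (2 * R)" if p: "p \<in> closed_segment y x" for p
      proof
        fix u assume u: "u \<in> ball p R"
        have "p \<in> cball 0 R" using p xy closed_segment_subset[of y "cball 0 R" x] by auto
        then have "norm p \<le> R" by simp
        moreover have "norm (u - p) < R" using u by (simp add: dist_norm norm_minus_commute)
        ultimately show "u \<in> cball 0 (2 * R)" using norm_triangle_ineq[of "u - p" p] by simp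
      qed
    qed
    also have "(C * (2 * R)\<^sup>2) / R = 4 * C * R" using R by (simp add: power2_eq_square)
    finally show ?thesis .
  qed
  have "saddle Lh Bu Ps Pu Qf aa qq s C1 C2"
  proof
    show "clin Lh" "clin Bu" "clin Ps" "clin Pu" by (rule clin_Lh clin_Bu clin_Ps clin_Pu)+
    show "Ps x + Pu x = x" for x by (simp add: Ps_def)
    show "Ps (Ps x) = Ps x" for x by (simp add: Ps_def clin_diff[OF clin_Pu] Pu_Pu)
    show "Ps (Lh x) = Lh (Ps x)" for x by (simp add: Ps_def Pu_Lh clin_diff[OF clin_Lh])
    show "Pu (Bu x) = Bu x" "Bu (Pu x) = Bu x" "Lh (Bu x) = Pu x" "Bu (Lh x) = Pu x" for x
      by (rule Pu_Bu Bu_Pu Lh_Bu Bu_Lh)+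
    show "aa (x + y) \<le> aa x + aa y" for x y
    proof -
      have "cmod (\<beta> (x + y)) \<le> cmod (\<beta> x) + cmod (\<beta> y)" by (simp add: beta_lin norm_triangle_ineq)
      moreover have "norm (Dw (x + y)) \<le> norm (Dw x) + norm (Dw y)" by (simp add: clin_add[OF Dw(2)] norm_triangle_ineq)
      ultimately show ?thesis unfolding aa_def using nu_add[of x y] by (simp add: max_def)
    qed
    show "aa (cs c x) = cmod c * aa x" for c x
    proof -
      have "max (cmod c * p) (cmod c * r) = cmod c * max p r" for p r
        by (simp add: max_mult_distrib_left)
      then show ?thesis by (simp add: aa_def beta_lin clin_cs[OF Dw(2)] norm_mult nu_cs distrib_left[symmetric])
    qed
    show "norm x \<le> C1 * aa x" "aa x \<le> C2 * norm x" for x by (rule C1 C2)+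
    show "aa x = max (aa (Ps x)) (aa (Pu x))" for x unfolding aa_Ps aa_Pu by (rule aa_def)
    show "0 < C1" "0 < C2" "0 < qq" "qq < 1" "0 < s" by fact+
    show "aa (Lh (Ps x)) \<le> qq * aa (Ps x)" for x
    proof -
      have "nu (Lh (Ps x)) = nu (Pu (Lh (Ps x)))" by (simp only: nu_Pu)
      also have "Pu (Lh (Ps x)) = 0"
        by (simp add: Pu_Lh Ps_def clin_diff[OF clin_Pu] Pu_Pu clin_0[OF clin_Lh])
      finally have "aa (Lh (Ps x)) = norm (Dw (Lh (Ps x)))" by (simp add: aa_def beta_Lh nu_0 max_def)
      also have "\<dots> \<le> 1 / 2 * norm (Dw x)" using norm_Dw_Lh[of "Ps x"] by (simp add: Dw_Ps)
      also have "\<dots> \<le> qq * aa (Ps x)" unfolding aa_Ps by (rule mult_mono) (use q in auto)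
      finally show ?thesis .
    qed
    show "aa (Bu x) \<le> qq * aa (Pu x)" for x
    proof -
      have "aa (Bu x) = aa (Pu (Bu x))" by (simp only: Pu_Bu)
      also have "\<dots> = nu (Bu x)" by (rule aa_Pu)
      also have "\<dots> \<le> \<kappa> * nu x" by (rule nu_Bu)
      also have "\<dots> \<le> qq * aa (Pu x)" unfolding aa_Pu by (rule mult_right_mono[OF q(4) nu_nonneg])
      finally show ?thesis .
    qed
    have "norm (Qf 0) \<le> C * (norm (0 :: 'd cf))\<^sup>2" unfolding Qf_def by (rule quad) (use e1 in simp)
    then show "Qf 0 = 0" by simp
    show "aa (Qf x - Qf y) \<le> (1 - qq) / 2 * aa (x - y)" if xy: "aa x \<le> s" "aa y \<le> s" for x y
    proof -
      have "aa (Qf x - Qf y) \<le> C2 * norm (Qf x - Qf y)" by (rule C2)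
      also have "\<dots> \<le> C2 * (4 * C * R * norm (x - y))" by (intro mult_left_mono lipQ as xy) (use C2 in simp)
      also have "\<dots> \<le> C2 * (4 * C * R * (C1 * aa (x - y)))" by (intro mult_left_mono C1) (use C2 e1 R in auto)
      also have "\<dots> = (C2 * (4 * C * R) * C1) * aa (x - y)" by (simp add: mult_ac)
      also have "\<dots> \<le> (1 - qq) / 2 * aa (x - y)"
        by (rule mult_right_mono[OF R3]) (use nu_nonneg[of "x - y"] in \<open>simp add: aa_def\<close>)
      finally show ?thesis .
    qed
    show "hcurve U (\<lambda>z. Qf (\<xi> z))" if "hcurve U \<xi>" "\<And>z. z \<in> U \<Longrightarrow> aa (\<xi> z) \<le> s" for U \<xi>
    proof (rule hQ[OF that(1)])
      show "norm (\<xi> z) \<le> e1" if "z \<in> U" for z using as[OF \<open>\<And>z. z \<in> U \<Longrightarrow> aa (\<xi> z) \<le> s\<close>[OF that]] R by simp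
    qed
    show "Qf (Pu x) = 0" if "aa (Pu x) \<le> s" for x
      using Rh_unstable[of x] as[OF that] R e1 by (simp add: Qf_def)
  qed
  then have "saddle Lh Bu Ps Pu (\<lambda>h. Rh (w + h) - w - Lh h) aa qq s C1 C2" unfolding Qf_def .
  from that[OF e1(1,2,4) quad bd hc this] show ?thesis .
qed

end

section \<open>Stable and unstable manifolds\<close>

text \<open>Beyond some index the terms are below r / 2, and before it there are only finitely many.
  Confinement of a convergent orbit to an open ball is therefore stable under small uniform
  perturbations.\<close>

lemma uniform_gap:
  fixes u :: "nat \<Rightarrow> real"
  assumes "u \<longlonglongrightarrow> 0" "\<And>n. u n < r" "0 < r"
  obtains c where "c < r" "\<And>n. u n \<le> c"
proof -
  have "\<forall>\<^sub>F n in sequentially. u n < r / 2" by (rule order_tendstoD[OF assms(1)]) (use assms(3) in simp)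
  then obtain n0 where "\<forall>n\<ge>n0. u n < r / 2" unfolding eventually_sequentially ..
  then have n0: "u n < r / 2" if "n \<ge> n0" for n using that by blast
  let ?S = "insert (r / 2) (u ` {..n0})"
  show ?thesis
  proof (rule that[of "Max ?S"])
    show "Max ?S < r" using assms by (subst Max_less_iff) auto
    show "u n \<le> Max ?S" for n
    proof (cases "n \<le> n0")
      case True
      then show ?thesis by (intro Max_ge) auto
    next
      case False
      then have "u n \<le> r / 2" using n0[of n] by simp
      also have "\<dots> \<le> Max ?S" by (intro Max_ge) auto
      finally show ?thesis .
    qed
  qed
qed

section \<open>Transport between \<ell>1 and spaces of vector fields\<close>

context
  fixes \<iota> :: "'j::countable ell1 \<Rightarrow> 'd::finite vfield" and V N
  assumes V: "repr UNIV \<iota> V N"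
begin

lemma repr_mem: "\<iota> x \<in> V"
  using reprD(1)[OF V] by blast

lemma repr_inv: "inv \<iota> (\<iota> x) = x"
  by (rule inv_f_f) (use V in \<open>simp add: repr_def\<close>)

lemma repr_nball: "nball V N (\<iota> x) r = \<iota> ` ball x r"
proof (rule set_eqI)
  fix f
  show "f \<in> nball V N (\<iota> x) r \<longleftrightarrow> f \<in> \<iota> ` ball x r"
  proof
    assume f: "f \<in> nball V N (\<iota> x) r"
    then obtain y where y: "f = \<iota> y" using reprD(1)[OF V] by (auto simp: nball_def)
    then have "norm (y - x) < r" using f reprD(5)[OF V, of "y - x"] repr_diff(1)[OF V, of y x] by (simp add: nball_def)
    then show "f \<in> \<iota> ` ball x r" using y by (auto simp: dist_norm norm_minus_commute)
  next
    assume "f \<in> \<iota> ` ball x r"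
    then obtain y where y: "f = \<iota> y" "y \<in> ball x r" ..
    then have "N (f - \<iota> x) < r"
      using reprD(5)[OF V, of "y - x"] repr_diff(1)[OF V, of y x] by (simp add: dist_norm norm_minus_commute)
    then show "f \<in> nball V N (\<iota> x) r" using y(1) repr_mem by (simp add: nball_def)
  qed
qed

lemma repr_nopen: "open A \<Longrightarrow> nopen V N (\<iota> ` A)"
  unfolding nopen_def
proof (intro conjI ballI)
  show "\<iota> ` A \<subseteq> V" using repr_mem by blast
  fix f assume A: "open A" "f \<in> \<iota> ` A"
  then obtain x where x: "f = \<iota> x" "x \<in> A" by blast
  obtain r where r: "r > 0" "ball x r \<subseteq> A" using A(1) x(2) by (meson openE)
  show "\<exists>r>0. nball V N f r \<subseteq> \<iota> ` A"
    by (rule exI[of _ r]) (use r in \<open>simp add: x(1) repr_nball image_mono\<close>)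
qed

lemma repr_nclosed: "closed A \<Longrightarrow> nclosed V N (\<iota> ` A)"
proof -
  assume "closed A"
  then have "nopen V N (\<iota> ` (- A))" by (intro repr_nopen) auto
  moreover have "V - \<iota> ` A = \<iota> ` (- A)" using reprD(1,2)[OF V] by auto
  ultimately show ?thesis using repr_mem by (auto simp: nclosed_def)
qed

lemma repr_csubspace:
  assumes "0 \<in> A" "\<And>x y. x \<in> A \<Longrightarrow> y \<in> A \<Longrightarrow> x + y \<in> A" "\<And>c x. x \<in> A \<Longrightarrow> cs c x \<in> A"
  shows "csubspace_of V (\<iota> ` A)"
  unfolding csubspace_of_def
proof (intro conjI ballI allI)
  show "\<iota> ` A \<subseteq> V" using repr_mem by blast
  show "0 \<in> \<iota> ` A" using assms(1) repr_diff(2)[OF V] by (metis imageI)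
  show "f + g \<in> \<iota> ` A" if fg: "f \<in> \<iota> ` A" "g \<in> \<iota> ` A" for f g
  proof -
    obtain x y where "f = \<iota> x" "x \<in> A" "g = \<iota> y" "y \<in> A" using fg by blast
    then show ?thesis using assms(2)[of x y] by (simp add: reprD(3)[OF V, symmetric])
  qed
  show "fscale c f \<in> \<iota> ` A" if f: "f \<in> \<iota> ` A" for c f
  proof -
    obtain x where "f = \<iota> x" "x \<in> A" using f by blast
    then show ?thesis using assms(3)[of x c] by (simp add: reprD(4)[OF V, symmetric])
  qed
qed

text \<open>Boundedness and preservation of holomorphic curves suffice, since
  \<open>hmap_frechet\<close> produces the derivative at every point of an open set.\<close>

lemma repr_analytic:
  assumes A: "open A" and h: "\<And>U \<gamma>. hcurve U \<gamma> \<Longrightarrow> \<gamma> ` U \<subseteq> A \<Longrightarrow> hcurve U (\<lambda>z. H (\<gamma> z))"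
    and M: "\<And>x. x \<in> A \<Longrightarrow> norm (H x) \<le> M" and G: "\<And>x. x \<in> A \<Longrightarrow> G (\<iota> x) = \<iota> (H x)"
  shows "analytic_map_on V N V N (\<iota> ` A) G"
  unfolding analytic_map_on_def
proof (intro conjI ballI)
  show "nopen V N (\<iota> ` A)" by (rule repr_nopen[OF A])
  fix f assume "f \<in> \<iota> ` A"
  then obtain x where x: "f = \<iota> x" "x \<in> A" ..
  show "G f \<in> V" using x G repr_mem by simp
  obtain r where r: "r > 0" "ball x r \<subseteq> A" using A x(2) by (meson openE)
  have "\<exists>L. clin L \<and> (\<forall>h. norm h < r / 2 \<longrightarrow> norm (H (x + h) - H x - L h) \<le> 8 * M / r\<^sup>2 * (norm h)\<^sup>2)"
  proof (rule hmap_frechet[of x r H M])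
    show "hcurve U (\<lambda>z. H (\<gamma> z))" if "hcurve U \<gamma>" "\<gamma> ` U \<subseteq> ball x r" for U \<gamma>
      by (rule h[OF that(1) subset_trans[OF that(2) r(2)]])
    show "norm (H y) \<le> M" if "y \<in> ball x r" for y using M r(2) that by blast
    show "r > 0" by fact
  qed blast
  then obtain L where L: "clin L \<and> (\<forall>h. norm h < r / 2 \<longrightarrow> norm (H (x + h) - H x - L h) \<le> 8 * M / r\<^sup>2 * (norm h)\<^sup>2)" ..
  note L1 = conjunct1[OF L] and L2 = conjunct2[OF L, rule_format]
  have "has_cderivative V N V N G (\<lambda>f. \<iota> (L (inv \<iota> f))) (\<iota> x)"
  proof (rule repr_cderivative[OF V V L1, where s = "r / 2" and H = H and C = "8 * M / r\<^sup>2"])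
    show "G (\<iota> (x + h)) = \<iota> (H (x + h)) \<and> H (x + h) \<in> UNIV" if "norm h < r / 2" for h
    proof -
      have "x + h \<in> ball x r" using that r(1) by (simp add: dist_norm)
      then show ?thesis using G r(2) by blast
    qed
  qed (use r L2 in auto)
  then show "\<exists>L. has_cderivative V N V N G L f" unfolding x(1) by (intro exI[of _ "\<lambda>f. \<iota> (L (inv \<iota> f))"])
qed

lemma repr_resolvent:
  assumes S: "clin S" "\<And>x. S (L x - cs z x) = x" "\<And>x. L (S x) - cs z (S x) = x"
  shows "z \<notin> op_spectrum V N (\<lambda>f. \<iota> (L (inv \<iota> f)))"
proof -
  obtain K where K: "K > 0" "\<And>x. norm (S x) \<le> K * norm x" using clin_bound[OF S(1)] by blast
  have "bounded_clinear_on V N V N (\<lambda>f. \<iota> (S (inv \<iota> f)))"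
    unfolding bounded_clinear_on_def reprD(1)[OF V]
    by (auto simp: repr_inv reprD(3,4)[OF V, symmetric] clin_add[OF S(1)] clin_cs[OF S(1)] reprD(5)[OF V] intro!: exI[of _ K] K)
  moreover have "\<iota> (S (inv \<iota> (\<iota> (L (inv \<iota> f)) - fscale z f))) = f \<and> \<iota> (L (inv \<iota> (\<iota> (S (inv \<iota> f))))) - fscale z (\<iota> (S (inv \<iota> f))) = f"
    if fV: "f \<in> V" for f
  proof -
    obtain x where f: "f = \<iota> x" using fV reprD(1)[OF V] by blast
    show ?thesis
      unfolding f repr_inv reprD(4)[OF V, symmetric] repr_diff(1)[OF V, symmetric] S by simp
  qed
  ultimately show ?thesis unfolding op_spectrum_def by blast
qed

end

section \<open>Local invariant manifolds of the fixed point\<close>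

locale saddle_chart = saddle L B Ps Pu Q a q s C1 C2
  for L B Ps Pu Q :: "'j::countable ell1 \<Rightarrow> 'j ell1" and a q s C1 C2 +
  fixes \<iota> :: "'j ell1 \<Rightarrow> 'd::finite vfield" and V N G w and e1 CQ M :: real and n :: nat
  assumes V: "repr UNIV \<iota> V N" and e1: "0 < e1"
    and G: "norm h \<le> e1 \<Longrightarrow> G (\<iota> (w + h)) = \<iota> (w + (L h + Q h))"
    and quad: "norm h \<le> e1 \<Longrightarrow> norm (Q h) \<le> CQ * (norm h)\<^sup>2"
    and hG: "hcurve U \<xi> \<Longrightarrow> (\<And>z. z \<in> U \<Longrightarrow> norm (\<xi> z - w) \<le> e1) \<Longrightarrow>
      hcurve U (\<lambda>z. w + (L (\<xi> z - w) + Q (\<xi> z - w)))"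
    and bG: "norm h \<le> e1 \<Longrightarrow> norm (w + (L h + Q h)) \<le> M"
    and dim: "has_cdim V n (\<iota> ` {x. Pu x = x})"
begin

text \<open>Within this norm radius the adapted norm stays below \<open>s1\<close>, so points of the
  ball admit the graph construction and orbits in it count as orbits of the saddle.\<close>

definition "r0 = min e1 (s1 / C2)"

lemma r0: "0 < r0" "r0 \<le> e1"
  using e1 s1 C by (auto simp: r0_def)

lemma small: "norm h < r \<Longrightarrow> r \<le> r0 \<Longrightarrow> a h < s1" "norm h < r \<Longrightarrow> r \<le> r0 \<Longrightarrow> a h \<le> s"
proof -
  show 1: "a h < s1" if "norm h < r" "r \<le> r0"
  proof -
    have "norm h < s1 / C2" using that by (simp add: r0_def)
    then have "C2 * norm h < s1" using C by (simp add: pos_less_divide_eq mult.commute)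
    then show ?thesis using a_norm[of h] by linarith
  qed
  show "a h \<le> s" if "norm h < r" "r \<le> r0" using 1[OF that] s1 by simp
qed

lemma F0: "F 0 = 0" by (simp add: F_def Q0 clin_0[OF cl(1)])

lemma G_F: "norm h \<le> e1 \<Longrightarrow> G (\<iota> (w + h)) = \<iota> (w + F h)"
  using G by (simp add: F_def)

lemma r_analytic: "analytic_map_on V N V N (nball V N (\<iota> w) r0) G"
  unfolding repr_nball[OF V]
proof (rule repr_analytic[OF V, where H = "\<lambda>x. w + (L (x - w) + Q (x - w))" and M = M])
  have b: "norm (x - w) \<le> e1" if "x \<in> ball w r0" for x
    using that r0 by (simp add: dist_norm norm_minus_commute)
  show "hcurve U (\<lambda>z. w + (L (\<gamma> z - w) + Q (\<gamma> z - w)))" if "hcurve U \<gamma>" "\<gamma> ` U \<subseteq> ball w r0" for U \<gamma>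
    by (rule hG[OF that(1) b]) (use that(2) in blast)
  show "norm (w + (L (x - w) + Q (x - w))) \<le> M" if "x \<in> ball w r0" for x by (rule bG[OF b[OF that]])
  show "G (\<iota> x) = \<iota> (w + (L (x - w) + Q (x - w)))" if "x \<in> ball w r0" for x
    using G[OF b[OF that]] by simp
qed simp

lemma hyperbolic: "hyperbolic_fixed_point V N G (\<iota> w)"
  unfolding hyperbolic_fixed_point_def
proof (intro conjI exI[of _ "\<lambda>f. \<iota> (L (inv \<iota> f))"])
  show "\<iota> w \<in> V" by (rule repr_mem[OF V])
  show "G (\<iota> w) = \<iota> w" using G_F[of 0] e1 F0 by simp
  show "has_cderivative V N V N G (\<lambda>f. \<iota> (L (inv \<iota> f))) (\<iota> w)"
  proof (rule repr_cderivative[OF V V cl(1), where s = e1 and H = "\<lambda>x. w + F (x - w)" and C = CQ])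
    show "G (\<iota> (w + h)) = \<iota> (w + F (w + h - w)) \<and> w + F (w + h - w) \<in> UNIV" if "norm h < e1" for h
      using G_F[of h] that by simp
    show "norm (w + F (w + h - w) - (w + F (w - w)) - L h) \<le> CQ * (norm h)\<^sup>2" if "norm h < e1" for h
      using quad[of h] that F0 by (simp add: F_def)
  qed (use e1 in auto)
  show "op_spectrum V N (\<lambda>f. \<iota> (L (inv \<iota> f))) \<inter> sphere 0 1 = {}"
  proof -
    have "z \<notin> op_spectrum V N (\<lambda>f. \<iota> (L (inv \<iota> f)))" if "cmod z = 1" for z
      by (rule resolvent_exists[OF that]) (rule repr_resolvent[OF V])
    then show ?thesis by auto
  qed
qed

text \<open>With \<open>un\<close>, the stable and unstable sets of the norm ball in centred
  coordinates. For \<open>un\<close> the backward orbit can be written with \<open>B\<close>,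
  because \<open>backward_orbit\<close> leaves no other possibility.\<close>

definition "st r = {y. \<forall>n. norm ((F ^^ n) y) < r}"
definition "un r = {y. Pu y = y \<and> (\<forall>n. norm ((B ^^ n) y) < r)}"

lemma stable_set_eq:
  assumes r: "r \<le> r0"
  shows "stable_set G (nball V N (\<iota> w) r) = (\<lambda>y. \<iota> (w + y)) ` st r"
proof -
  have mem: "\<iota> (w + y) \<in> nball V N (\<iota> w) r \<longleftrightarrow> norm y < r" for y
  proof -
    have "\<iota> (w + y) \<in> \<iota> ` ball w r \<longleftrightarrow> w + y \<in> ball w r" using reprD(2)[OF V] by (metis image_iff)
    then show ?thesis by (simp add: repr_nball[OF V] dist_norm)
  qed
  \<comment> \<open>\<open>G\<close> is known to agree with \<open>F\<close> only inside the ball,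
    so the form of the orbit and its confinement are carried along the same induction.\<close>
  have it: "(\<forall>n. (G ^^ n) (\<iota> (w + y)) \<in> nball V N (\<iota> w) r) \<longleftrightarrow> y \<in> st r" for y
  proof
    assume all: "\<forall>n. (G ^^ n) (\<iota> (w + y)) \<in> nball V N (\<iota> w) r"
    have "(G ^^ n) (\<iota> (w + y)) = \<iota> (w + (F ^^ n) y) \<and> norm ((F ^^ n) y) < r" for n
    proof (induction n)
      case 0
      then show ?case using all[rule_format, of 0] mem[of y] by simp
    next
      case (Suc n)
      have "(G ^^ Suc n) (\<iota> (w + y)) = \<iota> (w + (F ^^ Suc n) y)"
        using Suc G_F[of "(F ^^ n) y"] r r0(2) by simp
      then show ?case using all[rule_format, of "Suc n"] mem[of "(F ^^ Suc n) y"] by simp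
    qed
    then show "y \<in> st r" by (simp add: st_def)
  next
    assume y: "y \<in> st r"
    have "(G ^^ n) (\<iota> (w + y)) = \<iota> (w + (F ^^ n) y)" for n
    proof (induction n)
      case (Suc n)
      have "norm ((F ^^ n) y) < r" using y by (simp add: st_def)
      then show ?case using Suc G_F[of "(F ^^ n) y"] r r0(2) by simp
    qed simp
    then show "\<forall>n. (G ^^ n) (\<iota> (w + y)) \<in> nball V N (\<iota> w) r" using y by (simp add: mem st_def)
  qed
  show ?thesis
  proof (rule set_eqI)
    fix f
    show "f \<in> stable_set G (nball V N (\<iota> w) r) \<longleftrightarrow> f \<in> (\<lambda>y. \<iota> (w + y)) ` st r"
    proof
      assume f: "f \<in> stable_set G (nball V N (\<iota> w) r)"
      then have "f \<in> V" by (simp add: stable_set_def nball_def)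
      then obtain x where x: "f = \<iota> x" using reprD(1)[OF V] by blast
      then have e: "f = \<iota> (w + (x - w))" by simp
      have "\<forall>n. (G ^^ n) f \<in> nball V N (\<iota> w) r" using f by (simp add: stable_set_def)
      then have "x - w \<in> st r" by (intro iffD1[OF it], unfold e[symmetric])
      then show "f \<in> (\<lambda>y. \<iota> (w + y)) ` st r" using e by blast
    next
      assume "f \<in> (\<lambda>y. \<iota> (w + y)) ` st r"
      then obtain y where y: "f = \<iota> (w + y)" "y \<in> st r" ..
      then have all: "\<forall>n. (G ^^ n) f \<in> nball V N (\<iota> w) r" using it[of y] by simp
      then show "f \<in> stable_set G (nball V N (\<iota> w) r)"
        using all[rule_format, of 0] by (simp add: stable_set_def)
    qed
  qed
qed

lemma unstable_set_eq:
  assumes r: "r \<le> r0"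
  shows "unstable_set G (nball V N (\<iota> w) r) = (\<lambda>y. \<iota> (w + y)) ` un r"
proof -
  have nb: "f \<in> nball V N (\<iota> w) r \<longleftrightarrow> (\<exists>y. f = \<iota> (w + y) \<and> norm y < r)" for f
  proof -
    have "f \<in> \<iota> ` ball w r \<longleftrightarrow> (\<exists>y. f = \<iota> (w + y) \<and> norm y < r)"
    proof
      assume "f \<in> \<iota> ` ball w r"
      then obtain x where x: "f = \<iota> x" "x \<in> ball w r" ..
      have "norm (x - w) < r" using x(2) by (simp add: dist_norm norm_minus_commute)
      then have "f = \<iota> (w + (x - w)) \<and> norm (x - w) < r" using x(1) by simp
      then show "\<exists>y. f = \<iota> (w + y) \<and> norm y < r" ..
    next
      assume "\<exists>y. f = \<iota> (w + y) \<and> norm y < r"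
      then show "f \<in> \<iota> ` ball w r" by (auto simp: dist_norm)
    qed
    then show ?thesis by (simp add: repr_nball[OF V])
  qed
  show ?thesis
  proof (rule set_eqI)
    fix f
    show "f \<in> unstable_set G (nball V N (\<iota> w) r) \<longleftrightarrow> f \<in> (\<lambda>y. \<iota> (w + y)) ` un r"
    proof
      assume f: "f \<in> unstable_set G (nball V N (\<iota> w) r)"
      then obtain Y where Y: "Y 0 = f" "\<forall>n. Y n \<in> nball V N (\<iota> w) r \<and> G (Y (Suc n)) = Y n"
        unfolding unstable_set_def by blast
      then have "\<forall>n. \<exists>y. Y n = \<iota> (w + y) \<and> norm y < r" unfolding nb by blast
      from choice[OF this] obtain y where "\<forall>n. Y n = \<iota> (w + y n) \<and> norm (y n) < r" ..
      then have y: "Y n = \<iota> (w + y n)" "norm (y n) < r" for n by simp_all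
      have Fy: "F (y (Suc n)) = y n" for n
      proof -
        have "\<iota> (w + F (y (Suc n))) = \<iota> (w + y n)"
        proof -
          have "G (\<iota> (w + y (Suc n))) = \<iota> (w + y n)" using Y(2) unfolding y(1) by blast
          then show ?thesis using G_F[of "y (Suc n)"] y(2)[of "Suc n"] r r0(2) by simp
        qed
        then show ?thesis by (simp add: reprD(2)[OF V])
      qed
      have b: "a (y n) \<le> s" for n by (rule small(2)[OF y(2) r])
      note bo = backward_orbit[where y = y, OF b Fy]
      have "norm ((B ^^ n) (y 0)) < r" for n using bo(2)[of n] y(2)[of n] by simp
      then have "y 0 \<in> un r" using bo(1) by (simp add: un_def)
      then show "f \<in> (\<lambda>y. \<iota> (w + y)) ` un r" using Y(1) y(1)[of 0] by blast
    next
      assume "f \<in> (\<lambda>y. \<iota> (w + y)) ` un r"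
      then obtain y where y: "f = \<iota> (w + y)" "y \<in> un r" ..
      then have Py: "Pu y = y" and ny: "norm ((B ^^ n) y) < r" for n by (simp_all add: un_def)
      have ay: "a y \<le> s" using small(2)[OF ny[of 0] r] by simp
      define Y where "Y n = \<iota> (w + (B ^^ n) y)" for n
      have "G (Y (Suc n)) = Y n" for n
        using G_F[of "(B ^^ Suc n) y"] ny[of "Suc n"] r r0(2) unstable_orbit(3)[OF Py ay, of n] by (simp add: Y_def)
      moreover have "Y n \<in> nball V N (\<iota> w) r" for n unfolding nb Y_def using ny[of n] by blast
      moreover have "Y 0 = f" by (simp add: Y_def y(1))
      ultimately show "f \<in> unstable_set G (nball V N (\<iota> w) r)" unfolding unstable_set_def by blast
    qed
  qed
qed

lemma st_orbit: "y \<in> st r \<Longrightarrow> r \<le> r0 \<Longrightarrow> orbit (\<lambda>n. (F ^^ n) y)"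
  unfolding orbit_def st_def using small(2) by auto

lemma orbit_0: "orbit (\<lambda>n. 0)"
  using s by (simp add: orbit_def F0)

text \<open>The orbit of \<open>y\<close> tends to 0 and hence stays in a ball of radius
  \<open>c < r\<close>. A nearby point of the graph has an orbit whose distance from it never
  exceeds a multiple of the initial distance, so it stays in the ball of radius \<open>r\<close>
  too; conversely confined orbits lie on the graph.\<close>

lemma st_local:
  assumes y: "y \<in> st r" and r: "r \<le> r0"
  obtains \<epsilon> where "0 < \<epsilon>" "\<And>x. norm (x - y) < \<epsilon> \<Longrightarrow> norm x < r \<and> (x \<in> st r \<longleftrightarrow> Pu x = gr x)"
proof -
  have ny: "norm ((F ^^ n) y) < r" for n using y by (simp add: st_def)
  have rp: "0 < r" by (rule le_less_trans[OF norm_ge_zero ny])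
  have oy: "orbit (\<lambda>n. (F ^^ n) y)" by (rule st_orbit[OF y r])
  have "(\<lambda>n. norm ((F ^^ n) y)) \<longlonglongrightarrow> 0"
  proof (rule tendsto_norm_zero, rule Lim_null_comparison[OF always_eventually, rule_format])
    show "norm ((F ^^ n) y) \<le> (C1 * a (Ps y)) * mu ^ n" for n
    proof -
      have "a ((F ^^ n) y) \<le> mu ^ n * a (Ps y)" using orbit_contract[OF oy orbit_0, of n] by simp
      then have "C1 * a ((F ^^ n) y) \<le> C1 * (mu ^ n * a (Ps y))" using C by (intro mult_left_mono) auto
      then show ?thesis using norm_a[of "(F ^^ n) y"] by (simp add: mult_ac)
    qed
    show "(\<lambda>n. (C1 * a (Ps y)) * mu ^ n) \<longlonglongrightarrow> 0"
      by (intro tendsto_mult_right_zero LIMSEQ_realpow_zero) (use mu in auto)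
  qed
  from uniform_gap[OF this ny rp] obtain c where c: "c < r" "\<And>n. norm ((F ^^ n) y) \<le> c" by blast
  \<comment> \<open>The first bound keeps \<open>x\<close> in the ball; the second makes the
    distance between the two orbits at most \<open>r - c\<close> after the passage to the adapted
    norm and back.\<close>
  define \<epsilon> where "\<epsilon> = min (r - norm y) ((r - c) / (C1 * C2))"
  have ep: "0 < \<epsilon>" "\<epsilon> \<le> r - norm y" "\<epsilon> \<le> (r - c) / (C1 * C2)"
    using ny[of 0] c(1) C by (auto simp: \<epsilon>_def)
  show ?thesis
  proof (rule that[OF ep(1)], intro conjI)
    fix x assume x: "norm (x - y) < \<epsilon>"
    show nx: "norm x < r" using norm_triangle_ineq[of "x - y" y] x ep(2) by simp
    have ax: "a (Ps x) \<le> s1" using small(1)[OF nx r] a_Ps_le[of x] by simp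
    have ay: "a (Ps y) \<le> s1" using small(1)[OF ny[of 0] r] a_Ps_le[of y] by simp
    show "x \<in> st r \<longleftrightarrow> Pu x = gr x"
    proof
      assume "x \<in> st r"
      from orbit_gr[OF st_orbit[OF this r]] show "Pu x = gr x" using ax by simp
    next
      assume g: "Pu x = gr x"
      have z0: "zlim x 0 = x" using zlim_0[OF ax] split[of x] g by simp
      have zo: "orbit (zlim x)" by (rule zlim_orbit(1)[OF ax])
      have zn: "zlim x n = (F ^^ n) x" for n
        by (induction n) (use z0 zo in \<open>simp_all add: orbit_def\<close>)
      have "norm ((F ^^ n) x) < r" for n
      proof -
        have "a ((F ^^ n) x - (F ^^ n) y) \<le> mu ^ n * a (Ps (x - y))"
          using orbit_contract[OF zo oy, of n] unfolding zn by simp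
        also have "\<dots> \<le> 1 * a (Ps (x - y))" using mu by (intro mult_right_mono power_le_one) auto
        also have "\<dots> \<le> C2 * norm (x - y)" using a_Ps_le[of "x - y"] a_norm[of "x - y"] by simp
        finally have "C1 * a ((F ^^ n) x - (F ^^ n) y) \<le> C1 * (C2 * norm (x - y))"
          using C by (intro mult_left_mono) auto
        also have "\<dots> < r - c"
        proof -
          have "norm (x - y) < (r - c) / (C1 * C2)" using x ep(3) by simp
          then show ?thesis using C by (simp add: pos_less_divide_eq mult_ac)
        qed
        finally have "norm ((F ^^ n) x - (F ^^ n) y) < r - c" using norm_a[of "(F ^^ n) x - (F ^^ n) y"] by linarith
        then show ?thesis using norm_triangle_ineq[of "(F ^^ n) x - (F ^^ n) y" "(F ^^ n) y"] c(2)[of n] by simp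
      qed
      then show "x \<in> st r" by (simp add: st_def)
    qed
  qed
qed

text \<open>The same gap argument for backward orbits, simpler because \<open>B\<close> is linear:
  differences of backward orbits are themselves backward orbits and decay.\<close>

lemma un_local:
  assumes y: "y \<in> un r" and r: "r \<le> r0"
  obtains \<epsilon> where "0 < \<epsilon>" "\<And>x. norm (x - y) < \<epsilon> \<Longrightarrow> x \<in> un r \<longleftrightarrow> Pu x = x"
proof -
  have ny: "norm ((B ^^ n) y) < r" for n using y by (simp add: un_def)
  have rp: "0 < r" by (rule le_less_trans[OF norm_ge_zero ny])
  have Py: "Pu y = y" using y by (simp add: un_def)
  have ay: "a y \<le> s" using small(2)[OF ny[of 0] r] by simp
  have "(\<lambda>n. norm ((B ^^ n) y)) \<longlonglongrightarrow> 0"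
  proof (rule tendsto_norm_zero, rule Lim_null_comparison[OF always_eventually, rule_format])
    show "norm ((B ^^ n) y) \<le> (C1 * a y) * q ^ n" for n
    proof -
      have "C1 * a ((B ^^ n) y) \<le> C1 * (q ^ n * a y)" using C unstable_orbit(2)[OF Py ay] by (intro mult_left_mono) auto
      then show ?thesis using norm_a[of "(B ^^ n) y"] by (simp add: mult_ac)
    qed
    show "(\<lambda>n. (C1 * a y) * q ^ n) \<longlonglongrightarrow> 0"
      by (intro tendsto_mult_right_zero LIMSEQ_realpow_zero) (use q in auto)
  qed
  from uniform_gap[OF this ny rp] obtain c where c: "c < r" "\<And>n. norm ((B ^^ n) y) \<le> c" by blast
  define \<epsilon> where "\<epsilon> = min (s / C2) ((r - c) / (C1 * C2))"
  have ep: "0 < \<epsilon>" "\<epsilon> \<le> s / C2" "\<epsilon> \<le> (r - c) / (C1 * C2)"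
    using s c(1) C by (auto simp: \<epsilon>_def)
  show ?thesis
  proof (rule that[OF ep(1)])
    fix x assume x: "norm (x - y) < \<epsilon>"
    show "x \<in> un r \<longleftrightarrow> Pu x = x"
    proof
      assume Px: "Pu x = x"
      have Pd: "Pu (x - y) = x - y" by (simp add: clin_diff[OF cl(4)] Px Py)
      have "norm (x - y) < s / C2" using x ep(2) by simp
      then have "C2 * norm (x - y) < s" using C by (simp add: pos_less_divide_eq mult.commute)
      then have ad: "a (x - y) \<le> s" using a_norm[of "x - y"] by linarith
      have Bd: "(B ^^ n) (x - y) = (B ^^ n) x - (B ^^ n) y" for n
        by (induction n) (simp_all add: clin_diff[OF cl(2)])
      have "norm ((B ^^ n) x) < r" for n
      proof -
        have "a ((B ^^ n) (x - y)) \<le> q ^ n * a (x - y)" by (rule unstable_orbit(2)[OF Pd ad])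
        also have "\<dots> \<le> 1 * a (x - y)" using q by (intro mult_right_mono power_le_one) auto
        also have "\<dots> \<le> C2 * norm (x - y)" using a_norm[of "x - y"] by simp
        finally have "C1 * a ((B ^^ n) (x - y)) \<le> C1 * (C2 * norm (x - y))"
          using C by (intro mult_left_mono) auto
        also have "\<dots> < r - c"
        proof -
          have "norm (x - y) < (r - c) / (C1 * C2)" using x ep(3) by simp
          then show ?thesis using C by (simp add: pos_less_divide_eq mult_ac)
        qed
        finally have "norm ((B ^^ n) x - (B ^^ n) y) < r - c" using norm_a[of "(B ^^ n) (x - y)"] unfolding Bd by linarith
        then show ?thesis using norm_triangle_ineq[of "(B ^^ n) x - (B ^^ n) y" "(B ^^ n) y"] c(2)[of n] by simp
      qed
      then show "x \<in> un r" by (simp add: un_def Px)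
    qed (simp add: un_def)
  qed
qed

lemma Pu_closed: "closed {x. Pu x = 0}" "closed {x. Pu x = x}"
proof -
  have c: "continuous_on UNIV Pu" by (rule linear_continuous_on[OF clin_blin[OF cl(4)]])
  show "closed {x. Pu x = 0}" "closed {x. Pu x = x}"
    by (rule closed_Collect_eq[OF c]; intro continuous_intros)+
qed

lemma codim: "has_ccodim V n (\<iota> ` {x. Pu x = 0})"
  unfolding has_ccodim_def
proof (intro conjI exI[of _ "\<iota> ` {x. Pu x = x}"])
  show "csubspace_of V (\<iota> ` {x. Pu x = 0})"
    by (rule repr_csubspace[OF V]) (auto simp: clin_0[OF cl(4)] clin_add[OF cl(4)] clin_cs[OF cl(4)])
  show "has_cdim V n (\<iota> ` {x. Pu x = x})" by (rule dim)
  show "\<iota> ` {x. Pu x = 0} \<inter> \<iota> ` {x. Pu x = x} = {0}"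
  proof
    show "\<iota> ` {x. Pu x = 0} \<inter> \<iota> ` {x. Pu x = x} \<subseteq> {0}"
      using repr_diff(2)[OF V] reprD(2)[OF V] by auto
    have "0 \<in> \<iota> ` {x. Pu x = 0}" "0 \<in> \<iota> ` {x. Pu x = x}"
      by (rule image_eqI[of _ _ 0]; simp add: repr_diff(2)[OF V] clin_0[OF cl(4)])+
    then show "{0} \<subseteq> \<iota> ` {x. Pu x = 0} \<inter> \<iota> ` {x. Pu x = x}" by simp
  qed
  show "\<forall>f\<in>V. \<exists>g\<in>\<iota> ` {x. Pu x = 0}. \<exists>h\<in>\<iota> ` {x. Pu x = x}. f = g + h"
  proof
    fix f assume "f \<in> V"
    then obtain x where x: "f = \<iota> x" using reprD(1)[OF V] by blast
    have "f = \<iota> (Ps x) + \<iota> (Pu x)" using split[of x] by (simp add: x reprD(3)[OF V, symmetric])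
    moreover have "\<iota> (Ps x) \<in> \<iota> ` {x. Pu x = 0}" "\<iota> (Pu x) \<in> \<iota> ` {x. Pu x = x}" by (simp_all add: proj)
    ultimately show "\<exists>g\<in>\<iota> ` {x. Pu x = 0}. \<exists>h\<in>\<iota> ` {x. Pu x = x}. f = g + h" by blast
  qed
qed

text \<open>The chart \<open>x \<mapsto> x - gr x\<close> straightens the graph of \<open>gr\<close> over the stable subspace.\<close>

lemma stable_submanifold:
  assumes r: "r \<le> r0"
  shows "submanifold_of_codim V N n (stable_set G (nball V N (\<iota> w) r))"
  unfolding submanifold_of_codim_def analytic_submanifold_def stable_set_eq[OF r]
proof (intro conjI ballI)
  show "(\<lambda>y. \<iota> (w + y)) ` st r \<subseteq> V" using repr_mem[OF V] by blast
  fix p assume "p \<in> (\<lambda>y. \<iota> (w + y)) ` st r"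
  then obtain y where p: "p = \<iota> (w + y)" and y: "y \<in> st r" ..
  obtain \<epsilon> where ep: "0 < \<epsilon>" and loc: "\<And>x. norm (x - y) < \<epsilon> \<Longrightarrow> norm x < r \<and> (x \<in> st r \<longleftrightarrow> Pu x = gr x)"
    by (rule st_local[OF y r]) blast
  define A where "A = ball (w + y) \<epsilon>"
  \<comment> \<open>\<open>gr\<close> takes values in the unstable subspace and depends on the
    stable component alone, so subtracting and adding it do not alter its argument. This makes the
    two maps mutually inverse.\<close>
  define ph where "ph x = (x - w) - gr (x - w)" for x
  define ps where "ps u = w + u + gr u" for u
  have A: "x \<in> A \<longleftrightarrow> norm (x - w - y) < \<epsilon>" for x
    by (simp add: A_def dist_norm norm_minus_commute algebra_simps)
  have Ax: "norm (x - w) < r" "a (x - w) < s1" "a (Ps (x - w)) \<le> s1" if "x \<in> A" for x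
  proof -
    show 1: "norm (x - w) < r" using loc[of "x - w"] that A by simp
    show 2: "a (x - w) < s1" by (rule small(1)[OF 1 r])
    show "a (Ps (x - w)) \<le> s1" using 2 a_Ps_le[of "x - w"] by simp
  qed
  have Ps_ph: "Ps (ph x) = Ps (x - w)" for x by (simp add: ph_def clin_diff[OF cl(3)] gr_proj)
  have gr_ph: "gr (ph x) = gr (x - w)" for x by (rule gr_Ps[OF Ps_ph])
  have psph: "ps (ph x) = x" for x unfolding ps_def gr_ph by (simp add: ph_def)
  have phps: "ph (ps u) = u" for u
  proof -
    have "Ps (ps u - w) = Ps u" by (simp add: ps_def clin_add[OF cl(3)] gr_proj)
    from gr_Ps[OF this] show ?thesis by (simp add: ph_def ps_def)
  qed
  have opA': "open (ph ` A)"
    unfolding open_dist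
  proof (intro ballI)
    fix u0 assume "u0 \<in> ph ` A"
    then obtain x0 where x0: "u0 = ph x0" "x0 \<in> A" ..
    \<comment> \<open>\<open>t1\<close> keeps the stable component of \<open>u\<close> where
      \<open>gr\<close> is Lipschitz, and \<open>t2\<close> then keeps \<open>ps u\<close> in the
      ball, since \<open>ps\<close> has Lipschitz constant \<open>1 + C1 * C2\<close>. Openness of
      the image thus rests on the inverse chart.\<close>
    define t1 where "t1 = (s1 - a (x0 - w)) / C2"
    define t2 where "t2 = (\<epsilon> - norm (x0 - w - y)) / (1 + C1 * C2)"
    have C12: "0 < 1 + C1 * C2" using C by (simp add: add_pos_pos)
    have t: "0 < t1" "0 < t2" using Ax(2)[OF x0(2)] x0(2) A C C12 by (simp_all add: t1_def t2_def)
    have "u \<in> ph ` A" if u: "dist u u0 < min t1 t2" for u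
    proof -
      have n: "norm (u - u0) < t1" "norm (u - u0) < t2" using u by (simp_all add: dist_norm)
      have "C2 * norm (u - u0) < s1 - a (x0 - w)" using n(1) C by (simp add: t1_def pos_less_divide_eq mult.commute)
      moreover have "a (Ps u) \<le> a (Ps u0) + a (Ps (u - u0))"
        using a_add[of "Ps u0" "Ps (u - u0)"] by (simp add: clin_diff[OF cl(3)])
      moreover have "a (Ps u0) \<le> a (x0 - w)" unfolding x0(1) Ps_ph by (rule a_Ps_le)
      ultimately have au: "a (Ps u) \<le> s1" using a_Ps_le[of "u - u0"] a_norm[of "u - u0"] by linarith
      have au0: "a (Ps u0) \<le> s1" unfolding x0(1) Ps_ph by (rule Ax(3)[OF x0(2)])
      have "ps u - x0 = (u - u0) + (gr u - gr u0)"
        using psph[of x0] by (simp add: ps_def x0(1)[symmetric] algebra_simps)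
      then have "norm (ps u - x0) \<le> norm (u - u0) + C1 * C2 * norm (u - u0)"
        using norm_triangle_ineq[of "u - u0" "gr u - gr u0"] gr_lipschitz[OF au au0] by simp
      also have "\<dots> = (1 + C1 * C2) * norm (u - u0)" by (simp add: algebra_simps)
      also have "\<dots> < \<epsilon> - norm (x0 - w - y)" using n(2) C12 by (simp add: t2_def pos_less_divide_eq mult.commute)
      finally have "norm (ps u - w - y) < \<epsilon>"
        using norm_triangle_ineq[of "ps u - x0" "x0 - w - y"] by (simp add: algebra_simps)
      then have "ps u \<in> A" by (simp add: A)
      then show ?thesis using phps[of u] by (metis imageI)
    qed
    then show "\<exists>e>0. \<forall>u. dist u u0 < e \<longrightarrow> u \<in> ph ` A" using t by (intro exI[of _ "min t1 t2"]) simp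
  qed
  let ?E = "{x. Pu x = 0}"
  show "\<exists>A A' \<phi> \<psi> E. p \<in> A \<and> csubspace_of V E \<and> nclosed V N E \<and> has_ccodim V n E \<and>
      analytic_map_on V N V N A \<phi> \<and> analytic_map_on V N V N A' \<psi> \<and> \<phi> ` A = A' \<and> (\<forall>x\<in>A. \<psi> (\<phi> x) = x) \<and>
      \<phi> ` (A \<inter> (\<lambda>y. \<iota> (w + y)) ` st r) = A' \<inter> E"
  proof (intro exI conjI)
    let ?\<phi> = "\<lambda>f. \<iota> (ph (inv \<iota> f))" and ?\<psi> = "\<lambda>f. \<iota> (ps (inv \<iota> f))"
    show "p \<in> \<iota> ` A" using ep by (simp add: p A)
    show "csubspace_of V (\<iota> ` ?E)" using codim by (simp add: has_ccodim_def)
    show "nclosed V N (\<iota> ` ?E)" by (rule repr_nclosed[OF V Pu_closed(1)])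
    show "has_ccodim V n (\<iota> ` ?E)" by (rule codim)
    show "analytic_map_on V N V N (\<iota> ` A) ?\<phi>"
    proof (rule repr_analytic[OF V, where H = ph and M = "r + C1 * s"])
      show "open A" by (simp add: A_def)
      show "hcurve U (\<lambda>z. ph (\<gamma> z))" if g: "hcurve U \<gamma>" "\<gamma> ` U \<subseteq> A" for U \<gamma>
      proof -
        have d: "hcurve U (\<lambda>z. \<gamma> z - w)" by (rule hcurve_diff[OF g(1) hcurve_const[OF hcurve_open[OF g(1)]]])
        show ?thesis unfolding ph_def
          by (rule hcurve_diff[OF d hcurve_gr[OF d Ax(3)]]) (use g(2) in blast)
      qed
      show "norm (ph x) \<le> r + C1 * s" if "x \<in> A" for x
        using norm_triangle_ineq4[of "x - w" "gr (x - w)"] Ax(1)[OF that] gr_bound[OF Ax(3)[OF that]] by (simp add: ph_def)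
      show "\<iota> (ph (inv \<iota> (\<iota> x))) = \<iota> (ph x)" for x by (simp add: repr_inv[OF V])
    qed
    show "analytic_map_on V N V N (\<iota> ` ph ` A) ?\<psi>"
    proof (rule repr_analytic[OF V opA', where H = ps and M = "norm (w + y) + \<epsilon>"])
      show "hcurve U (\<lambda>z. ps (\<gamma> z))" if g: "hcurve U \<gamma>" "\<gamma> ` U \<subseteq> ph ` A" for U \<gamma>
      proof -
        have "a (Ps (\<gamma> z)) \<le> s1" if "z \<in> U" for z
        proof -
          obtain x where "\<gamma> z = ph x" "x \<in> A" using g(2) \<open>z \<in> U\<close> by blast
          then show ?thesis using Ax(3)[of x] by (simp add: Ps_ph)
        qed
        then show ?thesis unfolding ps_def
          by (intro hcurve_add hcurve_const[OF hcurve_open[OF g(1)]] g(1) hcurve_gr[OF g(1)])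
      qed
      show "norm (ps u) \<le> norm (w + y) + \<epsilon>" if u: "u \<in> ph ` A" for u
      proof -
        obtain x where x: "u = ph x" "x \<in> A" using u by blast
        have "norm x \<le> norm (x - w - y) + norm (w + y)" using norm_triangle_ineq[of "x - w - y" "w + y"] by simp
        then show ?thesis using x A psph[of x] by simp
      qed
      show "\<iota> (ps (inv \<iota> (\<iota> x))) = \<iota> (ps x)" for x by (simp add: repr_inv[OF V])
    qed
    show "?\<phi> ` \<iota> ` A = \<iota> ` ph ` A" by (simp add: image_image repr_inv[OF V])
    show "\<forall>x\<in>\<iota> ` A. ?\<psi> (?\<phi> x) = x" by (simp add: repr_inv[OF V] psph)
    have mem: "ph x \<in> ?E \<longleftrightarrow> x - w \<in> st r" if "x \<in> A" for x
    proof -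
      have "Pu (ph x) = Pu (x - w) - gr (x - w)" by (simp add: ph_def clin_diff[OF cl(4)] gr_proj)
      then show ?thesis using loc[of "x - w"] that A by simp
    qed
    show "?\<phi> ` (\<iota> ` A \<inter> (\<lambda>y. \<iota> (w + y)) ` st r) = \<iota> ` ph ` A \<inter> \<iota> ` ?E"
    proof
      show "?\<phi> ` (\<iota> ` A \<inter> (\<lambda>y. \<iota> (w + y)) ` st r) \<subseteq> \<iota> ` ph ` A \<inter> \<iota> ` ?E"
      proof
        fix f assume "f \<in> ?\<phi> ` (\<iota> ` A \<inter> (\<lambda>y. \<iota> (w + y)) ` st r)"
        then obtain x y where x: "f = ?\<phi> (\<iota> x)" "x \<in> A" "\<iota> x = \<iota> (w + y)" "y \<in> st r" by blast
        then have "x - w = y" by (simp add: reprD(2)[OF V])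
        then have "ph x \<in> ?E" using mem[OF x(2)] x(4) by simp
        then show "f \<in> \<iota> ` ph ` A \<inter> \<iota> ` ?E" unfolding x(1) repr_inv[OF V] using x(2) by blast
      qed
      show "\<iota> ` ph ` A \<inter> \<iota> ` ?E \<subseteq> ?\<phi> ` (\<iota> ` A \<inter> (\<lambda>y. \<iota> (w + y)) ` st r)"
      proof
        fix f assume "f \<in> \<iota> ` ph ` A \<inter> \<iota> ` ?E"
        then obtain x e where x: "f = \<iota> (ph x)" "x \<in> A" "\<iota> (ph x) = \<iota> e" "e \<in> ?E" by blast
        then have "ph x \<in> ?E" using reprD(2)[OF V] by metis
        then have "x - w \<in> st r" using mem[OF x(2)] by simp
        then have "\<iota> x \<in> (\<lambda>y. \<iota> (w + y)) ` st r" by (intro image_eqI[of _ _ "x - w"]) simp_all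
        then show "f \<in> ?\<phi> ` (\<iota> ` A \<inter> (\<lambda>y. \<iota> (w + y)) ` st r)"
          using x(2) by (intro image_eqI[of _ _ "\<iota> x"]) (simp_all add: x(1) repr_inv[OF V])
      qed
    qed
  qed
qed

text \<open>Near each of its points the unstable set is a piece of the affine space through \<omega>
  parallel to the unstable subspace, so a translation serves as chart.\<close>

lemma unstable_submanifold:
  assumes r: "r \<le> r0"
  shows "submanifold_of_dim V N n (unstable_set G (nball V N (\<iota> w) r))"
  unfolding submanifold_of_dim_def analytic_submanifold_def unstable_set_eq[OF r]
proof (intro conjI ballI)
  show "(\<lambda>y. \<iota> (w + y)) ` un r \<subseteq> V" using repr_mem[OF V] by blast
  fix p assume "p \<in> (\<lambda>y. \<iota> (w + y)) ` un r"
  then obtain y where p: "p = \<iota> (w + y)" and y: "y \<in> un r" ..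
  obtain \<epsilon> where ep: "0 < \<epsilon>" and loc: "\<And>x. norm (x - y) < \<epsilon> \<Longrightarrow> x \<in> un r \<longleftrightarrow> Pu x = x"
    by (rule un_local[OF y r]) blast
  let ?E = "{x. Pu x = x}"
  have bl: "x \<in> ball y \<epsilon> \<longleftrightarrow> norm (x - y) < \<epsilon>" for x by (simp add: dist_norm norm_minus_commute)
  have sh: "ball (w + y) \<epsilon> = (\<lambda>x. w + x) ` ball y \<epsilon>" by (simp add: add.commute[of w y])
  show "\<exists>A A' \<phi> \<psi> E. p \<in> A \<and> csubspace_of V E \<and> nclosed V N E \<and> has_cdim V n E \<and>
      analytic_map_on V N V N A \<phi> \<and> analytic_map_on V N V N A' \<psi> \<and> \<phi> ` A = A' \<and> (\<forall>x\<in>A. \<psi> (\<phi> x) = x) \<and>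
      \<phi> ` (A \<inter> (\<lambda>y. \<iota> (w + y)) ` un r) = A' \<inter> E"
  proof (intro exI conjI)
    let ?\<phi> = "\<lambda>f. f - \<iota> w" and ?\<psi> = "\<lambda>f. f + \<iota> w"
    have ph: "?\<phi> (\<iota> x) = \<iota> (x - w)" and psi: "?\<psi> (\<iota> x) = \<iota> (x + w)" for x
      by (simp_all add: repr_diff(1)[OF V] reprD(3)[OF V])
    show "p \<in> \<iota> ` ball (w + y) \<epsilon>" using ep by (simp add: p)
    show "csubspace_of V (\<iota> ` ?E)" using dim by (simp add: has_cdim_def)
    show "nclosed V N (\<iota> ` ?E)" by (rule repr_nclosed[OF V Pu_closed(2)])
    show "has_cdim V n (\<iota> ` ?E)" by (rule dim)
    show "analytic_map_on V N V N (\<iota> ` ball (w + y) \<epsilon>) ?\<phi>"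
    proof (rule repr_analytic[OF V, where H = "\<lambda>x. x - w" and M = "norm y + \<epsilon>"])
      show "hcurve U (\<lambda>z. \<gamma> z - w)" if "hcurve U \<gamma>" for U \<gamma>
        by (rule hcurve_diff[OF that hcurve_const[OF hcurve_open[OF that]]])
      show "norm (x - w) \<le> norm y + \<epsilon>" if "x \<in> ball (w + y) \<epsilon>" for x
      proof -
        have "norm (x - w - y) < \<epsilon>" using that by (simp add: dist_norm norm_minus_commute algebra_simps)
        then show ?thesis using norm_triangle_ineq[of "x - w - y" y] by simp
      qed
    qed (simp_all only: open_ball ph)
    show "analytic_map_on V N V N (\<iota> ` ball y \<epsilon>) ?\<psi>"
    proof (rule repr_analytic[OF V, where H = "\<lambda>x. x + w" and M = "norm y + \<epsilon> + norm w"])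
      show "hcurve U (\<lambda>z. \<gamma> z + w)" if "hcurve U \<gamma>" for U \<gamma>
        by (rule hcurve_add[OF that hcurve_const[OF hcurve_open[OF that]]])
      show "norm (x + w) \<le> norm y + \<epsilon> + norm w" if "x \<in> ball y \<epsilon>" for x
        using that norm_triangle_ineq[of "x - y" y] norm_triangle_ineq[of x w] by (simp add: dist_norm norm_minus_commute)
    qed (simp_all only: open_ball psi)
    show im: "?\<phi> ` \<iota> ` ball (w + y) \<epsilon> = \<iota> ` ball y \<epsilon>"
      unfolding sh image_image ph by simp
    show "\<forall>x\<in>\<iota> ` ball (w + y) \<epsilon>. ?\<psi> (?\<phi> x) = x" by simp
    show "?\<phi> ` (\<iota> ` ball (w + y) \<epsilon> \<inter> (\<lambda>y. \<iota> (w + y)) ` un r) = \<iota> ` ball y \<epsilon> \<inter> \<iota> ` ?E"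
    proof
      show "?\<phi> ` (\<iota> ` ball (w + y) \<epsilon> \<inter> (\<lambda>y. \<iota> (w + y)) ` un r) \<subseteq> \<iota> ` ball y \<epsilon> \<inter> \<iota> ` ?E"
      proof
        fix f assume f: "f \<in> ?\<phi> ` (\<iota> ` ball (w + y) \<epsilon> \<inter> (\<lambda>y. \<iota> (w + y)) ` un r)"
        then have "f \<in> ?\<phi> ` (\<lambda>y. \<iota> (w + y)) ` un r" by (rule rev_subsetD) blast
        then have "f \<in> (\<lambda>y. ?\<phi> (\<iota> (w + y))) ` un r" by (simp only: image_image)
        then obtain v where v: "f = ?\<phi> (\<iota> (w + v))" "v \<in> un r" ..
        then have "f = \<iota> v" by (simp add: ph)
        moreover have "Pu v = v" using v(2) by (simp add: un_def)
        moreover have "f \<in> \<iota> ` ball y \<epsilon>" using f im by blast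
        ultimately show "f \<in> \<iota> ` ball y \<epsilon> \<inter> \<iota> ` ?E" by blast
      qed
      show "\<iota> ` ball y \<epsilon> \<inter> \<iota> ` ?E \<subseteq> ?\<phi> ` (\<iota> ` ball (w + y) \<epsilon> \<inter> (\<lambda>y. \<iota> (w + y)) ` un r)"
      proof
        fix f assume "f \<in> \<iota> ` ball y \<epsilon> \<inter> \<iota> ` ?E"
        then obtain x e where x: "f = \<iota> x" "x \<in> ball y \<epsilon>" "\<iota> x = \<iota> e" "e \<in> ?E" by blast
        then have "Pu x = x" by (simp add: reprD(2)[OF V])
        then have "x \<in> un r" using loc[of x] x(2) bl by simp
        then have "\<iota> (w + x) \<in> (\<lambda>y. \<iota> (w + y)) ` un r" by blast
        moreover have "\<iota> (w + x) \<in> \<iota> ` ball (w + y) \<epsilon>" unfolding sh using x(2) by blast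
        moreover have "f = ?\<phi> (\<iota> (w + x))" by (simp add: ph x(1))
        ultimately show "f \<in> ?\<phi> ` (\<iota> ` ball (w + y) \<epsilon> \<inter> (\<lambda>y. \<iota> (w + y)) ` un r)" by blast
      qed
    qed
  qed
qed

end

section \<open>Dimension of the unstable subspace and conclusion\<close>

lemma dim_dotp_kernel:
  fixes u v :: "complex ^ 'd::finite"
  assumes uv: "dotp u v = 1"
  obtains b where "finite b" "card b = CARD('d) - 1" "vec.independent b" "vec.span b = {x. dotp u x = 0}"
proof -
  let ?H = "{x. dotp u x = 0}"
  have sub: "vec.subspace ?H"
    by (auto simp: vec.subspace_def dotp_add_right dotp_smult_right) (simp add: dotp_def)
  obtain b where b: "b \<subseteq> ?H" "vec.independent b" "?H \<subseteq> vec.span b" "card b = vec.dim ?H"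
    using vec.basis_exists[of ?H] by blast
  have sp: "vec.span b = ?H" using b sub by (metis vec.span_subspace)
  \<comment> \<open>The vector \<open>v\<close> complements the kernel: adjoining it raises the
    dimension by one and already spans the whole space.\<close>
  have "v \<notin> vec.span ?H" using uv sub by (simp add: vec.span_eq_iff[THEN iffD2])
  then have d: "vec.dim (insert v ?H) = vec.dim ?H + 1" by (simp add: vec.dim_insert)
  have "x \<in> vec.span (insert v ?H)" for x
  proof -
    have "x - dotp u x *s v \<in> ?H" by (simp add: dotp_diff_right dotp_smult_right uv)
    then have "(x - dotp u x *s v) + dotp u x *s v \<in> vec.span (insert v ?H)"
      by (intro vec.span_add vec.span_scale vec.span_base) auto
    then show ?thesis by simp
  qed
  then have "vec.span (insert v ?H) = UNIV" by blast
  then have "vec.dim (insert v ?H) = CARD('d)" by (metis vec.dim_span vec.dim_UNIV vec_dim_card)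
  then have "card b = CARD('d) - 1" using d b(4) by simp
  then show ?thesis using that[of b] b(2) sp vec.independent_bound_general by (simp add: vec.finiteI_independent)
qed

context hyperbolic_renormalisation
begin

text \<open>A basis of the kernel of \<omega>' is carried over by the injective linear map that
  sends a vector to its constant field.\<close>

lemma unstable_dim: "has_cdim (spaceA' \<rho>) (CARD('d) - 1) ((\<lambda>x. fldA \<rho> (em x)) ` {x. Pu x = x})"
proof -
  let ?i = "\<lambda>x :: 'd cf. fldA \<rho> (em x)"
  have V: "repr UNIV ?i (spaceA' \<rho>) (normA' \<rho>)" by (rule repr_spaceA'[OF rho_pos])
  have E: "{x. Pu x = x} = cst ` {v. dotp (vec_of_real \<omega>') v = 0}"
  proof
    show "{x. Pu x = x} \<subseteq> cst ` {v. dotp (vec_of_real \<omega>') v = 0}"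
    proof
      fix x assume "x \<in> {x. Pu x = x}"
      then have x: "Pu x = x" by simp
      then have "x = cst (m0 x)" using Pu_cst_m0[of x] by simp
      moreover have "dotp (vec_of_real \<omega>') (m0 x) = 0" using beta_Pu[of x] by (simp add: x beta_m0[symmetric])
      ultimately show "x \<in> cst ` {v. dotp (vec_of_real \<omega>') v = 0}" by blast
    qed
    show "cst ` {v. dotp (vec_of_real \<omega>') v = 0} \<subseteq> {x. Pu x = x}"
      using Pu_cst by (auto simp: beta_cst)
  qed
  have "dotp (vec_of_real \<omega>') (vec_of_real \<omega>) = (1 :: complex)" by (simp add: dotp_vec_of_real pair)
  then obtain b where b: "finite b" "card b = CARD('d) - 1" "vec.independent b"
      "vec.span b = {x. dotp (vec_of_real \<omega>') x = (0 :: complex)}"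
    by (rule dim_dotp_kernel)
  interpret fs: vector_space "fscale :: complex \<Rightarrow> 'd vfield \<Rightarrow> 'd vfield" by (rule vector_space_fscale)
  define j where "j v = ?i (cst v)" for v
  interpret lj: Vector_Spaces.linear "vector_scalar_mult :: complex \<Rightarrow> complex ^ 'd \<Rightarrow> complex ^ 'd" "fscale :: complex \<Rightarrow> 'd vfield \<Rightarrow> 'd vfield" j
  proof unfold_locales
    show "j (x + y) = j x + j y" for x y
    proof -
      have "cst (x + y) = cst x + cst y" by (rule ell1_eqI) (simp add: split_paired_all ap_cst)
      then show ?thesis by (simp only: j_def reprD(3)[OF V])
    qed
    show "j (c *s x) = fscale c (j x)" for c x by (simp only: j_def cst_smult reprD(4)[OF V])
  qed
  have inj: "inj j"
  proof (rule injI)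
    fix x y assume "j x = j y"
    then have "cst x = cst y" by (simp only: j_def reprD(2)[OF V])
    then have "m0 (cst x) = m0 (cst y)" by simp
    then show "x = y" by (simp only: m0_simps)
  qed
  have im: "?i ` {x. Pu x = x} = j ` {v. dotp (vec_of_real \<omega>') v = 0}"
    unfolding E image_image j_def ..
  show ?thesis
    unfolding has_cdim_def
  proof (intro conjI exI[of _ "j ` b"])
    show "csubspace_of (spaceA' \<rho>) (?i ` {x. Pu x = x})"
      by (rule repr_csubspace[OF V]) (auto simp: clin_0[OF clin_Pu] clin_add[OF clin_Pu] clin_cs[OF clin_Pu])
    show "finite (j ` b)" using b by simp
    show "card (j ` b) = CARD('d) - 1" using card_image[OF inj_on_subset[OF inj]] b(2) by simp
    show "\<not> fs.dependent (j ` b)" using lj.independent_injective_image[OF b(3) inj_on_subset[OF inj]] by simp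
    show "fs.span (j ` b) = ?i ` {x. Pu x = x}" unfolding im b(4)[symmetric] by (rule lj.span_image)
  qed
qed

lemma renorm_hyperbolic:
  "\<exists>r\<^sub>0>0. r\<^sub>0 \<le> eps_hat \<omega> \<sigma> \<rho> \<rho>' \<and>
    analytic_map_on (spaceA' \<rho>) (normA' \<rho>) (spaceA' \<rho>) (normA' \<rho>)
      (nball (spaceA' \<rho>) (normA' \<rho>) (const_field \<rho> (vec_of_real \<omega>)) r\<^sub>0) (renorm \<omega> T \<omega>' \<sigma> \<rho> \<rho>') \<and>
    hyperbolic_fixed_point (spaceA' \<rho>) (normA' \<rho>) (renorm \<omega> T \<omega>' \<sigma> \<rho> \<rho>') (const_field \<rho> (vec_of_real \<omega>)) \<and>
    (\<forall>r. 0 < r \<and> r \<le> r\<^sub>0 \<longrightarrow>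
      submanifold_of_codim (spaceA' \<rho>) (normA' \<rho>) (CARD('d) - 1)
        (stable_set (renorm \<omega> T \<omega>' \<sigma> \<rho> \<rho>') (nball (spaceA' \<rho>) (normA' \<rho>) (const_field \<rho> (vec_of_real \<omega>)) r)) \<and>
      submanifold_of_dim (spaceA' \<rho>) (normA' \<rho>) (CARD('d) - 1)
        (unstable_set (renorm \<omega> T \<omega>' \<sigma> \<rho> \<rho>') (nball (spaceA' \<rho>) (normA' \<rho>) (const_field \<rho> (vec_of_real \<omega>)) r)))"
proof (rule saddle_Rh)
  fix e1 C M s C1 C2
  assume e1: "0 < e1" "e1 \<le> e0" and C: "0 \<le> C"
    and quad: "\<And>f. norm f \<le> e1 \<Longrightarrow> norm (Rh (w + f) - w - Lh f) \<le> C * (norm f)\<^sup>2"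
    and bd: "\<And>X. norm (X - w) \<le> e1 \<Longrightarrow> \<beta> (Rh X) = 1 \<and> norm (Rh X) \<le> M"
    and hc: "\<And>U \<xi>. hcurve U \<xi> \<Longrightarrow> (\<And>z. z \<in> U \<Longrightarrow> norm (\<xi> z - w) \<le> e1) \<Longrightarrow> hcurve U (\<lambda>z. Rh (\<xi> z))"
    and sad: "saddle Lh Bu Ps Pu (\<lambda>h. Rh (w + h) - w - Lh h) aa qq s C1 C2"
  let ?i = "\<lambda>x :: 'd cf. fldA \<rho> (em x)"
  interpret sc: saddle_chart Lh Bu Ps Pu "\<lambda>h. Rh (w + h) - w - Lh h" aa qq s C1 C2 ?i "spaceA' \<rho>" "normA' \<rho>"
    "renorm \<omega> T \<omega>' \<sigma> \<rho> \<rho>'" w e1 C M "CARD('d) - 1"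
  proof (rule saddle_chart.intro[OF sad], unfold_locales)
    show "repr UNIV ?i (spaceA' \<rho>) (normA' \<rho>)" by (rule repr_spaceA'[OF rho_pos])
    show "0 < e1" by fact
    show "renorm \<omega> T \<omega>' \<sigma> \<rho> \<rho>' (?i (w + h)) = ?i (w + (Lh h + (Rh (w + h) - w - Lh h)))" if "norm h \<le> e1" for h
      using renorm_eq[of "w + h"] that e1(2) by simp
    show "norm (Rh (w + h) - w - Lh h) \<le> C * (norm h)\<^sup>2" if "norm h \<le> e1" for h by (rule quad[OF that])
    show "hcurve U (\<lambda>z. w + (Lh (\<xi> z - w) + (Rh (w + (\<xi> z - w)) - w - Lh (\<xi> z - w))))"
      if "hcurve U \<xi>" "\<And>z. z \<in> U \<Longrightarrow> norm (\<xi> z - w) \<le> e1" for U \<xi>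
      using hc[OF that] by simp
    show "norm (w + (Lh h + (Rh (w + h) - w - Lh h))) \<le> M" if "norm h \<le> e1" for h
      using bd[of "w + h"] that by simp
    show "has_cdim (spaceA' \<rho>) (CARD('d) - 1) (?i ` {x. Pu x = x})" by (rule unstable_dim)
  qed
  have X0: "const_field \<rho> (vec_of_real \<omega>) = ?i w" by (simp add: em_cst fldA_cst)
  show ?thesis
    unfolding X0
    by (intro exI[of _ sc.r0] conjI allI impI sc.r0(1) sc.r_analytic sc.hyperbolic sc.stable_submanifold sc.unstable_submanifold)
       (use sc.r0 e1(2) e0(2) in auto)
qed

end

theorem theorem8p1:
  fixes \<omega> \<omega>' :: "real ^ ('d::{finite,linorder})"
    and T :: "int ^ ('d::{finite,linorder}) ^ ('d::{finite,linorder})"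
    and lam :: "'d \<Rightarrow> complex"
    and \<kappa> \<rho> \<rho>' \<sigma> :: real
  assumes "CARD('d) \<ge> 2"
    and "\<omega> \<in> koch_type"
    and "koch_matrix \<omega> T lam"
    and "dual_eigenvector \<omega> T lam \<omega>'"
    and "0 < \<kappa>" "\<kappa> < 1"
    and "0 < \<rho>'" "\<rho>' < \<rho>" "\<kappa> * \<rho> < \<rho>'"
    and "{x. dotp \<omega> x = 0} \<subseteq> contracted_cone T \<kappa>"
    and "0 < \<sigma>" "\<sigma> < 1 / 2 * inverse (l1norm \<omega>')"
    and "vec_of_int ` resonant_modes \<omega> \<sigma> \<subseteq> contracted_cone T \<kappa>"
  defines "V \<equiv> spaceA' \<rho>"
    and "N \<equiv> normA' \<rho>"
    and "R \<equiv> renorm \<omega> T \<omega>' \<sigma> \<rho> \<rho>'"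
    and "X\<^sub>0 \<equiv> const_field \<rho> (vec_of_real \<omega>)"
  shows "\<exists>r\<^sub>0>0. r\<^sub>0 \<le> eps_hat \<omega> \<sigma> \<rho> \<rho>' \<and>
    analytic_map_on V N V N (nball V N X\<^sub>0 r\<^sub>0) R \<and>
    hyperbolic_fixed_point V N R X\<^sub>0 \<and>
    (\<forall>r. 0 < r \<and> r \<le> r\<^sub>0 \<longrightarrow>
      submanifold_of_codim V N (CARD('d) - 1) (stable_set R (nball V N X\<^sub>0 r)) \<and>
      submanifold_of_dim V N (CARD('d) - 1) (unstable_set R (nball V N X\<^sub>0 r)))"
proof -
  \<comment> \<open>The pairing of the two eigenvectors converts the bound on \<sigma> by the dual
    eigenvector into the bound \<open>\<sigma> < l1norm \<omega> / 2\<close>, on which all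
    contraction constants rest.\<close>
  have "1 \<le> l1norm \<omega>' * l1norm \<omega>"
    using dotp_le_l1norm[of \<omega>' \<omega>] assms(4) by (simp add: dual_eigenvector_def)
  moreover from this have "0 < l1norm \<omega>'" by (cases "l1norm \<omega>' = 0") (auto simp: less_le)
  ultimately have "inverse (l1norm \<omega>') \<le> l1norm \<omega>"
    by (simp add: inverse_eq_divide pos_divide_le_eq mult.commute)
  then have "\<sigma> < l1norm \<omega> / 2" using assms(12) by simp
  then interpret hyperbolic_renormalisation \<omega> \<sigma> \<rho> \<rho>' \<omega>' T "lam first_ix" \<kappa>
    using assms(3-11,13) by unfold_locales (auto simp: koch_matrix_def dual_eigenvector_def)
  show ?thesis unfolding V_def N_def R_def X\<^sub>0_def by (rule renorm_hyperbolic)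
qed

end
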